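(* Let $A=kQ/I$ and let $\mathcal R$ be a reduction system satisfying $(\lozenge)$ for $I$. Let $\{r^p\}_{p\in\mathcal A_2}$ and $\{t^p\}_{p\in\mathcal A_2}$ be two families of reductions such that $r^p(p)$ and $t^p(p)$ belong to $k\mathcal B$, $r^p$ starts on the left of $p$ and $t^p$ starts on the right of $p$, for every $p\in\mathcal A_2$. Let $d_2:A\otimes_E k\mathcal A_2\otimes_E A\to A\otimes_E k\mathcal A_1\otimes_E A$ be the map of $A$-bimodules defined by $d_2(1\otimes p\otimes1)=\phi_1(t^p,p)-\phi_1(r^p,p)$. Then the sequence $$A\otimes_E k\mathcal A_2\otimes_E A\xrightarrow{d_2}A\otimes_E k\mathcal A_1\otimes_E A\xrightarrow{d_1}A\otimes_E k\mathcal A_0\otimes_E A\xrightarrow{\delta_0}A\otimes_E A\xrightarrow{\delta_{-1}}A\to0$$ is exact.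
   Context: Let $k$ be a field, $Q$ a quiver with finitely many vertices, $Q_n$ the set of paths of length $n$, $Q_{\ge n}=\bigcup_{i\ge n}Q_i$, $E=kQ_0$. A path of length $n$ is written $c=c_n\cdots c_1$ with $c_i\in Q_1$. Let $I$ be a two-sided ideal of $kQ$, $A=kQ/I$, $\pi:kQ\to A$ the projection; assume $\pi(Q_0\cup Q_1)$ is linearly independent. A path $p$ is a divisor of a path $q$ if $q=apb$ for paths $a,b$; a left divisor if moreover $a$ is a vertex, a right divisor if $b$ is a vertex. An element $f\in kQ$ is parallel to a path $s$ if all paths in the support of $f$ have the same source and target as $s$. A reduction system is a set $\mathcal R=\{(s_i,f_i)\}_{i\in\Gamma}$ with $s_i\in Q_{\ge0}$, $f_i\in kQ$ parallel to $s_i$, $f_i\ne s_i$, and $s_i$ not dividing $s_j$ for $i\neq j$. For $(s,f)\in\mathcal R$ and paths $a,c$ with $asc\ne0$ in $kQ$, the basic reduction $r_{a,s,c}:kQ\to kQ$ is the linear map with $r_{a,s,c}(asc)=afc$ and $r_{a,s,c}(q)=q$ for every path $q\ne asc$. A reduction $r=(r_n,\dots,r_1)$ is a finite sequence of basic reductions, acting as $r_n\circ\cdots\circ r_1$. $x\in kQ$ is irreducible if $r(x)=x$ for all basic reductions $r$ (otherwise reducible). A path $p$ is reduction-finite if for every infinite sequence $(r_i)_{i\in\mathbb N}$ of basic reductions the sequence $r_n\circ\cdots\circ r_1(p)$ is eventually constant; it is reduction-unique if it is reduction-finite and $r(p)=r'(p)$ for any two reductions $r,r'$ with $r(p),r'(p)$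 both irreducible. $\mathcal R$ satisfies $(\lozenge)$ for $I$ if $I$ is the two-sided ideal generated by $\{s-f\}_{(s,f)\in\mathcal R}$, every path is reduction-unique, and $f$ is irreducible for each $(s,f)\in\mathcal R$. $S=\{s:(s,f)\in\mathcal R\}$ is assumed to satisfy $S\subseteq Q_{\ge2}$. $\mathcal B$ is the set of irreducible paths and $k\mathcal B$ its span; $\{\pi(b):b\in\mathcal B\}$ is a basis of $A$, and $\beta:kQ\to kQ$ is the linear map sending $x$ to the unique element $\beta(x)\in k\mathcal B$ with $\pi(\beta(x))=\pi(x)$ (so $\beta(s)=f$ for $(s,f)\in\mathcal R$). $\mathcal A_{0}=Q_1$, $\mathcal A_1=S$, and $\mathcal A_2$ is the set of paths $p=u_0u_1u_2$ with $u_0\in Q_1$, $u_1,u_2$ irreducible, such that for $i=0,1$, $u_iu_{i+1}$ is reducible but $u_id$ is irreducible for each proper left divisor $d$ of $u_{i+1}$; such $p$ can also be written $p=v_2v_1v_0$ with $v_0\in Q_1$, $v_1,v_2$ irreducible, $v_{i+1}v_i$ reducible but $dv_i$ irreducible for each proper right divisor $d$ of $v_{i+1}$ ($i=0,1$). Then $u_0u_1,v_1v_0\in S$. A reduction $r=(r_n,\dots,r_1)$ starts on the left of $p$ if $r_1=r_{a,s,c}$ with $asc=p$, $s=u_0u_1$, $a$ a vertex, $c=u_2$; it starts on the right of $p$ if $r_1=r_{a,s,c}$ with $asc=p$, $s=v_1v_0$, $a=v_2$, $c$ a vertex. Maps: $\delta_{-1}$ is multiplication; $\delta_0$ is the $A$-bimodule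 map with $\delta_0(1\otimes\alpha\otimes1)=\pi(\alpha)\otimes1-1\otimes\pi(\alpha)$ for $\alpha\in Q_1$. $\phi_0:kQ\to A\otimes_E k\mathcal A_0\otimes_E A$ is the $k$-linear map with $\phi_0(c_n\cdots c_1)=\sum_{i=1}^n\pi(c_n\cdots c_{i+1})\otimes c_i\otimes\pi(c_{i-1}\cdots c_1)$. $d_1:A\otimes_E k\mathcal A_1\otimes_E A\to A\otimes_E k\mathcal A_0\otimes_E A$ is the $A$-bimodule map with $d_1(1\otimes s\otimes1)=\phi_0(s)-\phi_0(\beta(s))$ for $s\in S$. For a basic reduction $r=r_{a,s,c}$, $\phi_1(r,-):kQ\to A\otimes_E k\mathcal A_1\otimes_E A$ is the $k$-linear map with $\phi_1(r,asc)=\pi(a)\otimes s\otimes\pi(c)$ and $\phi_1(r,p)=0$ for paths $p\ne asc$; for $r=(r_n,\dots,r_1)$ with $n\ge2$ and $r'=(r_n,\dots,r_2)$, recursively $\phi_1(r,p)=\phi_1(r_1,p)+\phi_1(r',r_1(p))$. *)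

theory Defs
  imports "HOL-Algebra.QuotRing" "HOL-Algebra.Free_Abelian_Groups" "Graph_Theory.Arc_Walk"
begin

section \<open>Paths of a quiver and the path algebra\<close>

text \<open>
  A quiver is a well-formed \<open>pre_digraph\<close>; loops and parallel arrows are allowed, and the set of
  arrows may be infinite.  The list of arrows of a path is stored in the order of traversal, so
  that \<open>c\<^sub>n \<cdots> c\<^sub>1\<close> is \<open>Path (tail Q c\<^sub>1) [c\<^sub>1, \<dots>, c\<^sub>n] (head Q c\<^sub>n)\<close>; products are
  written from right to left, \<open>q \<cdot> p\<close> being first \<open>p\<close> and then \<open>q\<close>.
\<close>

datatype ('v, 'a) qpath = Path (source: 'v) (arrows: "'a list") (target: 'v)

type_synonym ('v, 'a, 'k) pathvec = "('v, 'a) qpath \<Rightarrow>\<^sub>0 'k"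

definition paths :: "('v, 'a) pre_digraph \<Rightarrow> ('v, 'a) qpath set" where
  "paths Q = {p. pre_digraph.awalk Q (source p) (arrows p) (target p)}"

definition len :: "('v, 'a) qpath \<Rightarrow> nat" where
  "len p = length (arrows p)"

definition paths_of_len :: "('v, 'a) pre_digraph \<Rightarrow> nat \<Rightarrow> ('v, 'a) qpath set" where
  "paths_of_len Q n = {p \<in> paths Q. len p = n}"

definition vertex_path :: "'v \<Rightarrow> ('v, 'a) qpath" where
  "vertex_path v = Path v [] v"

definition composable :: "('v, 'a) qpath \<Rightarrow> ('v, 'a) qpath \<Rightarrow> bool" where
  "composable q p \<longleftrightarrow> source q = target p"

definition pcomp :: "('v, 'a) qpath \<Rightarrow> ('v, 'a) qpath \<Rightarrow> ('v, 'a) qpath"  (infixr \<open>\<cdot>\<close> 75) where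
  "q \<cdot> p = Path (source p) (arrows p @ arrows q) (target q)"

definition left_divisor :: "('v, 'a) pre_digraph \<Rightarrow> ('v, 'a) qpath \<Rightarrow> ('v, 'a) qpath \<Rightarrow> bool" where
  "left_divisor Q p q \<longleftrightarrow> p \<in> paths Q \<and> (\<exists>b\<in>paths Q. composable p b \<and> q = p \<cdot> b)"

definition right_divisor :: "('v, 'a) pre_digraph \<Rightarrow> ('v, 'a) qpath \<Rightarrow> ('v, 'a) qpath \<Rightarrow> bool" where
  "right_divisor Q p q \<longleftrightarrow> p \<in> paths Q \<and> (\<exists>a\<in>paths Q. composable a p \<and> q = a \<cdot> p)"

definition divisor :: "('v, 'a) pre_digraph \<Rightarrow> ('v, 'a) qpath \<Rightarrow> ('v, 'a) qpath \<Rightarrow> bool" where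
  "divisor Q p q \<longleftrightarrow> p \<in> paths Q \<and>
     (\<exists>a\<in>paths Q. \<exists>b\<in>paths Q. composable a p \<and> composable p b \<and> q = a \<cdot> p \<cdot> b)"

abbreviation pvec :: "('v, 'a) qpath \<Rightarrow> ('v, 'a, 'k::field) pathvec" where
  "pvec p \<equiv> Poly_Mapping.single p 1"

definition scale :: "'k::field \<Rightarrow> ('v, 'a, 'k) pathvec \<Rightarrow> ('v, 'a, 'k) pathvec" where
  "scale c x = Poly_Mapping.map (\<lambda>b. c * b) x"

definition kspan :: "('v, 'a) qpath set \<Rightarrow> ('v, 'a, 'k::field) pathvec set" where
  "kspan X = {x. Poly_Mapping.keys x \<subseteq> X}"

definition pmult :: "('v, 'a, 'k::field) pathvec \<Rightarrow> ('v, 'a, 'k) pathvec \<Rightarrow> ('v, 'a, 'k) pathvec" where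
  "pmult x y = (\<Sum>q\<in>Poly_Mapping.keys x. \<Sum>p\<in>Poly_Mapping.keys y.
     if composable q p
     then Poly_Mapping.single (q \<cdot> p) (Poly_Mapping.lookup x q * Poly_Mapping.lookup y p) else 0)"

definition path_algebra :: "('v, 'a) pre_digraph \<Rightarrow> ('v, 'a, 'k::field) pathvec ring" where
  "path_algebra Q = \<lparr>carrier = kspan (paths Q), mult = pmult,
     one = (\<Sum>v\<in>verts Q. pvec (vertex_path v)), ring.zero = 0, add = (+)\<rparr>"

abbreviation vertex_algebra :: "('v, 'a) pre_digraph \<Rightarrow> ('v, 'a, 'k::field) pathvec set" where
  "vertex_algebra Q \<equiv> kspan (paths_of_len Q 0)"

abbreviation quot_algebra ::
    "('v, 'a) pre_digraph \<Rightarrow> ('v, 'a, 'k::field) pathvec set \<Rightarrow> ('v, 'a, 'k) pathvec set ring" where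
  "quot_algebra Q I \<equiv> path_algebra Q Quot I"

definition proj ::
    "('v, 'a) pre_digraph \<Rightarrow> ('v, 'a, 'k::field) pathvec set \<Rightarrow> ('v, 'a, 'k) pathvec
     \<Rightarrow> ('v, 'a, 'k) pathvec set" where
  "proj Q I x = I +>\<^bsub>path_algebra Q\<^esub> x"

text \<open>
  Since \<open>proj Q I\<close> is linear, a linear combination of the classes of the paths in \<open>X\<close> is the class of
  a vector supported in \<open>X\<close>.
\<close>

definition proj_independent ::
    "('v, 'a) pre_digraph \<Rightarrow> ('v, 'a, 'k::field) pathvec set \<Rightarrow> ('v, 'a) qpath set \<Rightarrow> bool" where
  "proj_independent Q I X \<longleftrightarrow>
     (\<forall>x\<in>kspan X. proj Q I x = \<zero>\<^bsub>quot_algebra Q I\<^esub> \<longrightarrow> x = 0)"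


section \<open>Reduction systems\<close>

type_synonym ('v, 'a, 'k) redsys = "(('v, 'a) qpath \<times> ('v, 'a, 'k) pathvec) set"

definition parallel :: "('v, 'a, 'k::field) pathvec \<Rightarrow> ('v, 'a) qpath \<Rightarrow> bool" where
  "parallel f s \<longleftrightarrow> (\<forall>p\<in>Poly_Mapping.keys f. source p = source s \<and> target p = target s)"

definition reduction_system :: "('v, 'a) pre_digraph \<Rightarrow> ('v, 'a, 'k::field) redsys \<Rightarrow> bool" where
  "reduction_system Q \<R> \<longleftrightarrow>
     (\<forall>(s, f)\<in>\<R>. s \<in> paths Q \<and> f \<in> kspan (paths Q) \<and> parallel f s \<and> f \<noteq> pvec s) \<and>
     (\<forall>(s, f)\<in>\<R>. \<forall>(s', f')\<in>\<R>. (s, f) \<noteq> (s', f') \<longrightarrow> \<not> divisor Q s s')"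

text \<open>
  The basic reduction \<open>r\<^sub>a\<^sub>,\<^sub>s\<^sub>,\<^sub>c\<close> attached to \<open>(s, f) \<in> \<R>\<close> is represented by the tuple
  \<open>(a, s, f, c)\<close> and not by the linear map \<open>reduce1 (a, s, f, c)\<close>, because this map does not
  determine \<open>(a, s, c)\<close>.
\<close>

type_synonym ('v, 'a, 'k) basic_red =
  "('v, 'a) qpath \<times> ('v, 'a) qpath \<times> ('v, 'a, 'k) pathvec \<times> ('v, 'a) qpath"

definition basic_reductions ::
    "('v, 'a) pre_digraph \<Rightarrow> ('v, 'a, 'k::field) redsys \<Rightarrow> ('v, 'a, 'k) basic_red set" where
  "basic_reductions Q \<R> = {(a, s, f, c). (s, f) \<in> \<R> \<and> a \<in> paths Q \<and> c \<in> paths Q \<and>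
     composable a s \<and> composable s c}"

definition reduce1 ::
    "('v, 'a, 'k::field) basic_red \<Rightarrow> ('v, 'a, 'k) pathvec \<Rightarrow> ('v, 'a, 'k) pathvec" where
  "reduce1 = (\<lambda>(a, s, f, c) x. \<Sum>q\<in>Poly_Mapping.keys x. scale (Poly_Mapping.lookup x q)
     (if q = a \<cdot> s \<cdot> c then pmult (pvec a) (pmult f (pvec c)) else pvec q))"

text \<open>
  The reduction \<open>(r\<^sub>n, \<dots>, r\<^sub>1)\<close> is the list \<open>[r\<^sub>1, \<dots>, r\<^sub>n]\<close>, in the order of application.
\<close>

definition reduce ::
    "('v, 'a, 'k::field) basic_red list \<Rightarrow> ('v, 'a, 'k) pathvec \<Rightarrow> ('v, 'a, 'k) pathvec" where
  "reduce rs x = fold reduce1 rs x"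

abbreviation reductions ::
    "('v, 'a) pre_digraph \<Rightarrow> ('v, 'a, 'k::field) redsys \<Rightarrow> ('v, 'a, 'k) basic_red list set" where
  "reductions Q \<R> \<equiv> lists (basic_reductions Q \<R>)"

definition irred ::
    "('v, 'a) pre_digraph \<Rightarrow> ('v, 'a, 'k::field) redsys \<Rightarrow> ('v, 'a, 'k) pathvec \<Rightarrow> bool" where
  "irred Q \<R> x \<longleftrightarrow> x \<in> kspan (paths Q) \<and> (\<forall>\<rho>\<in>basic_reductions Q \<R>. reduce1 \<rho> x = x)"

definition irred_paths ::
    "('v, 'a) pre_digraph \<Rightarrow> ('v, 'a, 'k::field) redsys \<Rightarrow> ('v, 'a) qpath set" where
  "irred_paths Q \<R> = {p \<in> paths Q. irred Q \<R> (pvec p)}"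

definition reduction_finite ::
    "('v, 'a) pre_digraph \<Rightarrow> ('v, 'a, 'k::field) redsys \<Rightarrow> ('v, 'a) qpath \<Rightarrow> bool" where
  "reduction_finite Q \<R> p \<longleftrightarrow>
     (\<forall>r :: nat \<Rightarrow> ('v, 'a, 'k) basic_red. (\<forall>i. r i \<in> basic_reductions Q \<R>) \<longrightarrow>
        (\<exists>N. \<forall>n\<ge>N. reduce (map r [0..<n]) (pvec p) = reduce (map r [0..<N]) (pvec p)))"

definition reduction_unique ::
    "('v, 'a) pre_digraph \<Rightarrow> ('v, 'a, 'k::field) redsys \<Rightarrow> ('v, 'a) qpath \<Rightarrow> bool" where
  "reduction_unique Q \<R> p \<longleftrightarrow> reduction_finite Q \<R> p \<and>
     (\<forall>r\<in>reductions Q \<R>. \<forall>r'\<in>reductions Q \<R>.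
        irred Q \<R> (reduce r (pvec p)) \<and> irred Q \<R> (reduce r' (pvec p)) \<longrightarrow>
        reduce r (pvec p) = reduce r' (pvec p))"

definition lozenge ::
    "('v, 'a) pre_digraph \<Rightarrow> ('v, 'a, 'k::field) pathvec set \<Rightarrow> ('v, 'a, 'k) redsys \<Rightarrow> bool" where
  "lozenge Q I \<R> \<longleftrightarrow>
     I = genideal (path_algebra Q) {pvec s - f | s f. (s, f) \<in> \<R>} \<and>
     (\<forall>p\<in>paths Q. reduction_unique Q \<R> p) \<and>
     (\<forall>(s, f)\<in>\<R>. irred Q \<R> f)"

definition tips :: "('v, 'a, 'k) redsys \<Rightarrow> ('v, 'a) qpath set" where
  "tips \<R> = fst ` \<R>"

definition normal_form ::
    "('v, 'a) pre_digraph \<Rightarrow> ('v, 'a, 'k::field) pathvec set \<Rightarrow> ('v, 'a, 'k) redsys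
     \<Rightarrow> ('v, 'a, 'k) pathvec \<Rightarrow> ('v, 'a, 'k) pathvec" where
  "normal_form Q I \<R> x = (THE y. y \<in> kspan (irred_paths Q \<R>) \<and> proj Q I y = proj Q I x)"


section \<open>Ambiguities\<close>

definition left_ambiguity ::
    "('v, 'a) pre_digraph \<Rightarrow> ('v, 'a, 'k::field) redsys
     \<Rightarrow> ('v, 'a) qpath \<Rightarrow> ('v, 'a) qpath \<Rightarrow> ('v, 'a) qpath \<Rightarrow> bool" where
  "left_ambiguity Q \<R> u\<^sub>0 u\<^sub>1 u\<^sub>2 \<longleftrightarrow>
     u\<^sub>0 \<in> paths_of_len Q 1 \<and> u\<^sub>1 \<in> irred_paths Q \<R> \<and> u\<^sub>2 \<in> irred_paths Q \<R> \<and>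
     composable u\<^sub>0 u\<^sub>1 \<and> composable u\<^sub>1 u\<^sub>2 \<and>
     u\<^sub>0 \<cdot> u\<^sub>1 \<notin> irred_paths Q \<R> \<and>
     (\<forall>d. left_divisor Q d u\<^sub>1 \<and> d \<noteq> u\<^sub>1 \<longrightarrow> u\<^sub>0 \<cdot> d \<in> irred_paths Q \<R>) \<and>
     u\<^sub>1 \<cdot> u\<^sub>2 \<notin> irred_paths Q \<R> \<and>
     (\<forall>d. left_divisor Q d u\<^sub>2 \<and> d \<noteq> u\<^sub>2 \<longrightarrow> u\<^sub>1 \<cdot> d \<in> irred_paths Q \<R>)"

definition right_ambiguity ::
    "('v, 'a) pre_digraph \<Rightarrow> ('v, 'a, 'k::field) redsys
     \<Rightarrow> ('v, 'a) qpath \<Rightarrow> ('v, 'a) qpath \<Rightarrow> ('v, 'a) qpath \<Rightarrow> bool" where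
  "right_ambiguity Q \<R> v\<^sub>2 v\<^sub>1 v\<^sub>0 \<longleftrightarrow>
     v\<^sub>0 \<in> paths_of_len Q 1 \<and> v\<^sub>1 \<in> irred_paths Q \<R> \<and> v\<^sub>2 \<in> irred_paths Q \<R> \<and>
     composable v\<^sub>1 v\<^sub>0 \<and> composable v\<^sub>2 v\<^sub>1 \<and>
     v\<^sub>1 \<cdot> v\<^sub>0 \<notin> irred_paths Q \<R> \<and>
     (\<forall>d. right_divisor Q d v\<^sub>1 \<and> d \<noteq> v\<^sub>1 \<longrightarrow> d \<cdot> v\<^sub>0 \<in> irred_paths Q \<R>) \<and>
     v\<^sub>2 \<cdot> v\<^sub>1 \<notin> irred_paths Q \<R> \<and>
     (\<forall>d. right_divisor Q d v\<^sub>2 \<and> d \<noteq> v\<^sub>2 \<longrightarrow> d \<cdot> v\<^sub>1 \<in> irred_paths Q \<R>)"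

definition ambiguities ::
    "('v, 'a) pre_digraph \<Rightarrow> ('v, 'a, 'k::field) redsys \<Rightarrow> ('v, 'a) qpath set" where
  "ambiguities Q \<R> = {u\<^sub>0 \<cdot> u\<^sub>1 \<cdot> u\<^sub>2 | u\<^sub>0 u\<^sub>1 u\<^sub>2. left_ambiguity Q \<R> u\<^sub>0 u\<^sub>1 u\<^sub>2}"

definition starts_on_left ::
    "('v, 'a) pre_digraph \<Rightarrow> ('v, 'a, 'k::field) redsys
     \<Rightarrow> ('v, 'a, 'k) basic_red list \<Rightarrow> ('v, 'a) qpath \<Rightarrow> bool" where
  "starts_on_left Q \<R> r p \<longleftrightarrow>
     (\<exists>u\<^sub>0 u\<^sub>1 u\<^sub>2 a s f c rs. left_ambiguity Q \<R> u\<^sub>0 u\<^sub>1 u\<^sub>2 \<and> p = u\<^sub>0 \<cdot> u\<^sub>1 \<cdot> u\<^sub>2 \<and>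
        r = (a, s, f, c) # rs \<and> a \<cdot> s \<cdot> c = p \<and>
        s = u\<^sub>0 \<cdot> u\<^sub>1 \<and> a \<in> paths_of_len Q 0 \<and> c = u\<^sub>2)"

definition starts_on_right ::
    "('v, 'a) pre_digraph \<Rightarrow> ('v, 'a, 'k::field) redsys
     \<Rightarrow> ('v, 'a, 'k) basic_red list \<Rightarrow> ('v, 'a) qpath \<Rightarrow> bool" where
  "starts_on_right Q \<R> r p \<longleftrightarrow>
     (\<exists>v\<^sub>0 v\<^sub>1 v\<^sub>2 a s f c rs. right_ambiguity Q \<R> v\<^sub>2 v\<^sub>1 v\<^sub>0 \<and> p = v\<^sub>2 \<cdot> v\<^sub>1 \<cdot> v\<^sub>0 \<and>
        r = (a, s, f, c) # rs \<and> a \<cdot> s \<cdot> c = p \<and>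
        s = v\<^sub>1 \<cdot> v\<^sub>0 \<and> a = v\<^sub>2 \<and> c \<in> paths_of_len Q 0)"


section \<open>Bimodules and tensor products\<close>

text \<open>
  As for \<open>module\<close> in HOL-Algebra, the record extends \<open>ring\<close> to inherit the additive notation;
  the fields \<open>mult\<close> and \<open>one\<close> are not used.
\<close>

record ('l, 'm, 'r) bimodule = "'m ring" +
  lact :: "'l \<Rightarrow> 'm \<Rightarrow> 'm"
  ract :: "'m \<Rightarrow> 'r \<Rightarrow> 'm"

definition bimodule_hom ::
    "('c, 'x) ring_scheme \<Rightarrow> ('c, 'm, 'c) bimodule \<Rightarrow> ('c, 'n, 'c) bimodule \<Rightarrow> ('m \<Rightarrow> 'n) set" where
  "bimodule_hom A M N = {h. h \<in> carrier M \<rightarrow> carrier N \<and>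
     (\<forall>x\<in>carrier M. \<forall>y\<in>carrier M. h (x \<oplus>\<^bsub>M\<^esub> y) = h x \<oplus>\<^bsub>N\<^esub> h y) \<and>
     (\<forall>a\<in>carrier A. \<forall>x\<in>carrier M. h (lact M a x) = lact N a (h x)) \<and>
     (\<forall>a\<in>carrier A. \<forall>x\<in>carrier M. h (ract M x a) = ract N (h x) a)}"

text \<open>A ring as a bimodule, with both actions restricted along the maps \<open>f\<close> and \<open>g\<close>.\<close>

definition restr_bimodule ::
    "('c, 'x) ring_scheme \<Rightarrow> ('l \<Rightarrow> 'c) \<Rightarrow> ('r \<Rightarrow> 'c) \<Rightarrow> ('l, 'c, 'r) bimodule" where
  "restr_bimodule A f g = \<lparr>carrier = carrier A, mult = undefined, one = undefined,
     ring.zero = \<zero>\<^bsub>A\<^esub>, add = add A, lact = (\<lambda>l x. f l \<otimes>\<^bsub>A\<^esub> x), ract = (\<lambda>x r. x \<otimes>\<^bsub>A\<^esub> g r)\<rparr>"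

text \<open>
  The tensor product over a ring with carrier \<open>E\<close>: the free abelian group on pairs modulo the subgroup
  generated by the relations expressing biadditivity and \<open>E\<close>-balancedness.
\<close>

definition tensor_rels ::
    "'e set \<Rightarrow> ('l, 'm, 'e) bimodule \<Rightarrow> ('e, 'n, 'r) bimodule \<Rightarrow> ('m \<times> 'n \<Rightarrow>\<^sub>0 int) set" where
  "tensor_rels E M N =
     {frag_of (x \<oplus>\<^bsub>M\<^esub> x', y) - frag_of (x, y) - frag_of (x', y) | x x' y.
        x \<in> carrier M \<and> x' \<in> carrier M \<and> y \<in> carrier N} \<union>
     {frag_of (x, y \<oplus>\<^bsub>N\<^esub> y') - frag_of (x, y) - frag_of (x, y') | x y y'.
        x \<in> carrier M \<and> y \<in> carrier N \<and> y' \<in> carrier N} \<union>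
     {frag_of (ract M x e, y) - frag_of (x, lact N e y) | x e y.
        x \<in> carrier M \<and> e \<in> E \<and> y \<in> carrier N}"

abbreviation tensor_free ::
    "('l, 'm, 'e) bimodule \<Rightarrow> ('e, 'n, 'r) bimodule \<Rightarrow> ('m \<times> 'n \<Rightarrow>\<^sub>0 int) monoid" where
  "tensor_free M N \<equiv> free_Abelian_group (carrier M \<times> carrier N)"

definition tensor_coset ::
    "'e set \<Rightarrow> ('l, 'm, 'e) bimodule \<Rightarrow> ('e, 'n, 'r) bimodule
     \<Rightarrow> ('m \<times> 'n \<Rightarrow>\<^sub>0 int) \<Rightarrow> ('m \<times> 'n \<Rightarrow>\<^sub>0 int) set" where
  "tensor_coset E M N x =
     generate (tensor_free M N) (tensor_rels E M N) #>\<^bsub>tensor_free M N\<^esub> x"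

definition tensor ::
    "'e set \<Rightarrow> ('l, 'm, 'e) bimodule \<Rightarrow> ('e, 'n, 'r) bimodule
     \<Rightarrow> ('l, ('m \<times> 'n \<Rightarrow>\<^sub>0 int) set, 'r) bimodule" where
  "tensor E M N =
     (let T = tensor_free M N Mod generate (tensor_free M N) (tensor_rels E M N) in
      \<lparr>carrier = carrier T, mult = undefined, one = undefined, ring.zero = \<one>\<^bsub>T\<^esub>, add = mult T,
       lact = (\<lambda>l C. \<Union>x\<in>C. tensor_coset E M N (frag_extend (\<lambda>(m, n). frag_of (lact M l m, n)) x)),
       ract = (\<lambda>C r. \<Union>x\<in>C. tensor_coset E M N (frag_extend (\<lambda>(m, n). frag_of (m, ract N n r)) x))\<rparr>)"

definition pure_tensor ::
    "'e set \<Rightarrow> ('l, 'm, 'e) bimodule \<Rightarrow> ('e, 'n, 'r) bimodule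
     \<Rightarrow> 'm \<Rightarrow> 'n \<Rightarrow> ('m \<times> 'n \<Rightarrow>\<^sub>0 int) set" where
  "pure_tensor E M N m n = tensor_coset E M N (frag_of (m, n))"


section \<open>The bimodules and the maps of the sequence\<close>

text \<open>
  In the following names \<open>A\<close> stands for \<open>kQ/I\<close> and \<open>E\<close> for \<open>kQ\<^sub>0\<close>; \<open>A_E\<close> is \<open>A\<close> as an
  \<open>A\<close>-\<open>E\<close>-bimodule, \<open>E_A\<close> is \<open>A\<close> as an \<open>E\<close>-\<open>A\<close>-bimodule, \<open>AXA\<close> is \<open>A \<otimes>\<^sub>E kX \<otimes>\<^sub>E A\<close>,
  and \<open>AA\<close> is \<open>A \<otimes>\<^sub>E A\<close>.
\<close>

abbreviation (input) A_E where
  "A_E Q I \<equiv> restr_bimodule (quot_algebra Q I) (\<lambda>a. a) (proj Q I)"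

abbreviation (input) E_A where
  "E_A Q I \<equiv> restr_bimodule (quot_algebra Q I) (proj Q I) (\<lambda>a. a)"

abbreviation regular_bimodule where
  "regular_bimodule Q I \<equiv> restr_bimodule (quot_algebra Q I) (\<lambda>a. a) (\<lambda>a. a)"

definition kX_bimodule ::
    "('v, 'a) qpath set
     \<Rightarrow> (('v, 'a, 'k::field) pathvec, ('v, 'a, 'k) pathvec, ('v, 'a, 'k) pathvec) bimodule" where
  "kX_bimodule X = \<lparr>carrier = kspan X, mult = undefined, one = undefined, ring.zero = 0, add = (+),
     lact = pmult, ract = pmult\<rparr>"

definition AXA where
  "AXA Q I X = tensor (vertex_algebra Q)
     (tensor (vertex_algebra Q) (A_E Q I) (kX_bimodule X)) (E_A Q I)"

definition tens3 where
  "tens3 Q I X a x b = pure_tensor (vertex_algebra Q)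
     (tensor (vertex_algebra Q) (A_E Q I) (kX_bimodule X)) (E_A Q I)
     (pure_tensor (vertex_algebra Q) (A_E Q I) (kX_bimodule X) a x) b"

definition AA where
  "AA Q I = tensor (vertex_algebra Q) (A_E Q I) (E_A Q I)"

definition tens2 where
  "tens2 Q I a b = pure_tensor (vertex_algebra Q) (A_E Q I) (E_A Q I) a b"

text \<open>The action of a scalar on an \<open>A\<close>-bimodule is the left action of its image in \<open>A\<close>.\<close>

definition ksmult where
  "ksmult Q I M c m = lact M (proj Q I (scale c \<one>\<^bsub>path_algebra Q\<^esub>)) m"

text \<open>
  The list index \<open>i\<close> starts at 0, hence \<open>arrows p ! i\<close> is \<open>c\<^bsub>i+1\<^esub>\<close>; the two outer factors are
  the classes of the paths traversed after and before this arrow.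
\<close>

definition \<phi>0_path where
  "\<phi>0_path Q I p =
     finsum (AXA Q I (paths_of_len Q 1))
       (\<lambda>i. let c = arrows p ! i in
          tens3 Q I (paths_of_len Q 1)
            (proj Q I (pvec (Path (head Q c) (drop (Suc i) (arrows p)) (target p))))
            (pvec (Path (tail Q c) [c] (head Q c)))
            (proj Q I (pvec (Path (source p) (take i (arrows p)) (tail Q c)))))
       {..<len p}"

definition \<phi>0 where
  "\<phi>0 Q I x =
     finsum (AXA Q I (paths_of_len Q 1))
       (\<lambda>p. ksmult Q I (AXA Q I (paths_of_len Q 1)) (Poly_Mapping.lookup x p) (\<phi>0_path Q I p))
       (Poly_Mapping.keys x)"

definition \<phi>1_basic where
  "\<phi>1_basic Q I \<R> = (\<lambda>(a, s, f, c) x.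
     ksmult Q I (AXA Q I (tips \<R>)) (Poly_Mapping.lookup x (a \<cdot> s \<cdot> c))
       (tens3 Q I (tips \<R>) (proj Q I (pvec a)) (pvec s) (proj Q I (pvec c))))"

text \<open>
  Starting the recursion at the empty list, with value zero, amounts to \<open>\<phi>1 Q I \<R> [\<rho>] = \<phi>1_basic Q I \<R> \<rho>\<close>.
\<close>

primrec \<phi>1 where
  "\<phi>1 Q I \<R> [] x = \<zero>\<^bsub>AXA Q I (tips \<R>)\<^esub>"
| "\<phi>1 Q I \<R> (\<rho> # \<rho>s) x = \<phi>1_basic Q I \<R> \<rho> x \<oplus>\<^bsub>AXA Q I (tips \<R>)\<^esub> \<phi>1 Q I \<R> \<rho>s (reduce1 \<rho> x)"

end

(* All elements are lifted to combinations of triples (b, x, c) of paths, on which tensor products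
   become free.  By reduction-finiteness the relation "q occurs in a reduct of p" is well-founded, so
   reducing p to its normal form at a fixed redex in each step defines Psi p, the sum of the terms
   a (x) s (x) c of the basic reductions used, with Psi p = 0 for irreducible p.

   Modulo im d_2 the element Psi p does not depend on the chosen redexes.  As in Newman's lemma this
   is a Noetherian induction: two disjoint tips in p commute up to terms with an outer factor in I,
   and two overlapping tips lie in an ambiguity w in A_2, for which phi_1(t^w, w) and phi_1(r^w, w)
   agree modulo im d_2.  Hence h(b (x) alpha (x) c) = b Psi(alpha NF(c)), for arrows alpha, satisfies
   h d_1 = id modulo im d_2, and h only depends on the normal forms of b and c; therefore
   ker d_1 is contained in im d_2.

   In lower degrees, phi_0 is a derivation that maps I into im d_1 and satisfies
   delta_0 phi_0(x) = x (x) 1 - 1 (x) x; so a (x) b -> - a phi_0(b) and a -> a (x) 1 contract the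
   sequence modulo im d_1. *)
theory Submission
  imports Defs
begin

text \<open>Two obstacles shape the development. Reduction-finiteness speaks of the reducts of a
  whole vector, in which terms may cancel, whereas the recursion for \<open>Psi\<close> needs
  descent on single paths. And two overlapping tips need not span an element of A_2: the ambiguity
  that begins with the left tip may end earlier, with a third tip. The passage from one redex to
  another therefore runs through a chain of tips, controlled by a second induction on their starting
  positions inside one path.

  Elements of the tensor products are never compared directly. Their lifts are compared modulo a
  subspace \<open>D\<close> that contains the lifts of im d_2 and, with them, all triples having an
  outer factor in I. This is what allows an outer factor to be replaced by its normal form on either
  side, although the triples themselves know nothing of I.

  Reduction-uniqueness enters twice: it makes normal forms depend only on classes modulo I, and it
  lets the two reductions of an ambiguity end in the same vector, so that only the triples collected
  on the way have to be compared.\<close>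

definition smul :: "'k::field \<Rightarrow> ('b \<Rightarrow>\<^sub>0 'k) \<Rightarrow> ('b \<Rightarrow>\<^sub>0 'k)" where
  "smul c x = Poly_Mapping.map (\<lambda>b. c * b) x"

lemma scale_eq_smul: "scale = smul"
  by (simp add: fun_eq_iff scale_def smul_def)

lemma lookup_smul [simp]: "Poly_Mapping.lookup (smul c x) p = c * Poly_Mapping.lookup x p"
  unfolding smul_def by transfer (simp add: when_def)

lemma smul_simps [simp]:
  "smul c 0 = 0" "smul 0 x = 0" "smul 1 x = x" "smul c (smul d x) = smul (c * d) x"
  "smul c (Poly_Mapping.single p d) = Poly_Mapping.single p (c * d)"
  by (auto intro!: poly_mapping_eqI simp: lookup_single when_def)

lemma smul_distrib:
  "smul c (x + y) = smul c x + smul c y" "smul (c + d) x = smul c x + smul d x"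
  "smul c (x - y) = smul c x - smul c y" "smul c (- x) = - smul c x" "smul (- c) x = - smul c x"
  "smul (c - d) x = smul c x - smul d x"
  by (auto intro!: poly_mapping_eqI simp: lookup_add lookup_minus algebra_simps)

lemma smul_minus_one: "smul (- 1) x = - x"
  by (auto intro!: poly_mapping_eqI)

lemma keys_smul: "Poly_Mapping.keys (smul c x) \<subseteq> Poly_Mapping.keys x"
  by (auto simp: in_keys_iff)

section \<open>Linear maps and subspaces of finitely supported functions\<close>

definition klin :: "(('b \<Rightarrow>\<^sub>0 'k::field) \<Rightarrow> ('c \<Rightarrow>\<^sub>0 'k)) \<Rightarrow> bool" where
  "klin T \<longleftrightarrow> (\<forall>x y. T (x + y) = T x + T y) \<and> (\<forall>c x. T (smul c x) = smul c (T x))"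

lemma klinI: "(\<And>x y. T (x + y) = T x + T y) \<Longrightarrow> (\<And>c x. T (smul c x) = smul c (T x)) \<Longrightarrow> klin T"
  by (simp add: klin_def)

lemma klin_plus: "klin T \<Longrightarrow> T (x + y) = T x + T y"
  and klin_smul: "klin T \<Longrightarrow> T (smul c x) = smul c (T x)"
  by (auto simp: klin_def)

lemma klin_zero: "klin T \<Longrightarrow> T 0 = 0"
  using klin_smul[of T 0 0] by simp

lemma klin_uminus: "klin T \<Longrightarrow> T (- x) = - T x"
  using klin_smul[of T "- 1" x] by (simp add: smul_minus_one)

lemma klin_minus: "klin T \<Longrightarrow> T (x - y) = T x - T y"
  using klin_plus[of T x "- y"] by (simp add: klin_uminus)

lemma klin_comp: "klin S \<Longrightarrow> klin T \<Longrightarrow> klin (\<lambda>x. S (T x))"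
  by (auto simp: klin_def)

lemma klin_id: "klin (\<lambda>x. x)"
  by (auto simp: klin_def)

lemma klin_const0: "klin (\<lambda>x. 0)"
  by (auto simp: klin_def)

lemma klin_add: "klin S \<Longrightarrow> klin T \<Longrightarrow> klin (\<lambda>x. S x + T x)"
  by (auto simp: klin_def smul_distrib algebra_simps)

lemma klin_diff: "klin S \<Longrightarrow> klin T \<Longrightarrow> klin (\<lambda>x. S x - T x)"
  by (auto simp: klin_def smul_distrib algebra_simps)

lemma klin_neg: "klin S \<Longrightarrow> klin (\<lambda>x. - S x)"
  by (auto simp: klin_def smul_distrib algebra_simps)

lemma klin_smul_left: "klin S \<Longrightarrow> klin (\<lambda>x. smul c (S x))"
  by (auto simp: klin_def smul_distrib algebra_simps)

lemma klin_sum: "(\<And>i. i \<in> A \<Longrightarrow> klin (S i)) \<Longrightarrow> klin (\<lambda>x. \<Sum>i\<in>A. S i x)"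
  by (induct A rule: infinite_finite_induct) (auto intro!: klin_add klin_const0)

definition subsp :: "('b \<Rightarrow>\<^sub>0 'k::field) set \<Rightarrow> bool" where
  "subsp D \<longleftrightarrow> 0 \<in> D \<and> (\<forall>x\<in>D. \<forall>y\<in>D. x + y \<in> D) \<and> (\<forall>c. \<forall>x\<in>D. smul c x \<in> D)"

lemma subsp_zero: "subsp D \<Longrightarrow> 0 \<in> D"
  and subsp_add: "subsp D \<Longrightarrow> x \<in> D \<Longrightarrow> y \<in> D \<Longrightarrow> x + y \<in> D"
  and subsp_smul: "subsp D \<Longrightarrow> x \<in> D \<Longrightarrow> smul c x \<in> D"
  by (auto simp: subsp_def)

lemma subsp_neg: "subsp D \<Longrightarrow> x \<in> D \<Longrightarrow> - x \<in> D"
  using subsp_smul[of D x "- 1"] by (simp add: smul_minus_one)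

lemma subsp_diff: "subsp D \<Longrightarrow> x \<in> D \<Longrightarrow> y \<in> D \<Longrightarrow> x - y \<in> D"
  using subsp_add[of D x "- y"] subsp_neg[of D y] by simp

lemma subsp_vimage: "subsp D \<Longrightarrow> klin T \<Longrightarrow> subsp {x. T x \<in> D}"
  by (auto simp: subsp_def klin_zero klin_plus klin_smul)

lemma subsp_keys: "subsp {x. Poly_Mapping.keys x \<subseteq> X}"
  unfolding subsp_def using keys_add keys_smul by (fastforce simp: subset_iff)

lemma subsp_singleton_zero: "subsp {0}"
  by (auto simp: subsp_def)

lemma poly_mapping_sum_single:
  "x = (\<Sum>p\<in>Poly_Mapping.keys x. Poly_Mapping.single p (Poly_Mapping.lookup x p))"
  by (rule poly_mapping_eqI) (auto simp: lookup_sum lookup_single when_def in_keys_iff)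

lemma subsp_span:
  assumes "subsp D" "\<And>p. p \<in> Poly_Mapping.keys x \<Longrightarrow> Poly_Mapping.single p 1 \<in> D"
  shows "x \<in> D"
proof -
  have "(\<Sum>p\<in>P. Poly_Mapping.single p (Poly_Mapping.lookup x p)) \<in> D"
    if "P \<subseteq> Poly_Mapping.keys x" for P
    using that
  proof (induct P rule: infinite_finite_induct)
    case (insert p P)
    then show ?case
      using assms(2)[of p] subsp_smul[OF assms(1), of "Poly_Mapping.single p 1" "Poly_Mapping.lookup x p"]
      by (auto intro!: subsp_add[OF assms(1)])
  qed (use assms in \<open>auto simp: subsp_zero\<close>)
  from this[OF subset_refl] show ?thesis
    using poly_mapping_sum_single[of x] by simp
qed

text \<open>The vectors that \<open>T\<close> sends into \<open>D\<close> form a subspace, which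
  contains \<open>x\<close> as soon as it contains the basis vectors of \<open>x\<close>. The
  assumption is restricted to the support of \<open>x\<close> because facts such as composability
  hold only for the paths occurring in a given vector.\<close>

lemma klin_mem:
  assumes "subsp D" "klin T" "\<And>p. p \<in> Poly_Mapping.keys x \<Longrightarrow> T (Poly_Mapping.single p 1) \<in> D"
  shows "T x \<in> D"
  using subsp_span[OF subsp_vimage[OF assms(1,2)], of x] assms(3) by simp

lemma klin_eq:
  assumes "klin S" "klin T"
    and "\<And>p. p \<in> Poly_Mapping.keys x \<Longrightarrow> S (Poly_Mapping.single p 1) = T (Poly_Mapping.single p 1)"
  shows "S x = T x"
  using klin_mem[OF subsp_singleton_zero klin_diff[OF assms(1,2)], of x] assms(3) by simp

text \<open>Linear extension of a function given on basis vectors. Products, tensors and actions are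
  written below as nested uses of it, so that their linearity in each argument follows from the form
  of the term.\<close>

definition lin :: "('b \<Rightarrow> ('c \<Rightarrow>\<^sub>0 'k)) \<Rightarrow> ('b \<Rightarrow>\<^sub>0 'k::field) \<Rightarrow> ('c \<Rightarrow>\<^sub>0 'k)" where
  "lin f x = (\<Sum>p\<in>Poly_Mapping.keys x. smul (Poly_Mapping.lookup x p) (f p))"

lemma lin_superset:
  "finite P \<Longrightarrow> Poly_Mapping.keys x \<subseteq> P \<Longrightarrow> lin f x = (\<Sum>p\<in>P. smul (Poly_Mapping.lookup x p) (f p))"
  unfolding lin_def by (rule sum.mono_neutral_left) (auto simp: in_keys_iff)

lemma lin_single [simp]: "lin f (Poly_Mapping.single p c) = smul c (f p)"
  by (simp add: lin_superset[of "{p}"])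

lemma klin_lin [simp, intro!]: "klin (lin f)"
proof (rule klinI)
  fix x y :: "'a \<Rightarrow>\<^sub>0 'b"
  let ?P = "Poly_Mapping.keys x \<union> Poly_Mapping.keys y"
  show "lin f (x + y) = lin f x + lin f y"
    using keys_add[of x y]
    by (simp add: lin_superset[of ?P] lookup_add smul_distrib sum.distrib)
next
  fix c and x :: "'a \<Rightarrow>\<^sub>0 'b"
  have "smul c (\<Sum>p\<in>P. g p) = (\<Sum>p\<in>P. smul c (g p))" for P and g :: "'a \<Rightarrow> 'c \<Rightarrow>\<^sub>0 'b"
    by (induct P rule: infinite_finite_induct) (auto simp: smul_distrib)
  then show "lin f (smul c x) = smul c (lin f x)"
    using keys_smul[of c x]
    by (simp add: lin_superset[of "Poly_Mapping.keys x"])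
qed

lemmas lin_linear [simp] = klin_zero[OF klin_lin] klin_plus[OF klin_lin] klin_smul[OF klin_lin]
  klin_uminus[OF klin_lin] klin_minus[OF klin_lin]

lemma klin_lin_comp: "klin T \<Longrightarrow> klin (\<lambda>x. lin f (T x))"
  by (rule klin_comp) auto

lemma klin_lin_param:
  assumes "\<And>p. klin (\<lambda>y. f y p)"
  shows "klin (\<lambda>y. lin (f y) x)"
  unfolding lin_def by (intro klin_sum klin_smul_left assms)

lemma lin_cong: "x = y \<Longrightarrow> (\<And>p. p \<in> Poly_Mapping.keys y \<Longrightarrow> f p = g p) \<Longrightarrow> lin f x = lin g y"
  by (simp add: lin_def)

lemma keys_lin: "Poly_Mapping.keys (lin f x) \<subseteq> (\<Union>p\<in>Poly_Mapping.keys x. Poly_Mapping.keys (f p))"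
  unfolding lin_def using keys_sum keys_smul by fastforce

lemmas klin_intros = klin_lin_comp klin_lin_param klin_add klin_diff klin_neg klin_smul_left
  klin_id klin_const0

section \<open>Composition of paths and multiplication in the path algebra\<close>

lemma pcomp_simps [simp]:
  "source (q \<cdot> p) = source p" "target (q \<cdot> p) = target q"
  "arrows (q \<cdot> p) = arrows p @ arrows q" "len (q \<cdot> p) = len q + len p"
  "(r \<cdot> q) \<cdot> p = r \<cdot> q \<cdot> p"
  by (auto simp: pcomp_def len_def)

lemma composable_pcomp [simp]:
  "composable (r \<cdot> q) p \<longleftrightarrow> composable q p" "composable r (q \<cdot> p) \<longleftrightarrow> composable r q"
  by (auto simp: composable_def)

lemma pcomp_left_cancel:
  "composable q p \<Longrightarrow> composable q p' \<Longrightarrow> q \<cdot> p = q \<cdot> p' \<longleftrightarrow> p = p'"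
  by (cases p; cases p') (auto simp: pcomp_def composable_def)

lemma pcomp_right_cancel:
  "composable q p \<Longrightarrow> composable q' p \<Longrightarrow> q \<cdot> p = q' \<cdot> p \<longleftrightarrow> q = q'"
  by (cases q; cases q') (auto simp: pcomp_def composable_def)

lemma vertex_path_simps [simp]:
  "source (vertex_path v) = v" "target (vertex_path v) = v" "arrows (vertex_path v) = []"
  "len (vertex_path v) = 0"
  by (auto simp: vertex_path_def len_def)

lemma pcomp_vertex [simp]:
  "target p = v \<Longrightarrow> vertex_path v \<cdot> p = p" "source p = v \<Longrightarrow> p \<cdot> vertex_path v = p"
  by (cases p; auto simp: pcomp_def)+

text \<open>Nested linear extensions replace the explicit double sum; bilinearity and evaluation on
  paths then come from the rules for \<open>lin\<close>.\<close>

lemma pmult_eq_lin: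
  "pmult x y = lin (\<lambda>q. lin (\<lambda>p. if composable q p then pvec (q \<cdot> p) else 0) y) x"
proof -
  have *: "smul c (\<Sum>p\<in>P. g p) = (\<Sum>p\<in>P. smul c (g p))" for c P and g :: "'x \<Rightarrow> 'y \<Rightarrow>\<^sub>0 'z::field"
    by (induct P rule: infinite_finite_induct) (auto simp: smul_distrib)
  show ?thesis
    unfolding pmult_def lin_def * by (intro sum.cong refl) auto
qed

lemma klin_pmult_right: "klin (pmult x)"
  unfolding pmult_eq_lin by (intro klin_intros)

lemma klin_pmult_left: "klin (\<lambda>x. pmult x y)"
  unfolding pmult_eq_lin by (intro klin_intros)

lemma klin_pmult_right': "klin T \<Longrightarrow> klin (\<lambda>y. pmult x (T y))"
  using klin_comp[OF klin_pmult_right] by blast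

lemma klin_pmult_left': "klin T \<Longrightarrow> klin (\<lambda>x. pmult (T x) y)"
  using klin_comp[OF klin_pmult_left] by blast

lemma pmult_zero [simp]: "pmult 0 y = 0" "pmult x 0 = 0"
  using klin_zero[OF klin_pmult_left] klin_zero[OF klin_pmult_right] by auto

lemma pmult_distrib:
  "pmult (x + x') y = pmult x y + pmult x' y" "pmult x (y + y') = pmult x y + pmult x y'"
  "pmult (x - x') y = pmult x y - pmult x' y" "pmult x (y - y') = pmult x y - pmult x y'"
  "pmult (smul c x) y = smul c (pmult x y)" "pmult x (smul c y) = smul c (pmult x y)"
  by (auto simp: klin_plus[OF klin_pmult_left] klin_plus[OF klin_pmult_right]
    klin_minus[OF klin_pmult_left] klin_minus[OF klin_pmult_right]
    klin_smul[OF klin_pmult_left] klin_smul[OF klin_pmult_right])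

lemma pmult_single [simp]:
  "pmult (Poly_Mapping.single q c) (Poly_Mapping.single p d) =
    (if composable q p then Poly_Mapping.single (q \<cdot> p) (c * d) else 0)"
  by (auto simp: pmult_eq_lin)

text \<open>One variable after the other is reduced to basis vectors by \<open>klin_eq\<close>.
  Associativity of \<open>pmult\<close> and the laws for \<open>ten\<close> are thereby checked on
  paths only.\<close>

lemma klin_ext3:
  assumes "\<And>y z. klin (\<lambda>x. F x y z)" "\<And>x z. klin (\<lambda>y. F x y z)" "\<And>x y. klin (F x y)"
    and "\<And>y z. klin (\<lambda>x. G x y z)" "\<And>x z. klin (\<lambda>y. G x y z)" "\<And>x y. klin (G x y)"
    and "\<And>p q r. p \<in> Poly_Mapping.keys x \<Longrightarrow> q \<in> Poly_Mapping.keys y \<Longrightarrow> r \<in> Poly_Mapping.keys z \<Longrightarrow>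
      F (Poly_Mapping.single p 1) (Poly_Mapping.single q 1) (Poly_Mapping.single r 1) =
      G (Poly_Mapping.single p 1) (Poly_Mapping.single q 1) (Poly_Mapping.single r 1)"
  shows "F x y z = G x y z"
  by (rule klin_eq[OF assms(1,4)], rule klin_eq[OF assms(2,5)], rule klin_eq[OF assms(3,6)])
    (rule assms(7))

lemma pmult_assoc: "pmult (pmult x y) z = pmult x (pmult y z)"
  by (rule klin_ext3[where F = "\<lambda>x y z. pmult (pmult x y) z" and G = "\<lambda>x y z. pmult x (pmult y z)"])
    (intro klin_pmult_left klin_pmult_right klin_pmult_left' klin_pmult_right' klin_id | auto)+

lemma keys_pmult:
  "r \<in> Poly_Mapping.keys (pmult x y) \<Longrightarrow>
    \<exists>q\<in>Poly_Mapping.keys x. \<exists>p\<in>Poly_Mapping.keys y. composable q p \<and> r = q \<cdot> p"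
  unfolding pmult_eq_lin
  by (drule subsetD[OF keys_lin], clarify, drule subsetD[OF keys_lin]) (auto split: if_splits)

section \<open>Reductions as linear maps\<close>

lemma reduce1_eq_lin:
  "reduce1 (a, s, f, c) = lin (\<lambda>q. if q = a \<cdot> s \<cdot> c then pmult (pvec a) (pmult f (pvec c)) else pvec q)"
  by (simp add: fun_eq_iff reduce1_def lin_def scale_eq_smul)

lemma klin_reduce1: "klin (reduce1 \<rho>)"
  by (cases \<rho>) (simp add: reduce1_eq_lin)

lemma reduce_Nil [simp]: "reduce [] x = x"
  and reduce_Cons [simp]: "reduce (\<rho> # rs) x = reduce rs (reduce1 \<rho> x)"
  and reduce_append [simp]: "reduce (rs @ rs') x = reduce rs' (reduce rs x)"
  by (simp_all add: reduce_def)

lemma klin_reduce: "klin (reduce rs)"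
proof (induct rs)
  case (Cons \<rho> rs)
  then show ?case
    using klin_comp[OF Cons klin_reduce1[of \<rho>]] by (simp add: fun_eq_iff klin_def)
qed (simp add: klin_def)

section \<open>The free bimodule on a set of paths\<close>

type_synonym ('v, 'a, 'k) tripvec =
  "(('v, 'a) qpath \<times> ('v, 'a) qpath \<times> ('v, 'a) qpath) \<Rightarrow>\<^sub>0 'k"

text \<open>The lift of the tensor of \<open>a\<close>, \<open>x\<close> and \<open>c\<close>. Basis
  triples are arbitrary; those whose factors do not compose stand for zero tensors and are excluded
  later by a condition on supports.\<close>

definition ten :: "('v, 'a, 'k::field) pathvec \<Rightarrow> ('v, 'a) qpath \<Rightarrow> ('v, 'a, 'k) pathvec
    \<Rightarrow> ('v, 'a, 'k) tripvec" where
  "ten a x c = lin (\<lambda>p. lin (\<lambda>q. Poly_Mapping.single (p, x, q) 1) c) a"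

definition lmul :: "('v, 'a, 'k::field) pathvec \<Rightarrow> ('v, 'a, 'k) tripvec \<Rightarrow> ('v, 'a, 'k) tripvec" where
  "lmul a = lin (\<lambda>(p, x, q). ten (pmult a (pvec p)) x (pvec q))"

definition rmul :: "('v, 'a, 'k::field) tripvec \<Rightarrow> ('v, 'a, 'k) pathvec \<Rightarrow> ('v, 'a, 'k) tripvec" where
  "rmul g c = lin (\<lambda>(p, x, q). ten (pvec p) x (pmult (pvec q) c)) g"

lemma ten_single [simp]:
  "ten (Poly_Mapping.single p c) x (Poly_Mapping.single q d) = Poly_Mapping.single (p, x, q) (c * d)"
  by (simp add: ten_def)

lemma klin_ten_left: "klin T \<Longrightarrow> klin (\<lambda>a. ten (T a) x c)"
  unfolding ten_def by (intro klin_intros)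

lemma klin_ten_right: "klin T \<Longrightarrow> klin (\<lambda>c. ten a x (T c))"
  unfolding ten_def by (intro klin_intros)

lemma ten_distrib:
  "ten (a + a') x c = ten a x c + ten a' x c" "ten a x (c + c') = ten a x c + ten a x c'"
  "ten (a - a') x c = ten a x c - ten a' x c" "ten a x (c - c') = ten a x c - ten a x c'"
  "ten (smul d a) x c = smul d (ten a x c)" "ten a x (smul d c) = smul d (ten a x c)"
  by (auto simp: klin_plus[OF klin_ten_left[OF klin_id]] klin_plus[OF klin_ten_right[OF klin_id]]
    klin_minus[OF klin_ten_left[OF klin_id]] klin_minus[OF klin_ten_right[OF klin_id]]
    klin_smul[OF klin_ten_left[OF klin_id]] klin_smul[OF klin_ten_right[OF klin_id]])

lemma ten_zero [simp]: "ten 0 x c = 0" "ten a x 0 = 0"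
  using klin_zero[OF klin_ten_left[OF klin_id]] klin_zero[OF klin_ten_right[OF klin_id]] by auto

lemma klin_lmul: "klin T \<Longrightarrow> klin (\<lambda>g. lmul a (T g))"
  unfolding lmul_def by (intro klin_intros)

lemma klin_rmul: "klin T \<Longrightarrow> klin (\<lambda>g. rmul (T g) c)"
  unfolding rmul_def by (intro klin_intros)

lemma klin_lmul_left: "klin T \<Longrightarrow> klin (\<lambda>a. lmul (T a) g)"
  unfolding lmul_def
  by (intro klin_intros) (auto split: prod.split intro!: klin_ten_left klin_pmult_left')

lemma klin_rmul_right: "klin T \<Longrightarrow> klin (\<lambda>c. rmul g (T c))"
  unfolding rmul_def
  by (intro klin_intros) (auto split: prod.split intro!: klin_ten_right klin_pmult_right')

lemmas klin_path_intros = klin_pmult_left' klin_pmult_right' klin_ten_left klin_ten_right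
  klin_lmul klin_rmul klin_lmul_left klin_rmul_right klin_intros

lemma lmul_zero [simp]: "lmul 0 g = 0" "lmul a 0 = 0"
  and rmul_zero [simp]: "rmul 0 a = 0" "rmul g 0 = 0"
  using klin_zero[OF klin_lmul[OF klin_id]] klin_zero[OF klin_lmul_left[OF klin_id]]
    klin_zero[OF klin_rmul[OF klin_id]] klin_zero[OF klin_rmul_right[OF klin_id]] by auto

lemma lmul_distrib:
  "lmul (a + a') g = lmul a g + lmul a' g" "lmul a (g + g') = lmul a g + lmul a g'"
  "lmul (a - a') g = lmul a g - lmul a' g" "lmul a (g - g') = lmul a g - lmul a g'"
  "lmul (smul d a) g = smul d (lmul a g)" "lmul a (smul d g) = smul d (lmul a g)"
  by (auto simp: klin_plus[OF klin_lmul[OF klin_id]] klin_plus[OF klin_lmul_left[OF klin_id]]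
    klin_minus[OF klin_lmul[OF klin_id]] klin_minus[OF klin_lmul_left[OF klin_id]]
    klin_smul[OF klin_lmul[OF klin_id]] klin_smul[OF klin_lmul_left[OF klin_id]])

lemma rmul_distrib:
  "rmul g (a + a') = rmul g a + rmul g a'" "rmul (g + g') a = rmul g a + rmul g' a"
  "rmul g (a - a') = rmul g a - rmul g a'" "rmul (g - g') a = rmul g a - rmul g' a"
  "rmul g (smul d a) = smul d (rmul g a)" "rmul (smul d g) a = smul d (rmul g a)"
  by (auto simp: klin_plus[OF klin_rmul[OF klin_id]] klin_plus[OF klin_rmul_right[OF klin_id]]
    klin_minus[OF klin_rmul[OF klin_id]] klin_minus[OF klin_rmul_right[OF klin_id]]
    klin_smul[OF klin_rmul[OF klin_id]] klin_smul[OF klin_rmul_right[OF klin_id]])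

lemma lmul_single: "lmul a (Poly_Mapping.single (p, x, q) 1) = ten (pmult a (pvec p)) x (pvec q)"
  and rmul_single: "rmul (Poly_Mapping.single (p, x, q) 1) c = ten (pvec p) x (pmult (pvec q) c)"
  by (simp_all add: lmul_def rmul_def)

lemma lmul_ten: "lmul a (ten b x c) = ten (pmult a b) x c"
  by (rule klin_ext3[where F = "\<lambda>a b c. lmul a (ten b x c)" and G = "\<lambda>a b c. ten (pmult a b) x c"])
    (intro klin_path_intros | simp add: lmul_single)+

lemma rmul_ten: "rmul (ten b x c) a = ten b x (pmult c a)"
  by (rule klin_ext3[where F = "\<lambda>b c a. rmul (ten b x c) a" and G = "\<lambda>b c a. ten b x (pmult c a)"])
    (intro klin_path_intros | simp add: rmul_single)+

lemma lmul_lmul: "lmul a (lmul b g) = lmul (pmult a b) g"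
  by (rule klin_eq[where x = g]) (auto intro!: klin_path_intros simp: lmul_single lmul_ten pmult_assoc)

lemma lmul_rmul: "lmul a (rmul g c) = rmul (lmul a g) c"
  by (rule klin_eq[where x = g])
    (auto intro!: klin_path_intros simp: lmul_single rmul_single lmul_ten rmul_ten)

section \<open>Factorisations of paths\<close>

locale quiver =
  fixes Q :: "('v, 'a) pre_digraph"
  assumes wf: "wf_digraph Q"
begin

lemma pcomp_in_paths [intro]:
  "q \<in> paths Q \<Longrightarrow> p \<in> paths Q \<Longrightarrow> composable q p \<Longrightarrow> q \<cdot> p \<in> paths Q"
  using wf_digraph.awalk_appendI[OF wf] by (fastforce simp: paths_def composable_def)

lemma vertex_path_source_in_paths: "p \<in> paths Q \<Longrightarrow> vertex_path (source p) \<in> paths Q"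
  and vertex_path_target_in_paths: "p \<in> paths Q \<Longrightarrow> vertex_path (target p) \<in> paths Q"
  using wf_digraph.awalk_hd_in_verts[OF wf] wf_digraph.awalk_last_in_verts[OF wf]
    wf_digraph.awalk_Nil_iff[OF wf]
  by (fastforce simp: paths_def)+

lemma len_0_vertex: "p \<in> paths Q \<Longrightarrow> len p = 0 \<Longrightarrow> p = vertex_path (source p)"
  using wf_digraph.awalk_Nil_iff[OF wf] by (cases p) (auto simp: paths_def len_def vertex_path_def)

text \<open>Arrows are stored in the order of traversal, so the first \<open>i\<close> of them form
  the right factor \<open>p'\<close>. The leftmost arrow is split off with
  \<open>i = len p - 1\<close>.\<close>

lemma path_split:
  assumes "p \<in> paths Q" "i \<le> len p"
  obtains q p' where "p = q \<cdot> p'" "composable q p'" "q \<in> paths Q" "p' \<in> paths Q" "len p' = i"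
proof -
  have "pre_digraph.awalk Q (source p) (take i (arrows p) @ drop i (arrows p)) (target p)"
    using assms by (simp add: paths_def)
  then obtain v where v: "pre_digraph.awalk Q (source p) (take i (arrows p)) v"
      "pre_digraph.awalk Q v (drop i (arrows p)) (target p)"
    unfolding wf_digraph.awalk_append_iff[OF wf] by blast
  moreover have "p = Path v (drop i (arrows p)) (target p) \<cdot> Path (source p) (take i (arrows p)) v"
    by (cases p) (simp add: pcomp_def)
  ultimately show ?thesis
    using assms(2)
    by (intro that[of "Path v (drop i (arrows p)) (target p)" "Path (source p) (take i (arrows p)) v"])
      (auto simp: paths_def len_def composable_def)
qed

lemma levi:
  assumes "q \<in> paths Q" "p \<in> paths Q" "q' \<in> paths Q" "p' \<in> paths Q" "composable q p" "composable q' p'"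
    and eq: "q \<cdot> p = q' \<cdot> p'" and le: "len p \<le> len p'"
  obtains m where "m \<in> paths Q" "composable m p" "composable q' m" "p' = m \<cdot> p" "q = q' \<cdot> m"
proof -
  have eqs: "source p = source p'" "target q = target q'" "arrows p @ arrows q = arrows p' @ arrows q'"
    using eq by (auto simp: pcomp_def)
  have le': "length (arrows p) \<le> length (arrows p')"
    using le by (simp add: len_def)
  then have "arrows p' = arrows p @ drop (length (arrows p)) (arrows p')"
    by (metis append_eq_append_conv_if append_take_drop_id eqs(3))
  then obtain us where us: "arrows p' = arrows p @ us" "arrows q = us @ arrows q'"
    by (metis append.assoc eqs(3) same_append_eq)
  have "pre_digraph.awalk Q (source p) (arrows p @ us) (target p')"
    using assms us eqs by (simp add: paths_def)
  then obtain v where v: "pre_digraph.awalk Q (source p) (arrows p) v"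
      "pre_digraph.awalk Q v us (target p')"
    unfolding wf_digraph.awalk_append_iff[OF wf] by blast
  \<comment> \<open>If \<open>us\<close> is empty its arrows do not determine a vertex. The walk
    along \<open>p\<close> fixes the cut at \<open>target p\<close>.\<close>
  have "pre_digraph.awalk Q (source p) (arrows p) (target p)"
    using assms by (simp add: paths_def)
  then have "v = target p"
    using v(1) wf_digraph.awalk_ends[OF wf] by fastforce
  then show ?thesis
    using assms us eqs v
    by (intro that[of "Path (target p) us (target p')"])
      (auto simp: paths_def composable_def pcomp_def intro!: qpath.expand)
qed

end

section \<open>Reductions\<close>

lemma smul_eq_0_iff [simp]: "smul c x = 0 \<longleftrightarrow> c = 0 \<or> x = 0"
  by (metis lookup_smul lookup_zero mult_eq_0_iff poly_mapping_eqI smul_simps(1,2))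

lemma lookup_lin:
  "Poly_Mapping.lookup (lin F x) z =
    (\<Sum>p\<in>Poly_Mapping.keys x. Poly_Mapping.lookup x p * Poly_Mapping.lookup (F p) z)"
  by (simp add: lin_def lookup_sum)

abbreviation sandwich where
  "sandwich a f c \<equiv> pmult (pvec a) (pmult f (pvec c))"

text \<open>A basic reduction acts on a single term, so it adds a multiple of the difference between
  replacement and redex. Supports after a reduction are read off from this form.\<close>

lemma reduce1_eq:
  "reduce1 (a, s, f, c) x =
    x + smul (Poly_Mapping.lookup x (a \<cdot> s \<cdot> c)) (sandwich a f c - pvec (a \<cdot> s \<cdot> c))"
proof (rule klin_eq[OF klin_reduce1])
  show "klin (\<lambda>x. x + smul (Poly_Mapping.lookup x (a \<cdot> s \<cdot> c)) (sandwich a f c - pvec (a \<cdot> s \<cdot> c)))"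
    by (auto intro!: klinI simp: lookup_add smul_distrib single_add algebra_simps)
qed (auto simp: reduce1_eq_lin lookup_single when_def)

lemma kspan_iff: "x \<in> kspan X \<longleftrightarrow> Poly_Mapping.keys x \<subseteq> X"
  by (simp add: kspan_def)

lemma subsp_kspan: "subsp (kspan X)"
  using subsp_keys by (simp add: kspan_def)

lemma pvec_in_kspan [simp]: "pvec p \<in> kspan X \<longleftrightarrow> p \<in> X"
  by (simp add: kspan_def)

lemma context_eq_lin:
  assumes "\<And>g. g \<in> Poly_Mapping.keys x \<Longrightarrow> composable u g \<and> composable g w"
  shows "sandwich u x w = lin (\<lambda>g. pvec (u \<cdot> g \<cdot> w)) x"
  by (rule klin_eq[where S = "\<lambda>f. sandwich u f w"])
    (intro klin_path_intros klin_lin | use assms in simp)+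

text \<open>Within composable products \<open>u \<cdot> g \<cdot> w\<close> determines
  \<open>g\<close>, so distinct terms stay distinct in a context and no coefficient can
  cancel.\<close>

lemma lookup_context:
  assumes "\<And>g. g \<in> Poly_Mapping.keys x \<Longrightarrow> composable u g \<and> composable g w"
    and "composable u g" "composable g w"
  shows "Poly_Mapping.lookup (sandwich u x w) (u \<cdot> g \<cdot> w) = Poly_Mapping.lookup x g"
proof -
  have eq: "sandwich u x w = lin (\<lambda>g. pvec (u \<cdot> g \<cdot> w)) x"
    by (rule context_eq_lin) (use assms(1) in simp)
  have "Poly_Mapping.lookup (sandwich u x w) (u \<cdot> g \<cdot> w) =
    (\<Sum>p\<in>Poly_Mapping.keys x. if p = g then Poly_Mapping.lookup x g else 0)"
    unfolding eq lookup_lin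
    by (intro sum.cong refl)
      (use assms in \<open>auto simp: lookup_single when_def pcomp_left_cancel pcomp_right_cancel\<close>)
  then show ?thesis
    by (auto simp: in_keys_iff)
qed

context quiver begin

lemma kspan_pmult:
  "x \<in> kspan (paths Q) \<Longrightarrow> y \<in> kspan (paths Q) \<Longrightarrow> pmult x y \<in> kspan (paths Q)"
  unfolding kspan_iff by (auto dest!: keys_pmult)

end

locale redsys = quiver Q for Q :: "('v, 'a) pre_digraph" +
  fixes I :: "('v, 'a, 'k::field) pathvec set" and \<R> :: "('v, 'a, 'k) redsys"
  assumes ideal_I: "ideal I (path_algebra Q)"
    and rs: "reduction_system Q \<R>" and loz: "lozenge Q I \<R>"
    and len_tips: "s \<in> tips \<R> \<Longrightarrow> 2 \<le> len s"
begin

abbreviation "BR \<equiv> basic_reductions Q \<R>"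

lemma rule_facts:
  assumes "(s, f) \<in> \<R>"
  shows "s \<in> paths Q" "f \<in> kspan (paths Q)" "f \<noteq> pvec s" "s \<in> tips \<R>"
    and "\<And>p. p \<in> Poly_Mapping.keys f \<Longrightarrow> source p = source s \<and> target p = target s"
    and "irred Q \<R> f" "2 \<le> len s"
proof -
  show "s \<in> tips \<R>"
    using assms by (force simp: tips_def)
  then show "2 \<le> len s"
    by (rule len_tips)
qed (use assms rs loz in \<open>fastforce simp: reduction_system_def lozenge_def parallel_def\<close>)+

lemma divisor_tips:
  "(s, f) \<in> \<R> \<Longrightarrow> (s', f') \<in> \<R> \<Longrightarrow> divisor Q s s' \<Longrightarrow> s = s' \<and> f = f'"
  using rs unfolding reduction_system_def by fastforce

lemma BR_D:
  assumes "(a, s, f, c) \<in> BR"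
  shows "(s, f) \<in> \<R>" "a \<in> paths Q" "c \<in> paths Q" "composable a s" "composable s c"
    "s \<in> paths Q" "a \<cdot> s \<cdot> c \<in> paths Q"
  using assms rule_facts(1) by (auto simp: basic_reductions_def intro!: pcomp_in_paths)

lemma BR_I:
  "(s, f) \<in> \<R> \<Longrightarrow> a \<in> paths Q \<Longrightarrow> c \<in> paths Q \<Longrightarrow> composable a s \<Longrightarrow> composable s c \<Longrightarrow> (a, s, f, c) \<in> BR"
  by (auto simp: basic_reductions_def)

lemma BR_composable:
  assumes "(a, s, f, c) \<in> BR" "g \<in> Poly_Mapping.keys f"
  shows "composable a g" "composable g c"
  using BR_D[OF assms(1)] rule_facts(5)[of s f g] assms(2) by (auto simp: composable_def)

lemma sandwich_eq_lin:
  assumes "(a, s, f, c) \<in> BR"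
  shows "sandwich a f c = lin (\<lambda>g. pvec (a \<cdot> g \<cdot> c)) f"
  by (rule context_eq_lin) (use BR_composable[OF assms] in simp)

lemma keys_sandwich:
  assumes "(a, s, f, c) \<in> BR" "p \<in> Poly_Mapping.keys (sandwich a f c)"
  obtains g where "g \<in> Poly_Mapping.keys f" "p = a \<cdot> g \<cdot> c"
  using assms(2) keys_lin[of "\<lambda>g. pvec (a \<cdot> g \<cdot> c)" f] unfolding sandwich_eq_lin[OF assms(1)] by auto

lemma sandwich_in_kspan: "(a, s, f, c) \<in> BR \<Longrightarrow> sandwich a f c \<in> kspan (paths Q)"
  by (intro kspan_pmult) (auto dest: BR_D rule_facts)

lemma lookup_sandwich:
  assumes "(a, s, f, c) \<in> BR"
  shows "Poly_Mapping.lookup (sandwich a f c) (a \<cdot> s \<cdot> c) = Poly_Mapping.lookup f s"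
  by (rule lookup_context) (use BR_composable[OF assms] BR_D[OF assms] in auto)

lemma sandwich_vertices:
  assumes "(s, f) \<in> \<R>"
  shows "sandwich (vertex_path (target s)) f (vertex_path (source s)) = f"
  by (rule klin_eq[where T = "\<lambda>f. f"])
    (intro klin_path_intros | use rule_facts(5)[OF assms] in \<open>auto simp: composable_def\<close>)+

lemma vertex_BR:
  "(s, f) \<in> \<R> \<Longrightarrow> (vertex_path (target s), s, f, vertex_path (source s)) \<in> BR"
  using rule_facts(1) vertex_path_source_in_paths vertex_path_target_in_paths
  by (auto simp: basic_reductions_def composable_def)

text \<open>If \<open>s\<close> occurred in \<open>f\<close>, reducing \<open>s\<close> between two
  vertices would add a nonzero multiple of \<open>f - s\<close> to the irreducible vector
  \<open>f\<close>. Consequently a redex is absent right after it has been reduced.\<close>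

lemma tip_notin_keys:
  assumes "(s, f) \<in> \<R>"
  shows "Poly_Mapping.lookup f s = 0"
proof -
  have "reduce1 (vertex_path (target s), s, f, vertex_path (source s)) f = f"
    using rule_facts(6)[OF assms] vertex_BR[OF assms] by (auto simp: irred_def)
  then show ?thesis
    using rule_facts(3)[OF assms] by (simp add: reduce1_eq sandwich_vertices[OF assms])
qed

lemma lookup_sandwich_0:
  "(a, s, f, c) \<in> BR \<Longrightarrow> Poly_Mapping.lookup (sandwich a f c) (a \<cdot> s \<cdot> c) = 0"
  using lookup_sandwich tip_notin_keys BR_D(1) by metis

lemma lookup_reduce1_redex:
  "(a, s, f, c) \<in> BR \<Longrightarrow> Poly_Mapping.lookup (reduce1 (a, s, f, c) x) (a \<cdot> s \<cdot> c) = 0"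
  by (simp add: reduce1_eq lookup_add lookup_minus lookup_sandwich_0)

lemma reduce1_fixed_iff:
  "(a, s, f, c) \<in> BR \<Longrightarrow> reduce1 (a, s, f, c) x = x \<longleftrightarrow> a \<cdot> s \<cdot> c \<notin> Poly_Mapping.keys x"
  using lookup_reduce1_redex[of a s f c x] by (auto simp: in_keys_iff reduce1_eq)

lemma irred_paths_iff:
  "p \<in> irred_paths Q \<R> \<longleftrightarrow> p \<in> paths Q \<and> (\<forall>a s f c. (a, s, f, c) \<in> BR \<longrightarrow> a \<cdot> s \<cdot> c \<noteq> p)"
  by (auto simp: irred_paths_def irred_def reduce1_fixed_iff)

text \<open>A basic reduction fixes \<open>x\<close> exactly if its redex is not in the support.
  Being fixed by all of them is therefore a condition on each path of \<open>x\<close> separately,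
  in which coefficients cannot interfere.\<close>

lemma irred_iff: "irred Q \<R> x \<longleftrightarrow> x \<in> kspan (irred_paths Q \<R>)"
proof -
  have "irred Q \<R> x \<longleftrightarrow> x \<in> kspan (paths Q) \<and>
      (\<forall>a s f c. (a, s, f, c) \<in> BR \<longrightarrow> a \<cdot> s \<cdot> c \<notin> Poly_Mapping.keys x)"
    unfolding irred_def by (auto simp: reduce1_fixed_iff)
  then show ?thesis
    unfolding kspan_iff subset_iff irred_paths_iff by blast
qed

lemma reducible_cases:
  assumes "p \<in> paths Q" "p \<notin> irred_paths Q \<R>"
  obtains a s f c where "(a, s, f, c) \<in> BR" "p = a \<cdot> s \<cdot> c"
  using assms by (auto simp: irred_paths_iff)

lemma reduce_irred: "irred Q \<R> x \<Longrightarrow> rs \<in> reductions Q \<R> \<Longrightarrow> reduce rs x = x"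
  by (induct rs) (auto simp: irred_def)

lemma reduce1_in_kspan: "x \<in> kspan (paths Q) \<Longrightarrow> \<rho> \<in> BR \<Longrightarrow> reduce1 \<rho> x \<in> kspan (paths Q)"
  by (cases \<rho>) (auto simp: reduce1_eq sandwich_in_kspan BR_D subsp_kspan intro!: subsp_add subsp_smul subsp_diff)

lemma reduce_in_kspan: "x \<in> kspan (paths Q) \<Longrightarrow> rs \<in> reductions Q \<R> \<Longrightarrow> reduce rs x \<in> kspan (paths Q)"
  by (induct rs arbitrary: x) (auto simp: reduce1_in_kspan)

section \<open>Well-foundedness of reduction on single paths\<close>

definition smaller :: "(('v, 'a) qpath \<times> ('v, 'a) qpath) set" where
  "smaller = {(q, p). \<exists>a s f c. (a, s, f, c) \<in> BR \<and> p = a \<cdot> s \<cdot> c \<and> q \<in> Poly_Mapping.keys (sandwich a f c)}"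

text \<open>
  Reducing along the chain, some \<open>P i\<close> always occurs while \<open>P (Suc i)\<close> does not, so cancellation
  cannot make the sequence stationary.
\<close>

lemma no_recurrent_chain:
  assumes chain: "\<And>i. (P (Suc i), P i) \<in> smaller"
    and recurrent: "\<And>x :: ('v, 'a, 'k) pathvec. \<And>j. P j \<notin> Poly_Mapping.keys x \<Longrightarrow>
      \<exists>k>j. P k \<notin> Poly_Mapping.keys x"
  shows False
proof -
  have "\<exists>\<rho>\<in>BR. \<exists>a s f c. \<rho> = (a, s, f, c) \<and> P i = a \<cdot> s \<cdot> c \<and> P (Suc i) \<in> Poly_Mapping.keys (sandwich a f c)" for i
    using chain[of i] unfolding smaller_def by blast
  then obtain \<rho> where \<rho>: "\<And>i. \<rho> i \<in> BR"
    "\<And>i. \<exists>a s f c. \<rho> i = (a, s, f, c) \<and> P i = a \<cdot> s \<cdot> c \<and> P (Suc i) \<in> Poly_Mapping.keys (sandwich a f c)"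
    by metis
  have distinct: "P (Suc i) \<noteq> P i" for i
    using \<rho>[of i] lookup_sandwich_0 by (metis in_keys_iff)
  \<comment> \<open>At such an index \<open>P i\<close> is present, so reducing it has an effect,
    and \<open>P (Suc i)\<close> is absent, so its new coefficient, a product of nonzero field
    elements, meets no old one that could cancel it.\<close>
  define good where "good x i \<longleftrightarrow> P i \<in> Poly_Mapping.keys x \<and> P (Suc i) \<notin> Poly_Mapping.keys x"
    for x :: "('v, 'a, 'k) pathvec" and i
  have step: "\<exists>j. good (reduce1 (\<rho> i) x) j" "reduce1 (\<rho> i) x \<noteq> x" if "good x i" for x i
  proof -
    obtain a s f c where e: "\<rho> i = (a, s, f, c)" "P i = a \<cdot> s \<cdot> c"
        "P (Suc i) \<in> Poly_Mapping.keys (sandwich a f c)" "(a, s, f, c) \<in> BR"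
      using \<rho> by metis
    let ?y = "reduce1 (\<rho> i) x"
    have 1: "P i \<notin> Poly_Mapping.keys ?y"
      using lookup_reduce1_redex[OF e(4)] e by (simp add: in_keys_iff)
    then show "?y \<noteq> x"
      using that by (auto simp: good_def)
    have 2: "P (Suc i) \<in> Poly_Mapping.keys ?y"
      using that e distinct[of i]
      by (auto simp: good_def in_keys_iff reduce1_eq lookup_add lookup_minus lookup_single when_def)
    \<comment> \<open>The chain is now present at \<open>Suc i\<close> and absent at the later index
      \<open>k\<close>. Somewhere between the two it switches from present to absent, and this is
      the next good index.\<close>
    obtain k where "k > i" "P k \<notin> Poly_Mapping.keys ?y"
      using recurrent[OF 1] by blast
    then have k: "Suc i \<le> k" "P k \<notin> Poly_Mapping.keys ?y"
      by auto
    show "\<exists>j. good ?y j"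
    proof (rule ccontr)
      assume "\<nexists>j. good ?y j"
      with k(1) have "P k \<in> Poly_Mapping.keys ?y"
        by (induct k rule: dec_induct) (use 2 in \<open>auto simp: good_def\<close>)
      then show False
        using k by simp
    qed
  qed
  \<comment> \<open>Each step reduces at some good index of the current vector and changes the
    vector, so the sequence of reducts of \<open>P 0\<close> never becomes constant.\<close>
  define r where "r = rec_nat (pvec (P 0)) (\<lambda>_ x. reduce1 (\<rho> (SOME i. good x i)) x)"
  have r0: "r 0 = pvec (P 0)" and rS: "r (Suc n) = reduce1 (\<rho> (SOME i. good (r n) i)) (r n)" for n
    by (simp_all add: r_def)
  have good: "\<exists>i. good (r n) i" for n
  proof (induct n)
    case 0
    have "good (r 0) 0"
      using distinct[of 0] by (auto simp: r0 good_def)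
    then show ?case ..
  next
    case (Suc n)
    then show ?case
      unfolding rS by (intro step(1)) (rule someI_ex)
  qed
  define R where "R n = \<rho> (SOME i. good (r n) i)" for n
  have R: "reduce (map R [0..<n]) (pvec (P 0)) = r n" for n
    by (induct n) (simp_all add: r0 rS R_def)
  have "P 0 \<in> paths Q"
    using \<rho>[of 0] BR_D(7) by metis
  then have "reduction_finite Q \<R> (P 0)"
    using loz by (auto simp: lozenge_def reduction_unique_def)
  moreover have "R i \<in> BR" for i
    by (simp add: R_def \<rho>(1))
  ultimately obtain N where "\<And>n. n \<ge> N \<Longrightarrow> reduce (map R [0..<n]) (pvec (P 0)) = reduce (map R [0..<N]) (pvec (P 0))"
    unfolding reduction_finite_def by metis
  from this[of "Suc N"] have "r (Suc N) = r N"
    unfolding R by simp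
  then show False
    using step(2)[OF someI_ex[OF good[of N]]] by (simp add: rS)
qed

text \<open>The finite support of a vector misses some later member of an injective chain. In a
  chain with a repetition the cycle between two equal members can be traversed for ever instead, and
  then an absent path is absent again one period later.\<close>

lemma wf_smaller: "wf smaller"
  unfolding wf_iff_no_infinite_down_chain
proof
  assume "\<exists>P. \<forall>i. (P (Suc i), P i) \<in> smaller"
  then obtain P where P: "\<And>i. (P (Suc i), P i) \<in> smaller"
    by blast
  show False
  proof (cases "inj P")
    case True
    show ?thesis
    proof (rule no_recurrent_chain[of P, OF P])
      fix x :: "('v, 'a, 'k) pathvec" and j
      have "infinite (P ` {j<..})"
        using True by (simp add: finite_image_iff inj_on_subset infinite_Ioi)
      then have "\<not> P ` {j<..} \<subseteq> Poly_Mapping.keys x"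
        using finite_subset[OF _ finite_keys[of x]] by blast
      then show "\<exists>k>j. P k \<notin> Poly_Mapping.keys x"
        by auto
    qed
  next
    case False
    then obtain i j where ij: "i < j" "P i = P j"
      unfolding inj_on_def by (metis linorder_neqE_nat)
    define m where "m = j - i"
    have m: "m > 0" "P (i + m) = P i"
      using ij by (auto simp: m_def)
    show ?thesis
    proof (rule no_recurrent_chain[of "\<lambda>k. P (i + k mod m)"])
      fix k
      show "(P (i + Suc k mod m), P (i + k mod m)) \<in> smaller"
      proof -
        have "P (i + Suc k mod m) = P (Suc (i + k mod m))"
          using m by (cases "Suc (k mod m) = m") (simp_all add: mod_Suc flip: add_Suc_right)
        then show ?thesis
          using P[of "i + k mod m"] by simp
      qed
    next
      fix x :: "('v, 'a, 'k) pathvec" and k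
      assume "P (i + k mod m) \<notin> Poly_Mapping.keys x"
      then show "\<exists>l>k. P (i + l mod m) \<notin> Poly_Mapping.keys x"
        using m by (intro exI[of _ "k + m"]) auto
    qed
  qed
qed

lemma smallerI: "(a, s, f, c) \<in> BR \<Longrightarrow> q \<in> Poly_Mapping.keys (sandwich a f c) \<Longrightarrow> (q, a \<cdot> s \<cdot> c) \<in> smaller"
  by (auto simp: smaller_def)

section \<open>Normal forms\<close>

text \<open>Steps whose redex differs from \<open>p\<close> leave the single path \<open>p\<close>
  alone. The first step with redex \<open>p\<close> produces the sandwich on which the rest of the
  list acts.\<close>

lemma reduce_path_cases:
  assumes "rs \<in> reductions Q \<R>"
  shows "reduce rs (pvec p) = pvec p \<or>
    (\<exists>a s f c rs'. (a, s, f, c) \<in> BR \<and> p = a \<cdot> s \<cdot> c \<and> rs' \<in> reductions Q \<R> \<and>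
      reduce rs (pvec p) = reduce rs' (sandwich a f c))"
  using assms
proof (induct rs)
  case (Cons \<rho> rs)
  obtain a s f c where \<rho>: "\<rho> = (a, s, f, c)"
    by (cases \<rho>)
  show ?case
  proof (cases "p = a \<cdot> s \<cdot> c")
    case True
    then have "reduce (\<rho> # rs) (pvec p) = reduce rs (sandwich a f c)"
      by (simp add: \<rho> reduce1_eq)
    moreover have "(a, s, f, c) \<in> BR" "rs \<in> reductions Q \<R>"
      using Cons.hyps \<rho> by auto
    ultimately show ?thesis
      using True by blast
  next
    case False
    then have "reduce1 \<rho> (pvec p) = pvec p"
      using Cons(1,2) reduce1_fixed_iff[of a s f c "pvec p"] by (auto simp: \<rho>)
    then show ?thesis
      using Cons by auto
  qed
qed simp

text \<open>A list that finishes one path can be prolonged for the next one, since irreducible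
  vectors stay fixed. One list acts on all terms of a vector at once, so the second path is already
  modified when its turn comes; this is why the assumption allows an arbitrary prefix
  \<open>rs0\<close>.\<close>

lemma common_reduction:
  assumes "finite F" and "rs0 \<in> reductions Q \<R>"
    and "\<And>q rs0. q \<in> F \<Longrightarrow> rs0 \<in> reductions Q \<R> \<Longrightarrow>
      \<exists>rs\<in>reductions Q \<R>. irred Q \<R> (reduce rs (reduce rs0 (pvec q)))"
  shows "\<exists>rs\<in>reductions Q \<R>. \<forall>q\<in>F. irred Q \<R> (reduce rs (reduce rs0 (pvec q)))"
  using assms
proof (induct F arbitrary: rs0)
  case (insert q F)
  obtain rs1 where rs1: "rs1 \<in> reductions Q \<R>" "irred Q \<R> (reduce rs1 (reduce rs0 (pvec q)))"
    using insert.prems by blast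
  have "rs0 @ rs1 \<in> reductions Q \<R>"
    using insert.prems rs1 by simp
  then obtain rs2 where rs2: "rs2 \<in> reductions Q \<R>"
      "\<forall>q\<in>F. irred Q \<R> (reduce rs2 (reduce (rs0 @ rs1) (pvec q)))"
    using insert.hyps(3)[of "rs0 @ rs1"] insert.prems(2) by blast
  then show ?case
    using rs1 reduce_irred[OF rs1(2) rs2(1)] by (intro bexI[of _ "rs1 @ rs2"]) auto
qed auto

lemma klin_irred:
  assumes "klin T" "\<And>q. q \<in> Poly_Mapping.keys x \<Longrightarrow> irred Q \<R> (T (pvec q))"
  shows "irred Q \<R> (T x)"
  unfolding irred_iff
  by (rule klin_mem[OF subsp_kspan assms(1)]) (rule assms(2)[unfolded irred_iff])

text \<open>Well-founded induction on \<open>smaller\<close>. The prefix \<open>rs0\<close> is part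
  of the claim because \<open>common_reduction\<close> applies it to paths that have already been
  subjected to the lists of others.\<close>

lemma path_reduces:
  assumes "p \<in> paths Q" "rs0 \<in> reductions Q \<R>"
  shows "\<exists>rs\<in>reductions Q \<R>. irred Q \<R> (reduce rs (reduce rs0 (pvec p)))"
  using wf_smaller assms
proof (induct p arbitrary: rs0 rule: wf_induct_rule)
  case (less p)
  show ?case
  proof (cases "p \<in> irred_paths Q \<R>")
    case True
    then have "irred Q \<R> (pvec p)"
      by (simp add: irred_iff)
    then show ?thesis
      using reduce_irred[OF _ less.prems(2), of "pvec p"] by (intro bexI[of _ "[]"]) simp_all
  next
    case False
    have *: ?thesis if r: "(a, s, f, c) \<in> BR" "p = a \<cdot> s \<cdot> c" "rs \<in> reductions Q \<R>"
      "rs' \<in> reductions Q \<R>" "reduce rs (reduce rs0 (pvec p)) = reduce rs' (sandwich a f c)" for a s f c rs rs'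
    proof -
      let ?F = "Poly_Mapping.keys (sandwich a f c)"
      have "\<exists>rs''\<in>reductions Q \<R>. \<forall>q\<in>?F. irred Q \<R> (reduce rs'' (reduce rs' (pvec q)))"
      proof (rule common_reduction[OF finite_keys r(4)])
        fix q rs0
        assume q: "q \<in> ?F" "rs0 \<in> reductions Q \<R>"
        have "q \<in> paths Q"
          using q(1) sandwich_in_kspan[OF r(1)] by (auto simp: kspan_iff)
        then show "\<exists>rs\<in>reductions Q \<R>. irred Q \<R> (reduce rs (reduce rs0 (pvec q)))"
          using smallerI[OF r(1) q(1)] q(2) unfolding r(2)[symmetric] by (intro less.hyps)
      qed
      then obtain rs'' where rs'': "rs'' \<in> reductions Q \<R>"
          "\<forall>q\<in>?F. irred Q \<R> (reduce rs'' (reduce rs' (pvec q)))"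
        by (rule bexE)
      have "irred Q \<R> (reduce (rs' @ rs'') (sandwich a f c))"
        by (rule klin_irred[OF klin_reduce]) (use rs'' in simp)
      then have "irred Q \<R> (reduce (rs @ rs'') (reduce rs0 (pvec p)))"
        unfolding reduce_append r(5) .
      moreover have "rs @ rs'' \<in> reductions Q \<R>"
        using r(3) rs''(1) by simp
      ultimately show ?thesis
        by blast
    qed
    from reduce_path_cases[OF less.prems(2), of p] show ?thesis
    proof (elim disjE exE conjE)
      assume eq: "reduce rs0 (pvec p) = pvec p"
      obtain a s f c where r: "(a, s, f, c) \<in> BR" "p = a \<cdot> s \<cdot> c"
        using reducible_cases[OF less.prems(1) False] by metis
      have "reduce [(a, s, f, c)] (reduce rs0 (pvec p)) = reduce [] (sandwich a f c)"
        unfolding eq by (simp add: r(2) reduce1_eq)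
      then show ?thesis
        by (rule *[OF r, rotated 2]) (use r(1) in auto)
    next
      fix a s f c rs'
      assume r: "(a, s, f, c) \<in> BR" "p = a \<cdot> s \<cdot> c" "rs' \<in> reductions Q \<R>"
        and eq: "reduce rs0 (pvec p) = reduce rs' (sandwich a f c)"
      have "reduce [] (reduce rs0 (pvec p)) = reduce rs' (sandwich a f c)"
        unfolding eq by simp
      then show ?thesis
        by (rule *[OF r(1,2) _ r(3), rotated]) simp
    qed
  qed
qed

text \<open>The result of some list that makes \<open>p\<close> irreducible; \<open>nfp_eq\<close>
  turns reduction-uniqueness into independence of this choice.\<close>

definition nfp :: "('v, 'a) qpath \<Rightarrow> ('v, 'a, 'k) pathvec" where
  "nfp p = reduce (SOME rs. rs \<in> reductions Q \<R> \<and> irred Q \<R> (reduce rs (pvec p))) (pvec p)"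

abbreviation NF :: "('v, 'a, 'k) pathvec \<Rightarrow> ('v, 'a, 'k) pathvec" where
  "NF \<equiv> lin nfp"

lemma nfp:
  assumes "p \<in> paths Q"
  obtains rs where "rs \<in> reductions Q \<R>" "irred Q \<R> (nfp p)" "nfp p = reduce rs (pvec p)"
proof -
  have "\<exists>rs. rs \<in> reductions Q \<R> \<and> irred Q \<R> (reduce rs (pvec p))"
    using path_reduces[OF assms, of "[]"] by auto
  from someI_ex[OF this] show ?thesis
    by (intro that[OF _ _ nfp_def]) (simp_all add: nfp_def)
qed

lemma irred_nfp: "p \<in> paths Q \<Longrightarrow> irred Q \<R> (nfp p)"
  by (rule nfp)

lemma nfp_eq:
  assumes "p \<in> paths Q" "rs \<in> reductions Q \<R>" "irred Q \<R> (reduce rs (pvec p))"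
  shows "reduce rs (pvec p) = nfp p"
proof -
  obtain rs' where rs': "rs' \<in> reductions Q \<R>" "irred Q \<R> (nfp p)" "nfp p = reduce rs' (pvec p)"
    by (rule nfp[OF assms(1)])
  have "reduction_unique Q \<R> p"
    using loz assms(1) by (simp add: lozenge_def)
  then have "reduce rs (pvec p) = reduce rs' (pvec p)"
    unfolding reduction_unique_def using assms(2,3) rs'(1) rs'(2)[unfolded rs'(3)] by blast
  then show ?thesis
    by (simp add: rs'(3))
qed

lemma NF_irred: "x \<in> kspan (paths Q) \<Longrightarrow> irred Q \<R> (NF x)"
  by (rule klin_irred[OF klin_lin]) (auto simp: kspan_iff irred_nfp)

text \<open>The list \<open>rs\<close> may make \<open>x\<close> irreducible merely by cancellation,
  while single paths of \<open>x\<close> remain reducible. A further list \<open>rs'\<close>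
  finishes all of them, which gives \<open>NF x\<close> by linearity, and it does not move the
  irreducible vector \<open>reduce rs x\<close>.\<close>

lemma NF_eq_reduce:
  assumes "x \<in> kspan (paths Q)" "rs \<in> reductions Q \<R>" "irred Q \<R> (reduce rs x)"
  shows "NF x = reduce rs x"
proof -
  have "\<exists>rs'\<in>reductions Q \<R>. \<forall>q\<in>Poly_Mapping.keys x. irred Q \<R> (reduce rs' (reduce rs (pvec q)))"
    by (rule common_reduction[OF finite_keys assms(2)]) (use path_reduces assms in \<open>auto simp: kspan_iff\<close>)
  then obtain rs' where rs': "rs' \<in> reductions Q \<R>"
    "\<forall>q\<in>Poly_Mapping.keys x. irred Q \<R> (reduce rs' (reduce rs (pvec q)))"
    by blast
  have "reduce (rs @ rs') x = NF x"
  proof (rule klin_eq[OF klin_reduce klin_lin])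
    fix p
    assume "p \<in> Poly_Mapping.keys x"
    then show "reduce (rs @ rs') (pvec p) = NF (pvec p)"
      using nfp_eq[of p "rs @ rs'"] rs' assms by (auto simp: kspan_iff)
  qed
  then show ?thesis
    using reduce_irred[OF assms(3) rs'(1)] by simp
qed

lemma NF_irred_eq: "irred Q \<R> x \<Longrightarrow> NF x = x"
  using NF_eq_reduce[of x "[]"] by (auto simp: irred_def)

lemma NF_NF: "x \<in> kspan (paths Q) \<Longrightarrow> NF (NF x) = NF x"
  by (intro NF_irred_eq NF_irred)

lemma NF_in_kspan: "x \<in> kspan (paths Q) \<Longrightarrow> NF x \<in> kspan (paths Q)"
  using NF_irred by (auto simp: irred_def)

lemma vector_reduces:
  assumes "x \<in> kspan (paths Q)"
  obtains rs where "rs \<in> reductions Q \<R>" "irred Q \<R> (reduce rs x)"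
proof -
  have "\<exists>rs'\<in>reductions Q \<R>. \<forall>q\<in>Poly_Mapping.keys x. irred Q \<R> (reduce rs' (reduce [] (pvec q)))"
    by (rule common_reduction[OF finite_keys]) (use path_reduces assms in \<open>auto simp: kspan_iff\<close>)
  then obtain rs' where rs': "rs' \<in> reductions Q \<R>"
    "\<forall>q\<in>Poly_Mapping.keys x. irred Q \<R> (reduce rs' (reduce [] (pvec q)))"
    by blast
  then show ?thesis
    using klin_irred[OF klin_reduce, of x] by (intro that[of rs']) simp_all
qed

lemma NF_reduce:
  assumes "x \<in> kspan (paths Q)" "rs \<in> reductions Q \<R>"
  shows "NF (reduce rs x) = NF x"
proof -
  obtain rs' where rs': "rs' \<in> reductions Q \<R>" "irred Q \<R> (reduce rs' (reduce rs x))"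
    using vector_reduces[OF reduce_in_kspan[OF assms]] by blast
  then show ?thesis
    using NF_eq_reduce[OF reduce_in_kspan[OF assms] rs'] NF_eq_reduce[of x "rs @ rs'"] assms by simp
qed

lemma NF_sandwich:
  assumes "(a, s, f, c) \<in> BR"
  shows "NF (pvec (a \<cdot> s \<cdot> c)) = NF (sandwich a f c)"
  using NF_reduce[of "pvec (a \<cdot> s \<cdot> c)" "[(a, s, f, c)]"] BR_D(7)[OF assms] assms
  by (simp add: reduce1_eq)

text \<open>Each replacement is parallel to its tip, so reduction stays inside the span of the paths
  between two fixed vertices.\<close>

lemma reduce_parallel:
  assumes "rs \<in> reductions Q \<R>" "\<And>q. q \<in> Poly_Mapping.keys x \<Longrightarrow> source q = v \<and> target q = w"
  shows "q \<in> Poly_Mapping.keys (reduce rs x) \<Longrightarrow> source q = v \<and> target q = w"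
  using assms
proof (induct rs arbitrary: x)
  case (Cons \<rho> rs)
  obtain a s f c where \<rho>: "\<rho> = (a, s, f, c)" "(a, s, f, c) \<in> BR"
    using Cons by (cases \<rho>) auto
  have "source q = v \<and> target q = w" if q: "q \<in> Poly_Mapping.keys (reduce1 \<rho> x)" for q
  proof (cases "a \<cdot> s \<cdot> c \<in> Poly_Mapping.keys x")
    case True
    then have vw: "source c = v" "target a = w"
      using Cons.prems(2)[OF True] by auto
    have "q \<in> Poly_Mapping.keys x \<or> q \<in> Poly_Mapping.keys (sandwich a f c) \<or> q = a \<cdot> s \<cdot> c"
      using q by (auto simp: \<rho> reduce1_eq in_keys_iff lookup_add lookup_minus lookup_single when_def split: if_splits)
    then consider "q \<in> Poly_Mapping.keys x" | "q \<in> Poly_Mapping.keys (sandwich a f c)" | "q = a \<cdot> s \<cdot> c"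
      by blast
    then show ?thesis
    proof cases
      case 2
      then obtain g where "q = a \<cdot> g \<cdot> c"
        by (rule keys_sandwich[OF \<rho>(2)])
      then show ?thesis
        using vw by simp
    qed (use Cons.prems(2) vw in simp_all)
  next
    case False
    then show ?thesis
      using q Cons.prems(2) reduce1_fixed_iff[OF \<rho>(2), of x] \<rho>(1) False by simp
  qed
  then show ?case
    using Cons by auto
qed simp

lemma nfp_parallel:
  assumes "p \<in> paths Q" "q \<in> Poly_Mapping.keys (nfp p)"
  shows "source q = source p" "target q = target p"
proof -
  obtain rs where rs: "rs \<in> reductions Q \<R>" "nfp p = reduce rs (pvec p)"
    by (rule nfp[OF assms(1)])
  have "source q = source p \<and> target q = target p"
    by (rule reduce_parallel[OF rs(1), of "pvec p"]) (use rs(2) assms(2) in auto)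
  then show "source q = source p" "target q = target p"
    by simp_all
qed

section \<open>The ideal of relations\<close>

abbreviation kQ :: "('v, 'a, 'k) pathvec ring" where "kQ \<equiv> path_algebra Q"

lemma kQ_simps [simp]:
  "carrier kQ = kspan (paths Q)" "x \<otimes>\<^bsub>kQ\<^esub> y = pmult x y" "x \<oplus>\<^bsub>kQ\<^esub> y = x + y" "\<zero>\<^bsub>kQ\<^esub> = 0"
  by (simp_all add: path_algebra_def)

lemma ring_kQ: "ring kQ"
  using ideal_I ideal.axioms(2) by blast

lemma I_in_kspan: "x \<in> I \<Longrightarrow> x \<in> kspan (paths Q)"
  using ideal.Icarr[OF ideal_I] by simp

lemma I_lmult: "x \<in> I \<Longrightarrow> y \<in> kspan (paths Q) \<Longrightarrow> pmult y x \<in> I"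
  and I_rmult: "x \<in> I \<Longrightarrow> y \<in> kspan (paths Q) \<Longrightarrow> pmult x y \<in> I"
  using ideal.I_l_closed[OF ideal_I] ideal.I_r_closed[OF ideal_I] by auto

lemma one_closed: "\<one>\<^bsub>kQ\<^esub> \<in> kspan (paths Q)"
  using ring.ring_simprules(6)[OF ring_kQ] by simp

lemma pmult_one: "x \<in> kspan (paths Q) \<Longrightarrow> pmult \<one>\<^bsub>kQ\<^esub> x = x" "x \<in> kspan (paths Q) \<Longrightarrow> pmult x \<one>\<^bsub>kQ\<^esub> = x"
  using ring.ring_simprules(12)[OF ring_kQ] ring.ring_simprules(23)[OF ring_kQ]
    monoid.r_one[OF ring.is_monoid[OF ring_kQ]] monoid.l_one[OF ring.is_monoid[OF ring_kQ]] by auto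

text \<open>Closure of a ring ideal under scalars holds because a scalar acts as multiplication by
  its multiple of the unit.\<close>

lemma subsp_I: "subsp I"
proof -
  have "smul c x \<in> I" if "x \<in> I" for c x
  proof -
    have "smul c x = pmult (smul c \<one>\<^bsub>kQ\<^esub>) x"
      using pmult_one I_in_kspan[OF that] by (simp add: pmult_distrib)
    then show ?thesis
      using I_lmult[OF that] subsp_smul[OF subsp_kspan one_closed] by simp
  qed
  then show ?thesis
    using additive_subgroup.zero_closed[OF ideal.axioms(1)[OF ideal_I]]
      additive_subgroup.a_closed[OF ideal.axioms(1)[OF ideal_I]] by (auto simp: subsp_def)
qed

lemma ideal_kQ_I:
  assumes "subsp J" "J \<subseteq> kspan (paths Q)"
    "\<And>x y. x \<in> J \<Longrightarrow> y \<in> kspan (paths Q) \<Longrightarrow> pmult y x \<in> J"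
    "\<And>x y. x \<in> J \<Longrightarrow> y \<in> kspan (paths Q) \<Longrightarrow> pmult x y \<in> J"
  shows "ideal J kQ"
proof (rule idealI[OF ring_kQ])
  interpret ring kQ by (rule ring_kQ)
  have neg: "\<ominus>\<^bsub>kQ\<^esub> x = - x" if "x \<in> kspan (paths Q)" for x
    using that subsp_neg[OF subsp_kspan that] by (intro minus_equality) auto
  show "subgroup J (add_monoid kQ)"
    using assms(1,2) neg unfolding a_inv_def
    by (intro group.subgroupI[OF a_group]) (use subsp_zero[OF assms(1)] in \<open>auto simp: subsp_add subsp_neg subsetD\<close>)
qed (use assms in auto)

text \<open>Serves as an induction principle for \<open>I\<close>: a property is established by
  showing that it defines an ideal containing every \<open>s - f\<close>.\<close>

lemma I_subset:
  assumes "ideal J kQ" "\<And>s f. (s, f) \<in> \<R> \<Longrightarrow> pvec s - f \<in> J"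
  shows "I \<subseteq> J"
proof -
  have "I = genideal kQ {pvec s - f | s f. (s, f) \<in> \<R>}"
    using loz by (simp add: lozenge_def)
  then show ?thesis
    using ring.genideal_minimal[OF ring_kQ assms(1), of "{pvec s - f | s f. (s, f) \<in> \<R>}"] assms(2)
    by blast
qed

lemma rule_in_I: "(s, f) \<in> \<R> \<Longrightarrow> pvec s - f \<in> I"
proof -
  assume "(s, f) \<in> \<R>"
  moreover have "{pvec s - f | s f. (s, f) \<in> \<R>} \<subseteq> carrier kQ"
    using rule_facts subsp_kspan by (auto intro!: subsp_diff)
  moreover have "I = genideal kQ {pvec s - f | s f. (s, f) \<in> \<R>}"
    using loz by (simp add: lozenge_def)
  ultimately show ?thesis
    using ring.genideal_self[OF ring_kQ] by blast
qed

lemma sandwich_diff_in_I: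
  assumes "(a, s, f, c) \<in> BR"
  shows "pvec (a \<cdot> s \<cdot> c) - sandwich a f c \<in> I"
proof -
  have "pvec (a \<cdot> s \<cdot> c) - sandwich a f c = pmult (pvec a) (pmult (pvec s - f) (pvec c))"
    using BR_D[OF assms] by (simp add: pmult_distrib)
  then show ?thesis
    using BR_D[OF assms] rule_in_I[of s f] I_lmult[OF I_rmult, of "pvec s - f" "pvec c" "pvec a"] by simp
qed

lemma reduce_diff_in_I: "rs \<in> reductions Q \<R> \<Longrightarrow> x - reduce rs x \<in> I"
proof (induct rs arbitrary: x)
  case (Cons \<rho> rs)
  obtain a s f c where \<rho>: "\<rho> = (a, s, f, c)" "(a, s, f, c) \<in> BR"
    using Cons by (cases \<rho>) auto
  have "x - reduce1 \<rho> x = smul (Poly_Mapping.lookup x (a \<cdot> s \<cdot> c)) (pvec (a \<cdot> s \<cdot> c) - sandwich a f c)"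
    by (simp add: \<rho> reduce1_eq smul_distrib)
  then have "x - reduce1 \<rho> x \<in> I"
    using sandwich_diff_in_I[OF \<rho>(2)] subsp_smul[OF subsp_I] by simp
  then show ?case
    using Cons subsp_add[OF subsp_I, of "x - reduce1 \<rho> x" "reduce1 \<rho> x - reduce rs (reduce1 \<rho> x)"] by simp
qed (simp add: subsp_zero[OF subsp_I])

lemma NF_diff_in_I: "x \<in> kspan (paths Q) \<Longrightarrow> x - NF x \<in> I"
  by (rule vector_reduces[of x]) (simp_all add: NF_eq_reduce reduce_diff_in_I)

text \<open>The kernel of \<open>NF\<close> is not visibly an ideal. The set \<open>J\<close>
  demands that all two-sided multiples have normal form zero, so it is an ideal by associativity. On
  the generators the demand is \<open>NF_sandwich\<close>, and multiplying by the unit recovers the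
  claim for \<open>x\<close>.\<close>

lemma NF_in_0: "x \<in> I \<Longrightarrow> NF x = 0"
proof -
  define J where "J = {x \<in> kspan (paths Q). \<forall>y\<in>kspan (paths Q). \<forall>z\<in>kspan (paths Q).
    NF (pmult y (pmult x z)) = 0}"
  have "J \<subseteq> kspan (paths Q)"
    by (auto simp: J_def)
  have "ideal J kQ"
  proof (rule ideal_kQ_I)
    show "subsp J"
      unfolding subsp_def J_def
      by (auto simp: pmult_distrib subsp_zero subsp_add subsp_smul subsp_kspan)
    fix x y :: "('v, 'a, 'k) pathvec"
    assume "x \<in> J" "y \<in> kspan (paths Q)"
    moreover have "NF (pmult u (pmult (pmult y x) z)) = NF (pmult (pmult u y) (pmult x z))"
      and "NF (pmult u (pmult (pmult x y) z)) = NF (pmult u (pmult x (pmult y z)))" for u z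
      by (simp_all add: pmult_assoc)
    ultimately show "pmult y x \<in> J" "pmult x y \<in> J"
      unfolding J_def by (auto simp: kspan_pmult)
  qed fact
  moreover have "pvec s - f \<in> J" if sf: "(s, f) \<in> \<R>" for s f
  proof -
    have sf': "pvec s - f \<in> kspan (paths Q)"
      using rule_facts[OF sf] by (auto intro!: subsp_diff subsp_kspan)
    have *: "NF (pmult (pvec a) (pmult (pvec s - f) (pvec c))) = 0" if "a \<in> paths Q" "c \<in> paths Q" for a c
    proof (cases "composable a s \<and> composable s c")
      case True
      then have "(a, s, f, c) \<in> BR"
        using that sf by (intro BR_I) auto
      from NF_sandwich[OF this] show ?thesis
        using True by (simp add: pmult_distrib)
    next
      case False
      \<comment> \<open>Since \<open>f\<close> is parallel to \<open>s\<close>, a context that does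
        not compose with \<open>s\<close> annihilates every term of \<open>s - f\<close>.\<close>
      have "pmult (pvec a) (pmult (pvec s - f) (pvec c)) = 0"
      proof (rule ccontr)
        assume "pmult (pvec a) (pmult (pvec s - f) (pvec c)) \<noteq> 0"
        then obtain r where "r \<in> Poly_Mapping.keys (pmult (pvec a) (pmult (pvec s - f) (pvec c)))"
          by (metis all_not_in_conv keys_eq_empty)
        then obtain r' where "r' \<in> Poly_Mapping.keys (pmult (pvec s - f) (pvec c))" "composable a r'"
          using keys_pmult[of r "pvec a" "pmult (pvec s - f) (pvec c)"] by auto
        then obtain g where g: "g \<in> Poly_Mapping.keys (pvec s - f)" "composable a g" "composable g c"
          using keys_pmult[of r' "pvec s - f" "pvec c"] by auto
        then have "source g = source s \<and> target g = target s"
          using rule_facts(5)[OF sf, of g] by (auto simp: in_keys_iff lookup_minus lookup_single when_def split: if_splits)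
        then show False
          using g False by (simp add: composable_def)
      qed
      then show ?thesis
        by simp
    qed
    have "NF (pmult y (pmult (pvec s - f) z)) = 0" if "y \<in> kspan (paths Q)" "z \<in> kspan (paths Q)" for y z
    proof -
      have **: "NF (pmult (pvec a) (pmult (pvec s - f) z)) = 0" if "a \<in> paths Q" for a
        by (rule klin_eq[where S = "\<lambda>z. NF (pmult (pvec a) (pmult (pvec s - f) z))" and T = "\<lambda>z. 0"])
          (intro klin_path_intros | use * that \<open>z \<in> kspan (paths Q)\<close> in \<open>auto simp: kspan_iff\<close>)+
      show ?thesis
        by (rule klin_eq[where S = "\<lambda>y. NF (pmult y (pmult (pvec s - f) z))" and T = "\<lambda>y. 0"])
          (intro klin_path_intros | use ** that in \<open>auto simp: kspan_iff\<close>)+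
    qed
    then show ?thesis
      using sf' by (simp add: J_def)
  qed
  ultimately have "I \<subseteq> J"
    by (rule I_subset)
  moreover assume "x \<in> I"
  ultimately have "x \<in> J"
    by blast
  then have "NF (pmult \<one>\<^bsub>kQ\<^esub> (pmult x \<one>\<^bsub>kQ\<^esub>)) = 0"
    using one_closed by (simp add: J_def)
  then show ?thesis
    using I_in_kspan[OF \<open>x \<in> I\<close>] by (simp add: pmult_one)
qed

lemma NF_eq_iff:
  assumes "x \<in> kspan (paths Q)" "y \<in> kspan (paths Q)"
  shows "NF x = NF y \<longleftrightarrow> x - y \<in> I"
proof
  assume "NF x = NF y"
  then show "x - y \<in> I"
    using subsp_diff[OF subsp_I NF_diff_in_I[OF assms(1)] NF_diff_in_I[OF assms(2)]] by simp
qed (use NF_in_0[of "x - y"] in simp)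

end

section \<open>Reductions in a context, divisors of tips and overlapping tips\<close>

lemma sandwich_context:
  fixes f :: "('v, 'a, 'k::field) pathvec"
  assumes "composable u a" "composable c w"
  shows "sandwich (u \<cdot> a) f (c \<cdot> w) = sandwich u (sandwich a f c) w"
proof -
  have "pvec (u \<cdot> a) = pmult (pvec u) (pvec a :: ('v, 'a, 'k) pathvec)"
    "pvec (c \<cdot> w) = pmult (pvec c) (pvec w :: ('v, 'a, 'k) pathvec)"
    using assms by simp_all
  then show ?thesis
    by (simp only: pmult_assoc)
qed

context redsys begin

lemma smaller_paths: "(q, p) \<in> smaller \<Longrightarrow> q \<in> paths Q \<and> p \<in> paths Q"
  unfolding smaller_def using sandwich_in_kspan BR_D(7) by (fastforce simp: kspan_iff)

lemma BR_context:
  assumes "(a, s, f, c) \<in> BR" "u \<in> paths Q" "w \<in> paths Q" "composable u a" "composable c w"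
  shows "(u \<cdot> a, s, f, c \<cdot> w) \<in> BR"
  using BR_D[OF assms(1)] assms(2-) by (intro BR_I) auto

lemma keys_sandwich_parallel:
  assumes "(a, s, f, c) \<in> BR" "g \<in> Poly_Mapping.keys (sandwich a f c)"
  shows "source g = source c" "target g = target a"
proof -
  obtain h where "g = a \<cdot> h \<cdot> c"
    by (rule keys_sandwich[OF assms])
  then show "source g = source c" "target g = target a"
    by simp_all
qed

text \<open>The term of \<open>g\<close> survives in the larger context by
  \<open>lookup_context\<close>. This carries the well-founded induction from a path to reductions
  performed inside a longer one.\<close>

lemma smaller_context:
  assumes "(a, s, f, c) \<in> BR" "g \<in> Poly_Mapping.keys (sandwich a f c)"
    and "u \<in> paths Q" "w \<in> paths Q" "composable u a" "composable c w"
  shows "(u \<cdot> g \<cdot> w, u \<cdot> a \<cdot> s \<cdot> c \<cdot> w) \<in> smaller"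
proof -
  have par: "composable u g \<and> composable g w" if "g \<in> Poly_Mapping.keys (sandwich a f c)" for g
    using keys_sandwich_parallel[OF assms(1) that] assms(5,6) by (simp add: composable_def)
  have "Poly_Mapping.lookup (sandwich u (sandwich a f c) w) (u \<cdot> g \<cdot> w) \<noteq> 0"
    using lookup_context[of "sandwich a f c" u w g] par assms(2) by (simp add: in_keys_iff)
  then have "u \<cdot> g \<cdot> w \<in> Poly_Mapping.keys (sandwich (u \<cdot> a) f (c \<cdot> w))"
    unfolding sandwich_context[OF assms(5,6)] in_keys_iff .
  from smallerI[OF BR_context[OF assms(1,3-6)] this] show ?thesis
    by simp
qed

text \<open>Two tips at the left end of one path are comparable, and a tip dividing another one
  belongs to the same rule. So the left end of a path determines the tip, its replacement and the
  remaining factor.\<close>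

lemma tips_prefix:
  assumes "(s, f) \<in> \<R>" "(s', f') \<in> \<R>" "c \<in> paths Q" "c' \<in> paths Q"
    and "composable s c" "composable s' c'" "s \<cdot> c = s' \<cdot> c'"
  shows "s = s' \<and> f = f' \<and> c = c'"
proof -
  have main: "s = s' \<and> f = f'" if asm: "(s, f) \<in> \<R>" "(s', f') \<in> \<R>" "c \<in> paths Q" "c' \<in> paths Q"
    "composable s c" "composable s' c'" "s \<cdot> c = s' \<cdot> c'" "len c \<le> len c'" for s f s' f' c c'
  proof -
    obtain m where m: "m \<in> paths Q" "composable s' m" "s = s' \<cdot> m"
      by (rule levi[of s c s' c']) (use asm(3-8) rule_facts(1)[OF asm(1)] rule_facts(1)[OF asm(2)] in auto)
    have "divisor Q s' s"
      unfolding divisor_def using m rule_facts(1)[OF asm(2)]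
      by (intro conjI bexI[of _ "vertex_path (target s')"] bexI[of _ m])
        (auto simp: composable_def vertex_path_target_in_paths)
    then show ?thesis
      using divisor_tips[OF asm(2,1)] by simp
  qed
  have "s = s' \<and> f = f'"
    using main[of s f s' f' c c'] main[of s' f' s f c' c] assms by (cases "len c \<le> len c'") simp_all
  then show ?thesis
    using assms by (simp add: pcomp_left_cancel)
qed

lemma tips_suffix:
  assumes "(s, f) \<in> \<R>" "(s', f') \<in> \<R>" "a \<in> paths Q" "a' \<in> paths Q"
    and "composable a s" "composable a' s'" "a \<cdot> s = a' \<cdot> s'"
  shows "s = s' \<and> f = f' \<and> a = a'"
proof -
  have main: "s = s' \<and> f = f'" if asm: "(s, f) \<in> \<R>" "(s', f') \<in> \<R>" "a \<in> paths Q" "a' \<in> paths Q"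
    "composable a s" "composable a' s'" "a \<cdot> s = a' \<cdot> s'" "len s \<le> len s'" for s f s' f' a a'
  proof -
    obtain m where m: "m \<in> paths Q" "composable m s" "s' = m \<cdot> s"
      by (rule levi[of a s a' s']) (use asm(3-8) rule_facts(1)[OF asm(1)] rule_facts(1)[OF asm(2)] in auto)
    have "divisor Q s s'"
      unfolding divisor_def using m rule_facts(1)[OF asm(1)]
      by (intro conjI bexI[of _ m] bexI[of _ "vertex_path (source s)"])
        (auto simp: composable_def vertex_path_source_in_paths)
    then show ?thesis
      using divisor_tips[OF asm(1,2)] by simp
  qed
  have "s = s' \<and> f = f'"
    using main[of s f s' f' a a'] main[of s' f' s f a' a] assms by (cases "len s \<le> len s'") simp_all
  then show ?thesis
    using assms by (simp add: pcomp_right_cancel)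
qed

text \<open>A tip found inside a proper divisor would divide \<open>s\<close> without being equal to
  it.\<close>

lemma proper_divisor_irred:
  assumes "(s, f) \<in> \<R>" "s = x \<cdot> w \<cdot> y" "x \<in> paths Q" "w \<in> paths Q" "y \<in> paths Q"
    "composable x w" "composable w y" "len w < len s"
  shows "w \<in> irred_paths Q \<R>"
proof (rule ccontr)
  assume "w \<notin> irred_paths Q \<R>"
  obtain a s' f' c where r: "(a, s', f', c) \<in> BR" "w = a \<cdot> s' \<cdot> c"
    by (rule reducible_cases[OF assms(4) \<open>w \<notin> irred_paths Q \<R>\<close>])
  have "divisor Q s' s"
    unfolding divisor_def using BR_D[OF r(1)] assms r(2)
    by (intro conjI bexI[of _ "x \<cdot> a"] bexI[of _ "c \<cdot> y"]) auto
  then have "s' = s"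
    using divisor_tips[OF BR_D(1)[OF r(1)] assms(1)] by simp
  then show False
    using assms(8) r(2) by simp
qed

lemma len_0_pcomp:
  "m \<in> paths Q \<Longrightarrow> len m = 0 \<Longrightarrow> composable m p \<Longrightarrow> m \<cdot> p = p"
  "m \<in> paths Q \<Longrightarrow> len m = 0 \<Longrightarrow> composable p m \<Longrightarrow> p \<cdot> m = p"
  using len_0_vertex[of m] pcomp_vertex by (metis composable_def vertex_path_simps(1,2))+

lemma redex_irred:
  assumes "(s, f) \<in> \<R>" "a \<in> paths Q" "composable a s" "c \<in> paths Q" "composable s c"
  shows "a \<cdot> s \<cdot> c \<notin> irred_paths Q \<R>"
  using BR_I[of s f a c] assms by (auto simp: irred_paths_iff)

lemma tip_left_irred:
  assumes "(s, f) \<in> \<R>" "a \<in> paths Q" "composable a s"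
  shows "a \<cdot> s \<notin> irred_paths Q \<R>"
proof -
  have "s \<in> paths Q"
    by (rule rule_facts(1)[OF assms(1)])
  then show ?thesis
    using redex_irred[OF assms, of "vertex_path (source s)"] vertex_path_source_in_paths[of s]
    by (simp add: composable_def)
qed

lemma tip_reducible: "(s, f) \<in> \<R> \<Longrightarrow> s \<notin> irred_paths Q \<R>"
  using tip_left_irred[of s f "vertex_path (target s)"] rule_facts(1)[of s f]
    vertex_path_target_in_paths[of s] by (simp add: composable_def)

lemma left_divisor_irred:
  assumes "(s, f) \<in> \<R>" "s = w \<cdot> y" "w \<in> paths Q" "y \<in> paths Q" "composable w y" "0 < len y"
  shows "w \<in> irred_paths Q \<R>"
  by (rule proper_divisor_irred[OF assms(1), of "vertex_path (target w)" w y])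
    (use assms vertex_path_target_in_paths[of w] in \<open>auto simp: composable_def\<close>)

lemma right_divisor_irred:
  assumes "(s, f) \<in> \<R>" "s = x \<cdot> w" "x \<in> paths Q" "w \<in> paths Q" "composable x w" "0 < len x"
  shows "w \<in> irred_paths Q \<R>"
  by (rule proper_divisor_irred[OF assms(1), of x w "vertex_path (source w)"])
    (use assms vertex_path_source_in_paths[of w] in \<open>auto simp: composable_def\<close>)

text \<open>
  The left part \<open>d\<close> of \<open>x\<close> is cut off as soon as a tip \<open>S\<close> appears, so \<open>S\<close> ends with \<open>d\<close>.
\<close>

lemma overlap_ambiguity:
  assumes sf: "(s, f) \<in> \<R>" "(s', f') \<in> \<R>" and s: "s = m \<cdot> n" "s' = n \<cdot> x"
    and paths: "m \<in> paths Q" "n \<in> paths Q" "x \<in> paths Q"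
    and comp: "composable m n" "composable n x" and len: "0 < len m" "0 < len n"
  obtains A S F d y where "x = d \<cdot> y" "d \<in> paths Q" "y \<in> paths Q" "composable d y"
    "(S, F) \<in> \<R>" "A \<in> paths Q" "composable A S" "0 < len A" "s \<cdot> d = A \<cdot> S"
    "s \<cdot> d \<in> ambiguities Q \<R>"
proof -
  \<comment> \<open>The leftmost arrow of \<open>m\<close> becomes \<open>u0\<close>. The rest
    \<open>u1\<close> of \<open>s\<close> ends with \<open>n\<close>, so \<open>u1 \<cdot> x\<close>
    still contains \<open>s'\<close> and \<open>x\<close> itself is a candidate for
    \<open>d\<close>.\<close>
  obtain u0 m' where m: "m = u0 \<cdot> m'" "composable u0 m'" "u0 \<in> paths Q" "m' \<in> paths Q" "len u0 = 1"
    by (rule path_split[OF paths(1), of "len m - 1"]) (use len(1) in auto)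
  define u1 where "u1 = m' \<cdot> n"
  have u1: "u1 \<in> paths Q" "composable u0 u1" "s = u0 \<cdot> u1" "composable u1 x"
    using m paths comp s by (auto simp: u1_def)
  define good where "good d y \<longleftrightarrow> x = d \<cdot> y \<and> d \<in> paths Q \<and> y \<in> paths Q \<and> composable d y \<and>
    u1 \<cdot> d \<notin> irred_paths Q \<R>" for d y
  have "u1 \<cdot> x \<notin> irred_paths Q \<R>"
    using tip_left_irred[OF sf(2), of m'] m comp paths s by (simp add: u1_def)
  then have "good x (vertex_path (source x))"
    using paths vertex_path_source_in_paths[of x] by (simp add: good_def composable_def)
  from ex_has_least_nat[of "\<lambda>(d, y). good d y" "(x, vertex_path (source x))" "\<lambda>(d, y). len d"] this
  obtain d y where d: "good d y" "\<And>d' y'. good d' y' \<Longrightarrow> len d \<le> len d'"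
    by auto
  have dy: "x = d \<cdot> y" "d \<in> paths Q" "y \<in> paths Q" "composable d y" "u1 \<cdot> d \<notin> irred_paths Q \<R>"
    using d(1) by (auto simp: good_def)
  have comp_d: "composable u1 d"
    using u1(4) dy(1) by simp
  have d_min: "u1 \<cdot> e \<in> irred_paths Q \<R>"
    if "e \<in> paths Q" "b \<in> paths Q" "composable e b" "d = e \<cdot> b" "0 < len b" for e b
    using d(2)[of e "b \<cdot> y"] that dy unfolding good_def by auto
  have "u1 \<cdot> d \<in> paths Q"
    using u1(1) dy(2) comp_d by auto
  then obtain A' S F C where red: "(A', S, F, C) \<in> BR" "u1 \<cdot> d = A' \<cdot> S \<cdot> C"
    by (rule reducible_cases[OF _ dy(5)])
  note BR = BR_D[OF red(1)]
  have u1_irred: "u1 \<in> irred_paths Q \<R>"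
    by (rule right_divisor_irred[OF sf(1) u1(3)]) (use u1 m in simp_all)
  \<comment> \<open>If \<open>C\<close> contained an arrow, the rightmost arrow of \<open>d\<close>
    could be dropped and \<open>S\<close> would remain, against minimality. That \<open>d\<close>
    has an arrow to drop follows from the irreducibility of \<open>u1\<close>, a proper divisor of
    \<open>s\<close>.\<close>
  have "len C = 0"
  proof (rule ccontr)
    assume C: "len C \<noteq> 0"
    have "len d \<noteq> 0"
    proof
      assume "len d = 0"
      then have "u1 \<cdot> d = u1"
        using len_0_pcomp(2)[of d u1] dy(2) comp_d by simp
      then show False
        using dy(5) u1_irred by simp
    qed
    then have d1: "1 \<le> len d"
      by simp
    obtain d' \<alpha> where \<alpha>: "d = d' \<cdot> \<alpha>" "composable d' \<alpha>" "d' \<in> paths Q" "\<alpha> \<in> paths Q" "len \<alpha> = 1"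
      by (rule path_split[OF dy(2) d1])
    have "(u1 \<cdot> d') \<cdot> \<alpha> = (A' \<cdot> S) \<cdot> C"
      using red(2) \<alpha>(1) by simp
    then obtain k where k: "k \<in> paths Q" "composable (A' \<cdot> S) k" "u1 \<cdot> d' = (A' \<cdot> S) \<cdot> k"
      by (rule levi[rotated 6]) (use \<alpha> BR u1 comp_d C in auto)
    then have "u1 \<cdot> d' \<notin> irred_paths Q \<R>"
      using redex_irred[OF BR(1,2,4), of k] by simp
    then show False
      using d_min[OF \<alpha>(3,4,2,1)] \<alpha>(5) by simp
  qed
  then have u1d: "u1 \<cdot> d = A' \<cdot> S"
    using red(2) len_0_pcomp(2)[OF BR(3) _ BR(5)] by simp
  have "left_ambiguity Q \<R> u0 u1 d"
    unfolding left_ambiguity_def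
  proof (intro conjI allI impI)
    show "u0 \<in> paths_of_len Q 1"
      using m by (simp add: paths_of_len_def)
    show "d \<in> irred_paths Q \<R>"
      by (rule proper_divisor_irred[OF sf(2), of n d y]) (use s dy paths comp len in auto)
    show "u0 \<cdot> u1 \<notin> irred_paths Q \<R>"
      using tip_reducible[OF sf(1)] u1(3) by simp
  next
    fix e
    assume "left_divisor Q e u1 \<and> e \<noteq> u1"
    then obtain b where e: "e \<in> paths Q" "b \<in> paths Q" "composable e b" "u1 = e \<cdot> b" "e \<noteq> u1"
      by (auto simp: left_divisor_def)
    then have "len b \<noteq> 0"
      using len_0_pcomp(2)[OF e(2) _ e(3)] by auto
    then show "u0 \<cdot> e \<in> irred_paths Q \<R>"
      using left_divisor_irred[OF sf(1), of "u0 \<cdot> e" b] e u1 m(3) by auto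
  next
    fix e
    assume "left_divisor Q e d \<and> e \<noteq> d"
    then obtain b where e: "e \<in> paths Q" "b \<in> paths Q" "composable e b" "d = e \<cdot> b" "e \<noteq> d"
      by (auto simp: left_divisor_def)
    then have "len b \<noteq> 0"
      using len_0_pcomp(2)[OF e(2) _ e(3)] by auto
    then show "u1 \<cdot> e \<in> irred_paths Q \<R>"
      using d_min e by simp
  qed (use u1 dy comp_d u1_irred in auto)
  then have "s \<cdot> d \<in> ambiguities Q \<R>"
    unfolding ambiguities_def using u1(3) by auto
  \<comment> \<open>The arrow \<open>u0\<close> lies to the left of \<open>S\<close>. This yields
    \<open>0 < len A\<close>, the strict progress on which the induction over positions
    relies.\<close>
  moreover have "s \<cdot> d = (u0 \<cdot> A') \<cdot> S"
    using u1d u1(3) by simp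
  moreover have "composable u0 A'"
    using u1d u1(2) by (metis composable_def pcomp_simps(2))
  ultimately show ?thesis
    using dy BR m by (intro that[of d y S F "u0 \<cdot> A'"]) auto
qed

end

text \<open>The lift of \<open>\<phi>1\<close> to formal triples, where no tensor relations are
  imposed yet.\<close>

primrec phi1v :: "('v, 'a, 'k::field) basic_red list \<Rightarrow> ('v, 'a, 'k) pathvec \<Rightarrow> ('v, 'a, 'k) tripvec" where
  "phi1v [] x = 0"
| "phi1v (\<rho> # rs) x = (case \<rho> of (a, s, f, c) \<Rightarrow>
    smul (Poly_Mapping.lookup x (a \<cdot> s \<cdot> c)) (ten (pvec a) s (pvec c))) + phi1v rs (reduce1 \<rho> x)"

lemma lmul_single_coeff:
    "lmul a (Poly_Mapping.single (p, x, q) k) = smul k (ten (pmult a (pvec p)) x (pvec q))"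
  and rmul_single_coeff:
    "rmul (Poly_Mapping.single (p, x, q) k) c = smul k (ten (pvec p) x (pmult (pvec q) c))"
  by (simp_all add: lmul_def rmul_def)

section \<open>Comparing reductions modulo a subbimodule\<close>

text \<open>Abstracts from the image of d_2. \<open>D\<close> is any subspace of lifts that is
  stable under multiplication by paths on both sides and contains the triples with an outer factor
  in \<open>I\<close> as well as the difference between the two reductions of each
  ambiguity.\<close>

locale ambiguity_resolution = redsys Q I \<R>
  for Q :: "('v, 'a) pre_digraph" and I :: "('v, 'a, 'k::field) pathvec set" and \<R> +
  fixes D :: "('v, 'a, 'k) tripvec set"
  assumes D_subsp: "subsp D"
    and D_lmul: "g \<in> D \<Longrightarrow> a \<in> paths Q \<Longrightarrow> lmul (pvec a) g \<in> D"
    and D_rmul: "g \<in> D \<Longrightarrow> a \<in> paths Q \<Longrightarrow> rmul g (pvec a) \<in> D"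
    and D_left: "x \<in> I \<Longrightarrow> s \<in> tips \<R> \<Longrightarrow> y \<in> kspan (paths Q) \<Longrightarrow> ten x s y \<in> D"
    and D_right: "x \<in> kspan (paths Q) \<Longrightarrow> s \<in> tips \<R> \<Longrightarrow> y \<in> I \<Longrightarrow> ten x s y \<in> D"
    and D_ambiguity: "p \<in> ambiguities Q \<R> \<Longrightarrow> \<exists>r t. r \<in> reductions Q \<R> \<and> t \<in> reductions Q \<R> \<and>
      starts_on_left Q \<R> r p \<and> starts_on_right Q \<R> t p \<and> irred Q \<R> (reduce r (pvec p)) \<and>
      irred Q \<R> (reduce t (pvec p)) \<and> phi1v t (pvec p) - phi1v r (pvec p) \<in> D"
begin

definition eqv :: "('v, 'a, 'k) tripvec \<Rightarrow> ('v, 'a, 'k) tripvec \<Rightarrow> bool" (infix \<open>\<asymp>\<close> 50) where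
  "g \<asymp> h \<longleftrightarrow> g - h \<in> D"

lemma eqv_refl [simp]: "g \<asymp> g"
  by (simp add: eqv_def subsp_zero[OF D_subsp])

lemma eqv_sym: "g \<asymp> h \<Longrightarrow> h \<asymp> g"
  using subsp_neg[OF D_subsp, of "g - h"] by (simp add: eqv_def)

lemma eqv_trans [trans]: "g \<asymp> h \<Longrightarrow> h \<asymp> k \<Longrightarrow> g \<asymp> k"
  using subsp_add[OF D_subsp, of "g - h" "h - k"] by (simp add: eqv_def)

lemma eqv_add: "g \<asymp> h \<Longrightarrow> g' \<asymp> h' \<Longrightarrow> g + g' \<asymp> h + h'"
  using subsp_add[OF D_subsp, of "g - h" "g' - h'"] by (simp add: eqv_def algebra_simps)

lemma eqv_diff: "g \<asymp> h \<Longrightarrow> g' \<asymp> h' \<Longrightarrow> g - g' \<asymp> h - h'"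
  using subsp_diff[OF D_subsp, of "g - h" "g' - h'"] by (simp add: eqv_def algebra_simps)

lemma eqv_smul: "g \<asymp> h \<Longrightarrow> smul c g \<asymp> smul c h"
  using subsp_smul[OF D_subsp, of "g - h" c] by (simp add: eqv_def smul_distrib)

lemma klin_eqv:
  assumes "klin S" "klin T" "\<And>p. p \<in> Poly_Mapping.keys x \<Longrightarrow> S (Poly_Mapping.single p 1) \<asymp> T (Poly_Mapping.single p 1)"
  shows "S x \<asymp> T x"
  using klin_mem[OF D_subsp klin_diff[OF assms(1,2)], of x] assms(3) by (simp add: eqv_def)

lemma lmul_eqv:
  assumes "g \<asymp> h" "x \<in> kspan (paths Q)"
  shows "lmul x g \<asymp> lmul x h"
  unfolding eqv_def lmul_distrib(4)[symmetric]
  by (rule klin_mem[OF D_subsp klin_lmul_left[OF klin_id]])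
    (use assms D_lmul in \<open>auto simp: kspan_iff eqv_def\<close>)

lemma rmul_eqv: "g \<asymp> h \<Longrightarrow> a \<in> paths Q \<Longrightarrow> rmul g (pvec a) \<asymp> rmul h (pvec a)"
  using D_rmul[of "g - h" a] by (simp add: eqv_def rmul_distrib)

lemma ten_eqv_left:
  "x - x' \<in> I \<Longrightarrow> s \<in> tips \<R> \<Longrightarrow> y \<in> kspan (paths Q) \<Longrightarrow> ten x s y \<asymp> ten x' s y"
  using D_left[of "x - x'" s y] by (simp add: eqv_def ten_distrib)

lemma ten_eqv_right:
  "y - y' \<in> I \<Longrightarrow> s \<in> tips \<R> \<Longrightarrow> x \<in> kspan (paths Q) \<Longrightarrow> ten x s y \<asymp> ten x s y'"
  using D_right[of x s "y - y'"] by (simp add: eqv_def ten_distrib)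

definition redex :: "('v, 'a) qpath \<Rightarrow> ('v, 'a, 'k) basic_red" where
  "redex p = (SOME \<rho>. \<rho> \<in> BR \<and> (case \<rho> of (a, s, f, c) \<Rightarrow> p = a \<cdot> s \<cdot> c))"

definition Psi :: "('v, 'a) qpath \<Rightarrow> ('v, 'a, 'k) tripvec" where
  "Psi = wfrec smaller (\<lambda>h p. if p \<in> paths Q \<and> p \<notin> irred_paths Q \<R> then
    (case redex p of (a, s, f, c) \<Rightarrow> ten (pvec a) s (pvec c) + lin h (sandwich a f c)) else 0)"

text \<open>The value that \<open>Psi\<close> would take at the redex of \<open>\<rho>\<close> if
  \<open>\<rho>\<close> were the basic reduction chosen there. Independence of the choice means that
  these values are congruent for all redexes of one path.\<close>

abbreviation V :: "('v, 'a, 'k) basic_red \<Rightarrow> ('v, 'a, 'k) tripvec" where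
  "V \<rho> \<equiv> (case \<rho> of (a, s, f, c) \<Rightarrow> ten (pvec a) s (pvec c) + lin Psi (sandwich a f c))"

lemma redex:
  assumes "p \<in> paths Q" "p \<notin> irred_paths Q \<R>"
  obtains a s f c where "(a, s, f, c) \<in> BR" "p = a \<cdot> s \<cdot> c" "redex p = (a, s, f, c)"
proof -
  obtain a s f c where "(a, s, f, c) \<in> BR" "p = a \<cdot> s \<cdot> c"
    by (rule reducible_cases[OF assms])
  then have "\<exists>\<rho>. \<rho> \<in> BR \<and> (case \<rho> of (a, s, f, c) \<Rightarrow> p = a \<cdot> s \<cdot> c)"
    by (intro exI[of _ "(a, s, f, c)"]) simp
  from someI_ex[OF this] have "redex p \<in> BR \<and> (case redex p of (a, s, f, c) \<Rightarrow> p = a \<cdot> s \<cdot> c)"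
    unfolding redex_def .
  moreover obtain a s f c where "redex p = (a, s, f, c)"
    by (cases "redex p")
  ultimately show ?thesis
    by (intro that[of a s f c]) simp_all
qed

lemmas Psi_unfold = def_wfrec[OF Psi_def[THEN eq_reflection] wf_smaller]

lemma Psi_irred: "p \<in> irred_paths Q \<R> \<Longrightarrow> Psi p = 0"
  by (subst Psi_unfold) simp

lemma Psi_redex:
  assumes "p \<in> paths Q" "p \<notin> irred_paths Q \<R>"
  obtains a s f c where "(a, s, f, c) \<in> BR" "p = a \<cdot> s \<cdot> c" "Psi p = V (a, s, f, c)"
proof -
  obtain a s f c where r: "(a, s, f, c) \<in> BR" "p = a \<cdot> s \<cdot> c" "redex p = (a, s, f, c)"
    by (rule redex[OF assms])
  have "lin (cut Psi smaller p) (sandwich a f c) = lin Psi (sandwich a f c)"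
    by (rule lin_cong) (use smallerI[OF r(1)] r(2) in \<open>auto simp: cut_apply\<close>)
  then have "Psi p = V (a, s, f, c)"
    using assms by (subst Psi_unfold) (simp add: r(3))
  then show ?thesis
    using r by (intro that)
qed

definition confluent :: "('v, 'a) qpath \<Rightarrow> bool" where
  "confluent p \<longleftrightarrow> (\<forall>a s f c. (a, s, f, c) \<in> BR \<longrightarrow> p = a \<cdot> s \<cdot> c \<longrightarrow> Psi p \<asymp> V (a, s, f, c))"

lemma confluentD:
  "confluent (a \<cdot> s \<cdot> c) \<Longrightarrow> (a, s, f, c) \<in> BR \<Longrightarrow>
    Psi (a \<cdot> s \<cdot> c) \<asymp> ten (pvec a) s (pvec c) + lin Psi (sandwich a f c)"
  by (auto simp: confluent_def)

text \<open>Each effective step adds one triple, and confluence of its redex in the context says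
  that \<open>Psi\<close> changes by exactly this triple, up to \<open>D\<close>; so the changes
  telescope. The set \<open>X\<close> stands for the paths already known to be confluent and is
  closed downwards, so that it also contains whatever later steps produce.\<close>

lemma phi1v_context:
  assumes X: "\<And>p. p \<in> X \<Longrightarrow> confluent p" "\<And>p q. (q, p) \<in> smaller \<Longrightarrow> p \<in> X \<Longrightarrow> q \<in> X"
    and uw: "u \<in> paths Q" "w \<in> paths Q"
    and rs: "rs \<in> reductions Q \<R>"
    and x: "\<And>g. g \<in> Poly_Mapping.keys x \<Longrightarrow> composable u g \<and> composable g w \<and> u \<cdot> g \<cdot> w \<in> X"
  shows "lmul (pvec u) (rmul (phi1v rs x) (pvec w)) + lin Psi (sandwich u (reduce rs x) w)
    \<asymp> lin Psi (sandwich u x w)"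
  using rs x
proof (induct rs arbitrary: x rule: list.induct)
  case (Cons \<rho> rs)
  obtain a s f c where \<rho>: "\<rho> = (a, s, f, c)" "(a, s, f, c) \<in> BR"
    using Cons by (cases \<rho>) auto
  show ?case
  proof (cases "a \<cdot> s \<cdot> c \<in> Poly_Mapping.keys x")
    case False
    then have "reduce1 \<rho> x = x" "Poly_Mapping.lookup x (a \<cdot> s \<cdot> c) = 0"
      using reduce1_fixed_iff[OF \<rho>(2), of x] \<rho> by (auto simp: in_keys_iff)
    then show ?thesis
      using Cons by (simp add: \<rho>)
  next
    case True
    note t = Cons.prems(2)[OF True]
    then have comp: "composable u a" "composable c w"
      by simp_all
    let ?l = "Poly_Mapping.lookup x (a \<cdot> s \<cdot> c)" and ?x = "reduce1 \<rho> x"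
    have "composable u g \<and> composable g w \<and> u \<cdot> g \<cdot> w \<in> X" if g: "g \<in> Poly_Mapping.keys ?x" for g
    proof (cases "g \<in> Poly_Mapping.keys x")
      case True
      then show ?thesis
        by (rule Cons.prems(2))
    next
      case False
      then have g': "g \<in> Poly_Mapping.keys (sandwich a f c)"
        using g True by (auto simp: \<rho> reduce1_eq in_keys_iff lookup_add lookup_minus lookup_single when_def split: if_splits)
      have "u \<cdot> g \<cdot> w \<in> X"
        using X(2)[OF smaller_context[OF \<rho>(2) g' uw comp]] t by simp
      then show ?thesis
        using keys_sandwich_parallel[OF \<rho>(2) g'] comp by (simp add: composable_def)
    qed
    moreover have "rs \<in> reductions Q \<R>"
      using Cons.prems(1) by simp
    ultimately have IH: "lmul (pvec u) (rmul (phi1v rs ?x) (pvec w)) + lin Psi (sandwich u (reduce rs ?x) w)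
        \<asymp> lin Psi (sandwich u ?x w)"
      by (intro Cons.hyps)
    have BR: "(u \<cdot> a, s, f, c \<cdot> w) \<in> BR"
      by (rule BR_context[OF \<rho>(2) uw comp])
    have "confluent ((u \<cdot> a) \<cdot> s \<cdot> c \<cdot> w)"
      using X(1) t by simp
    note conf = confluentD[OF this BR]
    have "lmul (pvec u) (rmul (phi1v (\<rho> # rs) x) (pvec w)) + lin Psi (sandwich u (reduce (\<rho> # rs) x) w)
      = smul ?l (ten (pvec (u \<cdot> a)) s (pvec (c \<cdot> w))) +
        (lmul (pvec u) (rmul (phi1v rs ?x) (pvec w)) + lin Psi (sandwich u (reduce rs ?x) w))"
      using comp by (simp add: \<rho>(1) rmul_distrib lmul_distrib rmul_single_coeff lmul_single_coeff)
    also have "\<dots> \<asymp> smul ?l (ten (pvec (u \<cdot> a)) s (pvec (c \<cdot> w))) + lin Psi (sandwich u ?x w)"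
      by (intro eqv_add eqv_refl IH)
    also have "lin Psi (sandwich u ?x w) =
        lin Psi (sandwich u x w) + smul ?l (lin Psi (sandwich (u \<cdot> a) f (c \<cdot> w)) - Psi ((u \<cdot> a) \<cdot> s \<cdot> c \<cdot> w))"
      using comp t by (simp add: \<rho>(1) reduce1_eq pmult_distrib sandwich_context[OF comp])
    also have "smul ?l (ten (pvec (u \<cdot> a)) s (pvec (c \<cdot> w))) + \<dots> = lin Psi (sandwich u x w) +
        smul ?l ((ten (pvec (u \<cdot> a)) s (pvec (c \<cdot> w)) + lin Psi (sandwich (u \<cdot> a) f (c \<cdot> w))) - Psi ((u \<cdot> a) \<cdot> s \<cdot> c \<cdot> w))"
      by (simp add: smul_distrib algebra_simps)
    also have "\<dots> \<asymp> lin Psi (sandwich u x w) + smul ?l (Psi ((u \<cdot> a) \<cdot> s \<cdot> c \<cdot> w) - Psi ((u \<cdot> a) \<cdot> s \<cdot> c \<cdot> w))"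
      by (intro eqv_add eqv_smul eqv_diff eqv_refl eqv_sym[OF conf])
    finally show ?thesis
      by simp
  qed
qed simp

text \<open>The path \<open>u \<cdot> a \<cdot> s \<cdot> c \<cdot> w\<close> is the one whose
  confluence is still open and need not lie in \<open>X\<close>. The first step is therefore taken
  by the definition of \<open>V\<close>, and only the rest of the list, which acts on smaller paths,
  is left to \<open>phi1v_context\<close>.\<close>

lemma V_context:
  assumes X: "\<And>p. p \<in> X \<Longrightarrow> confluent p" "\<And>p q. (q, p) \<in> smaller \<Longrightarrow> p \<in> X \<Longrightarrow> q \<in> X"
    "\<And>q. (q, u \<cdot> a \<cdot> s \<cdot> c \<cdot> w) \<in> smaller \<Longrightarrow> q \<in> X"
    and uw: "u \<in> paths Q" "w \<in> paths Q" "composable u a" "composable c w"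
    and rs: "(a, s, f, c) # rs \<in> reductions Q \<R>"
  shows "V (u \<cdot> a, s, f, c \<cdot> w) \<asymp>
    lmul (pvec u) (rmul (phi1v ((a, s, f, c) # rs) (pvec (a \<cdot> s \<cdot> c))) (pvec w)) +
    lin Psi (sandwich u (reduce ((a, s, f, c) # rs) (pvec (a \<cdot> s \<cdot> c))) w)"
proof -
  have BR: "(a, s, f, c) \<in> BR" and rs': "rs \<in> reductions Q \<R>"
    using rs by simp_all
  have "lmul (pvec u) (rmul (phi1v rs (sandwich a f c)) (pvec w)) + lin Psi (sandwich u (reduce rs (sandwich a f c)) w)
    \<asymp> lin Psi (sandwich u (sandwich a f c) w)"
  proof (rule phi1v_context[OF X(1,2) uw(1,2) rs'])
    fix g
    assume g: "g \<in> Poly_Mapping.keys (sandwich a f c)"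
    show "composable u g \<and> composable g w \<and> u \<cdot> g \<cdot> w \<in> X"
      using keys_sandwich_parallel[OF BR g] uw X(3)[OF smaller_context[OF BR g uw]]
      by (simp add: composable_def)
  qed
  then have "V (u \<cdot> a, s, f, c \<cdot> w) \<asymp> ten (pvec (u \<cdot> a)) s (pvec (c \<cdot> w)) +
      (lmul (pvec u) (rmul (phi1v rs (sandwich a f c)) (pvec w)) + lin Psi (sandwich u (reduce rs (sandwich a f c)) w))"
    unfolding sandwich_context[OF uw(3,4)] prod.case by (intro eqv_add eqv_refl) (rule eqv_sym)
  also have "\<dots> = lmul (pvec u) (rmul (phi1v ((a, s, f, c) # rs) (pvec (a \<cdot> s \<cdot> c))) (pvec w)) +
      lin Psi (sandwich u (reduce ((a, s, f, c) # rs) (pvec (a \<cdot> s \<cdot> c))) w)"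
    using uw by (simp add: reduce1_eq rmul_distrib lmul_distrib rmul_single_coeff lmul_single_coeff algebra_simps)
  finally show ?thesis .
qed

text \<open>Either order leads to the vector in which both tips are replaced. The triples met on the
  two ways differ by \<open>s'\<close> against \<open>f'\<close>, or \<open>s\<close> against
  \<open>f\<close>, inside an outer factor, and these differences lie in \<open>I\<close>.\<close>

lemma disjoint_redexes:
  assumes r: "(s, f) \<in> \<R>" "(s', f') \<in> \<R>" "a \<in> paths Q" "m \<in> paths Q" "c \<in> paths Q"
    "composable a s" "composable s m" "composable m s'" "composable s' c"
    and conf: "\<And>q. (q, a \<cdot> s \<cdot> m \<cdot> s' \<cdot> c) \<in> smaller \<Longrightarrow> confluent q"
  shows "V (a, s, f, m \<cdot> s' \<cdot> c) \<asymp> V (a \<cdot> s \<cdot> m, s', f', c)"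
proof -
  note R = rule_facts[OF r(1)] and R' = rule_facts[OF r(2)]
  have BR: "(a, s, f, m \<cdot> s' \<cdot> c) \<in> BR" "(a \<cdot> s \<cdot> m, s', f', c) \<in> BR"
    using r R(1) R'(1) by (auto intro!: BR_I)
  let ?mid = "\<lambda>x y. pmult (pvec a) (pmult x (pmult (pvec m) (pmult y (pvec c))))"
  have comp_f: "composable a g \<and> composable g m" if "g \<in> Poly_Mapping.keys f" for g
    using R(5)[OF that] r(6,7) by (simp add: composable_def)
  have comp_f': "composable m g \<and> composable g c" if "g \<in> Poly_Mapping.keys f'" for g
    using R'(5)[OF that] r(8,9) by (simp add: composable_def)
  have g_paths: "g \<in> paths Q" if "g \<in> Poly_Mapping.keys f" for g
    using R(2) that by (auto simp: kspan_iff)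
  have g'_paths: "g \<in> paths Q" if "g \<in> Poly_Mapping.keys f'" for g
    using R'(2) that by (auto simp: kspan_iff)
  \<comment> \<open>After the left tip has been replaced, each term is a smaller path that still
    carries \<open>s'\<close>; its confluence permits reducing the right tip next.\<close>
  have 1: "lin Psi (?mid f (pvec s')) \<asymp> ten (pmult (pvec a) (pmult f (pvec m))) s' (pvec c) + lin Psi (?mid f f')"
  proof (rule klin_eqv[where S = "\<lambda>f. lin Psi (?mid f (pvec s'))"
        and T = "\<lambda>f. ten (pmult (pvec a) (pmult f (pvec m))) s' (pvec c) + lin Psi (?mid f f')"])
    fix g
    assume g: "g \<in> Poly_Mapping.keys f"
    note cg = comp_f[OF g]
    have BRg: "(a \<cdot> g \<cdot> m, s', f', c) \<in> BR"
      using r R'(1) cg g_paths[OF g] by (auto intro!: BR_I)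
    have "a \<cdot> g \<cdot> m \<cdot> s' \<cdot> c \<in> Poly_Mapping.keys (sandwich a f (m \<cdot> s' \<cdot> c))"
      using lookup_context[of f a "m \<cdot> s' \<cdot> c" g] comp_f g r(8,9) by (simp add: in_keys_iff)
    then have "confluent ((a \<cdot> g \<cdot> m) \<cdot> s' \<cdot> c)"
      using conf[of "a \<cdot> g \<cdot> m \<cdot> s' \<cdot> c"] smallerI[OF BR(1)] by simp
    from confluentD[OF this BRg]
    show "lin Psi (?mid (pvec g) (pvec s')) \<asymp> ten (pmult (pvec a) (pmult (pvec g) (pvec m))) s' (pvec c) + lin Psi (?mid (pvec g) f')"
      using cg r by (simp add: pmult_assoc[symmetric])
  qed (intro klin_path_intros)+
  have 2: "lin Psi (?mid (pvec s) f') \<asymp> ten (pvec a) s (pmult (pvec m) (pmult f' (pvec c))) + lin Psi (?mid f f')"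
  proof (rule klin_eqv[where S = "\<lambda>f'. lin Psi (?mid (pvec s) f')"
        and T = "\<lambda>f'. ten (pvec a) s (pmult (pvec m) (pmult f' (pvec c))) + lin Psi (?mid f f')"])
    fix g
    assume g: "g \<in> Poly_Mapping.keys f'"
    note cg = comp_f'[OF g]
    have BRg: "(a, s, f, m \<cdot> g \<cdot> c) \<in> BR"
      using r R(1) cg g'_paths[OF g] by (auto intro!: BR_I)
    have "(a \<cdot> s \<cdot> m) \<cdot> g \<cdot> c \<in> Poly_Mapping.keys (sandwich (a \<cdot> s \<cdot> m) f' c)"
      using lookup_context[of f' "a \<cdot> s \<cdot> m" c g] comp_f' g r(6,7) by (simp add: in_keys_iff)
    then have "confluent (a \<cdot> s \<cdot> m \<cdot> g \<cdot> c)"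
      using conf[of "a \<cdot> s \<cdot> m \<cdot> g \<cdot> c"] smallerI[OF BR(2)] by simp
    from confluentD[OF this BRg]
    show "lin Psi (?mid (pvec s) (pvec g)) \<asymp> ten (pvec a) s (pmult (pvec m) (pmult (pvec g) (pvec c))) + lin Psi (?mid f (pvec g))"
      using cg r by simp
  qed (intro klin_path_intros)+
  have "V (a, s, f, m \<cdot> s' \<cdot> c) = ten (pvec a) s (pmult (pvec m) (pmult (pvec s') (pvec c))) + lin Psi (?mid f (pvec s'))"
    using r by simp
  also have "\<dots> \<asymp> ten (pvec a) s (pmult (pvec m) (pmult f' (pvec c))) +
      (ten (pmult (pvec a) (pmult (pvec s) (pvec m))) s' (pvec c) + lin Psi (?mid f f'))"
  proof (intro eqv_add)
    have "pmult (pvec m) (pmult (pvec s') (pvec c)) - pmult (pvec m) (pmult f' (pvec c)) =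
        pmult (pvec m) (pmult (pvec s' - f') (pvec c))"
      by (simp only: pmult_distrib)
    also have "\<dots> \<in> I"
      using rule_in_I[OF r(2)] r(4,5) by (intro I_lmult I_rmult) simp_all
    finally show "ten (pvec a) s (pmult (pvec m) (pmult (pvec s') (pvec c))) \<asymp>
        ten (pvec a) s (pmult (pvec m) (pmult f' (pvec c)))"
      by (rule ten_eqv_right) (use R(4) r(3) in simp_all)
    have "pmult (pvec a) (pmult f (pvec m)) - pmult (pvec a) (pmult (pvec s) (pvec m)) =
        - pmult (pvec a) (pmult (pvec s - f) (pvec m))"
      by (simp only: pmult_distrib minus_diff_eq)
    also have "\<dots> \<in> I"
      using rule_in_I[OF r(1)] r(3,4) by (intro subsp_neg[OF subsp_I] I_lmult I_rmult) simp_all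
    finally have "ten (pmult (pvec a) (pmult f (pvec m))) s' (pvec c) \<asymp>
        ten (pmult (pvec a) (pmult (pvec s) (pvec m))) s' (pvec c)"
      by (rule ten_eqv_left) (use R'(4) r(5) in simp_all)
    then show "lin Psi (?mid f (pvec s')) \<asymp>
        ten (pmult (pvec a) (pmult (pvec s) (pvec m))) s' (pvec c) + lin Psi (?mid f f')"
      by (intro eqv_trans[OF 1] eqv_add eqv_refl)
  qed
  also have "\<dots> = ten (pmult (pvec a) (pmult (pvec s) (pvec m))) s' (pvec c) +
      (ten (pvec a) s (pmult (pvec m) (pmult f' (pvec c))) + lin Psi (?mid f f'))"
    by (simp add: algebra_simps)
  also have "\<dots> \<asymp> ten (pmult (pvec a) (pmult (pvec s) (pvec m))) s' (pvec c) + lin Psi (?mid (pvec s) f')"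
    by (intro eqv_add eqv_refl) (rule eqv_sym[OF 2])
  also have "\<dots> = V (a \<cdot> s \<cdot> m, s', f', c)"
    using r by (simp add: pmult_assoc[symmetric])
  finally show ?thesis .
qed

text \<open>The reductions supplied for \<open>p\<close> are prescribed only in their first step.
  Both end in the normal form of \<open>p\<close>, so by \<open>V_context\<close> the two values
  differ, up to \<open>D\<close>, by \<open>phi1v r - phi1v t\<close> placed in the context of
  \<open>u\<close> and \<open>w\<close>, which lies in \<open>D\<close> too.\<close>

lemma ambiguity_resolves:
  assumes conf: "\<And>q. (q, u \<cdot> p \<cdot> w) \<in> smaller\<^sup>+ \<Longrightarrow> confluent q"
    and p: "p \<in> ambiguities Q \<R>" "p \<in> paths Q" and uw: "u \<in> paths Q" "w \<in> paths Q" "composable u p" "composable p w"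
    and s: "(s, f) \<in> \<R>" "p = s \<cdot> d" "d \<in> paths Q" "composable s d"
    and S: "(S, F) \<in> \<R>" "p = A \<cdot> S" "A \<in> paths Q" "composable A S"
  shows "V (u, s, f, d \<cdot> w) \<asymp> V (u \<cdot> A, S, F, w)"
proof -
  obtain r t where rt: "r \<in> reductions Q \<R>" "t \<in> reductions Q \<R>"
      "starts_on_left Q \<R> r p" "starts_on_right Q \<R> t p" "irred Q \<R> (reduce r (pvec p))"
      "irred Q \<R> (reduce t (pvec p))" "phi1v t (pvec p) - phi1v r (pvec p) \<in> D"
    using D_ambiguity[OF p(1)] by (elim exE conjE)
  obtain a0 s0 f0 c0 rs where r: "r = (a0, s0, f0, c0) # rs" "a0 \<cdot> s0 \<cdot> c0 = p" "a0 \<in> paths_of_len Q 0"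
    using rt(3) unfolding starts_on_left_def by (elim exE conjE)
  obtain a1 s1 f1 c1 ts where t: "t = (a1, s1, f1, c1) # ts" "a1 \<cdot> s1 \<cdot> c1 = p" "c1 \<in> paths_of_len Q 0"
    using rt(4) unfolding starts_on_right_def by (elim exE conjE)
  have BR0: "(a0, s0, f0, c0) \<in> BR" and BR1: "(a1, s1, f1, c1) \<in> BR"
    using rt(1,2) r(1) t(1) by simp_all
  note B0 = BR_D[OF BR0] and B1 = BR_D[OF BR1]
  have a0: "a0 \<in> paths Q" "len a0 = 0" and c1: "c1 \<in> paths Q" "len c1 = 0"
    using r(3) t(3) by (simp_all add: paths_of_len_def)
  \<comment> \<open>A vertex at either end can be cancelled. As each end of a path carries at most
    one tip, the first steps of \<open>r\<close> and \<open>t\<close> are forced to be the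
    reductions of \<open>s\<close> and \<open>S\<close>.\<close>
  have "s0 \<cdot> c0 = s \<cdot> d"
    using r(2) s(2) len_0_pcomp(1)[OF a0, of "s0 \<cdot> c0"] B0 by simp
  then have 0: "s0 = s" "f0 = f" "c0 = d"
    using tips_prefix[OF B0(1) s(1) B0(3) s(3) B0(5) s(4)] by simp_all
  have "a1 \<cdot> s1 = A \<cdot> S"
    using t(2) S(2) len_0_pcomp(2)[OF c1, of "s1"] B1 by simp
  then have 1: "s1 = S" "f1 = F" "a1 = A"
    using tips_suffix[OF B1(1) S(1) B1(2) S(3) B1(4) S(4)] by simp_all
  have comp: "composable u a0" "composable c0 w" "composable u a1" "composable c1 w"
    using uw arg_cong[OF r(2), of target] arg_cong[OF t(2), of target]
      arg_cong[OF r(2), of source] arg_cong[OF t(2), of source]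
    by (simp_all add: composable_def)
  have ua0: "u \<cdot> a0 = u" and c1w: "c1 \<cdot> w = w"
    using len_0_pcomp(2)[OF a0 comp(1)] len_0_pcomp(1)[OF c1 comp(4)] by simp_all
  \<comment> \<open>All proper descendants of the path: closed downwards and confluent by
    hypothesis, whereas nothing is assumed about the path itself.\<close>
  let ?X = "{q. (q, u \<cdot> p \<cdot> w) \<in> smaller\<^sup>+}"
  have X: "\<And>q. q \<in> ?X \<Longrightarrow> confluent q" "\<And>q q'. (q', q) \<in> smaller \<Longrightarrow> q \<in> ?X \<Longrightarrow> q' \<in> ?X"
    "\<And>q. (q, u \<cdot> p \<cdot> w) \<in> smaller \<Longrightarrow> q \<in> ?X"
    using conf by (auto intro: trancl_into_trancl2)
  have ctx: "V (u \<cdot> a, s, f, c \<cdot> w) \<asymp> lmul (pvec u) (rmul (phi1v ((a, s, f, c) # rs) (pvec p)) (pvec w)) +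
      lin Psi (sandwich u (reduce ((a, s, f, c) # rs) (pvec p)) w)"
    if "(a, s, f, c) # rs \<in> reductions Q \<R>" "a \<cdot> s \<cdot> c = p" "composable u a" "composable c w" for a s f c rs
  proof -
    have *: "q \<in> ?X" if "(q, u \<cdot> a \<cdot> s \<cdot> c \<cdot> w) \<in> smaller" for q
      using that X(3)[of q] \<open>a \<cdot> s \<cdot> c = p\<close>[symmetric] by simp
    show ?thesis
      using V_context[OF X(1,2) * uw(1,2) that(3,4,1)] unfolding that(2) .
  qed
  have "V (u \<cdot> a0, s0, f0, c0 \<cdot> w) \<asymp>
    lmul (pvec u) (rmul (phi1v r (pvec p)) (pvec w)) + lin Psi (sandwich u (reduce r (pvec p)) w)"
    unfolding r(1) by (rule ctx) (use rt(1) r comp in simp_all)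
  \<comment> \<open>Reduction-uniqueness makes the two remainders equal, which leaves only the
    collected triples to compare.\<close>
  also have "reduce r (pvec p) = reduce t (pvec p)"
    using nfp_eq[OF p(2) rt(1,5)] nfp_eq[OF p(2) rt(2,6)] by simp
  also have "lmul (pvec u) (rmul (phi1v r (pvec p)) (pvec w)) + lin Psi (sandwich u (reduce t (pvec p)) w) \<asymp>
    lmul (pvec u) (rmul (phi1v t (pvec p)) (pvec w)) + lin Psi (sandwich u (reduce t (pvec p)) w)"
  proof (rule eqv_add[OF _ eqv_refl], rule lmul_eqv, rule rmul_eqv)
    show "phi1v r (pvec p) \<asymp> phi1v t (pvec p)"
      by (rule eqv_sym) (simp add: eqv_def rt(7))
  qed (use uw in simp_all)
  also have "\<dots> \<asymp> V (u \<cdot> a1, s1, f1, c1 \<cdot> w)"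
    unfolding t(1) by (rule eqv_sym, rule ctx) (use rt(2) t comp in simp_all)
  finally show ?thesis
    unfolding ua0 c1w 0 1 .
qed

text \<open>Induction on the number of arrows to the right of \<open>a\<close>, the redex that
  starts further left being named first. Disjoint tips are compared directly. For overlapping tips
  the ambiguity beginning with \<open>s\<close> leads to a tip \<open>S\<close>, possibly different
  from \<open>s'\<close>, and the induction hypothesis continues from there.\<close>

lemma redexes_agree:
  assumes conf: "\<And>q. (q, a \<cdot> s \<cdot> c) \<in> smaller\<^sup>+ \<Longrightarrow> confluent q"
    and r: "(a, s, f, c) \<in> BR" "(a', s', f', c') \<in> BR" "a \<cdot> s \<cdot> c = a' \<cdot> s' \<cdot> c'" "len a \<le> len a'"
  shows "V (a, s, f, c) \<asymp> V (a', s', f', c')"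
  using assms
proof (induct "len (a \<cdot> s \<cdot> c) - len a" arbitrary: a s f c a' s' f' c' rule: less_induct)
  case less
  note conf = less.prems(1) and r = less.prems(2-3) and eq = less.prems(4) and le = less.prems(5)
  note B = BR_D[OF r(1)] and B' = BR_D[OF r(2)]
  have total: "len a + len s + len c = len a' + len s' + len c'"
    using arg_cong[OF eq, of len] by simp
  obtain m where m: "m \<in> paths Q" "composable m (s' \<cdot> c')" "composable a m" "s \<cdot> c = m \<cdot> s' \<cdot> c'" "a' = a \<cdot> m"
    by (rule levi[of a' "s' \<cdot> c'" a "s \<cdot> c"]) (use B B' eq le total in auto)
  show ?case
  proof (cases "len (s' \<cdot> c') \<le> len c")
    case True
    obtain n where n: "n \<in> paths Q" "composable n (s' \<cdot> c')" "composable s n" "c = n \<cdot> s' \<cdot> c'" "m = s \<cdot> n"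
      by (rule levi[of m "s' \<cdot> c'" s c]) (use B B' m True in auto)
    have "V (a, s, f, n \<cdot> s' \<cdot> c') \<asymp> V (a \<cdot> s \<cdot> n, s', f', c')"
    proof (rule disjoint_redexes)
      fix q
      assume "(q, a \<cdot> s \<cdot> n \<cdot> s' \<cdot> c') \<in> smaller"
      then show "confluent q"
        using n(4) by (intro conf) auto
    qed (use B B' n in auto)
    then show ?thesis
      using m(5) n(4,5) by simp
  next
    case False
    obtain n where n: "n \<in> paths Q" "composable n c" "composable m n" "s' \<cdot> c' = n \<cdot> c" "s = m \<cdot> n"
      by (rule levi[of s c m "s' \<cdot> c'"]) (use B B' m False in auto)
    have len_s: "len s = len m + len n"
      using n(5) by simp
    have len_n: "0 < len n"
      using False arg_cong[OF n(4), of len] by simp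
    show ?thesis
    proof (cases "len m = 0")
      case True
      then have "s = n" "a' = a"
        using n(5) m(5) len_0_pcomp(1)[OF m(1) True n(3)] len_0_pcomp(2)[OF m(1) True m(3)] by simp_all
      moreover have "s \<cdot> c = s' \<cdot> c'"
        using n(4) \<open>s = n\<close> by simp
      ultimately show ?thesis
        using tips_prefix[OF B(1) B'(1) B(3) B'(3) B(5) B'(5)] by simp
    next
      case m_pos: False
      \<comment> \<open>Otherwise \<open>s'\<close> would divide \<open>s\<close>, and it would be
        shorter because \<open>m\<close> contains an arrow.\<close>
      have "\<not> len c \<le> len c'"
      proof
        assume *: "len c \<le> len c'"
        obtain k where k: "k \<in> paths Q" "composable k c" "composable s' k" "c' = k \<cdot> c" "n = s' \<cdot> k"
          by (rule levi[of n c s' c']) (use B B' n * in auto)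
        have "divisor Q s' s"
          unfolding divisor_def using B' m n k by (intro conjI bexI[of _ m] bexI[of _ k]) auto
        then have "s' = s"
          using divisor_tips[OF B'(1) B(1)] by simp
        then show False
          using len_s m_pos arg_cong[OF k(5), of len] by simp
      qed
      then have c: "len c' \<le> len c" "len c' \<noteq> len c"
        by simp_all
      obtain x where x: "x \<in> paths Q" "composable x c'" "composable n x" "c = x \<cdot> c'" "s' = n \<cdot> x"
        by (rule levi[of s' c' n c]) (use B B' n c in auto)
      obtain A S F d y where A: "x = d \<cdot> y" "d \<in> paths Q" "y \<in> paths Q" "composable d y"
        "(S, F) \<in> \<R>" "A \<in> paths Q" "composable A S" "0 < len A" "s \<cdot> d = A \<cdot> S"
        "s \<cdot> d \<in> ambiguities Q \<R>"
        by (rule overlap_ambiguity[OF B(1) B'(1) n(5) x(5) m(1) n(1) x(1) n(3) x(3)]) (use m_pos len_n in simp_all)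
      have sd: "composable s d" "composable a A" "composable S y" "composable y c'"
        using B(4) x(2,3) arg_cong[OF A(9), of target] arg_cong[OF A(9), of source] A(4)
        by (simp_all add: composable_def A(1) n(5))
      have w: "y \<cdot> c' \<in> paths Q" "S \<in> paths Q"
        using A B' sd rule_facts(1)[OF A(5)] by auto
      have c_eq: "c = d \<cdot> y \<cdot> c'"
        using x(4) A(1) by simp
      have p_eq: "a \<cdot> s \<cdot> c = (a \<cdot> A) \<cdot> S \<cdot> (y \<cdot> c')"
        using A(9) c_eq by (metis pcomp_simps(5))
      have step: "V (a, s, f, d \<cdot> y \<cdot> c') \<asymp> V (a \<cdot> A, S, F, y \<cdot> c')"
      proof (rule ambiguity_resolves[of a "s \<cdot> d"])
        fix q
        assume "(q, a \<cdot> (s \<cdot> d) \<cdot> y \<cdot> c') \<in> smaller\<^sup>+"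
        then show "confluent q"
          using c_eq by (intro conf) simp
      qed (use A B sd w in auto)
      have BR: "(a \<cdot> A, S, F, y \<cdot> c') \<in> BR"
        using A B sd w by (intro BR_I) auto
      have conf': "confluent q" if "(q, (a \<cdot> A) \<cdot> S \<cdot> (y \<cdot> c')) \<in> smaller\<^sup>+" for q
        using that unfolding p_eq[symmetric] by (rule conf)
      have conf'': "confluent q" if "(q, a' \<cdot> s' \<cdot> c') \<in> smaller\<^sup>+" for q
        using that unfolding eq[symmetric] by (rule conf)
      \<comment> \<open>\<open>S\<close> may start on either side of \<open>s'\<close>, so the
        hypothesis is invoked in either order. Both start strictly to the right of \<open>s\<close>:
        the former because \<open>A\<close> contains an arrow, the latter because \<open>m\<close>
        does.\<close>
      have "V (a \<cdot> A, S, F, y \<cdot> c') \<asymp> V (a', s', f', c')"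
      proof (cases "len (a \<cdot> A) \<le> len a'")
        case True
        show ?thesis
        proof (rule less.hyps[OF _ _ BR r(2) trans[OF p_eq[symmetric] eq] True])
          show "len ((a \<cdot> A) \<cdot> S \<cdot> y \<cdot> c') - len (a \<cdot> A) < len (a \<cdot> s \<cdot> c) - len a"
            unfolding p_eq using A(8) rule_facts(7)[OF A(5)] by simp
        qed (rule conf')
      next
        case False
        have "V (a', s', f', c') \<asymp> V (a \<cdot> A, S, F, y \<cdot> c')"
        proof (rule less.hyps[OF _ _ r(2) BR trans[OF eq[symmetric] p_eq]])
          show "len (a' \<cdot> s' \<cdot> c') - len a' < len (a \<cdot> s \<cdot> c) - len a"
            unfolding eq using m(5) m_pos rule_facts(7)[OF B'(1)] by simp
          show "len a' \<le> len (a \<cdot> A)"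
            using False by simp
        qed (rule conf'')
        then show ?thesis
          by (rule eqv_sym)
      qed
      then show ?thesis
        using eqv_trans[OF step] c_eq by simp
    qed
  qed
qed

text \<open>The transitive closure is the right relation for this induction because the lists
  attached to an ambiguity descend by many steps at once.\<close>

lemma confluent_all: "confluent p"
  using wf_trancl[OF wf_smaller]
proof (induct p rule: wf_induct_rule)
  case (less p)
  show ?case
    unfolding confluent_def
  proof (intro allI impI)
    fix a s f c
    assume r: "(a, s, f, c) \<in> BR" "p = a \<cdot> s \<cdot> c"
    have "p \<in> paths Q"
      using BR_D(7)[OF r(1)] r(2) by simp
    moreover have "p \<notin> irred_paths Q \<R>"
      using r by (auto simp: irred_paths_iff)
    ultimately obtain a' s' f' c' where r': "(a', s', f', c') \<in> BR" "p = a' \<cdot> s' \<cdot> c'" "Psi p = V (a', s', f', c')"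
      by (rule Psi_redex)
    have "V (a', s', f', c') \<asymp> V (a, s, f, c)"
    proof (cases "len a \<le> len a'")
      case True
      have "V (a, s, f, c) \<asymp> V (a', s', f', c')"
        by (rule redexes_agree[OF _ r(1) r'(1) _ True]) (use less r r' in simp_all)
      then show ?thesis
        by (rule eqv_sym)
    next
      case False
      show ?thesis
        by (rule redexes_agree[OF _ r'(1) r(1)]) (use less r r' False in simp_all)
    qed
    then show "Psi p \<asymp> V (a, s, f, c)"
      unfolding r'(3) .
  qed
qed

end

section \<open>The contracting homotopy\<close>

lemma pmult_vertex:
  assumes "\<And>p. p \<in> Poly_Mapping.keys x \<Longrightarrow> target p = v"
  shows "pmult (pvec (vertex_path v)) x = x"
  by (rule klin_eq[where T = "\<lambda>x. x", OF klin_pmult_right klin_id])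
    (use assms in \<open>simp add: composable_def\<close>)

lemma sum_lessThan_add: "(\<Sum>i<m + n. F i) = (\<Sum>i<m. F i) + (\<Sum>j<n. F (m + j))" for F :: "nat \<Rightarrow> 'x::comm_monoid_add"
  by (induct n) (simp_all add: add.assoc)

definition phi0p :: "('v, 'a) pre_digraph \<Rightarrow> ('v, 'a) qpath \<Rightarrow> ('v, 'a, 'k::field) tripvec" where
  "phi0p Q p = (\<Sum>i<len p. let c = arrows p ! i in
    Poly_Mapping.single (Path (head Q c) (drop (Suc i) (arrows p)) (target p),
      Path (tail Q c) [c] (head Q c), Path (source p) (take i (arrows p)) (tail Q c)) 1)"

lemma phi0p_len_0: "len p = 0 \<Longrightarrow> phi0p Q p = 0"
  by (simp add: phi0p_def)

text \<open>The arrows of \<open>p\<close> precede those of \<open>q\<close> in the list. Their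
  terms acquire \<open>q\<close> on the left and the remaining terms acquire \<open>p\<close> on the
  right, which is the Leibniz rule.\<close>

lemma phi0p_pcomp:
  assumes "composable q p"
  shows "(phi0p Q (q \<cdot> p) :: ('v, 'a, 'k::field) tripvec) =
    lmul (pvec q) (phi0p Q p) + rmul (phi0p Q q) (pvec p)"
proof -
  have sum_lin: "T (\<Sum>i\<in>A. g i) = (\<Sum>i\<in>A. T (g i))"
    if "klin T" for T :: "('v, 'a, 'k) tripvec \<Rightarrow> ('v, 'a, 'k) tripvec" and g and A :: "nat set"
    using that by (induct A rule: infinite_finite_induct) (simp_all add: klin_zero klin_plus)
  have len: "len (q \<cdot> p) = len p + len q"
    by simp
  have "lmul (pvec q) (phi0p Q p :: ('v, 'a, 'k) tripvec) = (\<Sum>i<len p. let c = arrows (q \<cdot> p) ! i in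
    Poly_Mapping.single (Path (head Q c) (drop (Suc i) (arrows (q \<cdot> p))) (target (q \<cdot> p)),
      Path (tail Q c) [c] (head Q c), Path (source (q \<cdot> p)) (take i (arrows (q \<cdot> p))) (tail Q c)) 1)"
    unfolding phi0p_def sum_lin[OF klin_lmul[OF klin_id]]
    by (rule sum.cong) (use assms in \<open>auto simp: Let_def lmul_single nth_append composable_def pcomp_def len_def\<close>)
  moreover have "rmul (phi0p Q q) (pvec p :: ('v, 'a, 'k) pathvec) = (\<Sum>j<len q. let i = len p + j; c = arrows (q \<cdot> p) ! i in
    Poly_Mapping.single (Path (head Q c) (drop (Suc i) (arrows (q \<cdot> p))) (target (q \<cdot> p)),
      Path (tail Q c) [c] (head Q c), Path (source (q \<cdot> p)) (take i (arrows (q \<cdot> p))) (tail Q c)) 1)"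
    unfolding phi0p_def sum_lin[OF klin_rmul[OF klin_id]]
    by (rule sum.cong) (use assms in \<open>auto simp: Let_def rmul_single nth_append composable_def pcomp_def len_def\<close>)
  ultimately show ?thesis
    unfolding phi0p_def len sum_lessThan_add by (simp add: Let_def)
qed

lemma (in quiver) phi0p_arrow:
  assumes "p \<in> paths Q" "len p = 1"
  shows "phi0p Q p = Poly_Mapping.single (vertex_path (target p), p, vertex_path (source p)) 1"
proof -
  obtain c where c: "arrows p = [c]"
    using assms(2) by (auto simp: len_def length_Suc_conv)
  then have "source p = tail Q c \<and> target p = head Q c"
    using assms(1) wf_digraph.awalk_Cons_iff[OF wf] wf_digraph.awalk_Nil_iff[OF wf]
    by (auto simp: paths_def)
  then show ?thesis
    using c by (cases p) (simp add: phi0p_def len_def vertex_path_def)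
qed

context redsys begin

lemma NF_pvec [simp]: "NF (pvec p) = nfp p"
  by simp

lemma nfp_tip: "(s, f) \<in> \<R> \<Longrightarrow> nfp s = f"
proof -
  assume sf: "(s, f) \<in> \<R>"
  have s: "s \<in> paths Q"
    by (rule rule_facts(1)[OF sf])
  have "NF (pvec (vertex_path (target s) \<cdot> s \<cdot> vertex_path (source s))) = NF f"
    using NF_sandwich[OF vertex_BR[OF sf]] unfolding sandwich_vertices[OF sf] .
  then show ?thesis
    using NF_irred_eq[OF rule_facts(6)[OF sf]] by simp
qed

lemma nfp_in_kspan: "p \<in> paths Q \<Longrightarrow> nfp p \<in> kspan (paths Q)"
  using NF_in_kspan[of "pvec p"] by simp

lemma nfp_diff_in_I: "p \<in> paths Q \<Longrightarrow> pvec p - nfp p \<in> I"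
  using NF_diff_in_I[of "pvec p"] by simp

lemma NF_nfp: "p \<in> paths Q \<Longrightarrow> NF (nfp p) = nfp p"
  using NF_NF[of "pvec p"] by simp

lemma keys_nfp:
  assumes "p \<in> paths Q" "q \<in> Poly_Mapping.keys (nfp p)"
  shows "q \<in> paths Q" "source q = source p" "target q = target p"
  using nfp_in_kspan[OF assms(1)] assms(2) nfp_parallel[OF assms] by (auto simp: kspan_iff)

definition d1v :: "('v, 'a, 'k) tripvec \<Rightarrow> ('v, 'a, 'k) tripvec" where
  "d1v = lin (\<lambda>(b, s, c). lmul (pvec b) (rmul (phi0p Q s - lin (phi0p Q) (nfp s)) (pvec c)))"

end

lemma (in redsys) klin_d1v: "klin T \<Longrightarrow> klin (\<lambda>x. d1v (T x))"
  unfolding d1v_def by (rule klin_lin_comp)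

context ambiguity_resolution begin

text \<open>Reductions keep end vertices, so the left factor of every triple in \<open>Psi p\<close>
  ends at \<open>target p\<close>. This absorbs the vertex that \<open>phi0p\<close> of an arrow
  puts into the left factor.\<close>

lemma Psi_unit: "p \<in> paths Q \<Longrightarrow> lmul (pvec (vertex_path (target p))) (Psi p) = Psi p"
  using wf_smaller
proof (induct p rule: wf_induct_rule)
  case (less p)
  show ?case
  proof (cases "p \<in> irred_paths Q \<R>")
    case False
    then obtain a s f c where r: "(a, s, f, c) \<in> BR" "p = a \<cdot> s \<cdot> c" "Psi p = V (a, s, f, c)"
      by (rule Psi_redex[OF less.prems])
    have "lmul (pvec (vertex_path (target a))) (lin Psi (sandwich a f c)) = lin Psi (sandwich a f c)"
    proof (rule klin_eq[where S = "\<lambda>x. lmul (pvec (vertex_path (target a))) (lin Psi x)"])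
      fix q
      assume q: "q \<in> Poly_Mapping.keys (sandwich a f c)"
      have "q \<in> paths Q"
        using smaller_paths[OF smallerI[OF r(1) q]] by simp
      then show "lmul (pvec (vertex_path (target a))) (lin Psi (pvec q)) = lin Psi (pvec q)"
        using less.hyps[of q] smallerI[OF r(1) q] r(2) keys_sandwich_parallel(2)[OF r(1) q] by simp
    qed (intro klin_path_intros klin_lin)+
    then show ?thesis
      using r by (simp add: lmul_distrib lmul_single composable_def)
  qed (simp add: Psi_irred)
qed

lemma keys_Psi: "p \<in> paths Q \<Longrightarrow> Poly_Mapping.keys (Psi p) \<subseteq> paths Q \<times> tips \<R> \<times> paths Q"
  using wf_smaller
proof (induct p rule: wf_induct_rule)
  case (less p)
  show ?case
  proof (cases "p \<in> irred_paths Q \<R>")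
    case False
    then obtain a s f c where r: "(a, s, f, c) \<in> BR" "p = a \<cdot> s \<cdot> c" "Psi p = V (a, s, f, c)"
      by (rule Psi_redex[OF less.prems])
    have "Poly_Mapping.keys (Psi q) \<subseteq> paths Q \<times> tips \<R> \<times> paths Q"
      if q: "q \<in> Poly_Mapping.keys (sandwich a f c)" for q
      using less.hyps[of q] smallerI[OF r(1) q] smaller_paths[OF smallerI[OF r(1) q]] r(2) by simp
    then have "Poly_Mapping.keys (lin Psi (sandwich a f c)) \<subseteq> paths Q \<times> tips \<R> \<times> paths Q"
      using keys_lin[of Psi "sandwich a f c"] by blast
    moreover have "a \<in> paths Q" "c \<in> paths Q" "s \<in> tips \<R>"
      using BR_D[OF r(1)] rule_facts(4) by simp_all
    ultimately show ?thesis
      unfolding r(3) using keys_add[of "ten (pvec a) s (pvec c)" "lin Psi (sandwich a f c)"] by auto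
  qed (simp add: Psi_irred)
qed

lemma keys_lin_Psi:
  "y \<in> kspan (paths Q) \<Longrightarrow> Poly_Mapping.keys (lin Psi y) \<subseteq> paths Q \<times> tips \<R> \<times> paths Q"
proof -
  assume y: "y \<in> kspan (paths Q)"
  have "Poly_Mapping.keys (Psi p) \<subseteq> paths Q \<times> tips \<R> \<times> paths Q" if "p \<in> Poly_Mapping.keys y" for p
    using keys_Psi y that by (simp add: kspan_iff subsetD)
  then show ?thesis
    using keys_lin[of Psi y] by blast
qed

lemma lmul_in_D:
  assumes "x \<in> I" "Poly_Mapping.keys g \<subseteq> paths Q \<times> tips \<R> \<times> paths Q"
  shows "lmul x g \<in> D"
proof (rule klin_mem[OF D_subsp klin_lmul[OF klin_id]])
  fix t
  assume "t \<in> Poly_Mapping.keys g"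
  moreover obtain p s q where "t = (p, s, q)"
    by (cases t)
  ultimately show "lmul x (Poly_Mapping.single t 1) \<in> D"
    using assms(2) D_left[OF I_rmult[OF assms(1), of "pvec p"], of s "pvec q"] by (auto simp: lmul_single)
qed

lemma Psi_BR:
  "(a, s, f, c) \<in> BR \<Longrightarrow> Psi (a \<cdot> s \<cdot> c) \<asymp> ten (pvec a) s (pvec c) + lin Psi (sandwich a f c)"
  by (rule confluentD[OF confluent_all])

text \<open>Compares reducing \<open>x \<cdot> y\<close> with reducing the factor \<open>y\<close> first.\<close>

lemma Psi_pcomp:
  assumes "x \<in> paths Q"
  shows "y \<in> paths Q \<Longrightarrow> composable x y \<Longrightarrow>
    Psi (x \<cdot> y) \<asymp> lmul (pvec x) (Psi y) + lin Psi (pmult (pvec x) (nfp y))"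
  using wf_smaller
proof (induct y rule: wf_induct_rule)
  case (less y)
  show ?case
  proof (cases "y \<in> irred_paths Q \<R>")
    case True
    then have "nfp y = pvec y"
      using NF_irred_eq[of "pvec y"] by (simp add: irred_iff)
    then show ?thesis
      using True less.prems by (simp add: Psi_irred)
  next
    case False
    obtain a s f c where r: "(a, s, f, c) \<in> BR" "y = a \<cdot> s \<cdot> c" "Psi y = V (a, s, f, c)"
      by (rule Psi_redex[OF less.prems(1) False])
    have xa: "composable x a"
      using less.prems(2) r(2) by simp
    have BR: "(x \<cdot> a, s, f, c) \<in> BR"
      using BR_D[OF r(1)] xa assms by (intro BR_I) auto
    have sw: "sandwich (x \<cdot> a) f c = pmult (pvec x) (sandwich a f c)"
      using xa by (simp flip: pmult_assoc)
    \<comment> \<open>The induction hypothesis is applied to every term of the replacement; the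
      normal forms of these terms add up to that of \<open>y\<close>.\<close>
    have "lin Psi (pmult (pvec x) (sandwich a f c)) \<asymp>
      lmul (pvec x) (lin Psi (sandwich a f c)) + lin Psi (pmult (pvec x) (NF (sandwich a f c)))"
    proof (rule klin_eqv[where S = "\<lambda>z. lin Psi (pmult (pvec x) z)"
          and T = "\<lambda>z. lmul (pvec x) (lin Psi z) + lin Psi (pmult (pvec x) (NF z))"])
      fix g
      assume g: "g \<in> Poly_Mapping.keys (sandwich a f c)"
      have g': "g \<in> paths Q" "composable x g" "(g, y) \<in> smaller"
        using smaller_paths[OF smallerI[OF r(1) g]] keys_sandwich_parallel[OF r(1) g] xa
          smallerI[OF r(1) g] r(2) by (simp_all add: composable_def)
      show "lin Psi (pmult (pvec x) (pvec g)) \<asymp>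
        lmul (pvec x) (lin Psi (pvec g)) + lin Psi (pmult (pvec x) (NF (pvec g)))"
        using less.hyps[OF g'(3,1,2)] g'(2) by simp
    qed (intro klin_path_intros klin_lin)+
    then have 1: "lin Psi (sandwich (x \<cdot> a) f c) \<asymp>
      lmul (pvec x) (lin Psi (sandwich a f c)) + lin Psi (pmult (pvec x) (nfp y))"
      unfolding sw NF_sandwich[OF r(1), symmetric] r(2)[symmetric] NF_pvec .
    have "Psi (x \<cdot> y) \<asymp> ten (pvec (x \<cdot> a)) s (pvec c) + lin Psi (sandwich (x \<cdot> a) f c)"
      using Psi_BR[OF BR] r(2) by simp
    also have "\<dots> \<asymp> ten (pvec (x \<cdot> a)) s (pvec c) +
        (lmul (pvec x) (lin Psi (sandwich a f c)) + lin Psi (pmult (pvec x) (nfp y)))"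
      by (rule eqv_add[OF eqv_refl 1])
    also have "\<dots> = lmul (pvec x) (Psi y) + lin Psi (pmult (pvec x) (nfp y))"
      unfolding r(3) using xa by (simp add: lmul_distrib lmul_single algebra_simps)
    finally show ?thesis .
  qed
qed

lemma Psi_pmult:
  assumes "x \<in> paths Q" "\<And>g. g \<in> Poly_Mapping.keys y \<Longrightarrow> g \<in> paths Q \<and> composable x g"
  shows "lin Psi (pmult (pvec x) y) \<asymp> lmul (pvec x) (lin Psi y) + lin Psi (pmult (pvec x) (NF y))"
  by (rule klin_eqv[where S = "\<lambda>z. lin Psi (pmult (pvec x) z)"
          and T = "\<lambda>z. lmul (pvec x) (lin Psi z) + lin Psi (pmult (pvec x) (NF z))"])
    (intro klin_path_intros klin_lin | use assms Psi_pcomp[OF assms(1)] in simp)+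

text \<open>In each path \<open>s \<cdot> g\<close> the tip at the left end is reduced, with only a
  vertex to its left. Confluence makes this redex as good as the chosen one.\<close>

lemma Psi_tip:
  assumes "(s, f) \<in> \<R>" "\<And>g. g \<in> Poly_Mapping.keys y \<Longrightarrow> g \<in> paths Q \<and> composable s g"
  shows "lin Psi (pmult (pvec s) y) \<asymp> ten (pvec (vertex_path (target s))) s y + lin Psi (pmult f y)"
proof (rule klin_eqv[where S = "\<lambda>y. lin Psi (pmult (pvec s) y)"
      and T = "\<lambda>y. ten (pvec (vertex_path (target s))) s y + lin Psi (pmult f y)"])
  fix g
  assume g: "g \<in> Poly_Mapping.keys y"
  let ?e = "vertex_path (target s)"
  have BR: "(?e, s, f, g) \<in> BR"
    using rule_facts(1)[OF assms(1)] assms g vertex_path_target_in_paths[of s]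
    by (intro BR_I) (simp_all add: composable_def)
  have "pmult (pvec ?e) (pmult f (pvec g)) = pmult f (pvec g)"
    unfolding pmult_assoc[symmetric]
    using pmult_vertex[of f "target s"] rule_facts(5)[OF assms(1)] by simp
  then show "lin Psi (pmult (pvec s) (pvec g)) \<asymp> ten (pvec ?e) s (pvec g) + lin Psi (pmult f (pvec g))"
    using Psi_BR[OF BR] assms(2)[OF g] by simp
qed (intro klin_path_intros klin_lin)+

text \<open>Only the right factor is normalised. The left factor is kept as it is, so that
  \<open>hmap\<close> commutes with left multiplication; modulo \<open>D\<close> its class alone
  matters, by \<open>lmul_in_D\<close>.\<close>

definition hmap :: "('v, 'a, 'k) tripvec \<Rightarrow> ('v, 'a, 'k) tripvec" where
  "hmap = lin (\<lambda>(b, \<alpha>, c). lmul (pvec b) (lin Psi (pmult (pvec \<alpha>) (nfp c))))"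

lemma klin_hmap: "klin T \<Longrightarrow> klin (\<lambda>x. hmap (T x))"
  unfolding hmap_def by (rule klin_lin_comp)

lemma hmap_single: "hmap (Poly_Mapping.single (b, \<alpha>, c) 1) = lmul (pvec b) (lin Psi (pmult (pvec \<alpha>) (nfp c)))"
  by (simp add: hmap_def)

lemma hmap_ten: "hmap (ten x \<alpha> y) = lmul x (lin Psi (pmult (pvec \<alpha>) (NF y)))"
proof (rule klin_eq[where S = "\<lambda>x. hmap (ten x \<alpha> y)"])
  fix p
  show "hmap (ten (pvec p) \<alpha> y) = lmul (pvec p) (lin Psi (pmult (pvec \<alpha>) (NF y)))"
    by (rule klin_eq[where S = "\<lambda>y. hmap (ten (pvec p) \<alpha> y)"])
      (intro klin_path_intros klin_hmap klin_lin | simp add: hmap_single)+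
qed (intro klin_path_intros klin_hmap)+

lemma hmap_lmul: "hmap (lmul a g) = lmul a (hmap g)"
proof (rule klin_eq[where S = "\<lambda>g. hmap (lmul a g)"])
  fix t :: "('v, 'a) qpath \<times> ('v, 'a) qpath \<times> ('v, 'a) qpath"
  obtain b \<alpha> c where t: "t = (b, \<alpha>, c)"
    by (cases t)
  show "hmap (lmul a (Poly_Mapping.single t 1)) = lmul a (hmap (Poly_Mapping.single t 1))"
    by (simp add: t lmul_single hmap_ten hmap_single lmul_lmul)
qed (intro klin_path_intros klin_hmap)+

text \<open>Induction on the length, splitting off the leftmost arrow \<alpha> of
  \<open>q = \<alpha> \<cdot> q'\<close>. The Leibniz rule contributes \<open>Psi\<close> of
  \<alpha> times the normal form of \<open>q' \<cdot> c\<close>, and \<open>Psi_pmult\<close>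
  recombines this with the inductive term. For a vertex both sides vanish because \<open>Psi\<close>
  is zero on normal forms.\<close>

lemma hmap_phi0p:
  assumes "c \<in> paths Q"
  shows "q \<in> paths Q \<Longrightarrow> composable q c \<Longrightarrow>
    hmap (rmul (phi0p Q q) (pvec c)) \<asymp> lin Psi (pmult (pvec q) (nfp c))"
proof (induct "len q" arbitrary: q)
  case 0
  have "q = vertex_path (target c)"
    using len_0_vertex[of q] 0 by (simp add: composable_def)
  then have "pmult (pvec q) (nfp c) = nfp c"
    using pmult_vertex[of "nfp c" "target c"] keys_nfp(3)[OF assms] by simp
  moreover have "lin Psi (nfp c) = 0"
    by (rule klin_eq[OF klin_lin klin_const0])
      (use irred_nfp[OF assms] in \<open>auto simp: irred_iff kspan_iff intro!: Psi_irred\<close>)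
  ultimately show ?case
    using 0 by (simp add: phi0p_len_0 hmap_def)
next
  case (Suc n)
  obtain \<alpha> q' where q: "q = \<alpha> \<cdot> q'" "composable \<alpha> q'" "\<alpha> \<in> paths Q" "q' \<in> paths Q" "len q' = n"
    by (rule path_split[OF Suc.prems(1), of n]) (use Suc.hyps(2) in auto)
  have \<alpha>: "len \<alpha> = 1"
    using Suc.hyps(2) q by simp
  have q'c: "composable q' c" "q' \<cdot> c \<in> paths Q"
    using Suc.prems q assms by auto
  let ?e = "vertex_path (target \<alpha>)"
  have e: "composable ?e \<alpha>" "composable (vertex_path (source \<alpha>)) q'" "vertex_path (source \<alpha>) \<cdot> q' = q'"
    using q by (simp_all add: composable_def)
  have unit: "lmul (pvec ?e) (lin Psi (pmult (pvec \<alpha>) (nfp (q' \<cdot> c)))) = lin Psi (pmult (pvec \<alpha>) (nfp (q' \<cdot> c)))"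
  proof (rule klin_eq[where S = "\<lambda>x. lmul (pvec ?e) (lin Psi (pmult (pvec \<alpha>) x))"])
    fix g
    assume g: "g \<in> Poly_Mapping.keys (nfp (q' \<cdot> c))"
    have "\<alpha> \<cdot> g \<in> paths Q"
      using keys_nfp[OF q'c(2) g] q by (auto simp: composable_def)
    then show "lmul (pvec ?e) (lin Psi (pmult (pvec \<alpha>) (pvec g))) = lin Psi (pmult (pvec \<alpha>) (pvec g))"
      using Psi_unit[of "\<alpha> \<cdot> g"] by simp
  qed (intro klin_path_intros)+
  have "(phi0p Q q :: ('v, 'a, 'k) tripvec) = lmul (pvec \<alpha>) (phi0p Q q') + rmul (phi0p Q \<alpha>) (pvec q')"
    unfolding q(1) by (rule phi0p_pcomp[OF q(2)])
  then have "rmul (phi0p Q q) (pvec c :: ('v, 'a, 'k) pathvec) = lmul (pvec \<alpha>) (rmul (phi0p Q q') (pvec c)) +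
      Poly_Mapping.single (?e, \<alpha>, q' \<cdot> c) 1"
    using q'c e by (simp add: rmul_distrib lmul_rmul phi0p_arrow[OF q(3) \<alpha>] rmul_single)
  then have "hmap (rmul (phi0p Q q) (pvec c)) = lmul (pvec \<alpha>) (hmap (rmul (phi0p Q q') (pvec c))) +
      lin Psi (pmult (pvec \<alpha>) (nfp (q' \<cdot> c)))"
    using unit by (simp add: klin_plus[OF klin_hmap[OF klin_id]] hmap_lmul hmap_single)
  also have "\<dots> \<asymp> lmul (pvec \<alpha>) (lin Psi (pmult (pvec q') (nfp c))) + lin Psi (pmult (pvec \<alpha>) (nfp (q' \<cdot> c)))"
    by (intro eqv_add eqv_refl lmul_eqv Suc.hyps(1)) (use q q'c in simp_all)
  also have "nfp (q' \<cdot> c) = NF (pmult (pvec q') (nfp c))"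
  proof -
    have "pvec (q' \<cdot> c) - pmult (pvec q') (nfp c) = pmult (pvec q') (pvec c - nfp c)"
      using q'c by (simp add: pmult_distrib)
    also have "\<dots> \<in> I"
      using nfp_diff_in_I[OF assms] q(4) by (intro I_lmult) simp_all
    finally have "NF (pvec (q' \<cdot> c)) = NF (pmult (pvec q') (nfp c))"
      by (subst NF_eq_iff) (use q q'c nfp_in_kspan[OF assms] in \<open>auto intro!: kspan_pmult\<close>)
    then show ?thesis
      by simp
  qed
  also have "lmul (pvec \<alpha>) (lin Psi (pmult (pvec q') (nfp c))) + lin Psi (pmult (pvec \<alpha>) \<dots>) \<asymp>
      lin Psi (pmult (pvec \<alpha>) (pmult (pvec q') (nfp c)))"
  proof (rule eqv_sym, rule Psi_pmult[OF q(3)])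
    fix g
    assume "g \<in> Poly_Mapping.keys (pmult (pvec q') (nfp c))"
    then obtain h where h: "h \<in> Poly_Mapping.keys (nfp c)" "composable q' h" "g = q' \<cdot> h"
      using keys_pmult[of g "pvec q'" "nfp c"] by auto
    then show "g \<in> paths Q \<and> composable \<alpha> g"
      using keys_nfp(1)[OF assms h(1)] q by auto
  qed
  also have "\<dots> = lin Psi (pmult (pvec q) (nfp c))"
    using q by (simp flip: pmult_assoc)
  finally show ?case .
qed

text \<open>By \<open>hmap_phi0p\<close> the two parts of d_1 turn into \<open>Psi\<close> of
  \<open>s\<close>, respectively of \<open>f\<close>, times the normal form of \<open>c\<close>.
  Reducing the tip \<open>s\<close> shows that they differ by the triple with right factor
  \<open>nfp c\<close>, which is congruent to the one with right factor \<open>c\<close>.\<close>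

lemma hmap_d1v:
  assumes "\<And>b s c. (b, s, c) \<in> Poly_Mapping.keys g \<Longrightarrow> b \<in> paths Q \<and> s \<in> tips \<R> \<and> c \<in> paths Q \<and>
    composable b s \<and> composable s c"
  shows "hmap (d1v g) \<asymp> g"
proof (rule klin_eqv[where S = "\<lambda>g. hmap (d1v g)"])
  fix t
  assume t: "t \<in> Poly_Mapping.keys g"
  obtain b s c where t': "t = (b, s, c)"
    by (cases t)
  have bsc: "b \<in> paths Q" "s \<in> tips \<R>" "c \<in> paths Q" "composable b s" "composable s c"
    using assms[of b s c] t t' by auto
  obtain f where f: "(s, f) \<in> \<R>"
    using bsc(2) by (auto simp: tips_def)
  note R = rule_facts[OF f]
  have "hmap (rmul (lin (phi0p Q) f) (pvec c)) \<asymp> lin Psi (pmult f (nfp c))"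
  proof (rule klin_eqv[where S = "\<lambda>f. hmap (rmul (lin (phi0p Q) f) (pvec c))"
        and T = "\<lambda>f. lin Psi (pmult f (nfp c))"])
    fix g
    assume g: "g \<in> Poly_Mapping.keys f"
    have "g \<in> paths Q" "composable g c"
      using R(2) R(5)[OF g] g bsc(5) by (auto simp: kspan_iff composable_def)
    then show "hmap (rmul (lin (phi0p Q) (pvec g)) (pvec c)) \<asymp> lin Psi (pmult (pvec g) (nfp c))"
      using hmap_phi0p[OF bsc(3)] by simp
  qed (intro klin_path_intros klin_hmap klin_lin)+
  then have "hmap (rmul (phi0p Q s - lin (phi0p Q) f) (pvec c)) \<asymp>
      lin Psi (pmult (pvec s) (nfp c)) - lin Psi (pmult f (nfp c))"
    unfolding rmul_distrib klin_minus[OF klin_hmap[OF klin_id]]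
    by (intro eqv_diff hmap_phi0p bsc R(1))
  also have "\<dots> \<asymp> ten (pvec (vertex_path (target s))) s (nfp c) + lin Psi (pmult f (nfp c)) - lin Psi (pmult f (nfp c))"
  proof (rule eqv_diff[OF _ eqv_refl], rule Psi_tip[OF f])
    fix g
    assume "g \<in> Poly_Mapping.keys (nfp c)"
    then show "g \<in> paths Q \<and> composable s g"
      using keys_nfp[OF bsc(3)] bsc(5) by (auto simp: composable_def)
  qed
  also have "\<dots> \<asymp> ten (pvec (vertex_path (target s))) s (pvec c)"
  proof -
    have "ten (pvec (vertex_path (target s))) s (pvec c) \<asymp> ten (pvec (vertex_path (target s))) s (nfp c)"
      by (rule ten_eqv_right[OF nfp_diff_in_I[OF bsc(3)] bsc(2)])
        (use vertex_path_target_in_paths[OF R(1)] in simp)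
    then show ?thesis
      by (simp add: eqv_sym)
  qed
  finally have "lmul (pvec b) (hmap (rmul (phi0p Q s - lin (phi0p Q) f) (pvec c))) \<asymp>
      lmul (pvec b) (ten (pvec (vertex_path (target s))) s (pvec c))"
    by (rule lmul_eqv) (use bsc(1) in simp)
  then show "hmap (d1v (Poly_Mapping.single t 1)) \<asymp> Poly_Mapping.single t 1"
    using bsc(4) by (simp add: t' d1v_def nfp_tip[OF f] hmap_lmul lmul_single composable_def)
qed (intro klin_hmap klin_d1v klin_id)+

text \<open>Normalising both outer factors moves \<open>hmap g\<close> only within \<open>D\<close>:
  on the right \<open>hmap\<close> normalises anyway, on the left the difference lies in
  \<open>I\<close>. The second assumption is the form in which vanishing in the tensor product
  becomes available.\<close>

lemma hmap_kernel:
  assumes "\<And>b \<alpha> c. (b, \<alpha>, c) \<in> Poly_Mapping.keys g \<Longrightarrow> b \<in> paths Q \<and> \<alpha> \<in> paths Q \<and> c \<in> paths Q \<and>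
    composable b \<alpha> \<and> composable \<alpha> c"
    and "lin (\<lambda>(b, \<alpha>, c). ten (nfp b) \<alpha> (nfp c)) g = 0"
  shows "hmap g \<in> D"
proof -
  have "hmap (lin (\<lambda>(b, \<alpha>, c). ten (nfp b) \<alpha> (nfp c)) g) \<asymp> hmap g"
  proof (rule klin_eqv[where S = "\<lambda>g. hmap (lin (\<lambda>(b, \<alpha>, c). ten (nfp b) \<alpha> (nfp c)) g)" and T = hmap])
    fix t
    assume t: "t \<in> Poly_Mapping.keys g"
    obtain b \<alpha> c where t': "t = (b, \<alpha>, c)"
      by (cases t)
    have bc: "b \<in> paths Q" "\<alpha> \<in> paths Q" "c \<in> paths Q"
      using assms(1)[of b \<alpha> c] t t' by auto
    have "Poly_Mapping.keys (lin Psi (pmult (pvec \<alpha>) (nfp c))) \<subseteq> paths Q \<times> tips \<R> \<times> paths Q"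
      using nfp_in_kspan[OF bc(3)] bc(2) by (intro keys_lin_Psi kspan_pmult) simp_all
    from lmul_in_D[OF nfp_diff_in_I[OF bc(1)] this]
    have "hmap (Poly_Mapping.single t 1) \<asymp> lmul (nfp b) (lin Psi (pmult (pvec \<alpha>) (nfp c)))"
      by (simp add: t' hmap_single eqv_def lmul_distrib)
    then show "hmap (lin (\<lambda>(b, \<alpha>, c). ten (nfp b) \<alpha> (nfp c)) (Poly_Mapping.single t 1)) \<asymp> hmap (Poly_Mapping.single t 1)"
      using eqv_sym by (simp add: t' hmap_ten NF_nfp[OF bc(3)])
  qed (intro klin_hmap klin_id klin_lin)+
  from eqv_sym[OF this] show ?thesis
    unfolding assms(2) by (simp add: eqv_def klin_zero[OF klin_hmap[OF klin_id]])
qed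

end

section \<open>Tensor products over a ring\<close>

text \<open>The target is a mere abelian group without scalars, so a value has to be prescribed at
  every multiple of a basis vector, additively in the coefficient.\<close>

lemma (in abelian_group) additive_extension:
  fixes u :: "'i \<Rightarrow> 'k::ab_group_add \<Rightarrow> 'a"
  assumes u: "\<And>b c. u b c \<in> carrier G" "\<And>b c d. u b (c + d) = u b c \<oplus> u b d"
  obtains S where "\<And>x. S x \<in> carrier G" "\<And>x y. S (x + y) = S x \<oplus> S y"
    "\<And>b c. S (Poly_Mapping.single b c) = u b c"
proof -
  define S where "S x = finsum G (\<lambda>b. u b (Poly_Mapping.lookup x b)) (Poly_Mapping.keys x)" for x
  have u0: "u b 0 = \<zero>" for b
    using u(2)[of b 0 0] u(1)[of b 0] by (metis add.right_cancel add_0 l_zero zero_closed)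
  have super: "S x = finsum G (\<lambda>b. u b (Poly_Mapping.lookup x b)) P"
    if "finite P" "Poly_Mapping.keys x \<subseteq> P" for x P
    unfolding S_def using that u0 u(1)
    by (intro add.finprod_mono_neutral_cong_left) (auto simp: in_keys_iff)
  show ?thesis
  proof (rule that[of S])
    show "S x \<in> carrier G" for x
      unfolding S_def by (rule finsum_closed) (simp add: u(1))
    show "S (x + y) = S x \<oplus> S y" for x y
    proof -
      let ?P = "Poly_Mapping.keys x \<union> Poly_Mapping.keys y"
      have "S (x + y) = finsum G (\<lambda>b. u b (Poly_Mapping.lookup x b) \<oplus> u b (Poly_Mapping.lookup y b)) ?P"
        using super[of ?P "x + y"] keys_add[of x y] by (simp add: lookup_add u(2))
      also have "\<dots> = S x \<oplus> S y"
        using super[of ?P x] super[of ?P y] u(1) by (subst finsum_addf) auto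
      finally show ?thesis .
    qed
    show "S (Poly_Mapping.single b c) = u b c" for b c
      using super[of "{b}" "Poly_Mapping.single b c"] u(1)[of b c] by simp
  qed
qed

text \<open>The assumptions concern only the additive groups and closure under the two inner
  actions. Compatibility conditions are imposed where an action or a map on the tensor product is
  constructed.\<close>

locale tensor_product =
  fixes E :: "'e set" and M :: "('l, 'm, 'e) bimodule" and N :: "('e, 'n, 'r) bimodule"
  assumes M: "abelian_group M" and N: "abelian_group N"
    and ract_M: "m \<in> carrier M \<Longrightarrow> e \<in> E \<Longrightarrow> ract M m e \<in> carrier M"
    and lact_N: "n \<in> carrier N \<Longrightarrow> e \<in> E \<Longrightarrow> lact N e n \<in> carrier N"
begin

abbreviation "F \<equiv> tensor_free M N"
abbreviation "H \<equiv> generate F (tensor_rels E M N)"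
abbreviation "tc \<equiv> tensor_coset E M N"
abbreviation "MN \<equiv> tensor E M N"
abbreviation "pure \<equiv> pure_tensor E M N"

interpretation M: abelian_group M by (rule M)
interpretation N: abelian_group N by (rule N)
interpretation F: comm_group F by (rule abelian_free_Abelian_group)

lemma keys_frag_combination:
  "p \<in> S \<Longrightarrow> q \<in> S \<Longrightarrow> r \<in> S \<Longrightarrow> Poly_Mapping.keys (frag_of p - frag_of q - frag_of r) \<subseteq> S"
  "p \<in> S \<Longrightarrow> q \<in> S \<Longrightarrow> Poly_Mapping.keys (frag_of p - frag_of q) \<subseteq> S"
  by (auto simp: in_keys_iff lookup_minus when_def split: if_splits)

lemma rels_carrier: "tensor_rels E M N \<subseteq> carrier F"
proof (rule subsetI)
  fix x
  assume "x \<in> tensor_rels E M N"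
  then show "x \<in> carrier F"
    unfolding tensor_rels_def carrier_free_Abelian_group_iff
  proof (elim UnE CollectE exE conjE)
    fix m m' n
    assume "x = frag_of (m \<oplus>\<^bsub>M\<^esub> m', n) - frag_of (m, n) - frag_of (m', n)"
      "m \<in> carrier M" "m' \<in> carrier M" "n \<in> carrier N"
    then show "Poly_Mapping.keys x \<subseteq> carrier M \<times> carrier N"
      by (simp only:, intro keys_frag_combination) simp_all
  next
    fix m n n'
    assume "x = frag_of (m, n \<oplus>\<^bsub>N\<^esub> n') - frag_of (m, n) - frag_of (m, n')"
      "m \<in> carrier M" "n \<in> carrier N" "n' \<in> carrier N"
    then show "Poly_Mapping.keys x \<subseteq> carrier M \<times> carrier N"
      by (simp only:, intro keys_frag_combination) simp_all
  next
    fix m e n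
    assume "x = frag_of (ract M m e, n) - frag_of (m, lact N e n)"
      "m \<in> carrier M" "e \<in> E" "n \<in> carrier N"
    then show "Poly_Mapping.keys x \<subseteq> carrier M \<times> carrier N"
      by (simp only:, intro keys_frag_combination) (simp_all add: ract_M lact_N)
  qed
qed

lemma subgroup_H: "subgroup H F"
  by (rule F.generate_is_subgroup[OF rels_carrier])

lemma H_carrier: "x \<in> H \<Longrightarrow> Poly_Mapping.keys x \<subseteq> carrier M \<times> carrier N"
  using subsetD[OF subgroup.subset[OF subgroup_H]] by (simp only: carrier_free_Abelian_group_iff)

lemma H_closed: "0 \<in> H" "x \<in> H \<Longrightarrow> y \<in> H \<Longrightarrow> x + y \<in> H" "x \<in> H \<Longrightarrow> - x \<in> H"
proof -
  show "0 \<in> H"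
    using subgroup.one_closed[OF subgroup_H] by simp
  show "x \<in> H \<Longrightarrow> y \<in> H \<Longrightarrow> x + y \<in> H"
    using subgroup.m_closed[OF subgroup_H, of x y] by simp
  show "x \<in> H \<Longrightarrow> - x \<in> H"
    using subgroup.m_inv_closed[OF subgroup_H, of x] H_carrier[of x] by simp
qed

lemma H_induct [consumes 1, case_names zero rel add neg]:
  assumes "x \<in> H" "P 0" "\<And>y. y \<in> tensor_rels E M N \<Longrightarrow> P y"
    "\<And>x y. P x \<Longrightarrow> P y \<Longrightarrow> P (x + y)" "\<And>x. P x \<Longrightarrow> P (- x)"
  shows "P x"
  using assms(1)
proof (induct x rule: generate.induct)
  case (inv h)
  then have "Poly_Mapping.keys h \<subseteq> carrier M \<times> carrier N"
    using subsetD[OF rels_carrier] by (simp only: carrier_free_Abelian_group_iff)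
  then show ?case
    using assms(3,5) inv by simp
qed (use assms in simp_all)

lemma tc_eq_image: "tc x = (\<lambda>h. h + x) ` H"
  by (auto simp: tensor_coset_def r_coset_def)

lemma tc_self: "x \<in> tc x"
  unfolding tc_eq_image using H_closed(1) by force

lemma mem_tc: "y \<in> tc x \<longleftrightarrow> y - x \<in> H"
proof
  assume "y - x \<in> H"
  then have "(y - x) + x \<in> tc x"
    unfolding tc_eq_image by (rule imageI)
  then show "y \<in> tc x"
    by simp
qed (auto simp: tc_eq_image)

text \<open>Cosets are translates of \<open>H\<close> inside the group of all integer combinations,
  so the equivalence holds for arbitrary \<open>x\<close> and \<open>y\<close>, also outside the
  carrier.\<close>

lemma tc_eq: "tc x = tc y \<longleftrightarrow> x - y \<in> H"
proof
  assume "tc x = tc y"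
  then show "x - y \<in> H"
    using tc_self[of x] by (simp add: mem_tc)
next
  assume xy: "x - y \<in> H"
  show "tc x = tc y"
  proof (rule Set.set_eqI)
    fix z
    have "z - x \<in> H \<longleftrightarrow> z - y \<in> H"
      using H_closed(2)[of "z - x" "x - y"] H_closed(2)[OF _ H_closed(3)[OF xy], of "z - y"] xy by auto
    then show "z \<in> tc x \<longleftrightarrow> z \<in> tc y"
      by (simp add: mem_tc)
  qed
qed

lemma MN_simps:
  "carrier MN = tc ` {x. Poly_Mapping.keys x \<subseteq> carrier M \<times> carrier N}"
  "\<zero>\<^bsub>MN\<^esub> = tc 0" "add MN = monoid.mult (F Mod H)"
proof -
  show "carrier MN = tc ` {x. Poly_Mapping.keys x \<subseteq> carrier M \<times> carrier N}"
    by (simp add: tensor_def Let_def carrier_FactGroup tensor_coset_def free_Abelian_group_def)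
  show "\<zero>\<^bsub>MN\<^esub> = tc 0"
    by (auto simp add: tensor_def Let_def tc_eq_image)
qed (simp add: tensor_def Let_def)

lemma tc_add:
  assumes "Poly_Mapping.keys x \<subseteq> carrier M \<times> carrier N" "Poly_Mapping.keys y \<subseteq> carrier M \<times> carrier N"
  shows "tc x \<oplus>\<^bsub>MN\<^esub> tc y = tc (x + y)"
  using normal.rcos_sum[OF F.subgroup_imp_normal[OF subgroup_H], of x y] assms
  by (simp add: MN_simps tensor_coset_def)

lemma abelian_group_tensor: "abelian_group MN"
proof -
  interpret T: comm_group "F Mod H"
    by (rule F.abelian_FactGroup[OF subgroup_H])
  have "carrier MN = carrier (F Mod H)" "\<zero>\<^bsub>MN\<^esub> = \<one>\<^bsub>F Mod H\<^esub>" "add MN = monoid.mult (F Mod H)"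
    by (simp_all add: tensor_def Let_def)
  then show ?thesis
    using T.l_inv_ex by (intro abelian_groupI) (simp_all del: mult_FactGroup one_FactGroup
        add: T.m_ac)
qed

interpretation MN: abelian_group MN by (rule abelian_group_tensor)

lemma tc_closed: "Poly_Mapping.keys x \<subseteq> carrier M \<times> carrier N \<Longrightarrow> tc x \<in> carrier MN"
  by (auto simp: MN_simps)

lemma pure_closed: "m \<in> carrier M \<Longrightarrow> n \<in> carrier N \<Longrightarrow> pure m n \<in> carrier MN"
  unfolding pure_tensor_def by (rule tc_closed) simp

lemma pure_add_left:
  assumes "m \<in> carrier M" "m' \<in> carrier M" "n \<in> carrier N"
  shows "pure (m \<oplus>\<^bsub>M\<^esub> m') n = pure m n \<oplus>\<^bsub>MN\<^esub> pure m' n"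
proof -
  have "frag_of (m \<oplus>\<^bsub>M\<^esub> m', n) - frag_of (m, n) - frag_of (m', n) \<in> H"
    using assms by (intro generate.incl) (auto simp: tensor_rels_def)
  then show ?thesis
    unfolding pure_tensor_def using assms by (simp add: tc_add tc_eq algebra_simps)
qed

lemma pure_add_right:
  assumes "m \<in> carrier M" "n \<in> carrier N" "n' \<in> carrier N"
  shows "pure m (n \<oplus>\<^bsub>N\<^esub> n') = pure m n \<oplus>\<^bsub>MN\<^esub> pure m n'"
proof -
  have "frag_of (m, n \<oplus>\<^bsub>N\<^esub> n') - frag_of (m, n) - frag_of (m, n') \<in> H"
    using assms by (intro generate.incl) (auto simp: tensor_rels_def)
  then show ?thesis
    unfolding pure_tensor_def using assms by (simp add: tc_add tc_eq algebra_simps)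
qed

lemma pure_balanced:
  assumes "m \<in> carrier M" "e \<in> E" "n \<in> carrier N"
  shows "pure (ract M m e) n = pure m (lact N e n)"
proof -
  have "frag_of (ract M m e, n) - frag_of (m, lact N e n) \<in> H"
    using assms by (intro generate.incl) (auto simp: tensor_rels_def)
  then show ?thesis
    unfolding pure_tensor_def by (simp add: tc_eq)
qed

lemma pure_zero_left: "n \<in> carrier N \<Longrightarrow> pure \<zero>\<^bsub>M\<^esub> n = \<zero>\<^bsub>MN\<^esub>"
  using pure_add_left[of "\<zero>\<^bsub>M\<^esub>" "\<zero>\<^bsub>M\<^esub>" n] pure_closed[of "\<zero>\<^bsub>M\<^esub>" n]
  by (metis M.l_zero M.zero_closed MN.add.l_cancel_one)

lemma pure_zero_right: "m \<in> carrier M \<Longrightarrow> pure m \<zero>\<^bsub>N\<^esub> = \<zero>\<^bsub>MN\<^esub>"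
  using pure_add_right[of m "\<zero>\<^bsub>N\<^esub>" "\<zero>\<^bsub>N\<^esub>"] pure_closed[of m "\<zero>\<^bsub>N\<^esub>"]
  by (metis N.l_zero N.zero_closed MN.add.l_cancel_one)

text \<open>The negative of a pure tensor is again pure, with the sign moved into the left factor;
  hence sums of pure tensors exhaust everything.\<close>

lemma tensor_induct [consumes 1, case_names pure add]:
  assumes "z \<in> carrier MN" "\<And>m n. m \<in> carrier M \<Longrightarrow> n \<in> carrier N \<Longrightarrow> P (pure m n)"
    and "\<And>a b. a \<in> carrier MN \<Longrightarrow> b \<in> carrier MN \<Longrightarrow> P a \<Longrightarrow> P b \<Longrightarrow> P (a \<oplus>\<^bsub>MN\<^esub> b)"
  shows "P z"
proof -
  obtain x where x: "Poly_Mapping.keys x \<subseteq> carrier M \<times> carrier N" "z = tc x"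
    using assms(1) by (auto simp: MN_simps)
  \<comment> \<open>The claim is carried for \<open>x\<close> and \<open>- x\<close> together
    because induction on the free abelian group proceeds by differences.\<close>
  have "P (tc x) \<and> P (tc (- x))"
    using x(1)
  proof (induct x rule: free_Abelian_group_induct[consumes 1, case_names zero diff of])
    case zero
    have "P (tc 0)"
      using assms(2)[of "\<zero>\<^bsub>M\<^esub>" "\<zero>\<^bsub>N\<^esub>"] pure_zero_left[of "\<zero>\<^bsub>N\<^esub>"] by (simp add: MN_simps)
    then show ?case
      by simp
  next
    case (diff x y)
    have "P (tc x \<oplus>\<^bsub>MN\<^esub> tc (- y))" "P (tc (- x) \<oplus>\<^bsub>MN\<^esub> tc y)"
      using diff by (auto intro!: assms(3) tc_closed)
    then show ?case
      using diff by (simp add: tc_add algebra_simps)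
  next
    case (of a)
    obtain m n where a: "a = (m, n)" "m \<in> carrier M" "n \<in> carrier N"
      using of by (cases a) auto
    have "pure m n \<oplus>\<^bsub>MN\<^esub> pure (\<ominus>\<^bsub>M\<^esub> m) n = \<zero>\<^bsub>MN\<^esub>"
      using pure_add_left[of m "\<ominus>\<^bsub>M\<^esub> m" n] a pure_zero_left by (simp add: M.r_neg)
    then have "tc (frag_of (m, n) + frag_of (\<ominus>\<^bsub>M\<^esub> m, n)) = tc 0"
      using a by (simp add: pure_tensor_def tc_add MN_simps(2))
    then have "frag_of (m, n) + frag_of (\<ominus>\<^bsub>M\<^esub> m, n) \<in> H"
      by (simp add: tc_eq)
    from H_closed(3)[OF this] have "tc (- frag_of a) = pure (\<ominus>\<^bsub>M\<^esub> m) n"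
      unfolding pure_tensor_def tc_eq by (simp add: a(1) algebra_simps)
    then show ?case
      using assms(2)[OF a(2,3)] assms(2)[of "\<ominus>\<^bsub>M\<^esub> m" n] a by (simp add: pure_tensor_def)
  qed
  then show ?thesis
    using x(2) by simp
qed

text \<open>A pair of additive maps commuting with the actions of \<open>E\<close> sends each
  defining relation to a relation of the same kind.\<close>

lemma frag_map_H:
  assumes g: "\<And>m n. m \<in> carrier M \<Longrightarrow> n \<in> carrier N \<Longrightarrow> g m \<in> carrier M \<and> h n \<in> carrier N"
    and "\<And>m m'. m \<in> carrier M \<Longrightarrow> m' \<in> carrier M \<Longrightarrow> g (m \<oplus>\<^bsub>M\<^esub> m') = g m \<oplus>\<^bsub>M\<^esub> g m'"
    and "\<And>n n'. n \<in> carrier N \<Longrightarrow> n' \<in> carrier N \<Longrightarrow> h (n \<oplus>\<^bsub>N\<^esub> n') = h n \<oplus>\<^bsub>N\<^esub> h n'"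
    and "\<And>m e. m \<in> carrier M \<Longrightarrow> e \<in> E \<Longrightarrow> g (ract M m e) = ract M (g m) e"
    and "\<And>n e. n \<in> carrier N \<Longrightarrow> e \<in> E \<Longrightarrow> h (lact N e n) = lact N e (h n)"
    and "x \<in> H"
  shows "frag_extend (\<lambda>(m, n). frag_of (g m, h n)) x \<in> H"
  using assms(6)
proof (induct x rule: H_induct)
  case (rel y)
  have g': "g m \<in> carrier M" if "m \<in> carrier M" for m
    using g[OF that N.zero_closed] by simp
  have h': "h n \<in> carrier N" if "n \<in> carrier N" for n
    using g[OF M.zero_closed that] by simp
  have "frag_extend (\<lambda>(m, n). frag_of (g m, h n)) y \<in> tensor_rels E M N"
    using rel unfolding tensor_rels_def
  proof (elim UnE CollectE exE conjE)
    fix m m' n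
    assume "y = frag_of (m \<oplus>\<^bsub>M\<^esub> m', n) - frag_of (m, n) - frag_of (m', n)"
      "m \<in> carrier M" "m' \<in> carrier M" "n \<in> carrier N"
    then show "frag_extend (\<lambda>(m, n). frag_of (g m, h n)) y \<in>
      {frag_of (x \<oplus>\<^bsub>M\<^esub> x', y) - frag_of (x, y) - frag_of (x', y) | x x' y.
        x \<in> carrier M \<and> x' \<in> carrier M \<and> y \<in> carrier N} \<union>
     {frag_of (x, y \<oplus>\<^bsub>N\<^esub> y') - frag_of (x, y) - frag_of (x, y') | x y y'.
        x \<in> carrier M \<and> y \<in> carrier N \<and> y' \<in> carrier N} \<union>
     {frag_of (ract M x e, y) - frag_of (x, lact N e y) | x e y.
        x \<in> carrier M \<and> e \<in> E \<and> y \<in> carrier N}"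
      by (intro UnI1 CollectI exI[of _ "g m"] exI[of _ "g m'"] exI[of _ "h n"])
        (simp add: frag_extend_diff assms(2) g' h')
  next
    fix m n n'
    assume "y = frag_of (m, n \<oplus>\<^bsub>N\<^esub> n') - frag_of (m, n) - frag_of (m, n')"
      "m \<in> carrier M" "n \<in> carrier N" "n' \<in> carrier N"
    then show "frag_extend (\<lambda>(m, n). frag_of (g m, h n)) y \<in>
      {frag_of (x \<oplus>\<^bsub>M\<^esub> x', y) - frag_of (x, y) - frag_of (x', y) | x x' y.
        x \<in> carrier M \<and> x' \<in> carrier M \<and> y \<in> carrier N} \<union>
     {frag_of (x, y \<oplus>\<^bsub>N\<^esub> y') - frag_of (x, y) - frag_of (x, y') | x y y'.
        x \<in> carrier M \<and> y \<in> carrier N \<and> y' \<in> carrier N} \<union>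
     {frag_of (ract M x e, y) - frag_of (x, lact N e y) | x e y.
        x \<in> carrier M \<and> e \<in> E \<and> y \<in> carrier N}"
      by (intro UnI1[OF UnI2] CollectI exI[of _ "g m"] exI[of _ "h n"] exI[of _ "h n'"])
        (simp add: frag_extend_diff assms(3) g' h')
  next
    fix m e n
    assume "y = frag_of (ract M m e, n) - frag_of (m, lact N e n)"
      "m \<in> carrier M" "e \<in> E" "n \<in> carrier N"
    then show "frag_extend (\<lambda>(m, n). frag_of (g m, h n)) y \<in>
      {frag_of (x \<oplus>\<^bsub>M\<^esub> x', y) - frag_of (x, y) - frag_of (x', y) | x x' y.
        x \<in> carrier M \<and> x' \<in> carrier M \<and> y \<in> carrier N} \<union>
     {frag_of (x, y \<oplus>\<^bsub>N\<^esub> y') - frag_of (x, y) - frag_of (x, y') | x y y'.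
        x \<in> carrier M \<and> y \<in> carrier N \<and> y' \<in> carrier N} \<union>
     {frag_of (ract M x e, y) - frag_of (x, lact N e y) | x e y.
        x \<in> carrier M \<and> e \<in> E \<and> y \<in> carrier N}"
      by (intro UnI2 CollectI exI[of _ "g m"] exI[of _ e] exI[of _ "h n"])
        (simp add: frag_extend_diff assms(4,5) g' h')
  qed
  then show ?case
    by (rule generate.incl)
qed (simp_all add: H_closed frag_extend_add frag_extend_minus)

text \<open>The actions are defined by a union over all representatives of a coset. Every
  representative yields the same coset, so the union collapses.\<close>

lemma UN_frag_map:
  assumes "\<And>x. x \<in> H \<Longrightarrow> frag_extend g x \<in> H"
  shows "(\<Union>y\<in>tc x. tc (frag_extend g y)) = tc (frag_extend g x)"
proof -
  have "tc (frag_extend g y) = tc (frag_extend g x)" if "y \<in> tc x" for y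
    using assms[of "y - x"] that by (simp add: mem_tc tc_eq frag_extend_diff)
  then have "(\<Union>y\<in>tc x. tc (frag_extend g y)) = (\<Union>y\<in>tc x. tc (frag_extend g x))"
    by (intro SUP_cong refl)
  also have "\<dots> = tc (frag_extend g x)"
    using tc_self[of x] by blast
  finally show ?thesis .
qed

lemma keys_frag_map:
  assumes "\<And>m n. m \<in> carrier M \<Longrightarrow> n \<in> carrier N \<Longrightarrow> g m \<in> carrier M \<and> h n \<in> carrier N"
    "Poly_Mapping.keys x \<subseteq> carrier M \<times> carrier N"
  shows "Poly_Mapping.keys (frag_extend (\<lambda>(m, n). frag_of (g m, h n)) x) \<subseteq> carrier M \<times> carrier N"
proof
  fix p
  assume "p \<in> Poly_Mapping.keys (frag_extend (\<lambda>(m, n). frag_of (g m, h n)) x)"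
  then obtain q where q: "q \<in> Poly_Mapping.keys x"
      "p \<in> Poly_Mapping.keys (case q of (m, n) \<Rightarrow> frag_of (g m, h n))"
    using keys_frag_extend[of "\<lambda>(m, n). frag_of (g m, h n)" x] by blast
  obtain m n where "q = (m, n)"
    by (cases q)
  then show "p \<in> carrier M \<times> carrier N"
    using q assms(1)[of m n] assms(2) by auto
qed

lemma lact_tensor:
  assumes l: "\<And>m. m \<in> carrier M \<Longrightarrow> lact M l m \<in> carrier M"
    "\<And>m m'. m \<in> carrier M \<Longrightarrow> m' \<in> carrier M \<Longrightarrow> lact M l (m \<oplus>\<^bsub>M\<^esub> m') = lact M l m \<oplus>\<^bsub>M\<^esub> lact M l m'"
    "\<And>m e. m \<in> carrier M \<Longrightarrow> e \<in> E \<Longrightarrow> lact M l (ract M m e) = ract M (lact M l m) e"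
  shows "z \<in> carrier MN \<Longrightarrow> lact MN l z \<in> carrier MN"
    and "z \<in> carrier MN \<Longrightarrow> z' \<in> carrier MN \<Longrightarrow> lact MN l (z \<oplus>\<^bsub>MN\<^esub> z') = lact MN l z \<oplus>\<^bsub>MN\<^esub> lact MN l z'"
    and "m \<in> carrier M \<Longrightarrow> n \<in> carrier N \<Longrightarrow> lact MN l (pure m n) = pure (lact M l m) n"
proof -
  let ?g = "frag_extend (\<lambda>(m, n). frag_of (lact M l m, n))"
  have "?g x \<in> H" if "x \<in> H" for x
    using frag_map_H[of "lact M l" "\<lambda>n. n"] that l by simp
  then have eq: "lact MN l (tc x) = tc (?g x)" for x
    using UN_frag_map[of "\<lambda>(m, n). frag_of (lact M l m, n)" x] by (simp add: tensor_def Let_def)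
  have keys: "Poly_Mapping.keys (?g x) \<subseteq> carrier M \<times> carrier N"
    if "Poly_Mapping.keys x \<subseteq> carrier M \<times> carrier N" for x
    using keys_frag_map[of "lact M l" "\<lambda>n. n"] that l(1) by simp
  show "z \<in> carrier MN \<Longrightarrow> lact MN l z \<in> carrier MN"
    unfolding MN_simps(1) by (clarsimp simp: eq) (intro imageI CollectI keys)
  show "z \<in> carrier MN \<Longrightarrow> z' \<in> carrier MN \<Longrightarrow> lact MN l (z \<oplus>\<^bsub>MN\<^esub> z') = lact MN l z \<oplus>\<^bsub>MN\<^esub> lact MN l z'"
    by (clarsimp simp: MN_simps(1) eq tc_add keys frag_extend_add)
  show "m \<in> carrier M \<Longrightarrow> n \<in> carrier N \<Longrightarrow> lact MN l (pure m n) = pure (lact M l m) n"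
    by (simp add: pure_tensor_def eq)
qed

lemma ract_tensor:
  assumes r: "\<And>n. n \<in> carrier N \<Longrightarrow> ract N n r \<in> carrier N"
    "\<And>n n'. n \<in> carrier N \<Longrightarrow> n' \<in> carrier N \<Longrightarrow> ract N (n \<oplus>\<^bsub>N\<^esub> n') r = ract N n r \<oplus>\<^bsub>N\<^esub> ract N n' r"
    "\<And>n e. n \<in> carrier N \<Longrightarrow> e \<in> E \<Longrightarrow> ract N (lact N e n) r = lact N e (ract N n r)"
  shows "z \<in> carrier MN \<Longrightarrow> ract MN z r \<in> carrier MN"
    and "z \<in> carrier MN \<Longrightarrow> z' \<in> carrier MN \<Longrightarrow> ract MN (z \<oplus>\<^bsub>MN\<^esub> z') r = ract MN z r \<oplus>\<^bsub>MN\<^esub> ract MN z' r"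
    and "m \<in> carrier M \<Longrightarrow> n \<in> carrier N \<Longrightarrow> ract MN (pure m n) r = pure m (ract N n r)"
proof -
  let ?g = "frag_extend (\<lambda>(m, n). frag_of (m, ract N n r))"
  have "?g x \<in> H" if "x \<in> H" for x
    using frag_map_H[of "\<lambda>m. m" "\<lambda>n. ract N n r"] that r by simp
  then have eq: "ract MN (tc x) r = tc (?g x)" for x
    using UN_frag_map[of "\<lambda>(m, n). frag_of (m, ract N n r)" x] by (simp add: tensor_def Let_def)
  have keys: "Poly_Mapping.keys (?g x) \<subseteq> carrier M \<times> carrier N"
    if "Poly_Mapping.keys x \<subseteq> carrier M \<times> carrier N" for x
    using keys_frag_map[of "\<lambda>m. m" "\<lambda>n. ract N n r"] that r(1) by simp
  show "z \<in> carrier MN \<Longrightarrow> ract MN z r \<in> carrier MN"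
    unfolding MN_simps(1) by (clarsimp simp: eq) (intro imageI CollectI keys)
  show "z \<in> carrier MN \<Longrightarrow> z' \<in> carrier MN \<Longrightarrow> ract MN (z \<oplus>\<^bsub>MN\<^esub> z') r = ract MN z r \<oplus>\<^bsub>MN\<^esub> ract MN z' r"
    by (clarsimp simp: MN_simps(1) eq tc_add keys frag_extend_add)
  show "m \<in> carrier M \<Longrightarrow> n \<in> carrier N \<Longrightarrow> ract MN (pure m n) r = pure m (ract N n r)"
    by (simp add: pure_tensor_def eq)
qed

text \<open>The universal property, for targets of finitely supported functions: this is where the
  maps leading back from tensors to lifts take their values.\<close>

lemma tensor_lift:
  fixes B :: "'m \<Rightarrow> 'n \<Rightarrow> ('c \<Rightarrow>\<^sub>0 'k::field)"
  assumes B: "\<And>m m' n. m \<in> carrier M \<Longrightarrow> m' \<in> carrier M \<Longrightarrow> n \<in> carrier N \<Longrightarrow> B (m \<oplus>\<^bsub>M\<^esub> m') n = B m n + B m' n"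
    "\<And>m n n'. m \<in> carrier M \<Longrightarrow> n \<in> carrier N \<Longrightarrow> n' \<in> carrier N \<Longrightarrow> B m (n \<oplus>\<^bsub>N\<^esub> n') = B m n + B m n'"
    "\<And>m e n. m \<in> carrier M \<Longrightarrow> e \<in> E \<Longrightarrow> n \<in> carrier N \<Longrightarrow> B (ract M m e) n = B m (lact N e n)"
  obtains T where "\<And>z z'. z \<in> carrier MN \<Longrightarrow> z' \<in> carrier MN \<Longrightarrow> T (z \<oplus>\<^bsub>MN\<^esub> z') = T z + T z'"
    "\<And>m n. m \<in> carrier M \<Longrightarrow> n \<in> carrier N \<Longrightarrow> T (pure m n) = B m n"
proof -
  define \<Phi> where "\<Phi> x = (\<Sum>p\<in>Poly_Mapping.keys x. smul (of_int (Poly_Mapping.lookup x p)) (B (fst p) (snd p)))" for x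
  have super: "\<Phi> x = (\<Sum>p\<in>P. smul (of_int (Poly_Mapping.lookup x p)) (B (fst p) (snd p)))"
    if "finite P" "Poly_Mapping.keys x \<subseteq> P" for x P
    unfolding \<Phi>_def using that by (intro sum.mono_neutral_left) (auto simp: in_keys_iff)
  have add: "\<Phi> (x + y) = \<Phi> x + \<Phi> y" for x y
  proof -
    let ?P = "Poly_Mapping.keys x \<union> Poly_Mapping.keys y"
    show ?thesis
      using super[of ?P x] super[of ?P y] super[of ?P "x + y"] keys_add[of x y]
      by (simp add: lookup_add smul_distrib sum.distrib)
  qed
  have zero: "\<Phi> 0 = 0"
    by (simp add: \<Phi>_def)
  have neg: "\<Phi> (- x) = - \<Phi> x" for x
    using add[of "- x" x] zero by (simp add: eq_neg_iff_add_eq_0)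
  have diff: "\<Phi> (x - y) = \<Phi> x - \<Phi> y" for x y
    using add[of x "- y"] neg by simp
  have of: "\<Phi> (frag_of (m, n)) = B m n" for m n
    by (simp add: \<Phi>_def)
  have kill: "\<Phi> x = 0" if "x \<in> H" for x
    using that
  proof (induct x rule: H_induct)
    case (rel y)
    then show ?case
      using B by (auto simp: tensor_rels_def diff of)
  qed (simp_all add: zero add neg)
  \<comment> \<open>Evaluation at an arbitrary representative, which is legitimate since
    \<open>\<Phi>\<close> vanishes on \<open>H\<close>.\<close>
  define T where "T C = \<Phi> (SOME x. x \<in> C)" for C
  have T: "T (tc x) = \<Phi> x" for x
  proof -
    have "(SOME y. y \<in> tc x) \<in> tc x"
      using tc_self[of x] by (rule someI)
    then have "\<Phi> ((SOME y. y \<in> tc x) - x) = 0"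
      by (intro kill) (simp add: mem_tc)
    then show ?thesis
      by (simp add: T_def diff)
  qed
  show ?thesis
  proof (rule that[of T])
    show "T (z \<oplus>\<^bsub>MN\<^esub> z') = T z + T z'" if "z \<in> carrier MN" "z' \<in> carrier MN" for z z'
      using that by (auto simp: MN_simps(1) tc_add T add)
    show "T (pure m n) = B m n" for m n
      by (simp add: pure_tensor_def T of)
  qed
qed

end

lemma abelian_group_restr: "abelian_group A \<Longrightarrow> abelian_group (restr_bimodule A f g)"
proof -
  assume "abelian_group A"
  then interpret abelian_group A .
  show ?thesis
    using l_neg by (intro abelian_groupI) (auto simp: restr_bimodule_def a_ac)
qed

lemma abelian_group_kX: "abelian_group (kX_bimodule X)"
proof (rule abelian_groupI)
  fix x
  assume "x \<in> carrier (kX_bimodule X :: (('a, 'b, 'c) pathvec, ('a, 'b, 'c) pathvec, ('a, 'b, 'c) pathvec) bimodule)"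
  then show "\<exists>y\<in>carrier (kX_bimodule X). y \<oplus>\<^bsub>kX_bimodule X\<^esub> x = \<zero>\<^bsub>kX_bimodule X\<^esub>"
    using subsp_neg[OF subsp_kspan[of X], of x] by (intro bexI[of _ "- x"]) (simp_all add: kX_bimodule_def)
qed (auto simp: kX_bimodule_def add.assoc add.commute subsp_zero subsp_add subsp_kspan)

section \<open>The quotient algebra\<close>

lemma keys_induct [consumes 1, case_names zero single add]:
  fixes x :: "'b \<Rightarrow>\<^sub>0 'k::ab_group_add"
  assumes "Poly_Mapping.keys x \<subseteq> Y" "P 0" "\<And>p c. p \<in> Y \<Longrightarrow> P (Poly_Mapping.single p c)"
    "\<And>x y. Poly_Mapping.keys x \<subseteq> Y \<Longrightarrow> Poly_Mapping.keys y \<subseteq> Y \<Longrightarrow> P x \<Longrightarrow> P y \<Longrightarrow> P (x + y)"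
  shows "P x"
proof -
  have "Poly_Mapping.keys (\<Sum>p\<in>B. Poly_Mapping.single p (Poly_Mapping.lookup x p)) \<subseteq> Y \<and>
      P (\<Sum>p\<in>B. Poly_Mapping.single p (Poly_Mapping.lookup x p))" if "finite B" "B \<subseteq> Y" for B
    using that
  proof (induct B rule: finite_induct)
    case (insert p B)
    have "Poly_Mapping.keys (Poly_Mapping.single p (Poly_Mapping.lookup x p)) \<subseteq> Y"
      using insert.prems by (auto split: if_splits)
    then show ?case
      using insert assms(3,4)
        keys_add[of "Poly_Mapping.single p (Poly_Mapping.lookup x p)" "\<Sum>p\<in>B. Poly_Mapping.single p (Poly_Mapping.lookup x p)"]
      by auto
  qed (simp add: assms(2))
  moreover have "(\<Sum>p\<in>Poly_Mapping.keys x. Poly_Mapping.single p (Poly_Mapping.lookup x p)) = x"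
    by (rule poly_mapping_eqI) (auto simp: lookup_sum lookup_single when_def in_keys_iff)
  ultimately show ?thesis
    using assms(1) finite_keys[of x] by metis
qed

context redsys begin

abbreviation "A \<equiv> quot_algebra Q I"
abbreviation "pr \<equiv> proj Q I"
abbreviation "e1 \<equiv> \<one>\<^bsub>kQ\<^esub>"
abbreviation "EE \<equiv> (vertex_algebra Q :: ('v, 'a, 'k) pathvec set)"

lemma ring_A: "ring A"
  by (rule ideal.quotient_is_ring[OF ideal_I])

lemma pr_ring_hom: "pr \<in> ring_hom kQ A"
proof -
  have "pr = (+>\<^bsub>kQ\<^esub>) I"
    by (simp add: fun_eq_iff proj_def)
  then show ?thesis
    using ideal.rcos_ring_hom[OF ideal_I] by simp
qed

lemma pr_closed: "x \<in> kspan (paths Q) \<Longrightarrow> pr x \<in> carrier A"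
  and pr_mult: "x \<in> kspan (paths Q) \<Longrightarrow> y \<in> kspan (paths Q) \<Longrightarrow> pr x \<otimes>\<^bsub>A\<^esub> pr y = pr (pmult x y)"
  and pr_add: "x \<in> kspan (paths Q) \<Longrightarrow> y \<in> kspan (paths Q) \<Longrightarrow> pr (x + y) = pr x \<oplus>\<^bsub>A\<^esub> pr y"
  and pr_one: "\<one>\<^bsub>A\<^esub> = pr e1"
  using ring_hom_memE[OF pr_ring_hom] by simp_all

lemma A_carrierE:
  assumes "a \<in> carrier A"
  obtains x where "x \<in> kspan (paths Q)" "a = pr x"
  using assms by (auto simp: FactRing_def A_RCOSETS_def' a_r_coset_def' proj_def)

lemma pr_eq_iff:
  assumes "x \<in> kspan (paths Q)" "y \<in> kspan (paths Q)"
  shows "pr x = pr y \<longleftrightarrow> x - y \<in> I"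
proof -
  have eq: "pr z = (\<lambda>i. i + z) ` I" for z
    by (auto simp: proj_def a_r_coset_def')
  show ?thesis
  proof
    assume "pr x = pr y"
    moreover have "x \<in> pr x"
      unfolding eq using subsp_zero[OF subsp_I] by (intro image_eqI[of _ _ 0]) simp_all
    ultimately show "x - y \<in> I"
      by (auto simp: eq)
  next
    assume xy: "x - y \<in> I"
    have "i + x \<in> pr y" if "i \<in> I" for i
      unfolding eq using subsp_add[OF subsp_I that xy] by (intro image_eqI[of _ _ "i + (x - y)"]) simp_all
    moreover have "i + y \<in> pr x" if "i \<in> I" for i
      unfolding eq using subsp_diff[OF subsp_I that xy] by (intro image_eqI[of _ _ "i - (x - y)"]) simp_all
    ultimately show "pr x = pr y"
      unfolding eq by blast
  qed
qed

lemma pr_zero: "pr 0 = \<zero>\<^bsub>A\<^esub>"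
proof -
  interpret ring A by (rule ring_A)
  have z: "0 \<in> kspan (paths Q)"
    by (rule subsp_zero[OF subsp_kspan])
  have "pr 0 \<in> carrier A" "pr 0 \<oplus>\<^bsub>A\<^esub> pr 0 = pr 0"
    using pr_closed[OF z] pr_add[OF z z] by simp_all
  then show ?thesis
    by (metis add.l_cancel_one)
qed

lemma pr_I: "x \<in> I \<Longrightarrow> pr x = \<zero>\<^bsub>A\<^esub>"
  using pr_eq_iff[of x 0] I_in_kspan[of x] subsp_zero[OF subsp_kspan[of "paths Q"]] pr_zero by simp

lemma EE_in_kspan: "e \<in> EE \<Longrightarrow> e \<in> kspan (paths Q)"
  by (auto simp: kspan_iff paths_of_len_def)

text \<open>The unit is the sum of the vertices, hence all its scalar multiples lie in
  \<open>EE\<close>. Balancedness over \<open>EE\<close> is therefore also the means of moving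
  scalars across a tensor sign.\<close>

lemma e1_in_EE: "e1 \<in> EE"
proof -
  have "(e1 :: ('v, 'a, 'k) pathvec) = (\<Sum>v\<in>verts Q. pvec (vertex_path v))"
    by (simp add: path_algebra_def)
  moreover have "pvec (vertex_path v) \<in> EE" if "v \<in> verts Q" for v
    using that wf_digraph.awalk_Nil_iff[OF wf] by (simp add: paths_of_len_def paths_def)
  moreover have "(\<Sum>v\<in>B. g v) \<in> EE" if "\<And>v. v \<in> B \<Longrightarrow> g v \<in> EE" for B and g :: "'v \<Rightarrow> ('v, 'a, 'k) pathvec"
    using that by (induct B rule: infinite_finite_induct) (auto intro: subsp_zero subsp_add subsp_kspan)
  ultimately show ?thesis
    by simp
qed

lemma vertex_in_EE: "p \<in> paths Q \<Longrightarrow> pvec (vertex_path (source p)) \<in> EE"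
    "p \<in> paths Q \<Longrightarrow> pvec (vertex_path (target p)) \<in> EE"
  using vertex_path_source_in_paths vertex_path_target_in_paths by (simp_all add: paths_of_len_def)

lemma kspan_EE_lmult:
  assumes "e \<in> EE" "x \<in> kspan X"
  shows "pmult e x \<in> kspan X"
  unfolding kspan_iff
proof
  fix r
  assume "r \<in> Poly_Mapping.keys (pmult e x)"
  then obtain q p where qp: "q \<in> Poly_Mapping.keys e" "p \<in> Poly_Mapping.keys x" "composable q p" "r = q \<cdot> p"
    using keys_pmult[of r e x] by auto
  have "q \<in> paths Q" "len q = 0"
    using qp(1) assms(1) by (auto simp: kspan_iff paths_of_len_def)
  then have "r = p"
    using len_0_pcomp(1) qp(3,4) by simp
  then show "r \<in> X"
    using qp(2) assms(2) by (auto simp: kspan_iff)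
qed

lemma kspan_EE_rmult:
  assumes "e \<in> EE" "x \<in> kspan X"
  shows "pmult x e \<in> kspan X"
  unfolding kspan_iff
proof
  fix r
  assume "r \<in> Poly_Mapping.keys (pmult x e)"
  then obtain q p where qp: "q \<in> Poly_Mapping.keys x" "p \<in> Poly_Mapping.keys e" "composable q p" "r = q \<cdot> p"
    using keys_pmult[of r x e] by auto
  have "p \<in> paths Q" "len p = 0"
    using qp(2) assms(1) by (auto simp: kspan_iff paths_of_len_def)
  then have "r = q"
    using len_0_pcomp(2) qp(3,4) by simp
  then show "r \<in> X"
    using qp(1) assms(2) by (auto simp: kspan_iff)
qed

text \<open>The normal form of a class, computed from any representative; \<open>NF_eq_iff\<close>
  makes it well defined. It provides the additive section of the projection from which maps out of
  tensor products are built.\<close>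

definition NFA :: "('v, 'a, 'k) pathvec set \<Rightarrow> ('v, 'a, 'k) pathvec" where
  "NFA a = NF (SOME x. x \<in> kspan (paths Q) \<and> a = pr x)"

lemma NFA_pr:
  assumes "x \<in> kspan (paths Q)"
  shows "NFA (pr x) = NF x"
proof -
  define y where "y = (SOME y. y \<in> kspan (paths Q) \<and> pr x = pr y)"
  have y: "y \<in> kspan (paths Q) \<and> pr x = pr y"
    unfolding y_def by (rule someI[of _ x]) (simp add: assms)
  then have "x - y \<in> I"
    using pr_eq_iff[OF assms, of y] by blast
  then have "NF x = NF y"
    using assms y by (simp add: NF_eq_iff)
  then show ?thesis
    by (simp add: NFA_def y_def)
qed

lemma NFA_add:
  assumes "a \<in> carrier A" "b \<in> carrier A"
  shows "NFA (a \<oplus>\<^bsub>A\<^esub> b) = NFA a + NFA b"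
proof -
  obtain x where x: "x \<in> kspan (paths Q)" "a = pr x"
    by (rule A_carrierE[OF assms(1)])
  obtain y where y: "y \<in> kspan (paths Q)" "b = pr y"
    by (rule A_carrierE[OF assms(2)])
  show ?thesis
    using x y subsp_add[OF subsp_kspan x(1) y(1)] by (simp add: NFA_pr flip: pr_add)
qed

text \<open>Normal forms keep source and target, so a vertex either fixes both a path and its normal
  form or annihilates both. Without this, maps built from normal forms could not be balanced over
  \<open>EE\<close>.\<close>

lemma NF_EE:
  assumes "x \<in> kspan (paths Q)" "e \<in> EE"
  shows "NF (pmult x e) = pmult (NF x) e" "NF (pmult e x) = pmult e (NF x)"
proof -
  have *: "NF (pmult (pvec p) (pvec w)) = pmult (NF (pvec p)) (pvec w)"
    "NF (pmult (pvec w) (pvec p)) = pmult (pvec w) (NF (pvec p))"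
    if p: "p \<in> paths Q" and w: "w \<in> paths Q" "len w = 0" for p w
  proof -
    have "pmult (nfp p) (pvec w) = nfp p" if c: "composable p w"
      by (rule klin_eq[OF klin_pmult_left klin_id])
        (use keys_nfp(2)[OF p] len_0_pcomp(2)[OF w] c in \<open>simp add: composable_def\<close>)
    moreover have "pmult (nfp p) (pvec w) = 0" if c: "\<not> composable p w"
      by (rule klin_eq[OF klin_pmult_left klin_const0]) (use keys_nfp(2)[OF p] c in \<open>simp add: composable_def\<close>)
    moreover have "pmult (pvec w) (nfp p) = nfp p" if c: "composable w p"
      by (rule klin_eq[OF klin_pmult_right klin_id])
        (use keys_nfp(3)[OF p] len_0_pcomp(1)[OF w] c in \<open>simp add: composable_def\<close>)
    moreover have "pmult (pvec w) (nfp p) = 0" if c: "\<not> composable w p"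
      by (rule klin_eq[OF klin_pmult_right klin_const0]) (use keys_nfp(3)[OF p] c in \<open>simp add: composable_def\<close>)
    ultimately show "NF (pmult (pvec p) (pvec w)) = pmult (NF (pvec p)) (pvec w)"
      "NF (pmult (pvec w) (pvec p)) = pmult (pvec w) (NF (pvec p))"
      using len_0_pcomp[OF w] by simp_all
  qed
  have x: "p \<in> paths Q" if "p \<in> Poly_Mapping.keys x" for p
    using assms(1) that by (auto simp: kspan_iff)
  have e: "w \<in> paths Q" "len w = 0" if "w \<in> Poly_Mapping.keys e" for w
    using assms(2) that by (auto simp: kspan_iff paths_of_len_def)
  show "NF (pmult x e) = pmult (NF x) e"
  proof (rule klin_eq[where S = "\<lambda>x. NF (pmult x e)"])
    fix p
    assume p: "p \<in> Poly_Mapping.keys x"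
    show "NF (pmult (pvec p) e) = pmult (NF (pvec p)) e"
      by (rule klin_eq[where S = "\<lambda>e. NF (pmult (pvec p) e)"])
        ((intro klin_path_intros klin_lin)+, rule *(1)[OF x[OF p] e])
  qed (intro klin_path_intros klin_lin)+
  show "NF (pmult e x) = pmult e (NF x)"
  proof (rule klin_eq[where S = "\<lambda>x. NF (pmult e x)"])
    fix p
    assume p: "p \<in> Poly_Mapping.keys x"
    show "NF (pmult e (pvec p)) = pmult e (NF (pvec p))"
      by (rule klin_eq[where S = "\<lambda>e. NF (pmult e (pvec p))"])
        ((intro klin_path_intros klin_lin)+, rule *(2)[OF x[OF p] e])
  qed (intro klin_path_intros klin_lin)+
qed

lemma NFA_EE:
  assumes "a \<in> carrier A" "e \<in> EE"
  shows "NFA (a \<otimes>\<^bsub>A\<^esub> pr e) = pmult (NFA a) e" "NFA (pr e \<otimes>\<^bsub>A\<^esub> a) = pmult e (NFA a)"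
proof -
  obtain x where x: "x \<in> kspan (paths Q)" "a = pr x"
    by (rule A_carrierE[OF assms(1)])
  note e = EE_in_kspan[OF assms(2)]
  show "NFA (a \<otimes>\<^bsub>A\<^esub> pr e) = pmult (NFA a) e" "NFA (pr e \<otimes>\<^bsub>A\<^esub> a) = pmult e (NFA a)"
    using x e assms(2) by (simp_all add: pr_mult NFA_pr kspan_pmult NF_EE)
qed

end

section \<open>The bimodules of the sequence\<close>

text \<open>Treats the three outer bimodules of the sequence at once; \<open>X\<close> becomes the
  set of arrows, of tips and of ambiguities.\<close>

locale free_bimodule = redsys Q I \<R>
  for Q :: "('v, 'a) pre_digraph" and I :: "('v, 'a, 'k::field) pathvec set" and \<R> +
  fixes X :: "('v, 'a) qpath set"
  assumes X: "X \<subseteq> paths Q"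
begin

abbreviation "AE \<equiv> A_E Q I"
abbreviation "EA \<equiv> E_A Q I"
abbreviation "KX \<equiv> (kX_bimodule X :: (('v, 'a, 'k) pathvec, ('v, 'a, 'k) pathvec, ('v, 'a, 'k) pathvec) bimodule)"
abbreviation "G \<equiv> AXA Q I X"
abbreviation "t3 \<equiv> tens3 Q I X"

interpretation A: ring A by (rule ring_A)

lemma KX_simps [simp]:
  "carrier KX = kspan X" "add KX = (+)" "lact KX = pmult" "ract KX = pmult" "\<zero>\<^bsub>KX\<^esub> = 0"
  by (simp_all add: kX_bimodule_def)

lemma AE_simps [simp]:
  "carrier AE = carrier A" "add AE = add A" "lact AE a b = a \<otimes>\<^bsub>A\<^esub> b" "ract AE a e = a \<otimes>\<^bsub>A\<^esub> pr e" "\<zero>\<^bsub>AE\<^esub> = \<zero>\<^bsub>A\<^esub>"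
  "carrier EA = carrier A" "add EA = add A" "lact EA e a = pr e \<otimes>\<^bsub>A\<^esub> a" "ract EA a b = a \<otimes>\<^bsub>A\<^esub> b" "\<zero>\<^bsub>EA\<^esub> = \<zero>\<^bsub>A\<^esub>"
  by (simp_all add: restr_bimodule_def)

lemma pr_EE_closed: "e \<in> EE \<Longrightarrow> pr e \<in> carrier A"
  by (rule pr_closed[OF EE_in_kspan])

abbreviation "M1 \<equiv> tensor EE AE KX"
abbreviation "pure1 \<equiv> pure_tensor EE AE KX"
abbreviation "pure3 \<equiv> pure_tensor EE M1 EA"

lemma AE_abelian: "abelian_group AE" "abelian_group EA"
  by (rule abelian_group_restr[OF A.abelian_group_axioms])+

sublocale T1: tensor_product EE AE KX
  by (rule tensor_product.intro[OF AE_abelian(1) abelian_group_kX])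
    (simp_all add: pr_EE_closed kspan_EE_lmult A.m_closed)

lemma M1_ract:
  assumes "e \<in> EE"
  shows "m \<in> carrier M1 \<Longrightarrow> ract M1 m e \<in> carrier M1"
    and "m \<in> carrier M1 \<Longrightarrow> m' \<in> carrier M1 \<Longrightarrow> ract M1 (m \<oplus>\<^bsub>M1\<^esub> m') e = ract M1 m e \<oplus>\<^bsub>M1\<^esub> ract M1 m' e"
    and "a \<in> carrier A \<Longrightarrow> x \<in> kspan X \<Longrightarrow> ract M1 (pure1 a x) e = pure1 a (pmult x e)"
proof -
  have *: "n \<in> carrier KX \<Longrightarrow> ract KX n e \<in> carrier KX"
    "n \<in> carrier KX \<Longrightarrow> n' \<in> carrier KX \<Longrightarrow> ract KX (n \<oplus>\<^bsub>KX\<^esub> n') e = ract KX n e \<oplus>\<^bsub>KX\<^esub> ract KX n' e"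
    "n \<in> carrier KX \<Longrightarrow> e' \<in> EE \<Longrightarrow> ract KX (lact KX e' n) e = lact KX e' (ract KX n e)" for n n' e'
    using assms by (simp_all add: kspan_EE_rmult pmult_distrib pmult_assoc)
  show "m \<in> carrier M1 \<Longrightarrow> ract M1 m e \<in> carrier M1"
    by (rule T1.ract_tensor(1)[OF *])
  show "m \<in> carrier M1 \<Longrightarrow> m' \<in> carrier M1 \<Longrightarrow> ract M1 (m \<oplus>\<^bsub>M1\<^esub> m') e = ract M1 m e \<oplus>\<^bsub>M1\<^esub> ract M1 m' e"
    by (rule T1.ract_tensor(2)[OF *])
  show "a \<in> carrier A \<Longrightarrow> x \<in> kspan X \<Longrightarrow> ract M1 (pure1 a x) e = pure1 a (pmult x e)"
    using T1.ract_tensor(3)[OF *, of a x] by simp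
qed

lemma M1_lact:
  assumes "b \<in> carrier A"
  shows "m \<in> carrier M1 \<Longrightarrow> lact M1 b m \<in> carrier M1"
    and "m \<in> carrier M1 \<Longrightarrow> m' \<in> carrier M1 \<Longrightarrow> lact M1 b (m \<oplus>\<^bsub>M1\<^esub> m') = lact M1 b m \<oplus>\<^bsub>M1\<^esub> lact M1 b m'"
    and "a \<in> carrier A \<Longrightarrow> x \<in> kspan X \<Longrightarrow> lact M1 b (pure1 a x) = pure1 (b \<otimes>\<^bsub>A\<^esub> a) x"
proof -
  have *: "n \<in> carrier AE \<Longrightarrow> lact AE b n \<in> carrier AE"
    "n \<in> carrier AE \<Longrightarrow> n' \<in> carrier AE \<Longrightarrow> lact AE b (n \<oplus>\<^bsub>AE\<^esub> n') = lact AE b n \<oplus>\<^bsub>AE\<^esub> lact AE b n'"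
    "n \<in> carrier AE \<Longrightarrow> e' \<in> EE \<Longrightarrow> lact AE b (ract AE n e') = ract AE (lact AE b n) e'" for n n' e'
    using assms by (simp_all add: A.r_distr A.m_assoc pr_EE_closed)
  show "m \<in> carrier M1 \<Longrightarrow> lact M1 b m \<in> carrier M1"
    by (rule T1.lact_tensor(1)[OF *])
  show "m \<in> carrier M1 \<Longrightarrow> m' \<in> carrier M1 \<Longrightarrow> lact M1 b (m \<oplus>\<^bsub>M1\<^esub> m') = lact M1 b m \<oplus>\<^bsub>M1\<^esub> lact M1 b m'"
    by (rule T1.lact_tensor(2)[OF *])
  show "a \<in> carrier A \<Longrightarrow> x \<in> kspan X \<Longrightarrow> lact M1 b (pure1 a x) = pure1 (b \<otimes>\<^bsub>A\<^esub> a) x"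
    using T1.lact_tensor(3)[OF *, of a x] by simp
qed

lemma pure1_closed: "a \<in> carrier A \<Longrightarrow> x \<in> kspan X \<Longrightarrow> pure1 a x \<in> carrier M1"
  using T1.pure_closed[of a x] by simp

text \<open>The left action passes from the inner to the outer tensor product only if it commutes
  with the right action of \<open>EE\<close>.\<close>

lemma M1_lact_ract:
  assumes "b \<in> carrier A" "e \<in> EE" "m \<in> carrier M1"
  shows "lact M1 b (ract M1 m e) = ract M1 (lact M1 b m) e"
  using assms(3)
proof (induct m rule: T1.tensor_induct)
  case (pure a x)
  then have "a \<in> carrier A" "x \<in> kspan X"
    by simp_all
  then show ?case
    using assms kspan_EE_rmult by (simp add: M1_lact(3) M1_ract(3))
next
  case (add m m')
  then show ?case
    using assms by (simp add: M1_lact M1_ract)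
qed

sublocale T3: tensor_product EE M1 EA
  by (rule tensor_product.intro[OF T1.abelian_group_tensor AE_abelian(2)])
    (simp_all add: pr_EE_closed M1_ract(1) A.m_closed)

lemma G_def: "G = tensor EE M1 EA" and t3_def: "t3 a x c = pure3 (pure1 a x) c"
  by (simp_all add: AXA_def tens3_def)

lemma G_abelian: "abelian_group G"
  unfolding G_def by (rule T3.abelian_group_tensor)

sublocale G: abelian_group G
  by (rule G_abelian)

lemma G_lact:
  assumes "b \<in> carrier A"
  shows "z \<in> carrier G \<Longrightarrow> lact G b z \<in> carrier G"
    and "z \<in> carrier G \<Longrightarrow> z' \<in> carrier G \<Longrightarrow> lact G b (z \<oplus>\<^bsub>G\<^esub> z') = lact G b z \<oplus>\<^bsub>G\<^esub> lact G b z'"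
    and "a \<in> carrier A \<Longrightarrow> x \<in> kspan X \<Longrightarrow> c \<in> carrier A \<Longrightarrow> lact G b (t3 a x c) = t3 (b \<otimes>\<^bsub>A\<^esub> a) x c"
proof -
  note L = T3.lact_tensor[OF M1_lact(1)[OF assms] M1_lact(2)[OF assms] M1_lact_ract[OF assms]]
  show "z \<in> carrier G \<Longrightarrow> lact G b z \<in> carrier G"
    unfolding G_def by (rule L(1))
  show "z \<in> carrier G \<Longrightarrow> z' \<in> carrier G \<Longrightarrow> lact G b (z \<oplus>\<^bsub>G\<^esub> z') = lact G b z \<oplus>\<^bsub>G\<^esub> lact G b z'"
    unfolding G_def by (rule L(2))
  show "a \<in> carrier A \<Longrightarrow> x \<in> kspan X \<Longrightarrow> c \<in> carrier A \<Longrightarrow> lact G b (t3 a x c) = t3 (b \<otimes>\<^bsub>A\<^esub> a) x c"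
    using L(3)[of "pure1 a x" c] assms unfolding G_def t3_def by (simp add: pure1_closed M1_lact(3))
qed

lemma G_ract:
  assumes "b \<in> carrier A"
  shows "z \<in> carrier G \<Longrightarrow> ract G z b \<in> carrier G"
    and "z \<in> carrier G \<Longrightarrow> z' \<in> carrier G \<Longrightarrow> ract G (z \<oplus>\<^bsub>G\<^esub> z') b = ract G z b \<oplus>\<^bsub>G\<^esub> ract G z' b"
    and "a \<in> carrier A \<Longrightarrow> x \<in> kspan X \<Longrightarrow> c \<in> carrier A \<Longrightarrow> ract G (t3 a x c) b = t3 a x (c \<otimes>\<^bsub>A\<^esub> b)"
proof -
  have *: "n \<in> carrier EA \<Longrightarrow> ract EA n b \<in> carrier EA"
    "n \<in> carrier EA \<Longrightarrow> n' \<in> carrier EA \<Longrightarrow> ract EA (n \<oplus>\<^bsub>EA\<^esub> n') b = ract EA n b \<oplus>\<^bsub>EA\<^esub> ract EA n' b"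
    "n \<in> carrier EA \<Longrightarrow> e \<in> EE \<Longrightarrow> ract EA (lact EA e n) b = lact EA e (ract EA n b)" for n n' e
    using assms by (simp_all add: A.l_distr A.m_assoc pr_EE_closed)
  note L = T3.ract_tensor[OF *]
  show "z \<in> carrier G \<Longrightarrow> ract G z b \<in> carrier G"
    unfolding G_def by (rule L(1))
  show "z \<in> carrier G \<Longrightarrow> z' \<in> carrier G \<Longrightarrow> ract G (z \<oplus>\<^bsub>G\<^esub> z') b = ract G z b \<oplus>\<^bsub>G\<^esub> ract G z' b"
    unfolding G_def by (rule L(2))
  show "a \<in> carrier A \<Longrightarrow> x \<in> kspan X \<Longrightarrow> c \<in> carrier A \<Longrightarrow> ract G (t3 a x c) b = t3 a x (c \<otimes>\<^bsub>A\<^esub> b)"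
    using L(3)[of "pure1 a x" c] unfolding G_def t3_def by (simp add: pure1_closed)
qed

lemma t3_closed: "a \<in> carrier A \<Longrightarrow> x \<in> kspan X \<Longrightarrow> c \<in> carrier A \<Longrightarrow> t3 a x c \<in> carrier G"
  unfolding G_def t3_def using T3.pure_closed[of "pure1 a x" c] pure1_closed by simp

lemma t3_add:
  shows "a \<in> carrier A \<Longrightarrow> a' \<in> carrier A \<Longrightarrow> x \<in> kspan X \<Longrightarrow> c \<in> carrier A \<Longrightarrow>
      t3 (a \<oplus>\<^bsub>A\<^esub> a') x c = t3 a x c \<oplus>\<^bsub>G\<^esub> t3 a' x c"
    and "a \<in> carrier A \<Longrightarrow> x \<in> kspan X \<Longrightarrow> x' \<in> kspan X \<Longrightarrow> c \<in> carrier A \<Longrightarrow>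
      t3 a (x + x') c = t3 a x c \<oplus>\<^bsub>G\<^esub> t3 a x' c"
    and "a \<in> carrier A \<Longrightarrow> x \<in> kspan X \<Longrightarrow> c \<in> carrier A \<Longrightarrow> c' \<in> carrier A \<Longrightarrow>
      t3 a x (c \<oplus>\<^bsub>A\<^esub> c') = t3 a x c \<oplus>\<^bsub>G\<^esub> t3 a x c'"
  using T1.pure_add_left[of a a' x] T1.pure_add_right[of a x x']
    T3.pure_add_left[of "pure1 a x" "pure1 a' x" c] T3.pure_add_left[of "pure1 a x" "pure1 a x'" c]
    T3.pure_add_right[of "pure1 a x" c c'] pure1_closed
  unfolding G_def t3_def by simp_all

lemma t3_zero:
  "x \<in> kspan X \<Longrightarrow> c \<in> carrier A \<Longrightarrow> t3 \<zero>\<^bsub>A\<^esub> x c = \<zero>\<^bsub>G\<^esub>"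
  "a \<in> carrier A \<Longrightarrow> c \<in> carrier A \<Longrightarrow> t3 a 0 c = \<zero>\<^bsub>G\<^esub>"
  "a \<in> carrier A \<Longrightarrow> x \<in> kspan X \<Longrightarrow> t3 a x \<zero>\<^bsub>A\<^esub> = \<zero>\<^bsub>G\<^esub>"
  unfolding G_def t3_def using T1.pure_zero_left[of x] T1.pure_zero_right[of a] T3.pure_zero_left[of c]
    T3.pure_zero_right[of "pure1 a x"] pure1_closed by simp_all

lemma t3_balanced:
  assumes "a \<in> carrier A" "x \<in> kspan X" "c \<in> carrier A" "e \<in> EE"
  shows "t3 (a \<otimes>\<^bsub>A\<^esub> pr e) x c = t3 a (pmult e x) c" "t3 a (pmult x e) c = t3 a x (pr e \<otimes>\<^bsub>A\<^esub> c)"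
  using T1.pure_balanced[of a e x] T3.pure_balanced[of "pure1 a x" e c] assms pure1_closed
  unfolding G_def t3_def by (simp_all add: M1_ract(3))

lemma G_induct [consumes 1, case_names pure add]:
  assumes "z \<in> carrier G" "\<And>a x c. a \<in> carrier A \<Longrightarrow> x \<in> kspan X \<Longrightarrow> c \<in> carrier A \<Longrightarrow> P (t3 a x c)"
    "\<And>z z'. z \<in> carrier G \<Longrightarrow> z' \<in> carrier G \<Longrightarrow> P z \<Longrightarrow> P z' \<Longrightarrow> P (z \<oplus>\<^bsub>G\<^esub> z')"
  shows "P z"
  using assms(1) unfolding G_def
proof (induct z rule: T3.tensor_induct)
  case (pure m c)
  then have c: "c \<in> carrier A"
    by simp
  show ?case
    using pure(1)
  proof (induct m rule: T1.tensor_induct)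
    case (pure a x)
    then show ?case
      using assms(2)[of a x c] c by (simp add: t3_def)
  next
    case (add m m')
    then have "P (pure3 m c \<oplus>\<^bsub>G\<^esub> pure3 m' c)"
      using c unfolding G_def by (intro assms(3)[unfolded G_def] T3.pure_closed) simp_all
    then show ?case
      using add c T3.pure_add_left[of m m' c] by (simp add: G_def)
  qed
qed (use assms(3) in \<open>simp add: G_def\<close>)

text \<open>The universal property of the tensor product is applied first in the two left factors,
  for each fixed \<open>c\<close>, and then in \<open>c\<close>. The lifts for different
  \<open>c\<close> are chosen independently, so their additivity and balancedness in
  \<open>c\<close> are recovered from their values on pure tensors.\<close>

lemma G_lift:
  fixes B :: "('v, 'a, 'k) pathvec set \<Rightarrow> ('v, 'a, 'k) pathvec \<Rightarrow> ('v, 'a, 'k) pathvec set \<Rightarrow> ('c \<Rightarrow>\<^sub>0 'k)"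
  assumes B: "\<And>a a' x c. a \<in> carrier A \<Longrightarrow> a' \<in> carrier A \<Longrightarrow> x \<in> kspan X \<Longrightarrow> c \<in> carrier A \<Longrightarrow>
      B (a \<oplus>\<^bsub>A\<^esub> a') x c = B a x c + B a' x c"
    "\<And>a x x' c. a \<in> carrier A \<Longrightarrow> x \<in> kspan X \<Longrightarrow> x' \<in> kspan X \<Longrightarrow> c \<in> carrier A \<Longrightarrow>
      B a (x + x') c = B a x c + B a x' c"
    "\<And>a x c c'. a \<in> carrier A \<Longrightarrow> x \<in> kspan X \<Longrightarrow> c \<in> carrier A \<Longrightarrow> c' \<in> carrier A \<Longrightarrow>
      B a x (c \<oplus>\<^bsub>A\<^esub> c') = B a x c + B a x c'"
    "\<And>a x c e. a \<in> carrier A \<Longrightarrow> x \<in> kspan X \<Longrightarrow> c \<in> carrier A \<Longrightarrow> e \<in> EE \<Longrightarrow>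
      B (a \<otimes>\<^bsub>A\<^esub> pr e) x c = B a (pmult e x) c"
    "\<And>a x c e. a \<in> carrier A \<Longrightarrow> x \<in> kspan X \<Longrightarrow> c \<in> carrier A \<Longrightarrow> e \<in> EE \<Longrightarrow>
      B a (pmult x e) c = B a x (pr e \<otimes>\<^bsub>A\<^esub> c)"
  obtains T where "\<And>z z'. z \<in> carrier G \<Longrightarrow> z' \<in> carrier G \<Longrightarrow> T (z \<oplus>\<^bsub>G\<^esub> z') = T z + T z'"
    "\<And>a x c. a \<in> carrier A \<Longrightarrow> x \<in> kspan X \<Longrightarrow> c \<in> carrier A \<Longrightarrow> T (t3 a x c) = B a x c"
proof -
  have "\<forall>c\<in>carrier A. \<exists>T. (\<forall>m\<in>carrier M1. \<forall>m'\<in>carrier M1. T (m \<oplus>\<^bsub>M1\<^esub> m') = T m + T m') \<and>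
      (\<forall>a\<in>carrier A. \<forall>x\<in>kspan X. T (pure1 a x) = B a x c)"
  proof
    fix c
    assume c: "c \<in> carrier A"
    show "\<exists>T. (\<forall>m\<in>carrier M1. \<forall>m'\<in>carrier M1. T (m \<oplus>\<^bsub>M1\<^esub> m') = T m + T m') \<and>
      (\<forall>a\<in>carrier A. \<forall>x\<in>kspan X. T (pure1 a x) = B a x c)"
    proof (rule T1.tensor_lift[of "\<lambda>a x. B a x c"])
      fix T
      assume T: "\<And>z z'. z \<in> carrier M1 \<Longrightarrow> z' \<in> carrier M1 \<Longrightarrow> T (z \<oplus>\<^bsub>M1\<^esub> z') = T z + T z'"
        "\<And>m n. m \<in> carrier AE \<Longrightarrow> n \<in> carrier KX \<Longrightarrow> T (pure1 m n) = B m n c"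
      show ?thesis
        using T by (intro exI[of _ T]) simp
    qed (use B c in simp_all)
  qed
  from bchoice[OF this] obtain T where T0: "\<forall>c\<in>carrier A. (\<forall>m\<in>carrier M1. \<forall>m'\<in>carrier M1. T c (m \<oplus>\<^bsub>M1\<^esub> m') = T c m + T c m') \<and>
      (\<forall>a\<in>carrier A. \<forall>x\<in>kspan X. T c (pure1 a x) = B a x c)"
    by (rule exE)
  have T: "T c (m \<oplus>\<^bsub>M1\<^esub> m') = T c m + T c m'" if "c \<in> carrier A" "m \<in> carrier M1" "m' \<in> carrier M1" for c m m'
    using T0 that by simp
  have T': "T c (pure1 a x) = B a x c" if "c \<in> carrier A" "a \<in> carrier A" "x \<in> kspan X" for a x c
    using T0 that by simp
  have add: "T (c \<oplus>\<^bsub>A\<^esub> c') m = T c m + T c' m" if "m \<in> carrier M1" and c: "c \<in> carrier A" "c' \<in> carrier A" for c c' m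
    using that(1)
  proof (induct m rule: T1.tensor_induct)
    case (pure a x)
    then show ?case
      using c by (simp add: T' B(3))
  next
    case (add m m')
    then show ?case
      using c by (simp add: T)
  qed
  have bal: "T c (ract M1 m e) = T (pr e \<otimes>\<^bsub>A\<^esub> c) m" if "m \<in> carrier M1" and c: "c \<in> carrier A" "e \<in> EE" for c m e
    using that(1)
  proof (induct m rule: T1.tensor_induct)
    case (pure a x)
    then show ?case
      using c pr_EE_closed[OF c(2)] kspan_EE_rmult[OF c(2)] by (simp add: T' M1_ract(3) B(5))
  next
    case (add m m')
    then show ?case
      using c pr_EE_closed[OF c(2)] by (simp add: T M1_ract)
  qed
  show ?thesis
  proof (rule T3.tensor_lift[of "\<lambda>m c. T c m"])
    fix S
    assume S: "\<And>z z'. z \<in> carrier (tensor EE M1 EA) \<Longrightarrow> z' \<in> carrier (tensor EE M1 EA) \<Longrightarrow>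
        S (z \<oplus>\<^bsub>tensor EE M1 EA\<^esub> z') = S z + S z'"
      "\<And>m n. m \<in> carrier M1 \<Longrightarrow> n \<in> carrier EA \<Longrightarrow> S (pure3 m n) = T n m"
    show ?thesis
      by (rule that[of S]) (use S in \<open>simp_all add: G_def t3_def pure1_closed T'\<close>)
  qed (use T add bal in simp_all)
qed

end

section \<open>Representing tensors by combinations of triples of paths\<close>

context free_bimodule begin

abbreviation "good \<equiv> paths Q \<times> X \<times> paths Q"

text \<open>Composable triples suffice to represent every tensor, and normal forms detect which of
  their combinations represent zero.\<close>

definition chains :: "(('v, 'a) qpath \<times> ('v, 'a) qpath \<times> ('v, 'a) qpath) set" where
  "chains = {(p, x, q). p \<in> paths Q \<and> x \<in> X \<and> q \<in> paths Q \<and> composable p x \<and> composable x q}"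

lemma chains_good: "chains \<subseteq> good"
  by (auto simp: chains_def)

interpretation A: ring A by (rule ring_A)

lemma single_in_kspan: "p \<in> Y \<Longrightarrow> Poly_Mapping.single p c \<in> kspan Y"
  by (simp add: kspan_iff)

text \<open>Evaluates a lift in the tensor product. The target has no scalar multiplication of its
  own, so the coefficient is placed in the left outer factor. On triples outside \<open>good\<close>
  the value is unspecified.\<close>

definition sigma :: "('v, 'a, 'k) tripvec \<Rightarrow> _" where
  "sigma = (SOME S. (\<forall>x. S x \<in> carrier G) \<and> (\<forall>x y. S (x + y) = S x \<oplus>\<^bsub>G\<^esub> S y) \<and>
    (\<forall>p x q k. (p, x, q) \<in> good \<longrightarrow>
      S (Poly_Mapping.single (p, x, q) k) = t3 (pr (Poly_Mapping.single p k)) (pvec x) (pr (pvec q))))"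

lemma sigma:
  "sigma g \<in> carrier G" "sigma (g + h) = sigma g \<oplus>\<^bsub>G\<^esub> sigma h"
  "(p, x, q) \<in> good \<Longrightarrow>
    sigma (Poly_Mapping.single (p, x, q) k) = t3 (pr (Poly_Mapping.single p k)) (pvec x) (pr (pvec q))"
proof -
  \<comment> \<open>The default value zero outside \<open>good\<close> keeps the prescription
    additive in the coefficient, as \<open>additive_extension\<close> demands.\<close>
  define u where "u = (\<lambda>(p, x, q) k. if (p, x, q) \<in> good
    then t3 (pr (Poly_Mapping.single p k)) (pvec x) (pr (pvec q)) else \<zero>\<^bsub>G\<^esub>)"
  have u_closed: "u t k \<in> carrier G" for t k
    by (auto simp: u_def split: prod.split intro!: t3_closed pr_closed single_in_kspan)
  have u_add: "u t (k + l) = u t k \<oplus>\<^bsub>G\<^esub> u t l" for t k l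
  proof -
    obtain p x q where t: "t = (p, x, q)"
      by (cases t)
    show ?thesis
    proof (cases "(p, x, q) \<in> good")
      case True
      then have "p \<in> paths Q" "x \<in> X" "q \<in> paths Q"
        by auto
      then show ?thesis
        using True by (simp add: t u_def single_add pr_add t3_add pr_closed single_in_kspan)
    next
      case False
      then have "u t = (\<lambda>_. \<zero>\<^bsub>G\<^esub>)"
        unfolding t u_def prod.case by (simp only: if_False)
      then show ?thesis
        by simp
    qed
  qed
  obtain S where S: "\<And>x. S x \<in> carrier G" "\<And>x y. S (x + y) = S x \<oplus>\<^bsub>G\<^esub> S y"
      "\<And>t k. S (Poly_Mapping.single t k) = u t k"
    by (rule G.additive_extension[of u, OF u_closed u_add]) blast
  have "\<exists>S. (\<forall>x. S x \<in> carrier G) \<and> (\<forall>x y. S (x + y) = S x \<oplus>\<^bsub>G\<^esub> S y) \<and>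
    (\<forall>p x q k. (p, x, q) \<in> good \<longrightarrow>
      S (Poly_Mapping.single (p, x, q) k) = t3 (pr (Poly_Mapping.single p k)) (pvec x) (pr (pvec q)))"
    by (rule exI[of _ S]) (simp add: S u_def)
  from someI_ex[OF this] have *: "(\<forall>x. sigma x \<in> carrier G) \<and> (\<forall>x y. sigma (x + y) = sigma x \<oplus>\<^bsub>G\<^esub> sigma y) \<and>
    (\<forall>p x q k. (p, x, q) \<in> good \<longrightarrow>
      sigma (Poly_Mapping.single (p, x, q) k) = t3 (pr (Poly_Mapping.single p k)) (pvec x) (pr (pvec q)))"
    unfolding sigma_def .
  show "sigma g \<in> carrier G" "sigma (g + h) = sigma g \<oplus>\<^bsub>G\<^esub> sigma h"
    using * by blast+
  show "(p, x, q) \<in> good \<Longrightarrow>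
    sigma (Poly_Mapping.single (p, x, q) k) = t3 (pr (Poly_Mapping.single p k)) (pvec x) (pr (pvec q))"
    using * by blast
qed

lemma sigma_zero: "sigma 0 = \<zero>\<^bsub>G\<^esub>"
  using sigma(2)[of 0 0] sigma(1)[of 0] by (metis G.add.l_cancel_one add_0)

lemma sigma_uminus: "sigma (- g) = \<ominus>\<^bsub>G\<^esub> sigma g"
  using sigma(2)[of "- g" g] sigma(1) sigma_zero by (metis G.minus_equality ab_left_minus)

lemma sigma_minus: "sigma (g - h) = sigma g \<ominus>\<^bsub>G\<^esub> sigma h"
  using sigma(2)[of g "- h"] by (simp add: sigma_uminus G.minus_eq)

lemma sigma_sum: "finite B \<Longrightarrow> sigma (\<Sum>i\<in>B. g i) = finsum G (\<lambda>i. sigma (g i)) B"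
  by (induct B rule: finite_induct) (simp_all add: sigma sigma_zero)

lemma t3_scalar:
  assumes "a \<in> kspan (paths Q)" "x \<in> kspan X" "c \<in> kspan (paths Q)"
  shows "t3 (pr a) (smul l x) (pr c) = t3 (pr (smul l a)) x (pr c)"
    "t3 (pr a) (smul l x) (pr c) = t3 (pr a) x (pr (smul l c))"
proof -
  have e: "smul l e1 \<in> EE"
    by (rule subsp_smul[OF subsp_kspan e1_in_EE])
  have x: "x \<in> kspan (paths Q)"
    using assms(2) X by (auto simp: kspan_iff)
  note e' = EE_in_kspan[OF e]
  show "t3 (pr a) (smul l x) (pr c) = t3 (pr (smul l a)) x (pr c)"
    using t3_balanced(1)[OF pr_closed[OF assms(1)] assms(2) pr_closed[OF assms(3)] e] assms x
    by (simp add: pr_mult[OF _ e'] pmult_distrib pmult_one)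
  show "t3 (pr a) (smul l x) (pr c) = t3 (pr a) x (pr (smul l c))"
    using t3_balanced(2)[OF pr_closed[OF assms(1)] assms(2) pr_closed[OF assms(3)] e] assms x
    by (simp add: pr_mult[OF e'] pmult_distrib pmult_one)
qed

lemma sigma_ten:
  assumes "a \<in> kspan (paths Q)" "x \<in> X" "c \<in> kspan (paths Q)"
  shows "sigma (ten a x c) = t3 (pr a) (pvec x) (pr c)"
proof -
  have x: "pvec x \<in> kspan X"
    using assms(2) by simp
  have a': "a \<in> kspan (paths Q) \<Longrightarrow> sigma (ten a x (Poly_Mapping.single q l)) = t3 (pr a) (pvec x) (pr (Poly_Mapping.single q l))"
    if q: "q \<in> paths Q" for q l a
    unfolding kspan_iff
  proof (induct a rule: keys_induct)
    case zero
    then show ?case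
      using t3_zero(1)[OF x pr_closed] q by (simp add: sigma_zero pr_zero single_in_kspan)
  next
    case (single p k)
    have "t3 (pr (smul l (Poly_Mapping.single p k))) (pvec x) (pr (pvec q)) =
        t3 (pr (Poly_Mapping.single p k)) (pvec x) (pr (smul l (pvec q)))"
      using t3_scalar[OF single_in_kspan[OF single] x single_in_kspan[OF q], of k l 1] by simp
    then show ?case
      using single q assms(2) by (simp add: sigma(3) mult.commute)
  next
    case (add a b)
    then show ?case
      using q x by (simp add: ten_distrib sigma pr_add pr_closed t3_add single_in_kspan kspan_iff)
  qed
  show ?thesis
    using assms(3) unfolding kspan_iff
  proof (induct c rule: keys_induct)
    case zero
    then show ?case
      using t3_zero(3)[OF pr_closed[OF assms(1)] x] by (simp add: sigma_zero pr_zero)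
  next
    case (single q l)
    then show ?case
      using a'[OF _ assms(1)] by simp
  next
    case (add c d)
    then show ?case
      using assms(1) x by (simp add: ten_distrib sigma pr_add pr_closed t3_add kspan_iff)
  qed
qed

lemma sigma_lmul:
  assumes "Poly_Mapping.keys g \<subseteq> good" "a \<in> kspan (paths Q)"
  shows "sigma (lmul a g) = lact G (pr a) (sigma g)"
  using assms(1)
proof (induct g rule: keys_induct)
  case zero
  have "lact G (pr a) \<zero>\<^bsub>G\<^esub> \<oplus>\<^bsub>G\<^esub> lact G (pr a) \<zero>\<^bsub>G\<^esub> = lact G (pr a) \<zero>\<^bsub>G\<^esub>"
    using G_lact(2)[OF pr_closed[OF assms(2)], of "\<zero>\<^bsub>G\<^esub>" "\<zero>\<^bsub>G\<^esub>"] by simp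
  then show ?case
    using G_lact(1)[OF pr_closed[OF assms(2)], of "\<zero>\<^bsub>G\<^esub>"] by (simp add: sigma_zero)
next
  case (single t k)
  obtain p x q where t: "t = (p, x, q)" "p \<in> paths Q" "x \<in> X" "q \<in> paths Q"
    using single by (cases t) auto
  have *: "Poly_Mapping.single t k = ten (Poly_Mapping.single p k) x (pvec q)"
    by (simp add: t)
  show ?case
    unfolding * lmul_ten using t assms(2)
    by (simp del: ten_single add: sigma_ten kspan_pmult single_in_kspan G_lact(3) pr_closed pr_mult)
next
  case (add g h)
  then show ?case
    using assms(2) by (simp add: lmul_distrib sigma G_lact(2) pr_closed)
qed

lemma sigma_rmul:
  assumes "Poly_Mapping.keys g \<subseteq> good" "a \<in> kspan (paths Q)"
  shows "sigma (rmul g a) = ract G (sigma g) (pr a)"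
  using assms(1)
proof (induct g rule: keys_induct)
  case zero
  have "ract G \<zero>\<^bsub>G\<^esub> (pr a) \<oplus>\<^bsub>G\<^esub> ract G \<zero>\<^bsub>G\<^esub> (pr a) = ract G \<zero>\<^bsub>G\<^esub> (pr a)"
    using G_ract(2)[OF pr_closed[OF assms(2)], of "\<zero>\<^bsub>G\<^esub>" "\<zero>\<^bsub>G\<^esub>"] by simp
  then show ?case
    using G_ract(1)[OF pr_closed[OF assms(2)], of "\<zero>\<^bsub>G\<^esub>"] by (simp add: sigma_zero)
next
  case (single t k)
  obtain p x q where t: "t = (p, x, q)" "p \<in> paths Q" "x \<in> X" "q \<in> paths Q"
    using single by (cases t) auto
  have *: "Poly_Mapping.single t k = ten (Poly_Mapping.single p k) x (pvec q)"
    by (simp add: t)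
  show ?case
    unfolding * rmul_ten using t assms(2)
    by (simp del: ten_single add: sigma_ten kspan_pmult single_in_kspan G_ract(3) pr_closed pr_mult)
next
  case (add g h)
  then show ?case
    using assms(2) by (simp add: rmul_distrib sigma G_ract(2) pr_closed)
qed

lemma lmul_e1: "Poly_Mapping.keys g \<subseteq> good \<Longrightarrow> lmul e1 g = g"
  by (rule klin_eq[OF klin_lmul[OF klin_id] klin_id]) (auto simp: lmul_single pmult_one)

lemma sigma_smul:
  assumes "Poly_Mapping.keys g \<subseteq> good"
  shows "sigma (smul l g) = ksmult Q I G l (sigma g)"
proof -
  have "smul l g = lmul (smul l e1) g"
    using lmul_e1[OF assms] by (simp add: lmul_distrib)
  then show ?thesis
    using sigma_lmul[OF assms subsp_smul[OF subsp_kspan one_closed], of l]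
    by (simp add: ksmult_def scale_eq_smul)
qed

text \<open>The end vertex of the outer path acts on it as an identity; moved across the tensor sign
  it meets \<open>x\<close> at a wrong vertex and annihilates it.\<close>

lemma t3_noncomposable:
  assumes "p \<in> paths Q" "x \<in> X" "q \<in> paths Q" "\<not> (composable p x \<and> composable x q)"
  shows "t3 (pr (Poly_Mapping.single p k)) (Poly_Mapping.single x l) (pr (Poly_Mapping.single q m)) = \<zero>\<^bsub>G\<^esub>"
proof (cases "composable p x")
  case False
  let ?e = "pvec (vertex_path (source p)) :: ('v, 'a, 'k) pathvec"
  have e: "?e \<in> EE"
    by (rule vertex_in_EE[OF assms(1)])
  have "pr (Poly_Mapping.single p k) \<otimes>\<^bsub>A\<^esub> pr ?e = pr (Poly_Mapping.single p k)"
    using assms(1) EE_in_kspan[OF e] by (subst pr_mult) (simp_all add: single_in_kspan composable_def)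
  then have "t3 (pr (Poly_Mapping.single p k)) (Poly_Mapping.single x l) (pr (Poly_Mapping.single q m)) =
      t3 (pr (Poly_Mapping.single p k)) (pmult ?e (Poly_Mapping.single x l)) (pr (Poly_Mapping.single q m))"
    using t3_balanced(1)[OF pr_closed[OF single_in_kspan[OF assms(1)]] single_in_kspan[OF assms(2)]
        pr_closed[OF single_in_kspan[OF assms(3)]] e, of k l m] by simp
  also have "pmult ?e (Poly_Mapping.single x l) = 0"
    using False by (simp add: composable_def)
  finally show ?thesis
    using t3_zero(2) assms by (simp add: pr_closed single_in_kspan)
next
  case True
  let ?e = "pvec (vertex_path (target q)) :: ('v, 'a, 'k) pathvec"
  have e: "?e \<in> EE"
    by (rule vertex_in_EE[OF assms(3)])
  have "pr ?e \<otimes>\<^bsub>A\<^esub> pr (Poly_Mapping.single q m) = pr (Poly_Mapping.single q m)"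
    using assms(3) EE_in_kspan[OF e] by (subst pr_mult) (simp_all add: single_in_kspan composable_def)
  then have "t3 (pr (Poly_Mapping.single p k)) (Poly_Mapping.single x l) (pr (Poly_Mapping.single q m)) =
      t3 (pr (Poly_Mapping.single p k)) (pmult (Poly_Mapping.single x l) ?e) (pr (Poly_Mapping.single q m))"
    using t3_balanced(2)[OF pr_closed[OF single_in_kspan[OF assms(1)]] single_in_kspan[OF assms(2)]
        pr_closed[OF single_in_kspan[OF assms(3)]] e, of k l m] by simp
  also have "pmult (Poly_Mapping.single x l) ?e = 0"
    using True assms(4) by (simp add: composable_def)
  finally show ?thesis
    using t3_zero(2) assms by (simp add: pr_closed single_in_kspan)
qed

text \<open>Pure tensors are expanded into paths one factor at a time; the terms that do not compose
  vanish by \<open>t3_noncomposable\<close>.\<close>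

lemma sigma_surj:
  assumes "z \<in> carrier G"
  obtains g where "Poly_Mapping.keys g \<subseteq> chains" "z = sigma g"
proof -
  define Im where "Im = {sigma g | g. Poly_Mapping.keys g \<subseteq> chains}"
  have Im_add: "y \<oplus>\<^bsub>G\<^esub> z \<in> Im" if yz: "y \<in> Im" "z \<in> Im" for y z
  proof -
    obtain g h where "Poly_Mapping.keys g \<subseteq> chains" "y = sigma g" "Poly_Mapping.keys h \<subseteq> chains" "z = sigma h"
      using yz unfolding Im_def by (elim CollectE exE conjE)
    then show ?thesis
      unfolding Im_def using keys_add[of g h] by (intro CollectI exI[of _ "g + h"]) (auto simp: sigma)
  qed
  have Im_zero: "\<zero>\<^bsub>G\<^esub> \<in> Im"
    unfolding Im_def by (intro CollectI exI[of _ 0]) (simp add: sigma_zero)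
  have Im_single: "t3 (pr (Poly_Mapping.single p k)) (Poly_Mapping.single x l) (pr (Poly_Mapping.single q m)) \<in> Im"
    if p: "p \<in> paths Q" "x \<in> X" "q \<in> paths Q" for p x q k l m
  proof (cases "composable p x \<and> composable x q")
    case True
    have "sigma (Poly_Mapping.single (p, x, q) (l * k * m)) = t3 (pr (Poly_Mapping.single p k)) (Poly_Mapping.single x l) (pr (Poly_Mapping.single q m))"
      using sigma_ten[OF single_in_kspan[OF p(1)] p(2) single_in_kspan[OF p(3)], of "l * k" m]
        t3_scalar(1)[OF single_in_kspan[OF p(1)] single_in_kspan[OF p(2)] single_in_kspan[OF p(3)], of k l 1 m] by simp
    moreover have "Poly_Mapping.keys (Poly_Mapping.single (p, x, q) (l * k * m)) \<subseteq> chains"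
      using True p by (auto simp: chains_def)
    ultimately show ?thesis
      unfolding Im_def by (intro CollectI exI[of _ "Poly_Mapping.single (p, x, q) (l * k * m)"]) simp
  qed (use t3_noncomposable[OF p] Im_zero in simp)
  have Im1: "t3 (pr (Poly_Mapping.single p k)) (Poly_Mapping.single x l) (pr c) \<in> Im"
    if p: "p \<in> paths Q" "x \<in> X" and c: "Poly_Mapping.keys c \<subseteq> paths Q" for p x k l c
    using c
  proof (induct c rule: keys_induct)
    case zero
    then show ?case
      using Im_zero t3_zero(3) p by (simp add: pr_zero pr_closed single_in_kspan)
  next
    case (add c d)
    then show ?case
      using Im_add p t3_add(3)[where a = "pr (Poly_Mapping.single p k)" and x = "Poly_Mapping.single x l" and c = "pr c" and c' = "pr d"]
      by (simp add: pr_add pr_closed single_in_kspan kspan_iff)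
  qed (use Im_single p in simp)
  have Im2: "t3 (pr (Poly_Mapping.single p k)) x (pr c) \<in> Im"
    if p: "p \<in> paths Q" "Poly_Mapping.keys c \<subseteq> paths Q" and x: "Poly_Mapping.keys x \<subseteq> X" for p k x c
    using x
  proof (induct x rule: keys_induct)
    case zero
    then show ?case
      using Im_zero t3_zero(2) p by (simp add: pr_closed single_in_kspan kspan_iff)
  next
    case (add x y)
    then show ?case
      using Im_add p t3_add(2)[where a = "pr (Poly_Mapping.single p k)" and x = x and x' = y and c = "pr c"]
      by (simp add: pr_closed single_in_kspan kspan_iff)
  qed (use Im1 p in simp)
  have Im3: "t3 (pr a) x (pr c) \<in> Im"
    if c: "Poly_Mapping.keys c \<subseteq> paths Q" "Poly_Mapping.keys x \<subseteq> X" and a: "Poly_Mapping.keys a \<subseteq> paths Q" for a x c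
    using a
  proof (induct a rule: keys_induct)
    case zero
    then show ?case
      using Im_zero t3_zero(1) c by (simp add: pr_zero pr_closed kspan_iff)
  next
    case (add a b)
    then show ?case
      using Im_add c t3_add(1)[where a = "pr a" and a' = "pr b" and x = x and c = "pr c"]
      by (simp add: pr_add pr_closed kspan_iff)
  qed (use Im2 c in simp)
  have "z \<in> Im"
    using assms
  proof (induct z rule: G_induct)
    case (pure a x c)
    obtain a0 where a0: "a0 \<in> kspan (paths Q)" "a = pr a0"
      by (rule A_carrierE[OF pure(1)])
    obtain c0 where c0: "c0 \<in> kspan (paths Q)" "c = pr c0"
      by (rule A_carrierE[OF pure(3)])
    show ?case
      using Im3[of c0 x a0] a0 c0 pure(2) by (simp add: kspan_iff)
  qed (rule Im_add)
  then show ?thesis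
    using that unfolding Im_def by (elim CollectE exE conjE)
qed

text \<open>The unit is a sum of vertices. Balancing with the two end vertices of \<open>x\<close>
  selects one summand on each side, so that the bimodule generators are represented by single
  triples.\<close>

lemma t3_unit:
  assumes "x \<in> X"
  shows "t3 \<one>\<^bsub>A\<^esub> (pvec x) \<one>\<^bsub>A\<^esub> = sigma (Poly_Mapping.single (vertex_path (target x), x, vertex_path (source x)) 1)"
proof -
  have x: "x \<in> paths Q"
    using assms X by auto
  let ?t = "pvec (vertex_path (target x)) :: ('v, 'a, 'k) pathvec"
  let ?s = "pvec (vertex_path (source x)) :: ('v, 'a, 'k) pathvec"
  have E: "?t \<in> EE" "?s \<in> EE"
    using vertex_in_EE[OF x] by simp_all
  note E' = EE_in_kspan[OF E(1)] EE_in_kspan[OF E(2)]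
  have "t3 \<one>\<^bsub>A\<^esub> (pvec x) \<one>\<^bsub>A\<^esub> = t3 (\<one>\<^bsub>A\<^esub> \<otimes>\<^bsub>A\<^esub> pr ?t) (pvec x) \<one>\<^bsub>A\<^esub>"
    using t3_balanced(1)[of "\<one>\<^bsub>A\<^esub>" "pvec x" "\<one>\<^bsub>A\<^esub>" ?t] E assms by (simp add: composable_def)
  also have "\<dots> = t3 (\<one>\<^bsub>A\<^esub> \<otimes>\<^bsub>A\<^esub> pr ?t) (pvec x) (pr ?s \<otimes>\<^bsub>A\<^esub> \<one>\<^bsub>A\<^esub>)"
    using t3_balanced(2)[of "\<one>\<^bsub>A\<^esub> \<otimes>\<^bsub>A\<^esub> pr ?t" "pvec x" "\<one>\<^bsub>A\<^esub>" ?s] E E' assms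
    by (simp add: composable_def pr_closed del: A.l_one A.r_one)
  also have "\<dots> = t3 (pr ?t) (pvec x) (pr ?s)"
    using E' by (simp add: pr_closed)
  finally show ?thesis
    using vertex_path_source_in_paths[OF x] vertex_path_target_in_paths[OF x] assms by (simp add: sigma(3))
qed

text \<open>Exhibits a triple as a two-sided multiple of a generator, the only place where the
  values of the given bimodule maps are known.\<close>

lemma sigma_single:
  assumes "p \<in> paths Q" "x \<in> X" "q \<in> paths Q"
  shows "sigma (Poly_Mapping.single (p, x, q) k) =
    lact G (pr (Poly_Mapping.single p k)) (ract G (t3 \<one>\<^bsub>A\<^esub> (pvec x) \<one>\<^bsub>A\<^esub>) (pr (pvec q)))"
proof -
  have "ract G (t3 \<one>\<^bsub>A\<^esub> (pvec x) \<one>\<^bsub>A\<^esub>) (pr (pvec q)) = t3 \<one>\<^bsub>A\<^esub> (pvec x) (\<one>\<^bsub>A\<^esub> \<otimes>\<^bsub>A\<^esub> pr (pvec q))"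
    using assms by (intro G_ract(3)) (simp_all add: pr_closed)
  then show ?thesis
    using assms by (simp add: sigma(3) pr_closed G_lact(3) single_in_kspan)
qed

text \<open>Drops the triples that do not compose, unlike \<open>ten\<close>. This is what makes it
  balanced over \<open>EE\<close>: a vertex may fix one factor and annihilate its neighbour only if
  the two do not compose.\<close>

definition tri :: "('v, 'a, 'k) pathvec \<Rightarrow> ('v, 'a, 'k) pathvec \<Rightarrow> ('v, 'a, 'k) pathvec \<Rightarrow> ('v, 'a, 'k) tripvec" where
  "tri a x c = lin (\<lambda>p. lin (\<lambda>y. lin (\<lambda>q. if composable p y \<and> composable y q
    then Poly_Mapping.single (p, y, q) 1 else 0) c) x) a"

lemma klin_tri:
  "klin T \<Longrightarrow> klin (\<lambda>a. tri (T a) x c)" "klin T \<Longrightarrow> klin (\<lambda>x. tri a (T x) c)" "klin T \<Longrightarrow> klin (\<lambda>c. tri a x (T c))"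
  unfolding tri_def by (intro klin_intros; assumption)+

lemma tri_add:
  "tri (a + a') x c = tri a x c + tri a' x c" "tri a (x + x') c = tri a x c + tri a x' c"
  "tri a x (c + c') = tri a x c + tri a x c'"
  by (rule klin_plus, rule klin_tri, rule klin_id)+

lemma tri_pvec: "tri (pvec p) (pvec x) (pvec q) = (if composable p x \<and> composable x q then Poly_Mapping.single (p, x, q) 1 else 0)"
  by (simp add: tri_def)

lemma vertex_pmult:
  assumes "w \<in> paths Q" "len w = 0"
  shows "pmult (pvec p) (pvec w) = (if source p = source w then pvec p else 0 :: ('v, 'a, 'k) pathvec)"
    "pmult (pvec w) (pvec p) = (if target p = source w then pvec p else 0 :: ('v, 'a, 'k) pathvec)"
  using len_0_vertex[OF assms] len_0_pcomp[OF assms, of p] by (auto simp: composable_def) (metis vertex_path_simps(1,2))+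

lemma tri_balanced:
  assumes "e \<in> EE"
  shows "tri (pmult a e) x c = tri a (pmult e x) c" "tri a (pmult x e) c = tri a x (pmult e c)"
proof -
  have w: "w \<in> paths Q" "len w = 0" if "w \<in> Poly_Mapping.keys e" for w
    using assms that by (auto simp: kspan_iff paths_of_len_def)
  have p: "tri (pmult (pvec p) (pvec w)) (pvec y) (pvec q) = tri (pvec p) (pmult (pvec w) (pvec y)) (pvec q)"
    "tri (pvec p) (pmult (pvec y) (pvec w)) (pvec q) = tri (pvec p) (pvec y) (pmult (pvec w) (pvec q))"
    if "w \<in> Poly_Mapping.keys e" for w p y q
    using klin_zero[OF klin_tri(1)[OF klin_id]] klin_zero[OF klin_tri(2)[OF klin_id]] klin_zero[OF klin_tri(3)[OF klin_id]]
    by (simp_all del: pmult_single add: vertex_pmult[OF w[OF that]] tri_pvec composable_def)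
  show "tri (pmult a e) x c = tri a (pmult e x) c"
  proof (rule klin_eq[where S = "\<lambda>e. tri (pmult a e) x c" and T = "\<lambda>e. tri a (pmult e x) c"])
    fix w
    assume "w \<in> Poly_Mapping.keys e"
    note p = p(1)[OF this]
    show "tri (pmult a (pvec w)) x c = tri a (pmult (pvec w) x) c"
      by (rule klin_ext3[where F = "\<lambda>a x c. tri (pmult a (pvec w)) x c" and G = "\<lambda>a x c. tri a (pmult (pvec w) x) c"])
        ((intro klin_tri klin_pmult_left' klin_pmult_right' klin_id)+, rule p)
  qed (intro klin_tri klin_pmult_left' klin_pmult_right' klin_id)+
  show "tri a (pmult x e) c = tri a x (pmult e c)"
  proof (rule klin_eq[where S = "\<lambda>e. tri a (pmult x e) c" and T = "\<lambda>e. tri a x (pmult e c)"])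
    fix w
    assume "w \<in> Poly_Mapping.keys e"
    note p = p(2)[OF this]
    show "tri a (pmult x (pvec w)) c = tri a x (pmult (pvec w) c)"
      by (rule klin_ext3[where F = "\<lambda>a x c. tri a (pmult x (pvec w)) c" and G = "\<lambda>a x c. tri a x (pmult (pvec w) c)"])
        ((intro klin_tri klin_pmult_left' klin_pmult_right' klin_id)+, rule p)
  qed (intro klin_tri klin_pmult_left' klin_pmult_right' klin_id)+
qed

text \<open>
  Normal forms of the outer factors define a map back to the free bimodule, which detects the
  kernel of \<open>sigma\<close>.
\<close>

lemma sigma_kernel:
  assumes g: "Poly_Mapping.keys g \<subseteq> chains" and "sigma g = \<zero>\<^bsub>G\<^esub>"
  shows "lin (\<lambda>(b, x, c). ten (nfp b) x (nfp c)) g = 0"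
proof (rule G_lift[of "\<lambda>a x c. tri (NFA a) x (NFA c)"])
  fix T :: "_ \<Rightarrow> ('v, 'a, 'k) tripvec"
  assume T: "\<And>z z'. z \<in> carrier G \<Longrightarrow> z' \<in> carrier G \<Longrightarrow> T (z \<oplus>\<^bsub>G\<^esub> z') = T z + T z'"
    "\<And>a x c. a \<in> carrier A \<Longrightarrow> x \<in> kspan X \<Longrightarrow> c \<in> carrier A \<Longrightarrow> T (t3 a x c) = tri (NFA a) x (NFA c)"
  have T0: "T \<zero>\<^bsub>G\<^esub> = 0"
    using T(1)[of "\<zero>\<^bsub>G\<^esub>" "\<zero>\<^bsub>G\<^esub>"] by simp
  have "T (sigma g) = lin (\<lambda>(b, x, c). ten (nfp b) x (nfp c)) g"
    using g
  proof (induct g rule: keys_induct)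
    case (single t k)
    obtain p x q where t: "t = (p, x, q)" "p \<in> paths Q" "x \<in> X" "q \<in> paths Q" "composable p x" "composable x q"
      using single by (cases t) (auto simp: chains_def)
    \<comment> \<open>Normal forms keep end vertices, so all triples arising from a composable one
      are composable and \<open>tri\<close> drops nothing.\<close>
    have "tri (smul k (nfp p)) (pvec x) (nfp q) = ten (smul k (nfp p)) x (nfp q)"
    proof (rule klin_eq[where S = "\<lambda>a. tri (smul k a) (pvec x) (nfp q)" and T = "\<lambda>a. ten (smul k a) x (nfp q)"])
      fix p'
      assume p': "p' \<in> Poly_Mapping.keys (nfp p)"
      show "tri (smul k (pvec p')) (pvec x) (nfp q) = ten (smul k (pvec p')) x (nfp q)"
      proof (rule klin_eq[where S = "\<lambda>c. tri (smul k (pvec p')) (pvec x) c" and T = "\<lambda>c. ten (smul k (pvec p')) x c"])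
        fix q'
        assume q': "q' \<in> Poly_Mapping.keys (nfp q)"
        show "tri (smul k (pvec p')) (pvec x) (pvec q') = ten (smul k (pvec p')) x (pvec q')"
          using keys_nfp[OF t(2) p'] keys_nfp[OF t(4) q'] t(5,6)
          by (simp add: tri_def composable_def)
      qed (intro klin_tri klin_ten_right klin_id)+
    qed (intro klin_tri klin_ten_left klin_smul_left klin_id)+
    then show ?case
      using t T(2)[of "pr (Poly_Mapping.single p k)" "pvec x" "pr (pvec q)"]
      by (simp add: sigma(3) pr_closed NFA_pr single_in_kspan ten_distrib)
  next
    case (add g h)
    then show ?case
      using T(1)[OF sigma(1) sigma(1)] by (simp add: sigma(2))
  qed (simp add: sigma_zero T0)
  then show ?thesis
    using assms(2) T0 by simp
qed (simp_all add: NFA_add tri_add NFA_EE tri_balanced)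

end

section \<open>Homomorphisms of bimodules and the lifts of their images\<close>

lemma keys_lmul:
  assumes "\<And>b p x q. b \<in> Poly_Mapping.keys a \<Longrightarrow> (p, x, q) \<in> Poly_Mapping.keys g \<Longrightarrow> composable b p \<Longrightarrow> (b \<cdot> p, x, q) \<in> Y"
  shows "Poly_Mapping.keys (lmul a g) \<subseteq> Y"
proof -
  have "lmul a g \<in> {y. Poly_Mapping.keys y \<subseteq> Y}"
  proof (rule klin_mem[OF subsp_keys klin_lmul[OF klin_id]])
    fix t
    assume t: "t \<in> Poly_Mapping.keys g"
    obtain p x q where t': "t = (p, x, q)"
      by (cases t)
    show "lmul a (Poly_Mapping.single t 1) \<in> {y. Poly_Mapping.keys y \<subseteq> Y}"
    proof (rule klin_mem[OF subsp_keys, where T = "\<lambda>a. lmul a (Poly_Mapping.single t 1)"])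
      fix b
      assume "b \<in> Poly_Mapping.keys a"
      then show "lmul (pvec b) (Poly_Mapping.single t 1) \<in> {y. Poly_Mapping.keys y \<subseteq> Y}"
        using assms[of b p x q] t by (auto simp: t' lmul_single)
    qed (intro klin_lmul_left klin_id)
  qed
  then show ?thesis
    by simp
qed

lemma keys_rmul:
  assumes "\<And>b p x q. b \<in> Poly_Mapping.keys a \<Longrightarrow> (p, x, q) \<in> Poly_Mapping.keys g \<Longrightarrow> composable q b \<Longrightarrow> (p, x, q \<cdot> b) \<in> Y"
  shows "Poly_Mapping.keys (rmul g a) \<subseteq> Y"
proof -
  have "rmul g a \<in> {y. Poly_Mapping.keys y \<subseteq> Y}"
  proof (rule klin_mem[OF subsp_keys klin_rmul[OF klin_id]])
    fix t
    assume t: "t \<in> Poly_Mapping.keys g"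
    obtain p x q where t': "t = (p, x, q)"
      by (cases t)
    show "rmul (Poly_Mapping.single t 1) a \<in> {y. Poly_Mapping.keys y \<subseteq> Y}"
    proof (rule klin_mem[OF subsp_keys, where T = "\<lambda>a. rmul (Poly_Mapping.single t 1) a"])
      fix b
      assume "b \<in> Poly_Mapping.keys a"
      then show "rmul (Poly_Mapping.single t 1) (pvec b) \<in> {y. Poly_Mapping.keys y \<subseteq> Y}"
        using assms[of b p x q] t by (auto simp: t' rmul_single)
    qed (intro klin_rmul_right klin_id)
  qed
  then show ?thesis
    by simp
qed

lemma bimodule_homD:
  assumes "h \<in> bimodule_hom A M N"
  shows "x \<in> carrier M \<Longrightarrow> h x \<in> carrier N"
    and "x \<in> carrier M \<Longrightarrow> y \<in> carrier M \<Longrightarrow> h (x \<oplus>\<^bsub>M\<^esub> y) = h x \<oplus>\<^bsub>N\<^esub> h y"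
    and "a \<in> carrier A \<Longrightarrow> x \<in> carrier M \<Longrightarrow> h (lact M a x) = lact N a (h x)"
    and "a \<in> carrier A \<Longrightarrow> x \<in> carrier M \<Longrightarrow> h (ract M x a) = ract N (h x) a"
  using assms by (auto simp: bimodule_hom_def)

lemma bimodule_hom_minus:
  assumes h: "h \<in> bimodule_hom A M N" and "abelian_group M" "abelian_group N"
  shows "h \<zero>\<^bsub>M\<^esub> = \<zero>\<^bsub>N\<^esub>"
    and "x \<in> carrier M \<Longrightarrow> h (\<ominus>\<^bsub>M\<^esub> x) = \<ominus>\<^bsub>N\<^esub> h x"
    and "x \<in> carrier M \<Longrightarrow> y \<in> carrier M \<Longrightarrow> h (x \<ominus>\<^bsub>M\<^esub> y) = h x \<ominus>\<^bsub>N\<^esub> h y"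
proof -
  interpret M: abelian_group M by fact
  interpret N: abelian_group N by fact
  show zero: "h \<zero>\<^bsub>M\<^esub> = \<zero>\<^bsub>N\<^esub>"
    using bimodule_homD(2)[OF h, of "\<zero>\<^bsub>M\<^esub>" "\<zero>\<^bsub>M\<^esub>"] bimodule_homD(1)[OF h, of "\<zero>\<^bsub>M\<^esub>"]
    by (metis M.l_zero M.zero_closed N.add.l_cancel_one)
  show neg: "h (\<ominus>\<^bsub>M\<^esub> x) = \<ominus>\<^bsub>N\<^esub> h x" if "x \<in> carrier M" for x
  proof -
    have "h (\<ominus>\<^bsub>M\<^esub> x) \<oplus>\<^bsub>N\<^esub> h x = \<zero>\<^bsub>N\<^esub>"
      using bimodule_homD(2)[OF h, of "\<ominus>\<^bsub>M\<^esub> x" x] that by (simp add: M.l_neg zero)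
    then show ?thesis
      using that bimodule_homD(1)[OF h] by (intro N.minus_equality[symmetric]) simp_all
  qed
  show "x \<in> carrier M \<Longrightarrow> y \<in> carrier M \<Longrightarrow> h (x \<ominus>\<^bsub>M\<^esub> y) = h x \<ominus>\<^bsub>N\<^esub> h y"
    using bimodule_homD(2)[OF h, of x "\<ominus>\<^bsub>M\<^esub> y"] by (simp add: M.minus_eq N.minus_eq neg)
qed

lemma bimodule_hom_comp:
  "g \<in> bimodule_hom A M N \<Longrightarrow> h \<in> bimodule_hom A N P \<Longrightarrow> (\<lambda>x. h (g x)) \<in> bimodule_hom A M P"
  by (auto simp: bimodule_hom_def Pi_iff)

context free_bimodule begin

interpretation A: ring A by (rule ring_A)

lemma G_act_zero:
  "a \<in> carrier A \<Longrightarrow> lact G a \<zero>\<^bsub>G\<^esub> = \<zero>\<^bsub>G\<^esub>" "a \<in> carrier A \<Longrightarrow> ract G \<zero>\<^bsub>G\<^esub> a = \<zero>\<^bsub>G\<^esub>"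
  using G_lact(2)[of a "\<zero>\<^bsub>G\<^esub>" "\<zero>\<^bsub>G\<^esub>"] G_lact(1)[of a "\<zero>\<^bsub>G\<^esub>"]
    G_ract(2)[of a "\<zero>\<^bsub>G\<^esub>" "\<zero>\<^bsub>G\<^esub>"] G_ract(1)[of a "\<zero>\<^bsub>G\<^esub>"] by simp_all

lemma zero_act_G:
  assumes "z \<in> carrier G"
  shows "lact G \<zero>\<^bsub>A\<^esub> z = \<zero>\<^bsub>G\<^esub>" "ract G z \<zero>\<^bsub>A\<^esub> = \<zero>\<^bsub>G\<^esub>"
  using assms by (induct z rule: G_induct) (simp_all add: G_lact G_ract t3_zero)

text \<open>Every tensor is a sum of two-sided multiples of the generators
  \<open>1 \<otimes> x \<otimes> 1\<close>. Applied to composites of consecutive maps this gives one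
  half of exactness.\<close>

lemma hom_zero:
  assumes h: "h \<in> bimodule_hom A G N" and N: "abelian_group N"
    and act: "\<And>a. a \<in> carrier A \<Longrightarrow> lact N a \<zero>\<^bsub>N\<^esub> = \<zero>\<^bsub>N\<^esub> \<and> ract N \<zero>\<^bsub>N\<^esub> a = \<zero>\<^bsub>N\<^esub>"
    and gen: "\<And>x. x \<in> X \<Longrightarrow> h (t3 \<one>\<^bsub>A\<^esub> (pvec x) \<one>\<^bsub>A\<^esub>) = \<zero>\<^bsub>N\<^esub>"
    and z: "z \<in> carrier G"
  shows "h z = \<zero>\<^bsub>N\<^esub>"
proof -
  interpret N: abelian_group N by fact
  note hD = bimodule_homD[OF h]
  obtain g where g: "Poly_Mapping.keys g \<subseteq> chains" "z = sigma g"
    by (rule sigma_surj[OF z])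
  have "h (sigma g) = \<zero>\<^bsub>N\<^esub>"
    using g(1)
  proof (induct g rule: keys_induct)
    case zero
    then show ?case
      using bimodule_hom_minus(1)[OF h G_abelian N] by (simp add: sigma_zero)
  next
    case (single t k)
    obtain p x q where t: "t = (p, x, q)" "p \<in> paths Q" "x \<in> X" "q \<in> paths Q"
      using single by (cases t) (auto simp: chains_def)
    have "t3 \<one>\<^bsub>A\<^esub> (pvec x) \<one>\<^bsub>A\<^esub> \<in> carrier G"
      using t(3) by (simp add: t3_closed)
    then show ?case
      using t by (simp add: sigma_single hD pr_closed single_in_kspan G_ract(1) gen act)
  next
    case (add g h)
    then show ?case
      by (simp add: sigma hD)
  qed
  then show ?thesis
    by (simp add: g(2))
qed

lemma keys_lmul_chains:
  assumes "a \<in> kspan (paths Q)" "Poly_Mapping.keys g \<subseteq> chains"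
  shows "Poly_Mapping.keys (lmul a g) \<subseteq> chains"
  by (rule keys_lmul) (use assms in \<open>auto simp: kspan_iff chains_def\<close>)

lemma keys_rmul_chains:
  assumes "a \<in> kspan (paths Q)" "Poly_Mapping.keys g \<subseteq> chains"
  shows "Poly_Mapping.keys (rmul g a) \<subseteq> chains"
  by (rule keys_rmul) (use assms in \<open>auto simp: kspan_iff chains_def\<close>)

lemma keys_lmul_good:
  assumes "a \<in> kspan (paths Q)" "Poly_Mapping.keys g \<subseteq> good"
  shows "Poly_Mapping.keys (lmul a g) \<subseteq> good"
  by (rule keys_lmul) (use assms in \<open>auto simp: kspan_iff\<close>)

lemma keys_rmul_good:
  assumes "a \<in> kspan (paths Q)" "Poly_Mapping.keys g \<subseteq> good"
  shows "Poly_Mapping.keys (rmul g a) \<subseteq> good"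
  by (rule keys_rmul) (use assms in \<open>auto simp: kspan_iff\<close>)

text \<open>The lifts of the image of \<open>d\<close>. Supports are confined to \<open>good\<close>
  because only there is \<open>sigma\<close> determined.\<close>

definition preimage where
  "preimage d C = {g. Poly_Mapping.keys g \<subseteq> good \<and> sigma g \<in> d ` carrier C}"

text \<open>The last two claims hold because an element of \<open>I\<close> acts as zero on the
  tensor product and zero is in the image of \<open>d\<close>. They are what makes normal forms and
  arbitrary representatives interchangeable modulo this subspace.\<close>

lemma preimage:
  assumes d: "d \<in> bimodule_hom A C G" and C: "abelian_group C"
    and C_act: "\<forall>a\<in>carrier A. \<forall>z\<in>carrier C. lact C a z \<in> carrier C \<and> ract C z a \<in> carrier C"
  shows "subsp (preimage d C)"
    and "g \<in> preimage d C \<Longrightarrow> a \<in> kspan (paths Q) \<Longrightarrow> lmul a g \<in> preimage d C"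
    and "g \<in> preimage d C \<Longrightarrow> a \<in> kspan (paths Q) \<Longrightarrow> rmul g a \<in> preimage d C"
    and "Poly_Mapping.keys g \<subseteq> good \<Longrightarrow> a \<in> I \<Longrightarrow> lmul a g \<in> preimage d C"
    and "Poly_Mapping.keys g \<subseteq> good \<Longrightarrow> a \<in> I \<Longrightarrow> rmul g a \<in> preimage d C"
proof -
  interpret C: abelian_group C by fact
  note dD = bimodule_homD[OF d]
  have zero: "\<zero>\<^bsub>G\<^esub> \<in> d ` carrier C"
    using bimodule_hom_minus(1)[OF d C G_abelian] by (metis C.zero_closed imageI)
  show L: "lmul a g \<in> preimage d C" if "g \<in> preimage d C" "a \<in> kspan (paths Q)" for a g
  proof -
    have g: "Poly_Mapping.keys g \<subseteq> good" "sigma g \<in> d ` carrier C"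
      using that by (simp_all add: preimage_def)
    then obtain z where "z \<in> carrier C" "sigma g = d z"
      by blast
    then have "sigma (lmul a g) = d (lact C (pr a) z)" "lact C (pr a) z \<in> carrier C"
      using sigma_lmul[OF g(1) that(2)] that(2) C_act by (simp_all add: dD pr_closed)
    then show ?thesis
      using keys_lmul_good[OF that(2) g(1)] by (simp add: preimage_def)
  qed
  show "rmul g a \<in> preimage d C" if "g \<in> preimage d C" "a \<in> kspan (paths Q)"
  proof -
    have g: "Poly_Mapping.keys g \<subseteq> good" "sigma g \<in> d ` carrier C"
      using that by (simp_all add: preimage_def)
    then obtain z where "z \<in> carrier C" "sigma g = d z"
      by blast
    then have "sigma (rmul g a) = d (ract C z (pr a))" "ract C z (pr a) \<in> carrier C"
      using sigma_rmul[OF g(1) that(2)] that(2) C_act by (simp_all add: dD pr_closed)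
    then show ?thesis
      using keys_rmul_good[OF that(2) g(1)] by (simp add: preimage_def)
  qed
  show "lmul a g \<in> preimage d C" if "Poly_Mapping.keys g \<subseteq> good" "a \<in> I"
    using sigma_lmul[OF that(1) I_in_kspan[OF that(2)]] keys_lmul_good[OF I_in_kspan[OF that(2)] that(1)]
      zero by (simp add: preimage_def pr_I[OF that(2)] zero_act_G sigma)
  show "rmul g a \<in> preimage d C" if "Poly_Mapping.keys g \<subseteq> good" "a \<in> I"
    using sigma_rmul[OF that(1) I_in_kspan[OF that(2)]] keys_rmul_good[OF I_in_kspan[OF that(2)] that(1)]
      zero by (simp add: preimage_def pr_I[OF that(2)] zero_act_G sigma)
  show "subsp (preimage d C)"
    unfolding subsp_def
  proof (intro conjI ballI allI)
    show "0 \<in> preimage d C"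
      using zero by (simp add: preimage_def sigma_zero)
  next
    fix g h
    assume gh: "g \<in> preimage d C" "h \<in> preimage d C"
    then obtain y z where yz: "y \<in> carrier C" "sigma g = d y" "z \<in> carrier C" "sigma h = d z"
      unfolding preimage_def by blast
    then have "sigma (g + h) = d (y \<oplus>\<^bsub>C\<^esub> z)"
      by (simp add: sigma dD)
    moreover have "Poly_Mapping.keys (g + h) \<subseteq> good"
      using gh keys_add[of g h] unfolding preimage_def by blast
    ultimately show "g + h \<in> preimage d C"
      using yz by (simp add: preimage_def)
  next
    fix c g
    assume g: "g \<in> preimage d C"
    then have "smul c g = lmul (smul c e1) g"
      using lmul_e1[of g] by (simp add: preimage_def lmul_distrib)
    then show "smul c g \<in> preimage d C"
      using L[OF g subsp_smul[OF subsp_kspan one_closed]] by simp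
  qed
qed

section \<open>The tensor square of the algebra over the vertices\<close>

sublocale T2: tensor_product EE AE EA
  by (rule tensor_product.intro[OF AE_abelian]) (simp_all add: pr_EE_closed A.m_closed)

abbreviation "t2 \<equiv> tens2 Q I"

lemma AA_def': "AA Q I = tensor EE AE EA" and t2_def: "t2 a b = pure_tensor EE AE EA a b"
  by (simp_all add: AA_def tens2_def)

lemma AA_abelian: "abelian_group (AA Q I)"
  unfolding AA_def' by (rule T2.abelian_group_tensor)

sublocale AA: abelian_group "AA Q I"
  by (rule AA_abelian)

lemma t2_closed: "a \<in> carrier A \<Longrightarrow> b \<in> carrier A \<Longrightarrow> t2 a b \<in> carrier (AA Q I)"
  unfolding AA_def' t2_def using T2.pure_closed[of a b] by simp

lemma t2_add:
  "a \<in> carrier A \<Longrightarrow> a' \<in> carrier A \<Longrightarrow> b \<in> carrier A \<Longrightarrow> t2 (a \<oplus>\<^bsub>A\<^esub> a') b = t2 a b \<oplus>\<^bsub>AA Q I\<^esub> t2 a' b"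
  "a \<in> carrier A \<Longrightarrow> b \<in> carrier A \<Longrightarrow> b' \<in> carrier A \<Longrightarrow> t2 a (b \<oplus>\<^bsub>A\<^esub> b') = t2 a b \<oplus>\<^bsub>AA Q I\<^esub> t2 a b'"
  unfolding AA_def' t2_def using T2.pure_add_left[of a a' b] T2.pure_add_right[of a b b'] by simp_all

lemma t2_zero:
  "a \<in> carrier A \<Longrightarrow> t2 a \<zero>\<^bsub>A\<^esub> = \<zero>\<^bsub>AA Q I\<^esub>" "a \<in> carrier A \<Longrightarrow> t2 \<zero>\<^bsub>A\<^esub> a = \<zero>\<^bsub>AA Q I\<^esub>"
  unfolding AA_def' t2_def using T2.pure_zero_left[of a] T2.pure_zero_right[of a] by simp_all

lemma t2_balanced:
  "a \<in> carrier A \<Longrightarrow> b \<in> carrier A \<Longrightarrow> e \<in> EE \<Longrightarrow> t2 (a \<otimes>\<^bsub>A\<^esub> pr e) b = t2 a (pr e \<otimes>\<^bsub>A\<^esub> b)"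
  unfolding t2_def using T2.pure_balanced[of a e b] by simp

lemma AA_lact:
  assumes "b \<in> carrier A"
  shows "z \<in> carrier (AA Q I) \<Longrightarrow> lact (AA Q I) b z \<in> carrier (AA Q I)"
    and "z \<in> carrier (AA Q I) \<Longrightarrow> z' \<in> carrier (AA Q I) \<Longrightarrow>
      lact (AA Q I) b (z \<oplus>\<^bsub>AA Q I\<^esub> z') = lact (AA Q I) b z \<oplus>\<^bsub>AA Q I\<^esub> lact (AA Q I) b z'"
    and "a \<in> carrier A \<Longrightarrow> c \<in> carrier A \<Longrightarrow> lact (AA Q I) b (t2 a c) = t2 (b \<otimes>\<^bsub>A\<^esub> a) c"
proof -
  have *: "n \<in> carrier AE \<Longrightarrow> lact AE b n \<in> carrier AE"
    "n \<in> carrier AE \<Longrightarrow> n' \<in> carrier AE \<Longrightarrow> lact AE b (n \<oplus>\<^bsub>AE\<^esub> n') = lact AE b n \<oplus>\<^bsub>AE\<^esub> lact AE b n'"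
    "n \<in> carrier AE \<Longrightarrow> e' \<in> EE \<Longrightarrow> lact AE b (ract AE n e') = ract AE (lact AE b n) e'" for n n' e'
    using assms by (simp_all add: A.r_distr A.m_assoc pr_EE_closed)
  note L = T2.lact_tensor[OF *]
  show "z \<in> carrier (AA Q I) \<Longrightarrow> lact (AA Q I) b z \<in> carrier (AA Q I)"
    unfolding AA_def' by (rule L(1))
  show "z \<in> carrier (AA Q I) \<Longrightarrow> z' \<in> carrier (AA Q I) \<Longrightarrow>
      lact (AA Q I) b (z \<oplus>\<^bsub>AA Q I\<^esub> z') = lact (AA Q I) b z \<oplus>\<^bsub>AA Q I\<^esub> lact (AA Q I) b z'"
    unfolding AA_def' by (rule L(2))
  show "a \<in> carrier A \<Longrightarrow> c \<in> carrier A \<Longrightarrow> lact (AA Q I) b (t2 a c) = t2 (b \<otimes>\<^bsub>A\<^esub> a) c"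
    using L(3)[of a c] unfolding AA_def' t2_def by simp
qed

lemma AA_ract:
  assumes "b \<in> carrier A"
  shows "z \<in> carrier (AA Q I) \<Longrightarrow> ract (AA Q I) z b \<in> carrier (AA Q I)"
    and "z \<in> carrier (AA Q I) \<Longrightarrow> z' \<in> carrier (AA Q I) \<Longrightarrow>
      ract (AA Q I) (z \<oplus>\<^bsub>AA Q I\<^esub> z') b = ract (AA Q I) z b \<oplus>\<^bsub>AA Q I\<^esub> ract (AA Q I) z' b"
    and "a \<in> carrier A \<Longrightarrow> c \<in> carrier A \<Longrightarrow> ract (AA Q I) (t2 a c) b = t2 a (c \<otimes>\<^bsub>A\<^esub> b)"
proof -
  have *: "n \<in> carrier EA \<Longrightarrow> ract EA n b \<in> carrier EA"
    "n \<in> carrier EA \<Longrightarrow> n' \<in> carrier EA \<Longrightarrow> ract EA (n \<oplus>\<^bsub>EA\<^esub> n') b = ract EA n b \<oplus>\<^bsub>EA\<^esub> ract EA n' b"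
    "n \<in> carrier EA \<Longrightarrow> e \<in> EE \<Longrightarrow> ract EA (lact EA e n) b = lact EA e (ract EA n b)" for n n' e
    using assms by (simp_all add: A.l_distr A.m_assoc pr_EE_closed)
  note L = T2.ract_tensor[OF *]
  show "z \<in> carrier (AA Q I) \<Longrightarrow> ract (AA Q I) z b \<in> carrier (AA Q I)"
    unfolding AA_def' by (rule L(1))
  show "z \<in> carrier (AA Q I) \<Longrightarrow> z' \<in> carrier (AA Q I) \<Longrightarrow>
      ract (AA Q I) (z \<oplus>\<^bsub>AA Q I\<^esub> z') b = ract (AA Q I) z b \<oplus>\<^bsub>AA Q I\<^esub> ract (AA Q I) z' b"
    unfolding AA_def' by (rule L(2))
  show "a \<in> carrier A \<Longrightarrow> c \<in> carrier A \<Longrightarrow> ract (AA Q I) (t2 a c) b = t2 a (c \<otimes>\<^bsub>A\<^esub> b)"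
    using L(3)[of a c] unfolding AA_def' t2_def by simp
qed

lemma AA_act_minus:
  assumes "b \<in> carrier A" "z \<in> carrier (AA Q I)" "z' \<in> carrier (AA Q I)"
  shows "lact (AA Q I) b (z \<ominus>\<^bsub>AA Q I\<^esub> z') = lact (AA Q I) b z \<ominus>\<^bsub>AA Q I\<^esub> lact (AA Q I) b z'"
    and "ract (AA Q I) (z \<ominus>\<^bsub>AA Q I\<^esub> z') b = ract (AA Q I) z b \<ominus>\<^bsub>AA Q I\<^esub> ract (AA Q I) z' b"
proof -
  have eq: "(z \<ominus>\<^bsub>AA Q I\<^esub> z') \<oplus>\<^bsub>AA Q I\<^esub> z' = z"
    using assms by (simp add: AA.minus_eq AA.a_assoc AA.l_neg)
  have closed: "z \<ominus>\<^bsub>AA Q I\<^esub> z' \<in> carrier (AA Q I)"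
    using assms by simp
  have cancel: "x = y \<ominus>\<^bsub>AA Q I\<^esub> w" if "x \<oplus>\<^bsub>AA Q I\<^esub> w = y" "x \<in> carrier (AA Q I)" "w \<in> carrier (AA Q I)" for x y w
    using that by (auto simp: AA.minus_eq AA.a_assoc AA.r_neg)
  show "lact (AA Q I) b (z \<ominus>\<^bsub>AA Q I\<^esub> z') = lact (AA Q I) b z \<ominus>\<^bsub>AA Q I\<^esub> lact (AA Q I) b z'"
    using AA_lact(2)[OF assms(1) closed assms(3), symmetric] closed assms
    by (intro cancel) (simp_all add: eq AA_lact(1))
  show "ract (AA Q I) (z \<ominus>\<^bsub>AA Q I\<^esub> z') b = ract (AA Q I) z b \<ominus>\<^bsub>AA Q I\<^esub> ract (AA Q I) z' b"
    using AA_ract(2)[OF assms(1) closed assms(3), symmetric] closed assms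
    by (intro cancel) (simp_all add: eq AA_ract(1))
qed

lemma AA_induct [consumes 1, case_names pure add]:
  assumes "z \<in> carrier (AA Q I)" "\<And>a b. a \<in> carrier A \<Longrightarrow> b \<in> carrier A \<Longrightarrow> P (t2 a b)"
    "\<And>z z'. z \<in> carrier (AA Q I) \<Longrightarrow> z' \<in> carrier (AA Q I) \<Longrightarrow> P z \<Longrightarrow> P z' \<Longrightarrow> P (z \<oplus>\<^bsub>AA Q I\<^esub> z')"
  shows "P z"
  using assms(1) unfolding AA_def'
proof (induct z rule: T2.tensor_induct)
  case (pure a b)
  then show ?case
    using assms(2)[of a b] by (simp add: t2_def)
qed (use assms(3) in \<open>simp add: AA_def'\<close>)

end

section \<open>The normal form map and the Leibniz rule for vectors\<close>

context redsys begin

lemma paths_of_len_paths: "paths_of_len Q n \<subseteq> paths Q"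
  by (auto simp: paths_of_len_def)

text \<open>An irreducible vector is its own normal form, so two of them in one class coincide. The
  map \<beta> of the sequence is thereby computed by reductions.\<close>

lemma normal_form_eq:
  assumes "x \<in> kspan (paths Q)"
  shows "normal_form Q I \<R> x = NF x"
  unfolding normal_form_def
proof (rule the_equality)
  have "pr (NF x) = pr x"
    using pr_eq_iff[OF assms NF_in_kspan[OF assms]] NF_diff_in_I[OF assms] by simp
  then show "NF x \<in> kspan (irred_paths Q \<R>) \<and> pr (NF x) = pr x"
    using NF_irred[OF assms] by (simp add: irred_iff)
next
  fix y
  assume y: "y \<in> kspan (irred_paths Q \<R>) \<and> pr y = pr x"
  then have "irred Q \<R> y"
    by (simp add: irred_iff)
  then have "NF y = y" "y \<in> kspan (paths Q)"
    by (simp_all add: NF_irred_eq irred_def)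
  then show "y = NF x"
    using y assms pr_eq_iff[of y x] NF_eq_iff[of y x] by simp
qed

lemma sum_klin:
  assumes "klin T"
  shows "T (\<Sum>i\<in>B. g i) = (\<Sum>i\<in>B. T (g i))"
  using assms by (induct B rule: infinite_finite_induct) (simp_all add: klin_zero klin_plus)

text \<open>For paths that do not compose, both terms on the right vanish too, because the outer
  factors in \<open>phi0p\<close> keep the end vertices of the path. The rule is therefore bilinear
  without side conditions.\<close>

lemma phi0_pmult:
  "lin (phi0p Q) (pmult x y) = lmul x (lin (phi0p Q) y) + rmul (lin (phi0p Q) x) (y :: ('v, 'a, 'k) pathvec)"
proof (rule klin_eq[where S = "\<lambda>x. lin (phi0p Q) (pmult x y)"])
  fix q
  show "lin (phi0p Q) (pmult (pvec q) y) = lmul (pvec q) (lin (phi0p Q) y) + rmul (lin (phi0p Q) (pvec q)) y"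
  proof (rule klin_eq[where S = "\<lambda>y. lin (phi0p Q) (pmult (pvec q) y)"])
    fix p
    show "lin (phi0p Q) (pmult (pvec q) (pvec p)) =
      lmul (pvec q) (lin (phi0p Q) (pvec p)) + rmul (lin (phi0p Q) (pvec q)) (pvec p :: ('v, 'a, 'k) pathvec)"
    proof (cases "composable q p")
      case False
      then have "lmul (pvec q) (phi0p Q p) = (0 :: ('v, 'a, 'k) tripvec)" "rmul (phi0p Q q) (pvec p) = (0 :: ('v, 'a, 'k) tripvec)"
        unfolding phi0p_def sum_klin[OF klin_lmul[OF klin_id]] sum_klin[OF klin_rmul[OF klin_id]]
        by (simp_all add: Let_def lmul_single rmul_single composable_def)
      then show ?thesis
        using False by simp
    qed (simp add: phi0p_pcomp)
  qed (intro klin_path_intros)+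
qed (intro klin_path_intros)+

end

section \<open>Exactness\<close>

locale resolution = redsys Q I \<R>
  for Q :: "('v, 'a) pre_digraph" and I :: "('v, 'a, 'k::field) pathvec set" and \<R> +
  fixes r t :: "('v, 'a) qpath \<Rightarrow> ('v, 'a, 'k) basic_red list" and \<delta>\<^sub>m \<delta>\<^sub>0 d\<^sub>1 d\<^sub>2
  assumes r: "p \<in> ambiguities Q \<R> \<Longrightarrow> r p \<in> reductions Q \<R> \<and> starts_on_left Q \<R> (r p) p \<and>
        reduce (r p) (pvec p) \<in> kspan (irred_paths Q \<R>)"
    and t: "p \<in> ambiguities Q \<R> \<Longrightarrow> t p \<in> reductions Q \<R> \<and> starts_on_right Q \<R> (t p) p \<and>
        reduce (t p) (pvec p) \<in> kspan (irred_paths Q \<R>)"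
    and \<delta>m: "\<delta>\<^sub>m \<in> bimodule_hom A (AA Q I) (regular_bimodule Q I)"
    and \<delta>m_t2: "a \<in> carrier A \<Longrightarrow> b \<in> carrier A \<Longrightarrow> \<delta>\<^sub>m (tens2 Q I a b) = a \<otimes>\<^bsub>A\<^esub> b"
    and \<delta>0: "\<delta>\<^sub>0 \<in> bimodule_hom A (AXA Q I (paths_of_len Q 1)) (AA Q I)"
    and \<delta>0_t3: "\<alpha> \<in> paths_of_len Q 1 \<Longrightarrow> \<delta>\<^sub>0 (tens3 Q I (paths_of_len Q 1) \<one>\<^bsub>A\<^esub> (pvec \<alpha>) \<one>\<^bsub>A\<^esub>) =
        tens2 Q I (pr (pvec \<alpha>)) \<one>\<^bsub>A\<^esub> \<ominus>\<^bsub>AA Q I\<^esub> tens2 Q I \<one>\<^bsub>A\<^esub> (pr (pvec \<alpha>))"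
    and d1: "d\<^sub>1 \<in> bimodule_hom A (AXA Q I (tips \<R>)) (AXA Q I (paths_of_len Q 1))"
    and d1_t3: "s \<in> tips \<R> \<Longrightarrow> d\<^sub>1 (tens3 Q I (tips \<R>) \<one>\<^bsub>A\<^esub> (pvec s) \<one>\<^bsub>A\<^esub>) =
        \<phi>0 Q I (pvec s) \<ominus>\<^bsub>AXA Q I (paths_of_len Q 1)\<^esub> \<phi>0 Q I (normal_form Q I \<R> (pvec s))"
    and d2: "d\<^sub>2 \<in> bimodule_hom A (AXA Q I (ambiguities Q \<R>)) (AXA Q I (tips \<R>))"
    and d2_t3: "p \<in> ambiguities Q \<R> \<Longrightarrow> d\<^sub>2 (tens3 Q I (ambiguities Q \<R>) \<one>\<^bsub>A\<^esub> (pvec p) \<one>\<^bsub>A\<^esub>) =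
        \<phi>1 Q I \<R> (t p) (pvec p) \<ominus>\<^bsub>AXA Q I (tips \<R>)\<^esub> \<phi>1 Q I \<R> (r p) (pvec p)"
begin

text \<open>Keeps the index in \<open>paths_of_len Q 1\<close> in the shape in which the facts on
  arrows are stated.\<close>

declare One_nat_def [simp del]

lemma tips_paths: "tips \<R> \<subseteq> paths Q"
  using rule_facts(1) by (auto simp: tips_def)

lemma ambiguities_paths: "ambiguities Q \<R> \<subseteq> paths Q"
  by (auto simp: ambiguities_def left_ambiguity_def paths_of_len_def irred_paths_def)

sublocale B0: free_bimodule Q I \<R> "paths_of_len Q 1"
  by (rule free_bimodule.intro[OF redsys_axioms], unfold_locales) (rule paths_of_len_paths)

sublocale B1: free_bimodule Q I \<R> "tips \<R>"
  by (rule free_bimodule.intro[OF redsys_axioms], unfold_locales) (rule tips_paths)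

sublocale B2: free_bimodule Q I \<R> "ambiguities Q \<R>"
  by (rule free_bimodule.intro[OF redsys_axioms], unfold_locales) (rule ambiguities_paths)

interpretation A: ring A by (rule ring_A)

section \<open>Lifts of the maps of the sequence\<close>

abbreviation "phi x \<equiv> (lin (phi0p Q) x :: ('v, 'a, 'k) tripvec)"
abbreviation "G0 \<equiv> AXA Q I (paths_of_len Q 1)"
abbreviation "G1 \<equiv> AXA Q I (tips \<R>)"
abbreviation "G2 \<equiv> AXA Q I (ambiguities Q \<R>)"
abbreviation "T \<equiv> AA Q I"
abbreviation "t2 \<equiv> tens2 Q I"

lemma regular_simps:
  "carrier (regular_bimodule Q I) = carrier A" "\<zero>\<^bsub>regular_bimodule Q I\<^esub> = \<zero>\<^bsub>A\<^esub>"
  "add (regular_bimodule Q I) = add A"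
  "lact (regular_bimodule Q I) a b = a \<otimes>\<^bsub>A\<^esub> b" "ract (regular_bimodule Q I) a b = a \<otimes>\<^bsub>A\<^esub> b"
  by (simp_all add: restr_bimodule_def)

lemma regular_abelian: "abelian_group (regular_bimodule Q I)"
  by (rule abelian_group_restr[OF A.abelian_group_axioms])

lemma T_act_zero: "a \<in> carrier A \<Longrightarrow> lact T a \<zero>\<^bsub>T\<^esub> = \<zero>\<^bsub>T\<^esub>" "a \<in> carrier A \<Longrightarrow> ract T \<zero>\<^bsub>T\<^esub> a = \<zero>\<^bsub>T\<^esub>"
  using B0.AA_lact(2)[of a "\<zero>\<^bsub>T\<^esub>" "\<zero>\<^bsub>T\<^esub>"] B0.AA_lact(1)[of a "\<zero>\<^bsub>T\<^esub>"]
    B0.AA_ract(2)[of a "\<zero>\<^bsub>T\<^esub>" "\<zero>\<^bsub>T\<^esub>"] B0.AA_ract(1)[of a "\<zero>\<^bsub>T\<^esub>"] by simp_all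

lemma arrow_factors:
  assumes "p \<in> paths Q" "i < len p" "c = arrows p ! i"
  shows "(Path (head Q c) (drop (Suc i) (arrows p)) (target p), Path (tail Q c) [c] (head Q c),
    Path (source p) (take i (arrows p)) (tail Q c)) \<in> B0.chains"
proof -
  have "arrows p = take i (arrows p) @ c # drop (Suc i) (arrows p)"
    using assms(2,3) by (simp add: len_def id_take_nth_drop)
  then have "pre_digraph.awalk Q (source p) (take i (arrows p) @ c # drop (Suc i) (arrows p)) (target p)"
    using assms(1) by (simp add: paths_def)
  then obtain v where v: "pre_digraph.awalk Q (source p) (take i (arrows p)) v"
      "pre_digraph.awalk Q v (c # drop (Suc i) (arrows p)) (target p)"
    unfolding wf_digraph.awalk_append_iff[OF wf] by blast
  then have c: "c \<in> arcs Q" "v = tail Q c" "pre_digraph.awalk Q (head Q c) (drop (Suc i) (arrows p)) (target p)"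
    unfolding wf_digraph.awalk_Cons_iff[OF wf] by simp_all
  have "pre_digraph.awalk Q (tail Q c) [c] (head Q c)"
    by (rule wf_digraph.arc_implies_awalk[OF wf c(1)])
  then have "Path (tail Q c) [c] (head Q c) \<in> paths_of_len Q 1"
    by (simp add: paths_of_len_def paths_def len_def)
  then show ?thesis
    unfolding B0.chains_def using v(1) c by (simp add: paths_def composable_def)
qed

lemma keys_phi0p:
  assumes "p \<in> paths Q"
  shows "Poly_Mapping.keys (phi0p Q p :: ('v, 'a, 'k) tripvec) \<subseteq> B0.chains"
  unfolding phi0p_def Let_def
proof (rule order_trans[OF keys_sum], rule UN_least)
  fix i
  assume "i \<in> {..<len p}"
  then have "(Path (head Q (arrows p ! i)) (drop (Suc i) (arrows p)) (target p),
      Path (tail Q (arrows p ! i)) [arrows p ! i] (head Q (arrows p ! i)),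
      Path (source p) (take i (arrows p)) (tail Q (arrows p ! i))) \<in> B0.chains"
    by (intro arrow_factors[OF assms]) simp_all
  then show "Poly_Mapping.keys (Poly_Mapping.single (Path (head Q (arrows p ! i)) (drop (Suc i) (arrows p)) (target p),
      Path (tail Q (arrows p ! i)) [arrows p ! i] (head Q (arrows p ! i)),
      Path (source p) (take i (arrows p)) (tail Q (arrows p ! i))) (1 :: 'k)) \<subseteq> B0.chains"
    by simp
qed

lemma keys_phi: "x \<in> kspan (paths Q) \<Longrightarrow> Poly_Mapping.keys (phi x) \<subseteq> B0.chains"
  using keys_lin[of "phi0p Q" x] keys_phi0p unfolding kspan_iff by blast

lemma chains_goodD: "Poly_Mapping.keys g \<subseteq> B0.chains \<Longrightarrow> Poly_Mapping.keys g \<subseteq> B0.good"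
  "Poly_Mapping.keys g \<subseteq> B1.chains \<Longrightarrow> Poly_Mapping.keys g \<subseteq> B1.good" for g :: "('v, 'a, 'k) tripvec"
  using B0.chains_good B1.chains_good by blast+

lemma sigma_phi0p: "p \<in> paths Q \<Longrightarrow> B0.sigma (phi0p Q p) = \<phi>0_path Q I p"
  unfolding phi0p_def \<phi>0_path_def B0.sigma_sum[OF finite_lessThan]
proof (rule B0.G.finsum_cong'[OF refl])
  fix i
  assume p: "p \<in> paths Q" and i: "i \<in> {..<len p}"
  let ?c = "arrows p ! i"
  have ch: "(Path (head Q ?c) (drop (Suc i) (arrows p)) (target p), Path (tail Q ?c) [?c] (head Q ?c),
      Path (source p) (take i (arrows p)) (tail Q ?c)) \<in> B0.chains"
    by (rule arrow_factors[OF p _ refl]) (use i in simp)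
  show "B0.sigma (let c = ?c in Poly_Mapping.single (Path (head Q c) (drop (Suc i) (arrows p)) (target p),
      Path (tail Q c) [c] (head Q c), Path (source p) (take i (arrows p)) (tail Q c)) 1) =
    (let c = ?c in B0.t3 (pr (pvec (Path (head Q c) (drop (Suc i) (arrows p)) (target p))))
      (pvec (Path (tail Q c) [c] (head Q c))) (pr (pvec (Path (source p) (take i (arrows p)) (tail Q c)))))"
    unfolding Let_def by (rule B0.sigma(3)[OF subsetD[OF B0.chains_good ch]])
next
  assume p: "p \<in> paths Q"
  show "(\<lambda>i. let c = arrows p ! i in B0.t3 (pr (pvec (Path (head Q c) (drop (Suc i) (arrows p)) (target p))))
      (pvec (Path (tail Q c) [c] (head Q c))) (pr (pvec (Path (source p) (take i (arrows p)) (tail Q c)))))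
    \<in> {..<len p} \<rightarrow> carrier G0"
  proof
    fix i
    assume i: "i \<in> {..<len p}"
    let ?c = "arrows p ! i"
    have "(Path (head Q ?c) (drop (Suc i) (arrows p)) (target p), Path (tail Q ?c) [?c] (head Q ?c),
        Path (source p) (take i (arrows p)) (tail Q ?c)) \<in> B0.chains"
      by (rule arrow_factors[OF p _ refl]) (use i in simp)
    then show "(let c = ?c in B0.t3 (pr (pvec (Path (head Q c) (drop (Suc i) (arrows p)) (target p))))
      (pvec (Path (tail Q c) [c] (head Q c))) (pr (pvec (Path (source p) (take i (arrows p)) (tail Q c))))) \<in> carrier G0"
      unfolding Let_def B0.chains_def by (intro B0.t3_closed pr_closed) simp_all
  qed
qed

lemma sigma_phi:
  assumes "x \<in> kspan (paths Q)"
  shows "B0.sigma (phi x) = \<phi>0 Q I x"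
proof -
  have x: "p \<in> paths Q" if "p \<in> Poly_Mapping.keys x" for p
    using assms that by (auto simp: kspan_iff)
  have eq: "B0.sigma (smul (Poly_Mapping.lookup x p) (phi0p Q p)) =
      ksmult Q I G0 (Poly_Mapping.lookup x p) (\<phi>0_path Q I p)" if "p \<in> Poly_Mapping.keys x" for p
    using B0.sigma_smul[OF chains_goodD(1)[OF keys_phi0p[OF x[OF that]]]] sigma_phi0p[OF x[OF that]] by simp
  have "B0.sigma (phi x) = finsum G0 (\<lambda>p. B0.sigma (smul (Poly_Mapping.lookup x p) (phi0p Q p))) (Poly_Mapping.keys x)"
    unfolding lin_def by (rule B0.sigma_sum[OF finite_keys])
  also have "\<dots> = \<phi>0 Q I x"
    unfolding \<phi>0_def
  proof (rule B0.G.finsum_cong'[OF refl _ eq])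
    show "(\<lambda>p. ksmult Q I G0 (Poly_Mapping.lookup x p) (\<phi>0_path Q I p)) \<in> Poly_Mapping.keys x \<rightarrow> carrier G0"
    proof
      fix p
      assume "p \<in> Poly_Mapping.keys x"
      show "ksmult Q I G0 (Poly_Mapping.lookup x p) (\<phi>0_path Q I p) \<in> carrier G0"
        unfolding eq[OF \<open>p \<in> Poly_Mapping.keys x\<close>, symmetric] by (rule B0.sigma(1))
    qed
  qed
  finally show ?thesis .
qed

lemma keys_phi1v: "rs \<in> reductions Q \<R> \<Longrightarrow> Poly_Mapping.keys (phi1v rs x) \<subseteq> B1.chains"
proof (induct rs arbitrary: x rule: list.induct)
  case (Cons \<rho> rs)
  obtain a s f c where \<rho>: "\<rho> = (a, s, f, c)" "(a, s, f, c) \<in> BR"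
    using Cons.prems by (cases \<rho>) auto
  have "(a, s, c) \<in> B1.chains"
    using BR_D[OF \<rho>(2)] rule_facts(4)[of s f] by (simp add: B1.chains_def)
  then have "Poly_Mapping.keys (smul (Poly_Mapping.lookup x (a \<cdot> s \<cdot> c)) (ten (pvec a) s (pvec c))) \<subseteq> B1.chains"
    by simp
  moreover have "Poly_Mapping.keys (phi1v rs (reduce1 \<rho> x)) \<subseteq> B1.chains"
    using Cons by simp
  ultimately show ?case
    unfolding phi1v.simps \<rho>(1) prod.case by (intro order_trans[OF keys_add] Un_least)
qed simp

lemma sigma_phi1v: "rs \<in> reductions Q \<R> \<Longrightarrow> B1.sigma (phi1v rs x) = \<phi>1 Q I \<R> rs x"
proof (induct rs arbitrary: x rule: list.induct)
  case (Cons \<rho> rs)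
  obtain a s f c where \<rho>: "\<rho> = (a, s, f, c)" "(a, s, f, c) \<in> BR"
    using Cons.prems by (cases \<rho>) auto
  have good: "(a, s, c) \<in> B1.good"
    using BR_D[OF \<rho>(2)] rule_facts(4)[of s f] by simp
  have "B1.sigma (smul (Poly_Mapping.lookup x (a \<cdot> s \<cdot> c)) (Poly_Mapping.single (a, s, c) 1)) = \<phi>1_basic Q I \<R> \<rho> x"
    using B1.sigma_smul[of "Poly_Mapping.single (a, s, c) 1"] B1.sigma(3)[OF good, of 1] good
    by (simp del: smul_simps add: \<phi>1_basic_def \<rho>(1))
  then show ?case
    using Cons by (simp del: smul_simps add: \<rho>(1) B1.sigma)
qed (simp add: B1.sigma_zero)

lemma sigma_rule:
  assumes "s \<in> tips \<R>"
  shows "B0.sigma (phi0p Q s - phi (nfp s)) = d\<^sub>1 (B1.t3 \<one>\<^bsub>A\<^esub> (pvec s) \<one>\<^bsub>A\<^esub>)"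
proof -
  have s: "s \<in> paths Q"
    using assms tips_paths by auto
  show ?thesis
    using d1_t3[OF assms] sigma_phi[of "pvec s"] sigma_phi[OF nfp_in_kspan[OF s]] s
    by (simp add: normal_form_eq B0.sigma_minus)
qed

text \<open>On generators the agreement is \<open>sigma_rule\<close>, and every other triple is a
  two-sided multiple of a generator. The bound on the support is what \<open>sigma_kernel\<close>
  requires of a lift in the kernel.\<close>

lemma d1_sigma:
  assumes "Poly_Mapping.keys g \<subseteq> B1.chains"
  shows "d\<^sub>1 (B1.sigma g) = B0.sigma (d1v g)" "Poly_Mapping.keys (d1v g) \<subseteq> B0.chains"
proof -
  have step: "d\<^sub>1 (B1.sigma (Poly_Mapping.single u k)) = B0.sigma (d1v (Poly_Mapping.single u k)) \<and>
      Poly_Mapping.keys (d1v (Poly_Mapping.single u k)) \<subseteq> B0.chains" if u: "u \<in> B1.chains" for u k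
  proof -
    obtain p s q where pq: "u = (p, s, q)" "p \<in> paths Q" "s \<in> tips \<R>" "q \<in> paths Q"
      using u by (cases u) (auto simp: B1.chains_def)
    have s: "s \<in> paths Q"
      using pq(3) tips_paths by auto
    let ?g = "phi0p Q s - phi (nfp s)"
    have g: "Poly_Mapping.keys ?g \<subseteq> B0.chains"
      using keys_diff[of "phi0p Q s" "phi (nfp s)"] keys_phi0p[OF s] keys_phi[OF nfp_in_kspan[OF s]] by blast
    have q': "pvec q \<in> kspan (paths Q)" "Poly_Mapping.single p k \<in> kspan (paths Q)"
      using pq by (simp_all add: kspan_iff)
    have gq: "Poly_Mapping.keys (rmul ?g (pvec q)) \<subseteq> B0.chains"
      by (rule B0.keys_rmul_chains[OF q'(1) g])
    have "d1v (Poly_Mapping.single u k) = lmul (smul k (pvec p)) (rmul ?g (pvec q))"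
      unfolding lmul_distrib(5) by (simp add: d1v_def pq(1))
    then have d1v: "d1v (Poly_Mapping.single u k) = lmul (Poly_Mapping.single p k) (rmul ?g (pvec q))"
      by simp
    have "d\<^sub>1 (B1.sigma (Poly_Mapping.single u k)) =
        lact G0 (pr (Poly_Mapping.single p k)) (ract G0 (B0.sigma ?g) (pr (pvec q)))"
      using pq q' by (simp add: B1.sigma_single bimodule_homD[OF d1] pr_closed B1.G_ract(1) B1.t3_closed sigma_rule)
    also have "\<dots> = B0.sigma (d1v (Poly_Mapping.single u k))"
      unfolding d1v using B0.sigma_rmul[OF chains_goodD(1)[OF g] q'(1)] B0.sigma_lmul[OF chains_goodD(1)[OF gq] q'(2)]
      by simp
    finally show ?thesis
      using B0.keys_lmul_chains[OF q'(2) gq] unfolding d1v by simp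
  qed
  have "d\<^sub>1 (B1.sigma g) = B0.sigma (d1v g) \<and> Poly_Mapping.keys (d1v g) \<subseteq> B0.chains"
    using assms
  proof (induct g rule: keys_induct)
    case zero
    then show ?case
      using bimodule_hom_minus(1)[OF d1 B1.G_abelian B0.G_abelian]
      by (simp add: B1.sigma_zero klin_zero[OF klin_d1v[OF klin_id]] B0.sigma_zero)
  next
    case (add g h)
    then show ?case
      using keys_add[of "d1v g" "d1v h"]
      by (auto simp: B1.sigma bimodule_homD[OF d1] klin_plus[OF klin_d1v[OF klin_id]] B0.sigma)
  qed (use step in simp)
  then show "d\<^sub>1 (B1.sigma g) = B0.sigma (d1v g)" "Poly_Mapping.keys (d1v g) \<subseteq> B0.chains"
    by simp_all
qed

subsection \<open>Exactness at the algebra and its tensor square\<close>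

lemma \<delta>m_surj: "\<delta>\<^sub>m ` carrier T = carrier A"
proof
  show "\<delta>\<^sub>m ` carrier T \<subseteq> carrier A"
    using bimodule_homD(1)[OF \<delta>m] by (auto simp: regular_simps)
  show "carrier A \<subseteq> \<delta>\<^sub>m ` carrier T"
  proof
    fix a
    assume a: "a \<in> carrier A"
    have "\<delta>\<^sub>m (t2 a \<one>\<^bsub>A\<^esub>) = a"
      using a by (simp add: \<delta>m_t2)
    then show "a \<in> \<delta>\<^sub>m ` carrier T"
      using B0.t2_closed[OF a A.one_closed] by (metis imageI)
  qed
qed

lemma t2_scalar:
  assumes "x \<in> kspan (paths Q)" "y \<in> kspan (paths Q)"
  shows "t2 (pr (smul k x)) (pr y) = t2 (pr x) (pr (smul k y))"
proof -
  have e: "smul k e1 \<in> EE"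
    by (rule subsp_smul[OF subsp_kspan e1_in_EE])
  note e' = EE_in_kspan[OF e]
  have "pr x \<otimes>\<^bsub>A\<^esub> pr (smul k e1) = pr (smul k x)" "pr (smul k e1) \<otimes>\<^bsub>A\<^esub> pr y = pr (smul k y)"
    using assms e' by (simp_all add: pr_mult pmult_distrib pmult_one)
  then show ?thesis
    using B0.t2_balanced[OF pr_closed[OF assms(1)] pr_closed[OF assms(2)] e] by simp
qed

lemma \<delta>0_sigma_single:
  assumes "(p, \<alpha>, q) \<in> B0.chains"
  shows "\<delta>\<^sub>0 (B0.sigma (Poly_Mapping.single (p, \<alpha>, q) k)) =
    t2 (pr (Poly_Mapping.single (p \<cdot> \<alpha>) k)) (pr (pvec q)) \<ominus>\<^bsub>T\<^esub> t2 (pr (Poly_Mapping.single p k)) (pr (pvec (\<alpha> \<cdot> q)))"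
proof -
  have pq: "p \<in> paths Q" "\<alpha> \<in> paths_of_len Q 1" "\<alpha> \<in> paths Q" "q \<in> paths Q" "composable p \<alpha>" "composable \<alpha> q"
    using assms paths_of_len_paths by (auto simp: B0.chains_def)
  have cl: "pr (Poly_Mapping.single p k) \<in> carrier A" "pr (pvec \<alpha>) \<in> carrier A" "pr (pvec q) \<in> carrier A"
    "pr (pvec (\<alpha> \<cdot> q)) \<in> carrier A"
    using pq by (auto intro!: pr_closed simp: kspan_iff)
  have m: "pr (Poly_Mapping.single p k) \<otimes>\<^bsub>A\<^esub> pr (pvec \<alpha>) = pr (Poly_Mapping.single (p \<cdot> \<alpha>) k)"
    "pr (pvec \<alpha>) \<otimes>\<^bsub>A\<^esub> pr (pvec q) = pr (pvec (\<alpha> \<cdot> q))"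
    using pq by (simp_all add: pr_mult kspan_iff)
  have "\<delta>\<^sub>0 (B0.sigma (Poly_Mapping.single (p, \<alpha>, q) k)) = lact T (pr (Poly_Mapping.single p k))
      (ract T (t2 (pr (pvec \<alpha>)) \<one>\<^bsub>A\<^esub> \<ominus>\<^bsub>T\<^esub> t2 \<one>\<^bsub>A\<^esub> (pr (pvec \<alpha>))) (pr (pvec q)))"
    using pq cl by (simp add: B0.sigma_single bimodule_homD[OF \<delta>0] \<delta>0_t3 B0.G_ract(1) B0.t3_closed)
  then show ?thesis
    using cl by (simp add: B0.AA_act_minus B0.AA_ract B0.AA_lact B0.t2_closed m)
qed

text \<open>Each arrow contributes the difference of the two tensors that cut the path on either
  side of it, so only the two extreme cuts remain. A scalar is treated as a left factor and then
  moved across the tensor sign with \<open>t2_scalar\<close>.\<close>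

lemma \<delta>0_phi:
  assumes "x \<in> kspan (paths Q)"
  shows "\<delta>\<^sub>0 (B0.sigma (phi x)) = t2 (pr x) \<one>\<^bsub>A\<^esub> \<ominus>\<^bsub>T\<^esub> t2 \<one>\<^bsub>A\<^esub> (pr x)"
proof -
  have path: "\<delta>\<^sub>0 (B0.sigma (phi0p Q p)) = t2 (pr (pvec p)) \<one>\<^bsub>A\<^esub> \<ominus>\<^bsub>T\<^esub> t2 \<one>\<^bsub>A\<^esub> (pr (pvec p))"
    if "p \<in> paths Q" for p
    using that
  proof (induct "len p" arbitrary: p)
    case 0
    have "pvec p \<in> EE"
      using 0 by (simp add: paths_of_len_def)
    then have "t2 (pr (pvec p)) \<one>\<^bsub>A\<^esub> = t2 \<one>\<^bsub>A\<^esub> (pr (pvec p))"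
      using B0.t2_balanced[OF A.one_closed A.one_closed, of "pvec p"] 0 by (simp add: pr_closed)
    then show ?case
      using 0 bimodule_hom_minus(1)[OF \<delta>0 B0.G_abelian B0.AA_abelian]
      by (simp add: phi0p_len_0 B0.sigma_zero B0.AA.minus_eq B0.AA.r_neg B0.t2_closed pr_closed)
  next
    case (Suc n)
    obtain \<alpha> q where q: "p = \<alpha> \<cdot> q" "composable \<alpha> q" "\<alpha> \<in> paths Q" "q \<in> paths Q" "len q = n"
      by (rule path_split[OF Suc.prems, of n]) (use Suc.hyps(2) in auto)
    have \<alpha>: "len \<alpha> = 1"
      using Suc.hyps(2) q by (simp add: One_nat_def)
    have cl: "pr (pvec \<alpha>) \<in> carrier A" "pr (pvec q) \<in> carrier A" "pr (pvec p) \<in> carrier A"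
      using q Suc.prems by (simp_all add: pr_closed)
    have m: "pr (pvec \<alpha>) \<otimes>\<^bsub>A\<^esub> pr (pvec q) = pr (pvec p)"
      using q by (simp add: pr_mult)
    have phi: "phi0p Q p = lmul (pvec \<alpha>) (phi0p Q q) + rmul (phi0p Q \<alpha>) (pvec q :: ('v, 'a, 'k) pathvec)"
      unfolding q(1) by (rule phi0p_pcomp[OF q(2)])
    have k: "Poly_Mapping.keys (phi0p Q q :: ('v, 'a, 'k) tripvec) \<subseteq> B0.good"
      "Poly_Mapping.keys (phi0p Q \<alpha> :: ('v, 'a, 'k) tripvec) \<subseteq> B0.good"
      by (rule chains_goodD(1)[OF keys_phi0p], fact)+
    have d\<alpha>: "\<delta>\<^sub>0 (B0.sigma (phi0p Q \<alpha>)) = t2 (pr (pvec \<alpha>)) \<one>\<^bsub>A\<^esub> \<ominus>\<^bsub>T\<^esub> t2 \<one>\<^bsub>A\<^esub> (pr (pvec \<alpha>))"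
      using \<delta>0_t3[of \<alpha>] B0.t3_unit[of \<alpha>] q(3) \<alpha> by (simp add: phi0p_arrow paths_of_len_def)
    have "\<delta>\<^sub>0 (B0.sigma (phi0p Q p)) =
        lact T (pr (pvec \<alpha>)) (\<delta>\<^sub>0 (B0.sigma (phi0p Q q))) \<oplus>\<^bsub>T\<^esub> ract T (\<delta>\<^sub>0 (B0.sigma (phi0p Q \<alpha>))) (pr (pvec q))"
      unfolding phi using q cl k
      by (simp add: B0.sigma B0.sigma_lmul B0.sigma_rmul bimodule_homD[OF \<delta>0] B0.G_lact(1) B0.G_ract(1))
    also have "\<dots> = (t2 (pr (pvec p)) \<one>\<^bsub>A\<^esub> \<ominus>\<^bsub>T\<^esub> t2 (pr (pvec \<alpha>)) (pr (pvec q))) \<oplus>\<^bsub>T\<^esub>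
        (t2 (pr (pvec \<alpha>)) (pr (pvec q)) \<ominus>\<^bsub>T\<^esub> t2 \<one>\<^bsub>A\<^esub> (pr (pvec p)))"
      unfolding d\<alpha> Suc.hyps(1)[OF q(5)[symmetric] q(4)] using cl
      by (simp add: B0.AA_act_minus B0.AA_ract B0.AA_lact B0.t2_closed m)
    also have "\<dots> = t2 (pr (pvec p)) \<one>\<^bsub>A\<^esub> \<ominus>\<^bsub>T\<^esub> t2 \<one>\<^bsub>A\<^esub> (pr (pvec p))"
    proof -
      have "(u \<ominus>\<^bsub>T\<^esub> v) \<oplus>\<^bsub>T\<^esub> (v \<ominus>\<^bsub>T\<^esub> w) = u \<ominus>\<^bsub>T\<^esub> w" if "u \<in> carrier T" "v \<in> carrier T" "w \<in> carrier T" for u v w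
        using that B0.AA.a_assoc[of "\<ominus>\<^bsub>T\<^esub> v" v "\<ominus>\<^bsub>T\<^esub> w"] by (simp add: B0.AA.minus_eq B0.AA.a_assoc B0.AA.l_neg)
      then show ?thesis
        using cl by (simp add: B0.t2_closed)
    qed
    finally show ?case .
  qed
  show ?thesis
    using assms unfolding kspan_iff
  proof (induct x rule: keys_induct)
    case zero
    have "\<zero>\<^bsub>T\<^esub> \<ominus>\<^bsub>T\<^esub> \<zero>\<^bsub>T\<^esub> = \<zero>\<^bsub>T\<^esub>"
      unfolding B0.AA.minus_eq by (rule B0.AA.r_neg) simp
    then show ?case
      using bimodule_hom_minus(1)[OF \<delta>0 B0.G_abelian B0.AA_abelian]
      by (simp add: B0.sigma_zero pr_zero B0.t2_zero)
  next
    case (single p k)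
    have e: "smul k e1 \<in> kspan (paths Q)"
      by (rule subsp_smul[OF subsp_kspan one_closed])
    have p: "pvec p \<in> kspan (paths Q)"
      using single by simp
    note keys = chains_goodD(1)[OF keys_phi0p[OF single]]
    have "phi (Poly_Mapping.single p k) = lmul (smul k e1) (phi0p Q p)"
      using B0.lmul_e1[OF keys] by (simp add: lmul_distrib)
    then have "\<delta>\<^sub>0 (B0.sigma (phi (Poly_Mapping.single p k))) =
        lact T (pr (smul k e1)) (t2 (pr (pvec p)) \<one>\<^bsub>A\<^esub> \<ominus>\<^bsub>T\<^esub> t2 \<one>\<^bsub>A\<^esub> (pr (pvec p)))"
      using B0.sigma_lmul[OF keys e] path[OF single] e by (simp add: bimodule_homD[OF \<delta>0] B0.sigma pr_closed)
    also have "\<dots> = t2 (pr (smul k e1) \<otimes>\<^bsub>A\<^esub> pr (pvec p)) \<one>\<^bsub>A\<^esub> \<ominus>\<^bsub>T\<^esub> t2 (pr (smul k e1)) (pr (pvec p))"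
      using p e by (simp add: B0.AA_act_minus B0.AA_lact B0.t2_closed pr_closed)
    also have "pr (smul k e1) \<otimes>\<^bsub>A\<^esub> pr (pvec p) = pr (Poly_Mapping.single p k)"
      using p e by (simp add: pr_mult pmult_distrib pmult_one)
    also have "t2 (pr (smul k e1)) (pr (pvec p)) = t2 \<one>\<^bsub>A\<^esub> (pr (Poly_Mapping.single p k))"
      using t2_scalar[OF one_closed p] by (simp add: pr_one)
    finally show ?case .
  next
    case (add x y)
    then have cl: "pr x \<in> carrier A" "pr y \<in> carrier A" "pr (x + y) = pr x \<oplus>\<^bsub>A\<^esub> pr y"
      by (simp_all add: pr_closed pr_add kspan_iff)
    have "(u \<ominus>\<^bsub>T\<^esub> v) \<oplus>\<^bsub>T\<^esub> (w \<ominus>\<^bsub>T\<^esub> z) = (u \<oplus>\<^bsub>T\<^esub> w) \<ominus>\<^bsub>T\<^esub> (v \<oplus>\<^bsub>T\<^esub> z)"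
      if "u \<in> carrier T" "v \<in> carrier T" "w \<in> carrier T" "z \<in> carrier T" for u v w z
      using that by (simp add: B0.AA.minus_eq B0.AA.minus_add B0.AA.a_ac)
    then show ?case
      using add cl by (simp add: B0.sigma bimodule_homD[OF \<delta>0] B0.t2_add B0.t2_closed)
  qed
qed

text \<open>Modulo the image of \<open>\<delta>\<^sub>0\<close> every tensor \<open>w\<close> equals
  \<open>\<delta>\<^sub>m w\<close> tensored with the unit, hence it lies in that image once
  \<open>\<delta>\<^sub>m w\<close> vanishes.\<close>

lemma exact_tensor_square: "\<delta>\<^sub>0 ` carrier G0 = a_kernel T (regular_bimodule Q I) \<delta>\<^sub>m"
proof
  have "\<delta>\<^sub>m (\<delta>\<^sub>0 z) = \<zero>\<^bsub>regular_bimodule Q I\<^esub>" if "z \<in> carrier G0" for z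
  proof (rule B0.hom_zero[OF bimodule_hom_comp[OF \<delta>0 \<delta>m] regular_abelian _ _ that])
    fix \<alpha>
    assume \<alpha>: "\<alpha> \<in> paths_of_len Q 1"
    then have "pr (pvec \<alpha>) \<in> carrier A"
      using paths_of_len_paths by (intro pr_closed) auto
    then show "\<delta>\<^sub>m (\<delta>\<^sub>0 (B0.t3 \<one>\<^bsub>A\<^esub> (pvec \<alpha>) \<one>\<^bsub>A\<^esub>)) = \<zero>\<^bsub>regular_bimodule Q I\<^esub>"
      using bimodule_hom_minus(3)[OF \<delta>m B0.AA_abelian regular_abelian]
        abelian_group.r_neg[OF regular_abelian] 
      by (simp add: \<delta>0_t3[OF \<alpha>] B0.t2_closed \<delta>m_t2 regular_simps a_minus_def)
  qed (simp add: regular_simps)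
  then show "\<delta>\<^sub>0 ` carrier G0 \<subseteq> a_kernel T (regular_bimodule Q I) \<delta>\<^sub>m"
    using bimodule_homD(1)[OF \<delta>0] by (auto simp: a_kernel_def')
  have main: "\<exists>z\<in>carrier G0. w = \<delta>\<^sub>0 z \<oplus>\<^bsub>T\<^esub> t2 (\<delta>\<^sub>m w) \<one>\<^bsub>A\<^esub>" if "w \<in> carrier T" for w
    using that
  proof (induct w rule: B0.AA_induct)
    case (pure a b)
    obtain b0 where b0: "b0 \<in> kspan (paths Q)" "b = pr b0"
      by (rule A_carrierE[OF pure(2)])
    \<comment> \<open>Multiplying \<open>\<delta>0_phi\<close> for \<open>b\<close> by
      \<open>a\<close> from the left moves \<open>b\<close> across the tensor sign. The opposite of
      this element gives the sign that is wanted.\<close>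
    let ?z = "lact G0 a (B0.sigma (phi b0))"
    have z: "?z \<in> carrier G0"
      by (rule B0.G_lact(1)[OF pure(1) B0.sigma(1)])
    have "\<delta>\<^sub>0 ?z = t2 (a \<otimes>\<^bsub>A\<^esub> b) \<one>\<^bsub>A\<^esub> \<ominus>\<^bsub>T\<^esub> t2 a b"
      using pure b0 by (simp add: bimodule_homD[OF \<delta>0] B0.sigma \<delta>0_phi B0.AA_act_minus B0.AA_lact B0.t2_closed)
    then have "\<delta>\<^sub>0 (\<ominus>\<^bsub>G0\<^esub> ?z) = t2 a b \<ominus>\<^bsub>T\<^esub> t2 (a \<otimes>\<^bsub>A\<^esub> b) \<one>\<^bsub>A\<^esub>"
      using bimodule_hom_minus(2)[OF \<delta>0 B0.G_abelian B0.AA_abelian z] pure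
      by (simp add: B0.AA.minus_eq B0.AA.minus_add B0.AA.a_comm B0.t2_closed)
    then have "t2 a b = \<delta>\<^sub>0 (\<ominus>\<^bsub>G0\<^esub> ?z) \<oplus>\<^bsub>T\<^esub> t2 (\<delta>\<^sub>m (t2 a b)) \<one>\<^bsub>A\<^esub>"
      using pure by (simp add: \<delta>m_t2 B0.AA.minus_eq B0.AA.a_assoc B0.AA.l_neg B0.t2_closed)
    then show ?case
      using B0.G.a_inv_closed[OF z] by (rule bexI)
  next
    case (add w w')
    then obtain z z' where z: "z \<in> carrier G0" "w = \<delta>\<^sub>0 z \<oplus>\<^bsub>T\<^esub> t2 (\<delta>\<^sub>m w) \<one>\<^bsub>A\<^esub>"
      "z' \<in> carrier G0" "w' = \<delta>\<^sub>0 z' \<oplus>\<^bsub>T\<^esub> t2 (\<delta>\<^sub>m w') \<one>\<^bsub>A\<^esub>"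
      by (elim bexE)
    have cl: "\<delta>\<^sub>m w \<in> carrier A" "\<delta>\<^sub>m w' \<in> carrier A" "\<delta>\<^sub>0 z \<in> carrier T" "\<delta>\<^sub>0 z' \<in> carrier T"
      using bimodule_homD(1)[OF \<delta>m] bimodule_homD(1)[OF \<delta>0] add z by (simp_all add: regular_simps)
    have swap: "(u \<oplus>\<^bsub>T\<^esub> v) \<oplus>\<^bsub>T\<^esub> (u' \<oplus>\<^bsub>T\<^esub> v') = (u \<oplus>\<^bsub>T\<^esub> u') \<oplus>\<^bsub>T\<^esub> (v \<oplus>\<^bsub>T\<^esub> v')"
      if "u \<in> carrier T" "v \<in> carrier T" "u' \<in> carrier T" "v' \<in> carrier T" for u v u' v'
      using that by (simp add: B0.AA.a_ac)
    have "w \<oplus>\<^bsub>T\<^esub> w' = (\<delta>\<^sub>0 z \<oplus>\<^bsub>T\<^esub> t2 (\<delta>\<^sub>m w) \<one>\<^bsub>A\<^esub>) \<oplus>\<^bsub>T\<^esub> (\<delta>\<^sub>0 z' \<oplus>\<^bsub>T\<^esub> t2 (\<delta>\<^sub>m w') \<one>\<^bsub>A\<^esub>)"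
      by (rule arg_cong2[OF z(2) z(4)])
    also have "\<dots> = (\<delta>\<^sub>0 z \<oplus>\<^bsub>T\<^esub> \<delta>\<^sub>0 z') \<oplus>\<^bsub>T\<^esub> (t2 (\<delta>\<^sub>m w) \<one>\<^bsub>A\<^esub> \<oplus>\<^bsub>T\<^esub> t2 (\<delta>\<^sub>m w') \<one>\<^bsub>A\<^esub>)"
      using cl by (intro swap) (simp_all add: B0.t2_closed)
    also have "\<dots> = \<delta>\<^sub>0 (z \<oplus>\<^bsub>G0\<^esub> z') \<oplus>\<^bsub>T\<^esub> t2 (\<delta>\<^sub>m (w \<oplus>\<^bsub>T\<^esub> w')) \<one>\<^bsub>A\<^esub>"
      using cl z add by (simp add: bimodule_homD(2)[OF \<delta>0] bimodule_homD(2)[OF \<delta>m] regular_simps B0.t2_add)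
    finally show ?case
      using z by (intro bexI[of _ "z \<oplus>\<^bsub>G0\<^esub> z'"]) simp_all
  qed
  show "a_kernel T (regular_bimodule Q I) \<delta>\<^sub>m \<subseteq> \<delta>\<^sub>0 ` carrier G0"
  proof
    fix w
    assume "w \<in> a_kernel T (regular_bimodule Q I) \<delta>\<^sub>m"
    then have w: "w \<in> carrier T" "\<delta>\<^sub>m w = \<zero>\<^bsub>A\<^esub>"
      by (simp_all add: a_kernel_def' regular_simps)
    obtain z where z: "z \<in> carrier G0" "w = \<delta>\<^sub>0 z \<oplus>\<^bsub>T\<^esub> t2 (\<delta>\<^sub>m w) \<one>\<^bsub>A\<^esub>"
      using main[OF w(1)] by (elim bexE)
    then have "w = \<delta>\<^sub>0 z"
      using bimodule_homD(1)[OF \<delta>0 z(1)] unfolding w(2) by (simp add: B0.t2_zero)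
    then show "w \<in> \<delta>\<^sub>0 ` carrier G0"
      using z(1) by (rule image_eqI)
  qed
qed

subsection \<open>Exactness at the arrows\<close>

abbreviation "D0 \<equiv> B0.preimage d\<^sub>1 G1"

lemma G1_act: "\<forall>a\<in>carrier A. \<forall>z\<in>carrier G1. lact G1 a z \<in> carrier G1 \<and> ract G1 z a \<in> carrier G1"
  by (simp add: B1.G_lact(1) B1.G_ract(1))

lemmas D0 = B0.preimage[OF d1 B1.G_abelian G1_act]

text \<open>In the Leibniz rule for a multiple of an element \<open>x\<close> of \<open>I\<close>,
  one term is a multiple of \<open>phi x\<close> and the other has \<open>x\<close> as an outer
  factor. So the elements of \<open>I\<close> with \<open>phi x\<close> in \<open>D0\<close> form an
  ideal; on the generators \<open>s - f\<close> the value represents d_1 of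
  \<open>1 \<otimes> s \<otimes> 1\<close>.\<close>

lemma phi_I:
  assumes "x \<in> I"
  shows "phi x \<in> D0"
proof -
  define J where "J = {x \<in> I. phi x \<in> D0}"
  have "ideal J kQ"
  proof (rule ideal_kQ_I)
    show "subsp J"
      using subsp_I D0(1) by (auto simp: J_def subsp_def)
    show "J \<subseteq> kspan (paths Q)"
      using I_in_kspan by (auto simp: J_def)
    fix x y :: "('v, 'a, 'k) pathvec"
    assume xy: "x \<in> J" "y \<in> kspan (paths Q)"
    then have x: "x \<in> I" "phi x \<in> D0"
      by (simp_all add: J_def)
    show "pmult y x \<in> J"
      using subsp_add[OF D0(1) D0(2)[OF x(2) xy(2)] D0(5)[OF chains_goodD(1)[OF keys_phi[OF xy(2)]] x(1)]] I_lmult[OF x(1) xy(2)]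
      by (simp add: J_def phi0_pmult)
    show "pmult x y \<in> J"
      using subsp_add[OF D0(1) D0(4)[OF chains_goodD(1)[OF keys_phi[OF xy(2)]] x(1)] D0(3)[OF x(2) xy(2)]] I_rmult[OF x(1) xy(2)]
      by (simp add: J_def phi0_pmult)
  qed
  moreover have "pvec s - f \<in> J" if sf: "(s, f) \<in> \<R>" for s f
  proof -
    note R = rule_facts[OF sf]
    have sf': "pvec s - f \<in> kspan (paths Q)"
      using R by (intro subsp_diff[OF subsp_kspan]) simp_all
    have "phi (pvec s - f) = phi0p Q s - phi (nfp s)"
      by (simp add: nfp_tip[OF sf])
    then have "B0.sigma (phi (pvec s - f)) \<in> d\<^sub>1 ` carrier G1"
      using sigma_rule[OF R(4)] B1.t3_closed[OF A.one_closed _ A.one_closed, of "pvec s"] R(4) by simp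
    then show ?thesis
      using chains_goodD(1)[OF keys_phi[OF sf']] rule_in_I[OF sf] by (simp add: J_def B0.preimage_def)
  qed
  ultimately have "I \<subseteq> J"
    by (rule I_subset)
  then show ?thesis
    using assms by (auto simp: J_def)
qed

text \<open>Both replacements by normal forms change a factor by an element of \<open>I\<close>: in
  the left factor it acts as zero, under \<open>phi\<close> it is covered by
  \<open>phi_I\<close>.\<close>

lemma NF_phi_D0:
  assumes x: "x \<in> kspan (paths Q)" and y: "y \<in> kspan (paths Q)"
  shows "lmul (NF x) (phi (NF y)) - lmul x (phi y) \<in> D0"
proof -
  have "lmul (x - NF x) (phi (NF y)) \<in> D0"
    by (rule D0(4)[OF chains_goodD(1)[OF keys_phi[OF NF_in_kspan[OF y]]] NF_diff_in_I[OF x]])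
  moreover have "lmul x (phi (y - NF y)) \<in> D0"
    by (rule D0(2)[OF phi_I[OF NF_diff_in_I[OF y]] x])
  ultimately have "- lmul (x - NF x) (phi (NF y)) - lmul x (phi (y - NF y)) \<in> D0"
    by (intro subsp_diff[OF D0(1)] subsp_neg[OF D0(1)])
  then show ?thesis
    by (simp add: lmul_distrib klin_minus[OF klin_lin] algebra_simps)
qed

text \<open>The product of \<open>a\<close> with \<open>\<phi>0\<close> of \<open>b\<close> does not
  depend only on the class of \<open>b\<close> modulo \<open>I\<close>. Taking normal forms in both
  places gives a map on the tensor square, and by \<open>NF_phi_D0\<close> this costs only lifts of
  the image of d_1.\<close>

lemma exact_arrows: "d\<^sub>1 ` carrier G1 = a_kernel G0 T \<delta>\<^sub>0"
proof
  have "\<delta>\<^sub>0 (d\<^sub>1 z) = \<zero>\<^bsub>T\<^esub>" if "z \<in> carrier G1" for z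
  proof (rule B1.hom_zero[OF bimodule_hom_comp[OF d1 \<delta>0] B0.AA_abelian _ _ that])
    fix s
    assume s: "s \<in> tips \<R>"
    then have s': "s \<in> paths Q"
      using tips_paths by auto
    note n = nfp_in_kspan[OF s']
    have eq: "pr (nfp s) = pr (pvec s)"
      using pr_eq_iff[of "pvec s" "nfp s"] n s' nfp_diff_in_I[OF s'] by simp
    have "\<delta>\<^sub>0 (d\<^sub>1 (B1.t3 \<one>\<^bsub>A\<^esub> (pvec s) \<one>\<^bsub>A\<^esub>)) = \<delta>\<^sub>0 (B0.sigma (phi (pvec s)) \<ominus>\<^bsub>G0\<^esub> B0.sigma (phi (nfp s)))"
      using sigma_rule[OF s] by (simp add: B0.sigma_minus)
    also have "\<dots> = (t2 (pr (pvec s)) \<one>\<^bsub>A\<^esub> \<ominus>\<^bsub>T\<^esub> t2 \<one>\<^bsub>A\<^esub> (pr (pvec s))) \<ominus>\<^bsub>T\<^esub>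
        (t2 (pr (pvec s)) \<one>\<^bsub>A\<^esub> \<ominus>\<^bsub>T\<^esub> t2 \<one>\<^bsub>A\<^esub> (pr (pvec s)))"
      unfolding bimodule_hom_minus(3)[OF \<delta>0 B0.G_abelian B0.AA_abelian B0.sigma(1) B0.sigma(1)] \<delta>0_phi[OF n] eq
      using \<delta>0_phi[of "pvec s"] s' by simp
    also have "\<dots> = \<zero>\<^bsub>T\<^esub>"
      using s' by (subst B0.AA.minus_eq, intro B0.AA.r_neg B0.AA.minus_closed B0.t2_closed) (simp_all add: pr_closed)
    finally show "\<delta>\<^sub>0 (d\<^sub>1 (B1.t3 \<one>\<^bsub>A\<^esub> (pvec s) \<one>\<^bsub>A\<^esub>)) = \<zero>\<^bsub>T\<^esub>" .
  qed (simp add: T_act_zero)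
  then show "d\<^sub>1 ` carrier G1 \<subseteq> a_kernel G0 T \<delta>\<^sub>0"
    using bimodule_homD(1)[OF d1] by (auto simp: a_kernel_def')
  show "a_kernel G0 T \<delta>\<^sub>0 \<subseteq> d\<^sub>1 ` carrier G1"
  proof
    fix z
    assume "z \<in> a_kernel G0 T \<delta>\<^sub>0"
    then have z: "z \<in> carrier G0" "\<delta>\<^sub>0 z = \<zero>\<^bsub>T\<^esub>"
      by (simp_all add: a_kernel_def')
    obtain g where g: "Poly_Mapping.keys g \<subseteq> B0.chains" "z = B0.sigma g"
      by (rule B0.sigma_surj[OF z(1)])
    let ?B = "\<lambda>a b. lmul (NFA a) (phi (NFA b))"
    show "z \<in> d\<^sub>1 ` carrier G1"
    proof (rule B0.T2.tensor_lift[of ?B])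
      show "?B (ract B0.AE a e) b = ?B a (lact B0.EA e b)" if "a \<in> carrier B0.AE" "e \<in> EE" "b \<in> carrier B0.EA" for a e b
      proof -
        \<comment> \<open>A vertex contains no arrow, so the derivation kills it. The Leibniz rule
          then yields balancedness over \<open>EE\<close>.\<close>
        have "phi e = 0"
          by (rule klin_eq[OF klin_lin klin_const0]) (use that(2) in \<open>auto simp: kspan_iff paths_of_len_def phi0p_len_0\<close>)
        then show ?thesis
          using that by (simp add: NFA_EE phi0_pmult lmul_lmul lmul_distrib)
      qed
    next
      fix \<tau>
      assume \<tau>': "\<And>z z'. z \<in> carrier (tensor EE B0.AE B0.EA) \<Longrightarrow> z' \<in> carrier (tensor EE B0.AE B0.EA) \<Longrightarrow>
          \<tau> (z \<oplus>\<^bsub>tensor EE B0.AE B0.EA\<^esub> z') = \<tau> z + \<tau> z'"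
        "\<And>m n. m \<in> carrier B0.AE \<Longrightarrow> n \<in> carrier B0.EA \<Longrightarrow> \<tau> (pure_tensor EE B0.AE B0.EA m n) = ?B m n"
      have \<tau>: "\<tau> (w \<oplus>\<^bsub>T\<^esub> w') = \<tau> w + \<tau> w'" if "w \<in> carrier T" "w' \<in> carrier T" for w w'
        using \<tau>'(1) that unfolding B0.AA_def' .
      have \<tau>_t2: "\<tau> (t2 (pr x) (pr y)) = lmul (NF x) (phi (NF y))" if "x \<in> kspan (paths Q)" "y \<in> kspan (paths Q)" for x y
        using \<tau>'(2)[of "pr x" "pr y"] that by (simp add: B0.t2_def pr_closed NFA_pr)
      have \<tau>_zero: "\<tau> \<zero>\<^bsub>T\<^esub> = 0"
        using \<tau>[of "\<zero>\<^bsub>T\<^esub>" "\<zero>\<^bsub>T\<^esub>"] by simp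
      have \<tau>_minus: "\<tau> (w \<ominus>\<^bsub>T\<^esub> w') = \<tau> w - \<tau> w'" if "w \<in> carrier T" "w' \<in> carrier T" for w w'
        using \<tau>[of "w \<ominus>\<^bsub>T\<^esub> w'" w'] that by (simp add: B0.AA.minus_eq B0.AA.a_assoc B0.AA.l_neg)
      \<comment> \<open>The homotopy identity, with the sign that belongs to the contraction by
        minus \<open>a\<close> times \<open>\<phi>0\<close> of \<open>b\<close>. For
        \<open>g\<close> representing a kernel element the first summand vanishes, so
        \<open>g\<close> itself lies in \<open>D0\<close>.\<close>
      have "\<tau> (\<delta>\<^sub>0 (B0.sigma g)) + g \<in> D0"
        using g(1)
      proof (induct g rule: keys_induct)
        case zero
        then show ?case
          using bimodule_hom_minus(1)[OF \<delta>0 B0.G_abelian B0.AA_abelian]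
          by (simp add: B0.sigma_zero \<tau>_zero subsp_zero[OF D0(1)])
      next
        case (single u k)
        obtain p \<alpha> q where u: "u = (p, \<alpha>, q)"
          by (cases u)
        have ch: "(p, \<alpha>, q) \<in> B0.chains"
          using single unfolding u .
        then have "p \<in> paths Q" "\<alpha> \<in> paths_of_len Q 1" "q \<in> paths Q" "composable p \<alpha>" "composable \<alpha> q"
          by (simp_all add: B0.chains_def)
        then have pq: "p \<in> paths Q" "\<alpha> \<in> paths Q" "len \<alpha> = 1" "q \<in> paths Q"
            "composable p \<alpha>" "composable \<alpha> q"
          by (simp_all add: paths_of_len_def)
        let ?pk = "Poly_Mapping.single p k :: ('v, 'a, 'k) pathvec"
        let ?p\<alpha> = "Poly_Mapping.single (p \<cdot> \<alpha>) k :: ('v, 'a, 'k) pathvec"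
        have cl: "?pk \<in> kspan (paths Q)" "?p\<alpha> \<in> kspan (paths Q)" "pvec q \<in> kspan (paths Q)" "pvec (\<alpha> \<cdot> q) \<in> kspan (paths Q)"
          using pq by (auto simp: kspan_iff split: if_splits)
        have "\<tau> (\<delta>\<^sub>0 (B0.sigma (Poly_Mapping.single u k))) =
            lmul (NF ?p\<alpha>) (phi (NF (pvec q))) - lmul (NF ?pk) (phi (NF (pvec (\<alpha> \<cdot> q))))"
          unfolding u \<delta>0_sigma_single[OF ch]
            \<tau>_minus[OF B0.t2_closed[OF pr_closed[OF cl(2)] pr_closed[OF cl(3)]]
              B0.t2_closed[OF pr_closed[OF cl(1)] pr_closed[OF cl(4)]]] \<tau>_t2[OF cl(2,3)] \<tau>_t2[OF cl(1,4)] ..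
        \<comment> \<open>Without normal forms the identity is exact: it is the Leibniz rule for
          \<open>\<alpha> \<cdot> q\<close>, whose extra term is the given triple.\<close>
        moreover have "lmul ?p\<alpha> (phi (pvec q)) - lmul ?pk (phi (pvec (\<alpha> \<cdot> q))) = - Poly_Mapping.single u k"
        proof -
          have "lmul ?pk (phi (pvec (\<alpha> \<cdot> q))) = lmul ?pk (lmul (pvec \<alpha>) (phi (pvec q))) +
              lmul ?pk (rmul (phi0p Q \<alpha>) (pvec q))"
            using phi0_pmult[of "pvec \<alpha>" "pvec q"] pq(6) by (simp add: lmul_distrib)
          also have "lmul ?pk (rmul (phi0p Q \<alpha>) (pvec q)) = Poly_Mapping.single u k"
            using pq by (simp add: phi0p_arrow rmul_single lmul_single composable_def u)
          finally show ?thesis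
            using pq by (simp add: lmul_lmul)
        qed
        moreover have "u = x - y \<Longrightarrow> x' - y' = - s \<Longrightarrow> u + s = (x - x') - (y - y')"
          for u x y x' y' s :: "('v, 'a, 'k) tripvec"
          by (simp add: algebra_simps eq_diff_eq)
        ultimately have eq: "\<tau> (\<delta>\<^sub>0 (B0.sigma (Poly_Mapping.single u k))) + Poly_Mapping.single u k =
          (lmul (NF ?p\<alpha>) (phi (NF (pvec q))) - lmul ?p\<alpha> (phi (pvec q))) -
          (lmul (NF ?pk) (phi (NF (pvec (\<alpha> \<cdot> q)))) - lmul ?pk (phi (pvec (\<alpha> \<cdot> q))))"
          by blast
        show ?case
          unfolding eq by (rule subsp_diff[OF D0(1) NF_phi_D0[OF cl(2,3)] NF_phi_D0[OF cl(1,4)]])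
      next
        case (add g h)
        have eq: "\<tau> (\<delta>\<^sub>0 (B0.sigma (g + h))) + (g + h) = (\<tau> (\<delta>\<^sub>0 (B0.sigma g)) + g) + (\<tau> (\<delta>\<^sub>0 (B0.sigma h)) + h)"
          by (simp add: B0.sigma bimodule_homD[OF \<delta>0] \<tau> algebra_simps)
        show ?case
          unfolding eq by (rule subsp_add[OF D0(1) add(3,4)])
      qed
      then show ?thesis
        using z(2) by (simp add: g(2) \<tau>_zero B0.preimage_def)
    qed (simp_all add: NFA_add lmul_distrib)
  qed
qed

subsection \<open>Exactness at the tips\<close>

text \<open>For one basic reduction the Leibniz rule splits \<open>phi\<close> of
  \<open>a (s - f) c\<close> into three terms. Those that differentiate \<open>a\<close> or
  \<open>c\<close> keep the factor \<open>s - f\<close>, which is zero in the quotient, and the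
  middle one is d_1 of the triple. Along a list the differences telescope, so reductions with the
  same start and the same result have equal images under d_1.\<close>

lemma d1_phi1v:
  assumes "rs \<in> reductions Q \<R>" "x \<in> kspan (paths Q)"
  shows "d\<^sub>1 (B1.sigma (phi1v rs x)) = B0.sigma (phi x - phi (reduce rs x))"
  using assms
proof (induct rs arbitrary: x rule: list.induct)
  case Nil
  then show ?case
    using bimodule_hom_minus(1)[OF d1 B1.G_abelian B0.G_abelian] by (simp add: B1.sigma_zero B0.sigma_zero)
next
  case (Cons \<rho> rs)
  obtain a s f c where \<rho>: "\<rho> = (a, s, f, c)" "(a, s, f, c) \<in> BR"
    using Cons.prems by (cases \<rho>) auto
  note BR = BR_D[OF \<rho>(2)]
  note R = rule_facts[OF BR(1)]
  let ?l = "Poly_Mapping.lookup x (a \<cdot> s \<cdot> c)" and ?x = "reduce1 \<rho> x"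
  have x: "?x \<in> kspan (paths Q)" "rs \<in> reductions Q \<R>"
    using Cons.prems \<rho> reduce1_in_kspan by simp_all
  have ch: "(a, s, c) \<in> B1.chains"
    using BR R(4) by (simp add: B1.chains_def)
  have f: "pvec s - f \<in> I" "pvec s - f \<in> kspan (paths Q)"
    using rule_in_I[OF BR(1)] I_in_kspan by simp_all
  have ac: "pvec a \<in> kspan (paths Q)" "pvec c \<in> kspan (paths Q)"
    using BR by simp_all
  have keys_f: "Poly_Mapping.keys (phi (pvec s - f)) \<subseteq> B0.chains"
    by (rule keys_phi[OF f(2)])
  let ?m = "lmul (pvec a) (rmul (phi (pvec s - f)) (pvec c))"
  have split: "phi (sandwich a (pvec s - f) c) = lmul (pmult (pvec a) (pvec s - f)) (phi (pvec c)) + ?m +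
      rmul (phi (pvec a)) (pmult (pvec s - f) (pvec c))"
    by (simp only: phi0_pmult lmul_distrib(2) lmul_lmul)
  have "B0.sigma (lmul (pmult (pvec a) (pvec s - f)) (phi (pvec c))) = \<zero>\<^bsub>G0\<^esub>"
    unfolding B0.sigma_lmul[OF chains_goodD(1)[OF keys_phi[OF ac(2)]] I_in_kspan[OF I_lmult[OF f(1) ac(1)]]]
      pr_I[OF I_lmult[OF f(1) ac(1)]] by (rule B0.zero_act_G(1)[OF B0.sigma(1)])
  moreover have "B0.sigma (rmul (phi (pvec a)) (pmult (pvec s - f) (pvec c))) = \<zero>\<^bsub>G0\<^esub>"
    unfolding B0.sigma_rmul[OF chains_goodD(1)[OF keys_phi[OF ac(1)]] I_in_kspan[OF I_rmult[OF f(1) ac(2)]]]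
      pr_I[OF I_rmult[OF f(1) ac(2)]] by (rule B0.zero_act_G(2)[OF B0.sigma(1)])
  ultimately have sigma_m: "B0.sigma (phi (sandwich a (pvec s - f) c)) = B0.sigma ?m"
    unfolding split by (simp add: B0.sigma)
  have keys_l: "Poly_Mapping.keys (phi (sandwich a (pvec s - f) c)) \<subseteq> B0.good" "Poly_Mapping.keys ?m \<subseteq> B0.good"
    using keys_phi[OF kspan_pmult[OF ac(1) kspan_pmult[OF f(2) ac(2)]]]
      B0.keys_lmul_chains[OF ac(1) B0.keys_rmul_chains[OF ac(2) keys_f]] by (blast dest: chains_goodD(1))+
  have "d\<^sub>1 (B1.sigma (Poly_Mapping.single (a, s, c) ?l)) = B0.sigma (d1v (Poly_Mapping.single (a, s, c) ?l))"
    by (rule d1_sigma) (use ch in simp)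
  also have "d1v (Poly_Mapping.single (a, s, c) ?l) = smul ?l ?m"
    by (simp add: d1v_def nfp_tip[OF BR(1)])
  also have "B0.sigma (smul ?l ?m) = B0.sigma (smul ?l (phi (sandwich a (pvec s - f) c)))"
    unfolding B0.sigma_smul[OF keys_l(1)] B0.sigma_smul[OF keys_l(2)] sigma_m ..
  also have "smul ?l (phi (sandwich a (pvec s - f) c)) = phi x - phi ?x"
    using BR by (simp add: \<rho>(1) reduce1_eq pmult_distrib smul_distrib)
  finally have 1: "d\<^sub>1 (B1.sigma (Poly_Mapping.single (a, s, c) ?l)) = B0.sigma (phi x - phi ?x)" .
  have "d\<^sub>1 (B1.sigma (phi1v (\<rho> # rs) x)) = B0.sigma (phi x - phi ?x) \<oplus>\<^bsub>G0\<^esub> B0.sigma (phi ?x - phi (reduce rs ?x))"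
    using 1 Cons.hyps[OF x(2,1)] by (simp add: \<rho>(1) B1.sigma bimodule_homD[OF d1])
  then show ?case
    by (simp flip: B0.sigma(2))
qed

lemma nfp_ambiguity:
  assumes "p \<in> ambiguities Q \<R>"
  shows "reduce (r p) (pvec p) = nfp p" "reduce (t p) (pvec p) = nfp p"
  using nfp_eq[of p "r p"] nfp_eq[of p "t p"] r[OF assms] t[OF assms] assms ambiguities_paths
  by (auto simp: irred_iff)

lemma d2_unit:
  assumes "p \<in> ambiguities Q \<R>"
  shows "d\<^sub>2 (B2.t3 \<one>\<^bsub>A\<^esub> (pvec p) \<one>\<^bsub>A\<^esub>) = B1.sigma (phi1v (t p) (pvec p) - phi1v (r p) (pvec p))"
  using d2_t3[OF assms] r[OF assms] t[OF assms] by (simp add: sigma_phi1v B1.sigma_minus)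

abbreviation "D1 \<equiv> B1.preimage d\<^sub>2 G2"

lemma G2_act: "\<forall>a\<in>carrier A. \<forall>z\<in>carrier G2. lact G2 a z \<in> carrier G2 \<and> ract G2 z a \<in> carrier G2"
  by (simp add: B2.G_lact(1) B2.G_ract(1))

lemmas D1 = B1.preimage[OF d2 B2.G_abelian G2_act]

lemma D1_I:
  assumes "s \<in> tips \<R>" "x \<in> kspan (paths Q)" "y \<in> kspan (paths Q)" "x \<in> I \<or> y \<in> I"
  shows "ten x s y \<in> D1"
proof -
  have "B1.sigma (ten x s y) = \<zero>\<^bsub>G1\<^esub>"
    using assms by (auto simp: B1.sigma_ten pr_I B1.t3_zero pr_closed)
  also have "\<dots> = d\<^sub>2 \<zero>\<^bsub>G2\<^esub>"
    by (rule bimodule_hom_minus(1)[OF d2 B2.G_abelian B1.G_abelian, symmetric])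
  finally have "B1.sigma (ten x s y) \<in> d\<^sub>2 ` carrier G2"
    by (rule image_eqI) simp
  moreover have "ten x s y \<in> {g. Poly_Mapping.keys g \<subseteq> B1.good}"
  proof (rule klin_mem[OF subsp_keys, where T = "\<lambda>x. ten x s y"])
    fix p
    assume "p \<in> Poly_Mapping.keys x"
    then have p: "p \<in> paths Q"
      using assms(2) by (auto simp: kspan_iff)
    show "ten (pvec p) s y \<in> {g. Poly_Mapping.keys g \<subseteq> B1.good}"
      by (rule klin_mem[OF subsp_keys, where T = "\<lambda>y. ten (pvec p) s y"])
        (use assms(1,3) p in \<open>auto simp: kspan_iff intro!: klin_ten_right klin_id\<close>)
  qed (intro klin_ten_left klin_id)
  ultimately show ?thesis
    by (simp add: B1.preimage_def)
qed

text \<open>With the lifts of im d_2 for \<open>D\<close>, the condition on an ambiguity says that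
  the chosen difference of \<open>phi1v\<close> represents the value of d_2 on a generator.\<close>

sublocale ambiguity_resolution Q I \<R> D1
proof unfold_locales
  show "subsp D1"
    by (rule D1(1))
  show "lmul (pvec a) g \<in> D1" if "g \<in> D1" "a \<in> paths Q" for g a
    by (rule D1(2)[OF that(1)]) (use that(2) in simp)
  show "rmul g (pvec a) \<in> D1" if "g \<in> D1" "a \<in> paths Q" for g a
    by (rule D1(3)[OF that(1)]) (use that(2) in simp)
  show "ten x s y \<in> D1" if "x \<in> I" "s \<in> tips \<R>" "y \<in> kspan (paths Q)" for x s y
    by (rule D1_I) (use that I_in_kspan in simp_all)
  show "ten x s y \<in> D1" if "x \<in> kspan (paths Q)" "s \<in> tips \<R>" "y \<in> I" for x s y
    by (rule D1_I) (use that I_in_kspan in simp_all)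
  fix p
  assume p: "p \<in> ambiguities Q \<R>"
  note r = r[OF p] and t = t[OF p]
  have "B1.sigma (phi1v (t p) (pvec p) - phi1v (r p) (pvec p)) \<in> d\<^sub>2 ` carrier G2"
    unfolding d2_unit[OF p, symmetric] by (intro imageI B2.t3_closed A.one_closed) (use p in simp)
  moreover have "Poly_Mapping.keys (phi1v (t p) (pvec p) - phi1v (r p) (pvec p)) \<subseteq> B1.good"
    by (intro order_trans[OF keys_diff] Un_least chains_goodD(2) keys_phi1v) (use r t in simp_all)
  ultimately have "phi1v (t p) (pvec p) - phi1v (r p) (pvec p) \<in> D1"
    by (simp add: B1.preimage_def)
  then show "\<exists>r t. r \<in> reductions Q \<R> \<and> t \<in> reductions Q \<R> \<and>
      starts_on_left Q \<R> r p \<and> starts_on_right Q \<R> t p \<and> irred Q \<R> (reduce r (pvec p)) \<and>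
      irred Q \<R> (reduce t (pvec p)) \<and> phi1v t (pvec p) - phi1v r (pvec p) \<in> D1"
    using r t by (intro exI[of _ "r p"] exI[of _ "t p"]) (simp add: irred_iff)
qed

lemma exact_tips: "d\<^sub>2 ` carrier G2 = a_kernel G1 G0 d\<^sub>1"
proof
  have "d\<^sub>1 (d\<^sub>2 z) = \<zero>\<^bsub>G0\<^esub>" if "z \<in> carrier G2" for z
  proof (rule B2.hom_zero[OF bimodule_hom_comp[OF d2 d1] B0.G_abelian _ _ that])
    fix p
    assume p: "p \<in> ambiguities Q \<R>"
    then have p': "pvec p \<in> kspan (paths Q)"
      using ambiguities_paths by auto
    have rt: "r p \<in> reductions Q \<R>" "t p \<in> reductions Q \<R>"
      using r[OF p] t[OF p] by simp_all
    have "d\<^sub>1 (d\<^sub>2 (B2.t3 \<one>\<^bsub>A\<^esub> (pvec p) \<one>\<^bsub>A\<^esub>)) =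
        d\<^sub>1 (B1.sigma (phi1v (t p) (pvec p)) \<ominus>\<^bsub>G1\<^esub> B1.sigma (phi1v (r p) (pvec p)))"
      unfolding d2_unit[OF p] B1.sigma_minus ..
    also have "\<dots> = B0.sigma (phi (pvec p) - phi (nfp p)) \<ominus>\<^bsub>G0\<^esub> B0.sigma (phi (pvec p) - phi (nfp p))"
      unfolding bimodule_hom_minus(3)[OF d1 B1.G_abelian B0.G_abelian B1.sigma(1) B1.sigma(1)]
        d1_phi1v[OF rt(1) p'] d1_phi1v[OF rt(2) p'] nfp_ambiguity[OF p] ..
    also have "\<dots> = \<zero>\<^bsub>G0\<^esub>"
      unfolding B0.G.minus_eq by (rule B0.G.r_neg[OF B0.sigma(1)])
    finally show "d\<^sub>1 (d\<^sub>2 (B2.t3 \<one>\<^bsub>A\<^esub> (pvec p) \<one>\<^bsub>A\<^esub>)) = \<zero>\<^bsub>G0\<^esub>" .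
  qed (simp add: B0.G_act_zero)
  then show "d\<^sub>2 ` carrier G2 \<subseteq> a_kernel G1 G0 d\<^sub>1"
    using bimodule_homD(1)[OF d2] by (auto simp: a_kernel_def')
  show "a_kernel G1 G0 d\<^sub>1 \<subseteq> d\<^sub>2 ` carrier G2"
  proof
    fix z
    assume "z \<in> a_kernel G1 G0 d\<^sub>1"
    then have z: "z \<in> carrier G1" "d\<^sub>1 z = \<zero>\<^bsub>G0\<^esub>"
      by (simp_all add: a_kernel_def')
    obtain g where g: "Poly_Mapping.keys g \<subseteq> B1.chains" "z = B1.sigma g"
      by (rule B1.sigma_surj[OF z(1)])
    have "B0.sigma (d1v g) = \<zero>\<^bsub>G0\<^esub>"
      using d1_sigma(1)[OF g(1)] z(2) by (simp add: g(2))
    \<comment> \<open>Vanishing in the tensor product becomes an identity between lifts once the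
      outer factors are normalised; \<open>d1v g\<close> itself need not be zero.\<close>
    note kernel = B0.sigma_kernel[OF d1_sigma(2)[OF g(1)] this]
    have "hmap (d1v g) \<in> D1"
    proof (rule hmap_kernel[OF _ kernel])
      fix b \<alpha> c
      assume "(b, \<alpha>, c) \<in> Poly_Mapping.keys (d1v g)"
      then have "(b, \<alpha>, c) \<in> B0.chains"
        using d1_sigma(2)[OF g(1)] by (rule set_mp[rotated])
      then show "b \<in> paths Q \<and> \<alpha> \<in> paths Q \<and> c \<in> paths Q \<and> composable b \<alpha> \<and> composable \<alpha> c"
        unfolding B0.chains_def using paths_of_len_paths by auto
    qed
    moreover have "eqv (hmap (d1v g)) g"
    proof (rule hmap_d1v)
      fix b s c
      assume "(b, s, c) \<in> Poly_Mapping.keys g"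
      then have "(b, s, c) \<in> B1.chains"
        using g(1) by (rule set_mp[rotated])
      then show "b \<in> paths Q \<and> s \<in> tips \<R> \<and> c \<in> paths Q \<and> composable b s \<and> composable s c"
        by (simp add: B1.chains_def)
    qed
    ultimately have "hmap (d1v g) - (hmap (d1v g) - g) \<in> D1"
      unfolding eqv_def by (rule subsp_diff[OF D1(1)])
    then have "g \<in> D1"
      by simp
    then show "z \<in> d\<^sub>2 ` carrier G2"
      by (simp add: g(2) B1.preimage_def)
  qed
qed

end

theorem proposition6p6:
  fixes Q :: "('v, 'a) pre_digraph"
    and I :: "('v, 'a, 'k::field) pathvec set"
    and \<R> :: "('v, 'a, 'k) redsys"
    and r t :: "('v, 'a) qpath \<Rightarrow> ('v, 'a, 'k) basic_red list"
  assumes "wf_digraph Q" and "finite (verts Q)"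
    and "ideal I (path_algebra Q)"
    and "proj_independent Q I (paths_of_len Q 0 \<union> paths_of_len Q 1)"
    and "reduction_system Q \<R>" and "lozenge Q I \<R>"
    and "\<And>s. s \<in> tips \<R> \<Longrightarrow> 2 \<le> len s"
    and "\<And>p. p \<in> ambiguities Q \<R> \<Longrightarrow>
           r p \<in> reductions Q \<R> \<and> starts_on_left Q \<R> (r p) p \<and>
           reduce (r p) (pvec p) \<in> kspan (irred_paths Q \<R>)"
    and "\<And>p. p \<in> ambiguities Q \<R> \<Longrightarrow>
           t p \<in> reductions Q \<R> \<and> starts_on_right Q \<R> (t p) p \<and>
           reduce (t p) (pvec p) \<in> kspan (irred_paths Q \<R>)"
    and "\<delta>\<^sub>m \<in> bimodule_hom (quot_algebra Q I) (AA Q I) (regular_bimodule Q I)"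
    and "\<And>a b. a \<in> carrier (quot_algebra Q I) \<Longrightarrow> b \<in> carrier (quot_algebra Q I) \<Longrightarrow>
           \<delta>\<^sub>m (tens2 Q I a b) = a \<otimes>\<^bsub>quot_algebra Q I\<^esub> b"
    and "\<delta>\<^sub>0 \<in> bimodule_hom (quot_algebra Q I) (AXA Q I (paths_of_len Q 1)) (AA Q I)"
    and "\<And>\<alpha>. \<alpha> \<in> paths_of_len Q 1 \<Longrightarrow>
           \<delta>\<^sub>0 (tens3 Q I (paths_of_len Q 1) \<one>\<^bsub>quot_algebra Q I\<^esub> (pvec \<alpha>) \<one>\<^bsub>quot_algebra Q I\<^esub>) =
             tens2 Q I (proj Q I (pvec \<alpha>)) \<one>\<^bsub>quot_algebra Q I\<^esub>
             \<ominus>\<^bsub>AA Q I\<^esub> tens2 Q I \<one>\<^bsub>quot_algebra Q I\<^esub> (proj Q I (pvec \<alpha>))"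
    and "d\<^sub>1 \<in> bimodule_hom (quot_algebra Q I) (AXA Q I (tips \<R>)) (AXA Q I (paths_of_len Q 1))"
    and "\<And>s. s \<in> tips \<R> \<Longrightarrow>
           d\<^sub>1 (tens3 Q I (tips \<R>) \<one>\<^bsub>quot_algebra Q I\<^esub> (pvec s) \<one>\<^bsub>quot_algebra Q I\<^esub>) =
             \<phi>0 Q I (pvec s) \<ominus>\<^bsub>AXA Q I (paths_of_len Q 1)\<^esub> \<phi>0 Q I (normal_form Q I \<R> (pvec s))"
    and "d\<^sub>2 \<in> bimodule_hom (quot_algebra Q I) (AXA Q I (ambiguities Q \<R>)) (AXA Q I (tips \<R>))"
    and "\<And>p. p \<in> ambiguities Q \<R> \<Longrightarrow>
           d\<^sub>2 (tens3 Q I (ambiguities Q \<R>) \<one>\<^bsub>quot_algebra Q I\<^esub> (pvec p) \<one>\<^bsub>quot_algebra Q I\<^esub>) =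
             \<phi>1 Q I \<R> (t p) (pvec p) \<ominus>\<^bsub>AXA Q I (tips \<R>)\<^esub> \<phi>1 Q I \<R> (r p) (pvec p)"
  shows "d\<^sub>2 ` carrier (AXA Q I (ambiguities Q \<R>)) =
           a_kernel (AXA Q I (tips \<R>)) (AXA Q I (paths_of_len Q 1)) d\<^sub>1
       \<and> d\<^sub>1 ` carrier (AXA Q I (tips \<R>)) =
           a_kernel (AXA Q I (paths_of_len Q 1)) (AA Q I) \<delta>\<^sub>0
       \<and> \<delta>\<^sub>0 ` carrier (AXA Q I (paths_of_len Q 1)) =
           a_kernel (AA Q I) (regular_bimodule Q I) \<delta>\<^sub>m
       \<and> \<delta>\<^sub>m ` carrier (AA Q I) = carrier (quot_algebra Q I)"
proof -
  interpret redsys Q I \<R>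
    by (intro redsys.intro quiver.intro redsys_axioms.intro assms)
  interpret resolution Q I \<R> r t \<delta>\<^sub>m \<delta>\<^sub>0 d\<^sub>1 d\<^sub>2
    by (rule resolution.intro[OF redsys_axioms]) (rule resolution_axioms.intro; fact assms)
  show ?thesis
    by (intro conjI exact_tips exact_arrows exact_tensor_square \<delta>m_surj)
qed

end
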